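(* If $G$ is a finite subgroup of $GL_{4}(\mathbb{R})$ that is strictly generated in codimension two, then $$\operatorname{h}^{1}(U_G)= \operatorname{h}_{1}(\Delta_{G}) + \sum_{l} M_l -a^G_3 + N + a^G_2,$$ $$\operatorname{h}^{2}(U_G)>2N-1,$$ where the sum runs over the lines $l$ of $\mathcal A^G$, $M_l$ is the number of planes (two-dimensional subspaces) $\pi\in\mathcal A^G$ with $l\subset\pi$, $a^G_i$ is the number of subspaces of codimension $i$ in $\mathcal A^G$, and $N$ is the number of atom lines of $\mathcal A^G$.
   Context: Let $V=\mathbb R^4$. For $g\in G$, $V^{\langle g\rangle}$ is the subspace of vectors fixed by $g$; for a subgroup $H\subset G$, $V^H$ is the subspace of vectors fixed by every element of $H$. $G$ is strictly generated in codimension two if it is generated by its elements $g$ with $\operatorname{codim}V^{\langle g\rangle}=2$. A subgroup $H\subset G$ is a stabilizer subgroup if $H=\{g\in G\mid gv=v\ \text{for all } v\in V^H\}$. The subspace arrangement of $G$ is $\mathcal A^G=\{V^H\mid \{e\}\neq H \text{ a stabilizer subgroup}\}$, and $U_G=V\setminus\bigcup_{S\in\mathcal A^G}S$. The lattice of intersections $\mathcal L(\mathcal A^G)$ is the set of all intersections of subfamilies of $\mathcal A^G$ (the empty intersection being $V=\hat 0$), ordered by reverse inclusion, with maximum $\hat 1$ the intersection of all members. A line is a one-dimensional subspace, and an atom line is a line which is an atom of $\mathcal L(\mathcal A^G)$. $\Delta_G$ is the simplicial complex of chains of $\mathcal L(\mathcal A^G)\setminus\{\hat 0,\hat 1\}$.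 $\operatorname h^i(U_G)$ is the dimension of the $i$-th reduced rational singular cohomology of $U_G$, and $\operatorname h_i(\Delta_G)$ is the dimension of the $i$-th reduced rational simplicial homology of $\Delta_G$ (the empty complex has $\operatorname h_{-1}=1$ and all other $\operatorname h_i=0$). *)

theory Defs
  imports
    "HOL-Analysis.Analysis"
    "HOL-Homology.Homology"
    "HOL-Algebra.Generated_Groups"
    "HOL-Library.Extended_Nat"
begin

section \<open>Dimensions of quotients of rational vector spaces\<close>

text \<open>
  For subspaces \<open>B \<subseteq> Z\<close> of the rational vector space of all functions \<open>'b \<Rightarrow> rat\<close>, the set
  \<open>S\<close> represents a finite basis of \<open>Z/B\<close>: every element of \<open>Z\<close> is congruent modulo \<open>B\<close> to
  exactly one linear combination of \<open>S\<close> (coefficient families live on \<open>S\<close>, whence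
  \<open>extensional\<close>).
\<close>

definition quotient_basis :: "('b \<Rightarrow> rat) set \<Rightarrow> ('b \<Rightarrow> rat) set \<Rightarrow> ('b \<Rightarrow> rat) set \<Rightarrow> bool" where
  "quotient_basis Z B S \<longleftrightarrow>
     finite S \<and> S \<subseteq> Z \<and>
     (\<forall>z\<in>Z. \<exists>!u. u \<in> extensional S \<and> (\<lambda>x. z x - (\<Sum>v\<in>S. u v * v x)) \<in> B)"

text \<open>
  All finite bases of \<open>Z/B\<close> have the same number of elements, so the infimum only selects that
  number; it is \<open>\<infinity>\<close> exactly when \<open>Z/B\<close> has no finite basis.
\<close>

definition quotient_dim :: "('b \<Rightarrow> rat) set \<Rightarrow> ('b \<Rightarrow> rat) set \<Rightarrow> enat" where
  "quotient_dim Z B = (INF S\<in>{S. quotient_basis Z B S}. enat (card S))"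


section \<open>Reduced rational singular cohomology\<close>

text \<open>
  A rational \<open>p\<close>-cochain is a function on the singular \<open>p\<close>-simplices of \<open>X\<close> (extended by \<open>0\<close>),
  acting on integral singular chains by linear extension.
\<close>

definition sing_cochains :: "nat \<Rightarrow> 'a topology \<Rightarrow> (((nat \<Rightarrow> real) \<Rightarrow> 'a) \<Rightarrow> rat) set" where
  "sing_cochains p X = {c. \<forall>f. \<not> singular_simplex p X f \<longrightarrow> c f = 0}"

definition cochain_eval :: "(((nat \<Rightarrow> real) \<Rightarrow> 'a) \<Rightarrow> rat) \<Rightarrow> 'a chain \<Rightarrow> rat" where
  "cochain_eval c a = (\<Sum>f\<in>Poly_Mapping.keys a. of_int (Poly_Mapping.lookup a f) * c f)"

definition sing_coboundary ::
    "nat \<Rightarrow> 'a topology \<Rightarrow> (((nat \<Rightarrow> real) \<Rightarrow> 'a) \<Rightarrow> rat) \<Rightarrow> ((nat \<Rightarrow> real) \<Rightarrow> 'a) \<Rightarrow> rat" where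
  "sing_coboundary p X c =
     (\<lambda>f. if singular_simplex (Suc p) X f
          then cochain_eval c (chain_boundary (Suc p) (frag_of f)) else 0)"

definition sing_cocycles :: "nat \<Rightarrow> 'a topology \<Rightarrow> (((nat \<Rightarrow> real) \<Rightarrow> 'a) \<Rightarrow> rat) set" where
  "sing_cocycles p X = {c \<in> sing_cochains p X. sing_coboundary p X c = (\<lambda>f. 0)}"

text \<open>
  In degree \<open>0\<close> the coboundaries of the augmented complex are the constant cochains.
\<close>

fun reduced_sing_coboundaries :: "nat \<Rightarrow> 'a topology \<Rightarrow> (((nat \<Rightarrow> real) \<Rightarrow> 'a) \<Rightarrow> rat) set" where
  "reduced_sing_coboundaries 0 X = range (\<lambda>q f. if singular_simplex 0 X f then q else 0)"
| "reduced_sing_coboundaries (Suc p) X = sing_coboundary p X ` sing_cochains p X"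

text \<open>
  Only degrees \<open>p \<ge> 0\<close> are covered; degree \<open>-1\<close> vanishes for every nonempty space.
\<close>

definition reduced_cohomology_dim :: "nat \<Rightarrow> 'a topology \<Rightarrow> enat" where
  "reduced_cohomology_dim p X = quotient_dim (sing_cocycles p X) (reduced_sing_coboundaries p X)"


section \<open>Reduced rational simplicial homology of order complexes\<close>

text \<open>
  Simplicial complexes are sets of finite sets and contain the empty simplex, of dimension \<open>-1\<close>.
\<close>

definition order_complex :: "('a \<Rightarrow> 'a \<Rightarrow> bool) \<Rightarrow> 'a set \<Rightarrow> 'a set set" where
  "order_complex r P = {C. finite C \<and> pred_on.chain P r C}"

definition simplicial_chains :: "'a set set \<Rightarrow> int \<Rightarrow> ('a set \<Rightarrow> rat) set" where
  "simplicial_chains K i =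
     {c. finite {s. c s \<noteq> 0} \<and> (\<forall>s. c s \<noteq> 0 \<longrightarrow> s \<in> K \<and> finite s \<and> int (card s) = i + 1)}"

text \<open>
  Simplices are oriented by the strict vertex order \<open>r\<close>, which is assumed to be total on each
  simplex.  The face of \<open>{x\<^sub>0 < \<dots> < x\<^sub>i}\<close> omitting \<open>x\<^sub>j\<close> has incidence number \<open>(-1)\<^sup>j\<close>, and \<open>j\<close> is
  the number of vertices of that face below \<open>x\<^sub>j\<close>.  The coefficient of \<open>t\<close> in the boundary of \<open>c\<close>
  therefore sums over the simplices \<open>insert x t\<close> in the support of \<open>c\<close>.  On \<open>0\<close>-chains this is
  the augmentation.
\<close>

definition simplicial_boundary ::
    "('a \<Rightarrow> 'a \<Rightarrow> bool) \<Rightarrow> ('a set \<Rightarrow> rat) \<Rightarrow> 'a set \<Rightarrow> rat" where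
  "simplicial_boundary r c =
     (\<lambda>t. \<Sum>x | x \<notin> t \<and> c (insert x t) \<noteq> 0. (-1) ^ card {y \<in> t. r y x} * c (insert x t))"

definition reduced_homology_dim ::
    "('a \<Rightarrow> 'a \<Rightarrow> bool) \<Rightarrow> 'a set set \<Rightarrow> int \<Rightarrow> enat" where
  "reduced_homology_dim r K i =
     quotient_dim {c \<in> simplicial_chains K i. simplicial_boundary r c = (\<lambda>t. 0)}
                  (simplicial_boundary r ` simplicial_chains K (i + 1))"


section \<open>Linear groups and their subspace arrangements\<close>

definition GL :: "(real^'n^'n) monoid" where
  "GL = \<lparr>carrier = {A. invertible A}, mult = (**), one = mat 1\<rparr>"

lemma group_GL: "group GL"
proof (rule groupI)
  fix A :: "real^'n^'n" assume "A \<in> carrier GL"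
  then show "\<exists>B\<in>carrier GL. B \<otimes>\<^bsub>GL\<^esub> A = \<one>\<^bsub>GL\<^esub>"
    by (auto simp: GL_def invertible_def)
qed (auto simp: GL_def invertible_mult matrix_mul_assoc invertible_def[of "mat 1"])

definition codim :: "(real^'n) set \<Rightarrow> nat" where
  "codim S = CARD('n) - dim S"

definition fixed_space :: "(real^'n^'n) set \<Rightarrow> (real^'n) set" where
  "fixed_space H = {v. \<forall>g\<in>H. g *v v = v}"

definition strictly_generated_in_codim_two :: "(real^'n^'n) set \<Rightarrow> bool" where
  "strictly_generated_in_codim_two G \<longleftrightarrow>
     generate GL {g \<in> G. codim (fixed_space (generate GL {g})) = 2} = G"

definition stabilizer_subgroup :: "(real^'n^'n) set \<Rightarrow> (real^'n^'n) set \<Rightarrow> bool" where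
  "stabilizer_subgroup G H \<longleftrightarrow>
     subgroup H GL \<and> H \<subseteq> G \<and> H = {g \<in> G. \<forall>v\<in>fixed_space H. g *v v = v}"

definition arrangement :: "(real^'n^'n) set \<Rightarrow> (real^'n) set set" where
  "arrangement G = {fixed_space H | H. stabilizer_subgroup G H \<and> H \<noteq> {mat 1}}"

definition arr_complement :: "(real^'n^'n) set \<Rightarrow> (real^'n) set" where
  "arr_complement G = UNIV - \<Union> (arrangement G)"

definition intersection_lattice :: "(real^'n) set set \<Rightarrow> (real^'n) set set" where
  "intersection_lattice \<A> = Inter ` Pow \<A>"

text \<open>
  The order is reverse inclusion, so \<open>UNIV\<close> is the minimum and \<open>\<Inter> (arrangement G)\<close> the maximum.
\<close>

definition Delta :: "(real^'n^'n) set \<Rightarrow> (real^'n) set set set" where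
  "Delta G = order_complex (\<supset>)
     (intersection_lattice (arrangement G) - {UNIV, \<Inter> (arrangement G)})"

definition lattice_atom :: "(real^'n) set set \<Rightarrow> (real^'n) set \<Rightarrow> bool" where
  "lattice_atom L X \<longleftrightarrow> X \<in> L \<and> X \<noteq> UNIV \<and> \<not> (\<exists>Y\<in>L. X \<subset> Y \<and> Y \<subset> UNIV)"

definition arr_lines :: "(real^'n^'n) set \<Rightarrow> (real^'n) set set" where
  "arr_lines G = {l \<in> arrangement G. dim l = 1}"

definition planes_through :: "(real^'n^'n) set \<Rightarrow> (real^'n) set \<Rightarrow> nat" where
  "planes_through G l = card {\<pi> \<in> arrangement G. dim \<pi> = 2 \<and> l \<subset> \<pi>}"

definition codim_count :: "(real^'n^'n) set \<Rightarrow> nat \<Rightarrow> nat" where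
  "codim_count G i = card {S \<in> arrangement G. codim S = i}"

definition atom_line_count :: "(real^'n^'n) set \<Rightarrow> nat" where
  "atom_line_count G =
     card {l. dim l = 1 \<and> lattice_atom (intersection_lattice (arrangement G)) l}"

end

(*
Every generator has an eigenspace of dimension 2 for the eigenvalue 1 and determinant 1, so G has
determinant 1 throughout.  As det g = (-1)^codim(V^g), the arrangement consists of planes, of lines
that are intersections of planes, and possibly of {0}; in particular no line is an atom, N = 0, and
the second claim is trivial.  U_G is the complement of the planes.

For h^1 a singular cocycle is replaced by a locally exact function z(x,y) of two points.  Near a
point x of a plane S on no other plane, z is a multiple wt z S x of the winding class around S, and
the class of z vanishes iff all these weights do, because codimension-3 subspaces do not matter.
In S the lines of the arrangement cut out sectors; the weights are determined by one weight per
plane and by the jumps across the two halves of each line.  The jumps satisfy a Kirchhoff law at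
each half-line (summing over the planes through it) and, in each plane, the jumps over the upper and
over the lower half-lines have the same sum.  Winding classes around planes realise the first kind
of data, classes of "bent planes" (one half of S together with one half of T) realise equal jumps
across both halves of a line.  What is left are upper jumps with zero sum at every line and in every
plane: these are the 1-cycles of the incidence graph of lines and planes, that is, of Delta_G, and
each one is realised by gluing a combination of bent classes on the upper half-space with 0 on the
lower one.  Hence h^1 = a_2 + sum_l (M_l - 1) + h_1(Delta_G).
*)
theory Submission
  imports Defs
begin

section \<open>Locally exact functions of two points\<close>

text \<open>Functions of two points replace paths: they can be restricted, glued and cut off by open
  covers alone, and simplices enter only in the comparison with singular cohomology. The obstacle is
  to coordinate sides and signs between the planes. One functional \<open>\<eta>\<close>, nonzero on
  every plane and every line, does this: the upper half of a line means the same in all planes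
  through it, and in each plane the levels 1 and -1 run between the same two directions
  \<open>- r S\<close> and \<open>r S\<close> of level 0. So both levels start with the same base
  weight and have the same total jump. Coframes oriented by \<open>vol\<close> give a bent class
  weight 1 on the one plane and -1 on the other, as the Kirchhoff law demands. Gluing along level 0
  works because the planes leave there a set of lines in a three-dimensional space, and zero jump
  sums in the planes, with zero base weights, say exactly that no weight is left along these lines.
  The class is then exact near the wall and can be continued by 0 below it.\<close>

text \<open>
  \<open>z a b\<close> plays the role of the integral of a closed 1-form from \<open>a\<close> to \<open>b\<close>; only its values on
  pairs of nearby points matter, so classes modulo \<open>exact_on\<close> are the first cohomology of \<open>X\<close> with
  rational coefficients.
\<close>

definition primitive_on :: "'a::topological_space set \<Rightarrow> ('a \<Rightarrow> 'a \<Rightarrow> rat) \<Rightarrow> ('a \<Rightarrow> rat) \<Rightarrow> bool" where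
  "primitive_on X z F \<longleftrightarrow>
     (\<forall>x\<in>X. \<exists>N. open N \<and> x \<in> N \<and> (\<forall>a\<in>N \<inter> X. \<forall>b\<in>N \<inter> X. z a b = F b - F a))"

definition cocycle_on :: "'a::topological_space set \<Rightarrow> ('a \<Rightarrow> 'a \<Rightarrow> rat) \<Rightarrow> bool" where
  "cocycle_on X z \<longleftrightarrow>
     (\<forall>x\<in>X. \<exists>N F. open N \<and> x \<in> N \<and> (\<forall>a\<in>N \<inter> X. \<forall>b\<in>N \<inter> X. z a b = F b - F a))"

definition exact_on :: "'a::topological_space set \<Rightarrow> ('a \<Rightarrow> 'a \<Rightarrow> rat) \<Rightarrow> bool" where
  "exact_on X z \<longleftrightarrow> (\<exists>F. primitive_on X z F)"

lemma bchoice2: "\<forall>x\<in>S. \<exists>y w. Q x y w \<Longrightarrow> \<exists>f g. \<forall>x\<in>S. Q x (f x) (g x)"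
  by metis

lemma primitive_onE:
  assumes "primitive_on X z F" "x \<in> X"
  obtains N where "open N" "x \<in> N" "\<And>a b. a \<in> N \<Longrightarrow> a \<in> X \<Longrightarrow> b \<in> N \<Longrightarrow> b \<in> X \<Longrightarrow> z a b = F b - F a"
  using assms unfolding primitive_on_def by (metis IntI)

lemma cocycle_onE:
  assumes "cocycle_on X z" "x \<in> X"
  obtains N F where "open N" "x \<in> N" "\<And>a b. a \<in> N \<Longrightarrow> a \<in> X \<Longrightarrow> b \<in> N \<Longrightarrow> b \<in> X \<Longrightarrow> z a b = F b - F a"
  using assms unfolding cocycle_on_def by (metis IntI)

lemma primitive_onI:
  assumes "\<And>x. x \<in> X \<Longrightarrow> \<exists>N. open N \<and> x \<in> N \<and> (\<forall>a\<in>N \<inter> X. \<forall>b\<in>N \<inter> X. z a b = F b - F a)"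
  shows "primitive_on X z F"
  using assms unfolding primitive_on_def by blast

lemma primitive_imp_cocycle: "primitive_on X z F \<Longrightarrow> cocycle_on X z"
  unfolding primitive_on_def cocycle_on_def by (intro ballI) (drule bspec, assumption, iprover)

lemma exact_imp_cocycle: "exact_on X z \<Longrightarrow> cocycle_on X z"
  unfolding exact_on_def using primitive_imp_cocycle by blast

lemma cocycle_onI:
  assumes "\<And>x. x \<in> X \<Longrightarrow> \<exists>N F. open N \<and> x \<in> N \<and> (\<forall>a\<in>N \<inter> X. \<forall>b\<in>N \<inter> X. z a b = F b - F a)"
  shows "cocycle_on X z"
  unfolding cocycle_on_def by (intro ballI assms)

lemma primitive_on_subset:
  assumes "primitive_on X z F" "Y \<subseteq> X"
  shows "primitive_on Y z F"
proof (rule primitive_onI)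
  fix x assume "x \<in> Y"
  then obtain N where "open N" "x \<in> N" "\<And>a b. a \<in> N \<Longrightarrow> a \<in> X \<Longrightarrow> b \<in> N \<Longrightarrow> b \<in> X \<Longrightarrow> z a b = F b - F a"
    using primitive_onE[OF assms(1), of x] assms(2) by auto
  then show "\<exists>N. open N \<and> x \<in> N \<and> (\<forall>a\<in>N \<inter> Y. \<forall>b\<in>N \<inter> Y. z a b = F b - F a)"
    using assms(2) by (intro exI[of _ N]) auto
qed

lemma cocycle_on_subset:
  assumes "cocycle_on X z" "Y \<subseteq> X"
  shows "cocycle_on Y z"
proof (rule cocycle_onI)
  fix x assume "x \<in> Y"
  then obtain N F where "open N" "x \<in> N" "\<And>a b. a \<in> N \<Longrightarrow> a \<in> X \<Longrightarrow> b \<in> N \<Longrightarrow> b \<in> X \<Longrightarrow> z a b = F b - F a"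
    using cocycle_onE[OF assms(1), of x] assms(2) by auto
  then show "\<exists>N F. open N \<and> x \<in> N \<and> (\<forall>a\<in>N \<inter> Y. \<forall>b\<in>N \<inter> Y. z a b = F b - F a)"
    using assms(2) by (intro exI[of _ N] exI[of _ F]) auto
qed

lemma exact_on_subset: "exact_on X z \<Longrightarrow> Y \<subseteq> X \<Longrightarrow> exact_on Y z"
  unfolding exact_on_def using primitive_on_subset by blast

lemma primitive_on_lincomb:
  assumes "primitive_on X z F" "primitive_on X w G"
  shows "primitive_on X (\<lambda>a b. p * z a b + q * w a b) (\<lambda>a. p * F a + q * G a)"
proof (rule primitive_onI)
  fix x assume x: "x \<in> X"
  obtain N where N: "open N" "x \<in> N" "\<And>a b. a \<in> N \<Longrightarrow> a \<in> X \<Longrightarrow> b \<in> N \<Longrightarrow> b \<in> X \<Longrightarrow> z a b = F b - F a"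
    using primitive_onE[OF assms(1) x] by blast
  obtain M where M: "open M" "x \<in> M" "\<And>a b. a \<in> M \<Longrightarrow> a \<in> X \<Longrightarrow> b \<in> M \<Longrightarrow> b \<in> X \<Longrightarrow> w a b = G b - G a"
    using primitive_onE[OF assms(2) x] by blast
  show "\<exists>N. open N \<and> x \<in> N \<and> (\<forall>a\<in>N \<inter> X. \<forall>b\<in>N \<inter> X. p * z a b + q * w a b = (p * F b + q * G b) - (p * F a + q * G a))"
    by (rule exI[of _ "N \<inter> M"]) (auto simp: N M algebra_simps)
qed

lemma exact_on_lincomb:
  "exact_on X z \<Longrightarrow> exact_on X w \<Longrightarrow> exact_on X (\<lambda>a b. p * z a b + q * w a b)"
  unfolding exact_on_def using primitive_on_lincomb by blast

lemma cocycle_on_lincomb: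
  assumes "cocycle_on X z" "cocycle_on X w"
  shows "cocycle_on X (\<lambda>a b. p * z a b + q * w a b)"
  unfolding cocycle_on_def
proof (rule ballI)
  fix x assume x: "x \<in> X"
  obtain N F where N: "open N" "x \<in> N" "\<And>a b. a \<in> N \<Longrightarrow> a \<in> X \<Longrightarrow> b \<in> N \<Longrightarrow> b \<in> X \<Longrightarrow> z a b = F b - F a"
    using cocycle_onE[OF assms(1) x] by blast
  obtain M G where M: "open M" "x \<in> M" "\<And>a b. a \<in> M \<Longrightarrow> a \<in> X \<Longrightarrow> b \<in> M \<Longrightarrow> b \<in> X \<Longrightarrow> w a b = G b - G a"
    using cocycle_onE[OF assms(2) x] by blast
  show "\<exists>N H. open N \<and> x \<in> N \<and> (\<forall>a\<in>N \<inter> X. \<forall>b\<in>N \<inter> X. p * z a b + q * w a b = H b - H a)"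
    by (rule exI[of _ "N \<inter> M"], rule exI[of _ "\<lambda>a. p * F a + q * G a"]) (auto simp: N M algebra_simps)
qed

lemma primitive_on_zero: "primitive_on X (\<lambda>a b. 0) (\<lambda>a. 0)"
  unfolding primitive_on_def by auto

lemma exact_on_zero: "exact_on X (\<lambda>a b. 0)"
  unfolding exact_on_def using primitive_on_zero by blast

lemma exact_on_diff: "exact_on X z \<Longrightarrow> exact_on X w \<Longrightarrow> exact_on X (\<lambda>a b. z a b - w a b)"
  using exact_on_lincomb[of X z w 1 "-1"] by simp

lemma exact_on_add: "exact_on X z \<Longrightarrow> exact_on X w \<Longrightarrow> exact_on X (\<lambda>a b. z a b + w a b)"
  using exact_on_lincomb[of X z w 1 1] by simp

lemma cocycle_on_diff: "cocycle_on X z \<Longrightarrow> cocycle_on X w \<Longrightarrow> cocycle_on X (\<lambda>a b. z a b - w a b)"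
  using cocycle_on_lincomb[of X z w 1 "-1"] by simp

lemma cocycle_on_add: "cocycle_on X z \<Longrightarrow> cocycle_on X w \<Longrightarrow> cocycle_on X (\<lambda>a b. z a b + w a b)"
  using cocycle_on_lincomb[of X z w 1 1] by simp

lemma cocycle_on_scale: "cocycle_on X z \<Longrightarrow> cocycle_on X (\<lambda>a b. c * z a b)"
  using cocycle_on_lincomb[of X z z c 0] by simp

lemma cocycle_on_zero: "cocycle_on X (\<lambda>a b. 0)"
  using exact_imp_cocycle[OF exact_on_zero] .

lemma cocycle_on_sum:
  assumes "\<And>i. i \<in> I \<Longrightarrow> cocycle_on X (z i)"
  shows "cocycle_on X (\<lambda>a b. \<Sum>i\<in>I. z i a b)"
  using assms by (induction I rule: infinite_finite_induct) (auto intro: cocycle_on_add cocycle_on_zero)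

lemma primitive_on_pullback:
  assumes "primitive_on X z F" "continuous_on Y f" "f ` Y \<subseteq> X"
  shows "primitive_on Y (\<lambda>a b. z (f a) (f b)) (F \<circ> f)"
proof (rule primitive_onI)
  fix y assume y: "y \<in> Y"
  obtain N where N: "open N" "f y \<in> N" "\<And>a b. a \<in> N \<Longrightarrow> a \<in> X \<Longrightarrow> b \<in> N \<Longrightarrow> b \<in> X \<Longrightarrow> z a b = F b - F a"
    using primitive_onE[OF assms(1), of "f y"] y assms(3) by blast
  obtain M where M: "open M" "y \<in> M" "M \<inter> Y \<subseteq> f -` N"
    using assms(2) N y unfolding continuous_on_topological by (metis Int_iff subsetI vimageI)
  show "\<exists>N. open N \<and> y \<in> N \<and> (\<forall>a\<in>N \<inter> Y. \<forall>b\<in>N \<inter> Y. z (f a) (f b) = (F \<circ> f) b - (F \<circ> f) a)"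
    using M N(3) assms(3) by (intro exI[of _ M]) (auto simp: subset_iff)
qed

lemma cocycle_on_pullback:
  assumes "cocycle_on X z" "continuous_on Y f" "f ` Y \<subseteq> X"
  shows "cocycle_on Y (\<lambda>a b. z (f a) (f b))"
  unfolding cocycle_on_def
proof (rule ballI)
  fix y assume y: "y \<in> Y"
  obtain N F where N: "open N" "f y \<in> N" "\<And>a b. a \<in> N \<Longrightarrow> a \<in> X \<Longrightarrow> b \<in> N \<Longrightarrow> b \<in> X \<Longrightarrow> z a b = F b - F a"
    using cocycle_onE[OF assms(1), of "f y"] y assms(3) by blast
  obtain M where M: "open M" "y \<in> M" "M \<inter> Y \<subseteq> f -` N"
    using assms(2) N y unfolding continuous_on_topological by (metis Int_iff subsetI vimageI)
  show "\<exists>N F. open N \<and> y \<in> N \<and> (\<forall>a\<in>N \<inter> Y. \<forall>b\<in>N \<inter> Y. z (f a) (f b) = F b - F a)"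
    using M N(3) assms(3) by (intro exI[of _ M] exI[of _ "F \<circ> f"]) (auto simp: subset_iff)
qed

text \<open>The difference of two primitives is locally constant. The constants found in this way on
  connected overlaps are what all later gluing compares.\<close>

lemma primitive_on_unique:
  assumes "connected X" "primitive_on X z F" "primitive_on X z G" "x \<in> X" "y \<in> X"
  shows "F x - G x = F y - G y"
proof (rule connected_local_const[OF assms(1,4,5)], rule ballI)
  fix a assume a: "a \<in> X"
  obtain N where N: "open N" "a \<in> N" "\<And>c b. c \<in> N \<Longrightarrow> c \<in> X \<Longrightarrow> b \<in> N \<Longrightarrow> b \<in> X \<Longrightarrow> z c b = F b - F c"
    using primitive_onE[OF assms(2) a] by blast
  obtain M where M: "open M" "a \<in> M" "\<And>c b. c \<in> M \<Longrightarrow> c \<in> X \<Longrightarrow> b \<in> M \<Longrightarrow> b \<in> X \<Longrightarrow> z c b = G b - G c"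
    using primitive_onE[OF assms(3) a] by blast
  have "F a - G a = F b - G b" if "b \<in> N \<inter> M" "b \<in> X" for b
    using N(3)[of a b] M(3)[of a b] a N(2) M(2) that by simp
  then show "eventually (\<lambda>b. F a - G a = F b - G b) (at a within X)"
    using N(1,2) M(1,2) unfolding eventually_at_topological
    by (intro exI[of _ "N \<inter> M"]) auto
qed

section \<open>Exactness on intervals, starlike sets and convex sets\<close>

lemma cocycle_on_interval_exact:
  fixes z :: "real \<Rightarrow> real \<Rightarrow> rat"
  assumes "cocycle_on {0..1} z"
  shows "exact_on {0..1} z"
proof -
  have "exact_on ({0..1} \<inter> {0..1}) z"
  \<comment> \<open>Bisection: exactness passes to the union of two adjacent intervals and holds on
    short ones. The intervals offered by \<open>Bolzano\<close> may leave \<open>{0..1}\<close>,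
    hence the intersection.\<close>
  proof (rule Bolzano[of 0 1 "\<lambda>a b. exact_on ({a..b} \<inter> {0..1}) z"])
    fix a b c :: real
    assume ab: "exact_on ({a..b} \<inter> {0..1}) z" and bc: "exact_on ({b..c} \<inter> {0..1}) z"
      and le: "a \<le> b" "b \<le> c"
    show "exact_on ({a..c} \<inter> {0..1}) z"
    proof (cases "b \<in> {0..1}")
      case False
      then have "{a..c} \<inter> {0..1} = {a..b} \<inter> {0..1} \<or> {a..c} \<inter> {0..1} = {b..c} \<inter> {0..1}"
        using le by auto
      then show ?thesis using ab bc by metis
    next
      case True
      obtain F G where F: "primitive_on ({a..b} \<inter> {0..1}) z F" and G: "primitive_on ({b..c} \<inter> {0..1}) z G"
        using ab bc unfolding exact_on_def by blast
      \<comment> \<open>\<open>G\<close> is shifted so as to agree with \<open>F\<close> at the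
        common point \<open>b\<close>.\<close>
      define H where "H = (\<lambda>t. if t \<le> b then F t else G t - G b + F b)"
      have "primitive_on ({a..c} \<inter> {0..1}) z H"
      proof (rule primitive_onI)
        fix x assume x: "x \<in> {a..c} \<inter> {0..1}"
        consider "x < b" | "x > b" | "x = b" by linarith
        then show "\<exists>N. open N \<and> x \<in> N \<and> (\<forall>s\<in>N \<inter> ({a..c} \<inter> {0..1}). \<forall>t\<in>N \<inter> ({a..c} \<inter> {0..1}). z s t = H t - H s)"
        proof cases
          case 1
          then have "x \<in> {a..b} \<inter> {0..1}" using x by auto
          then obtain N where N: "open N" "x \<in> N" "\<And>s t. s \<in> N \<Longrightarrow> s \<in> {a..b} \<inter> {0..1} \<Longrightarrow> t \<in> N \<Longrightarrow> t \<in> {a..b} \<inter> {0..1} \<Longrightarrow> z s t = F t - F s"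
            using primitive_onE[OF F] by blast
          then show ?thesis using 1 by (intro exI[of _ "N \<inter> {..<b}"]) (auto simp: H_def)
        next
          case 2
          then have "x \<in> {b..c} \<inter> {0..1}" using x by auto
          then obtain N where N: "open N" "x \<in> N" "\<And>s t. s \<in> N \<Longrightarrow> s \<in> {b..c} \<inter> {0..1} \<Longrightarrow> t \<in> N \<Longrightarrow> t \<in> {b..c} \<inter> {0..1} \<Longrightarrow> z s t = G t - G s"
            using primitive_onE[OF G] by blast
          then show ?thesis using 2 by (intro exI[of _ "N \<inter> {b<..}"]) (auto simp: H_def)
        next
          case 3
          have bX: "b \<in> {a..b} \<inter> {0..1}" "b \<in> {b..c} \<inter> {0..1}" using True le by auto
          obtain N where N: "open N" "b \<in> N" "\<And>s t. s \<in> N \<Longrightarrow> s \<in> {a..b} \<inter> {0..1} \<Longrightarrow> t \<in> N \<Longrightarrow> t \<in> {a..b} \<inter> {0..1} \<Longrightarrow> z s t = F t - F s"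
            using primitive_onE[OF F bX(1)] by blast
          obtain M where M: "open M" "b \<in> M" "\<And>s t. s \<in> M \<Longrightarrow> s \<in> {b..c} \<inter> {0..1} \<Longrightarrow> t \<in> M \<Longrightarrow> t \<in> {b..c} \<inter> {0..1} \<Longrightarrow> z s t = G t - G s"
            using primitive_onE[OF G bX(2)] by blast
          \<comment> \<open>\<open>F\<close> and \<open>G\<close> say nothing about pairs on
            different sides of \<open>b\<close>; a local primitive \<open>K\<close> at
            \<open>b\<close> links the two sides.\<close>
          obtain K L where L: "open L" "b \<in> L" "\<And>s t. s \<in> L \<Longrightarrow> s \<in> {0..1} \<Longrightarrow> t \<in> L \<Longrightarrow> t \<in> {0..1} \<Longrightarrow> z s t = K t - K s"
            using cocycle_onE[OF assms True] by blast
          have HK: "H t - K t = F b - K b" if t: "t \<in> N \<inter> M \<inter> L" "t \<in> {a..c} \<inter> {0..1}" for t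
          proof (cases "t \<le> b")
            case le': True
            then show ?thesis using N(3)[of t b] L(3)[of t b] t True le N(2) L(2) by (auto simp: H_def)
          next
            case False
            then show ?thesis using M(3)[of b t] L(3)[of b t] t True le M(2) L(2) by (auto simp: H_def)
          qed
          have "z s t = H t - H s" if "s \<in> N \<inter> M \<inter> L" "s \<in> {a..c} \<inter> {0..1}" "t \<in> N \<inter> M \<inter> L" "t \<in> {a..c} \<inter> {0..1}" for s t
            using HK[OF that(1,2)] HK[OF that(3,4)] L(3)[of s t] that by auto
          then show ?thesis using 3 N(1,2) M(1,2) L(1,2) 
            by (intro exI[of _ "N \<inter> M \<inter> L"]) auto
        qed
      qed
      then show ?thesis unfolding exact_on_def by blast
    qed
  next
    fix x :: real assume "0 \<le> x" "x \<le> 1"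
    then have x: "x \<in> {0..1}" by simp
    obtain N F where N: "open N" "x \<in> N" "\<And>s t. s \<in> N \<Longrightarrow> s \<in> {0..1} \<Longrightarrow> t \<in> N \<Longrightarrow> t \<in> {0..1} \<Longrightarrow> z s t = F t - F s"
      using cocycle_onE[OF assms x] by blast
    obtain d where d: "d > 0" "ball x d \<subseteq> N" using N(1,2) openE by blast
    have "exact_on ({a..b} \<inter> {0..1}) z" if "a \<le> x" "x \<le> b" "b - a < d" for a b
    proof -
      have "{a..b} \<subseteq> N" using d(2) that by (auto simp: dist_real_def subset_iff)
      then have "primitive_on ({a..b} \<inter> {0..1}) z F"
        using N by (intro primitive_onI exI[of _ N]) auto
      then show ?thesis unfolding exact_on_def by blast
    qed
    then show "\<exists>d>0. \<forall>a b. a \<le> x \<and> x \<le> b \<and> b - a < d \<longrightarrow> exact_on ({a..b} \<inter> {0..1}) z"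
      using d(1) by blast
  qed simp
  then show ?thesis by simp
qed

text \<open>Integration along the segments from \<open>x0\<close>: \<open>F x\<close> is the total
  increment of a primitive on the segment to \<open>x\<close>. Comparing neighbouring segments at
  equal parameters shows that \<open>F\<close> is a primitive.\<close>

lemma cocycle_on_starlike_exact:
  fixes X :: "'a::real_normed_vector set"
  assumes star: "x0 \<in> X" "\<And>x. x \<in> X \<Longrightarrow> closed_segment x0 x \<subseteq> X" and z: "cocycle_on X z"
  shows "exact_on X z"
proof -
  define p where "p = (\<lambda>x t. x0 + t *\<^sub>R (x - x0))"
  have pX: "p x ` {0..1} \<subseteq> X" if "x \<in> X" for x
  proof
    fix y assume "y \<in> p x ` {0..1}"
    then obtain t where "t \<in> {0..1}" "y = p x t" by blast
    then have "y \<in> closed_segment x0 x"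
      unfolding p_def in_segment by (intro exI[of _ t]) (auto simp: algebra_simps)
    then show "y \<in> X" using star(2)[OF that] by blast
  qed
  have pc: "continuous_on A (p x)" for x A unfolding p_def by (intro continuous_intros)
  have "\<exists>F. primitive_on {0..1} (\<lambda>s t. z (p x s) (p x t)) F" if "x \<in> X" for x
    using cocycle_on_interval_exact[OF cocycle_on_pullback[OF z pc pX[OF that]]] unfolding exact_on_def .
  then obtain \<Phi> where \<Phi>: "\<And>x. x \<in> X \<Longrightarrow> primitive_on {0..1} (\<lambda>s t. z (p x s) (p x t)) (\<Phi> x)" by metis
  define F where "F = (\<lambda>x. \<Phi> x 1 - \<Phi> x 0)"
  have "primitive_on X z F"
  proof (rule primitive_onI)
    fix x assume x: "x \<in> X"
    obtain N K where NK: "\<forall>y\<in>X. open (N y) \<and> y \<in> N y \<and> (\<forall>a\<in>N y \<inter> X. \<forall>b\<in>N y \<inter> X. z a b = K y b - K y a)"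
      using bchoice2[OF z[unfolded cocycle_on_def]] by blast
    have N: "\<And>y. y \<in> X \<Longrightarrow> open (N y)" "\<And>y. y \<in> X \<Longrightarrow> y \<in> N y"
      "\<And>y a b. y \<in> X \<Longrightarrow> a \<in> N y \<Longrightarrow> a \<in> X \<Longrightarrow> b \<in> N y \<Longrightarrow> b \<in> X \<Longrightarrow> z a b = K y b - K y a"
      using NK by auto
    have cpt: "compact (p x ` {0..1})" by (intro compact_continuous_image pc) auto
    \<comment> \<open>\<open>e\<close> is a Lebesgue number of the cover by domains of local
      primitives, so points with equal parameters on neighbouring segments share such a
      domain.\<close>
    obtain e where e: "e > 0" "\<And>y. y \<in> p x ` {0..1} \<Longrightarrow> \<exists>G\<in>N ` X. ball y e \<subseteq> G"
    proof (rule Heine_Borel_lemma[OF cpt, of "N ` X"])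
      show "p x ` {0..1} \<subseteq> \<Union> (N ` X)" using N(2) pX[OF x] by blast
      show "open G" if "G \<in> N ` X" for G using N(1) that by blast
    qed blast
    have near: "p a t \<in> ball (p x t) e" if "a \<in> ball x e" "t \<in> {0..1}" for a t
    proof -
      have "dist (p x t) (p a t) = \<bar>t\<bar> * dist x a"
        unfolding p_def dist_norm by (simp add: algebra_simps flip: scaleR_diff_right)
      also have "\<dots> \<le> dist x a" using that by (simp add: mult_left_le_one_le)
      also have "\<dots> < e" using that by simp
      finally show ?thesis by simp
    qed
    have "z a b = F b - F a" if a: "a \<in> ball x e \<inter> X" and b: "b \<in> ball x e \<inter> X" for a b
    proof -
      \<comment> \<open>\<open>G\<close> is locally constant in \<open>t\<close>. Equating its
        values at 0, where both points are \<open>x0\<close>, and at 1 gives the increment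
        formula.\<close>
      define G where "G = (\<lambda>t. \<Phi> b t - \<Phi> a t - z (p a t) (p b t))"
      have "G 0 = G 1"
      proof (rule connected_local_const[of "{0..1::real}"])
        show "\<forall>t\<in>{0..1}. eventually (\<lambda>s. G t = G s) (at t within {0..1})"
        proof
          fix t :: real assume t: "t \<in> {0..1}"
          then obtain y where y: "y \<in> X" "ball (p x t) e \<subseteq> N y" using e(2)[of "p x t"] by blast
          have inN: "p a t \<in> N y" "p b t \<in> N y" using near[of a t] near[of b t] a b t y by auto
          obtain A where A: "open A" "t \<in> A" "\<And>u v. u \<in> A \<Longrightarrow> u \<in> {0..1} \<Longrightarrow> v \<in> A \<Longrightarrow> v \<in> {0..1} \<Longrightarrow> z (p a u) (p a v) = \<Phi> a v - \<Phi> a u"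
            using primitive_onE[OF \<Phi> t] a by (metis IntD2)
          obtain B where B: "open B" "t \<in> B" "\<And>u v. u \<in> B \<Longrightarrow> u \<in> {0..1} \<Longrightarrow> v \<in> B \<Longrightarrow> v \<in> {0..1} \<Longrightarrow> z (p b u) (p b v) = \<Phi> b v - \<Phi> b u"
            using primitive_onE[OF \<Phi> t] b by (metis IntD2)
          define C where "C = A \<inter> B \<inter> p a -` N y \<inter> p b -` N y"
          have "open C" unfolding C_def using A(1) B(1) N(1)[OF y(1)] pc[of UNIV]
            by (intro open_Int open_vimage) auto
          moreover have "t \<in> C" using A(2) B(2) inN unfolding C_def by auto
          moreover have "G t = G s" if s: "s \<in> C" "s \<in> {0..1}" for s
          proof -
            have X: "p a s \<in> X" "p b s \<in> X" "p a t \<in> X" "p b t \<in> X" using pX a b s t by blast+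
            have sC: "s \<in> A" "s \<in> B" "p a s \<in> N y" "p b s \<in> N y" using s unfolding C_def by auto
            have "\<Phi> a s - \<Phi> a t = K y (p a s) - K y (p a t)"
              using A(3)[of t s] N(3)[OF y(1), of "p a t" "p a s"] X sC inN t s A(2) by simp
            moreover have "\<Phi> b s - \<Phi> b t = K y (p b s) - K y (p b t)"
              using B(3)[of t s] N(3)[OF y(1), of "p b t" "p b s"] X sC inN t s B(2) by simp
            moreover have "z (p a t) (p b t) = K y (p b t) - K y (p a t)"
              using N(3)[OF y(1)] X inN by simp
            moreover have "z (p a s) (p b s) = K y (p b s) - K y (p a s)"
              using N(3)[OF y(1)] X sC by simp
            ultimately show ?thesis unfolding G_def by (simp add: algebra_simps)
          qed
          ultimately show "eventually (\<lambda>s. G t = G s) (at t within {0..1})"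
            unfolding eventually_at_topological by blast
        qed
      qed auto
      moreover have "z x0 x0 = 0" using N(3)[OF star(1), of x0 x0] N(2)[OF star(1)] star(1) by simp
      ultimately show ?thesis unfolding G_def F_def p_def by simp
    qed
    then show "\<exists>N. open N \<and> x \<in> N \<and> (\<forall>a\<in>N \<inter> X. \<forall>b\<in>N \<inter> X. z a b = F b - F a)"
      using e(1) by (intro exI[of _ "ball x e"]) auto
  qed
  then show ?thesis unfolding exact_on_def by blast
qed

lemma cocycle_on_convex_exact:
  fixes X :: "'a::real_normed_vector set"
  assumes "convex X" "cocycle_on X z"
  shows "exact_on X z"
proof (cases "X = {}")
  case True
  then show ?thesis unfolding exact_on_def primitive_on_def by simp
next
  case False
  then obtain x0 where "x0 \<in> X" by blast
  then show ?thesis using cocycle_on_starlike_exact[of x0 X z] assms closed_segment_subset by metis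
qed

section \<open>Complements of subspaces of codimension two and three\<close>

lemma closed_Union_subspaces:
  fixes \<P> :: "'a::euclidean_space set set"
  assumes "finite \<P>" "\<And>S. S \<in> \<P> \<Longrightarrow> subspace S"
  shows "closed (\<Union>\<P>)"
  using assms closed_subspace by (intro closed_Union) auto

text \<open>Sets of smaller dimension are Lebesgue negligible, so finitely many of them cannot cover
  a nonempty open set. This is the source of the generic points below.\<close>

lemma open_not_subset_Union_subspaces:
  fixes \<P> :: "'a::euclidean_space set set"
  assumes "finite \<P>" "\<And>S. S \<in> \<P> \<Longrightarrow> dim S < DIM('a)" "open C" "C \<noteq> {}"
  obtains c where "c \<in> C" "c \<notin> \<Union>\<P>"
proof -
  have "negligible (\<Union>\<P>)" using assms(1,2) negligible_lowdim by (intro negligible_Union) auto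
  then have "\<not> C \<subseteq> \<Union>\<P>" using open_not_negligible[OF assms(3,4)] negligible_subset by blast
  then show ?thesis using that by blast
qed

lemma dim_span_insert_le: "dim (span (insert (a::'a::euclidean_space) S)) \<le> Suc (dim S)"
  by (simp add: dim_insert)

text \<open>A point of the segment in \<open>S\<close>, with parameter \<open>t \<noteq> 0\<close>,
  would express \<open>c\<close> through \<open>a\<close> and \<open>S\<close>.\<close>

lemma closed_segment_avoids_subspace:
  fixes a c :: "'a::euclidean_space"
  assumes "subspace S" "a \<notin> S" "c \<notin> span (insert a S)"
  shows "closed_segment a c \<inter> S = {}"
proof -
  have False if y: "y \<in> closed_segment a c" "y \<in> S" for y
  proof -
    obtain t where t: "y = (1 - t) *\<^sub>R a + t *\<^sub>R c" using y(1) unfolding in_segment by blast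
    show False
    proof (cases "t = 0")
      case True
      then show False using t y(2) assms(2) by simp
    next
      case False
      have "c = (1 / t) *\<^sub>R (y - (1 - t) *\<^sub>R a)" unfolding t using False by simp
      also have "\<dots> \<in> span (insert a S)"
        using y(2) by (intro span_scale span_diff) (auto intro: span_base)
      finally show False using assms(3) by simp
    qed
  qed
  then show ?thesis by blast
qed

text \<open>Two points are joined by a detour through a generic \<open>c\<close>. It has to avoid
  the spans of \<open>S\<close> with \<open>a\<close> and with \<open>b\<close>, which are still
  proper subspaces because \<open>S\<close> has codimension two.\<close>

lemma connected_convex_diff_subspaces:
  fixes \<P> :: "'a::euclidean_space set set"
  assumes fin: "finite \<P>" and \<P>: "\<And>S. S \<in> \<P> \<Longrightarrow> subspace S" "\<And>S. S \<in> \<P> \<Longrightarrow> dim S + 2 \<le> DIM('a)"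
    and C: "open C" "convex C"
  shows "connected (C - \<Union>\<P>)"
  unfolding connected_iff_connected_component
proof (intro ballI)
  fix a b assume a: "a \<in> C - \<Union>\<P>" and b: "b \<in> C - \<Union>\<P>"
  define \<Q> where "\<Q> = (\<lambda>S. span (insert a S)) ` \<P> \<union> (\<lambda>S. span (insert b S)) ` \<P>"
  have "dim S < DIM('a)" if SQ: "S \<in> \<Q>" for S
  proof -
    obtain T v where "T \<in> \<P>" "S = span (insert v T)" using SQ unfolding \<Q>_def by blast
    then show ?thesis using \<P>(2)[of T] dim_span_insert_le[of v T] by simp
  qed
  then obtain c where c: "c \<in> C" "c \<notin> \<Union>\<Q>"
    using open_not_subset_Union_subspaces[of \<Q> C] fin C(1) a unfolding \<Q>_def by blast
  have "closed_segment a c \<inter> S = {}" "closed_segment b c \<inter> S = {}" if "S \<in> \<P>" for S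
  proof -
    have "a \<notin> S" "b \<notin> S" "c \<notin> span (insert a S)" "c \<notin> span (insert b S)"
      using that a b c(2) unfolding \<Q>_def by blast+
    then show "closed_segment a c \<inter> S = {}" "closed_segment b c \<inter> S = {}"
      using closed_segment_avoids_subspace[OF \<P>(1)[OF that]] by blast+
  qed
  then have "closed_segment a c \<union> closed_segment b c \<subseteq> C - \<Union>\<P>"
    using closed_segment_subset[OF _ c(1) C(2)] a b by blast
  moreover have "connected (closed_segment a c \<union> closed_segment b c)"
    by (rule connected_Un) auto
  ultimately show "connected_component (C - \<Union>\<P>) a b"
    by (intro connected_componentI[of "closed_segment a c \<union> closed_segment b c"]) auto
qed

text \<open>
  Complements of subspaces of codimension two are locally connected along the subspaces, so local
  primitives of \<open>z\<close> near \<open>x \<in> X\<close> differ by constants on overlaps; these constants define \<open>w\<close>.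
\<close>

lemma cocycle_extension:
  fixes \<P> :: "'a::euclidean_space set set"
  assumes fin: "finite \<P>" and \<P>: "\<And>S. S \<in> \<P> \<Longrightarrow> subspace S" "\<And>S. S \<in> \<P> \<Longrightarrow> dim S + 2 \<le> DIM('a)"
    and X: "open X"
    and loc: "\<And>x. x \<in> X \<Longrightarrow> \<exists>N. open N \<and> x \<in> N \<and> exact_on (N - \<Union>\<P>) z"
  obtains w where "cocycle_on X w" "exact_on (X - \<Union>\<P>) (\<lambda>a b. z a b - w a b)"
proof -
  have "\<forall>x\<in>X. \<exists>r \<phi>. r > 0 \<and> ball x r \<subseteq> X \<and> primitive_on (ball x r - \<Union>\<P>) z \<phi>"
  proof
    fix x assume x: "x \<in> X"
    then obtain N \<phi> where N: "open N" "x \<in> N" "primitive_on (N - \<Union>\<P>) z \<phi>"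
      using loc unfolding exact_on_def by blast
    obtain r where r: "r > 0" "ball x r \<subseteq> N \<inter> X" using openE[of "N \<inter> X" x] N(1,2) X x by blast
    then show "\<exists>r \<phi>. r > 0 \<and> ball x r \<subseteq> X \<and> primitive_on (ball x r - \<Union>\<P>) z \<phi>"
      using primitive_on_subset[OF N(3), of "ball x r - \<Union>\<P>"] by blast
  qed
  from bchoice2[OF this] obtain r \<phi> where
    r\<phi>: "\<forall>x\<in>X. r x > 0 \<and> ball x (r x) \<subseteq> X \<and> primitive_on (ball x (r x) - \<Union>\<P>) z (\<phi> x)" by blast
  define B where "B = (\<lambda>x. ball x (r x))"
  have B: "\<And>x. x \<in> X \<Longrightarrow> x \<in> B x" "\<And>x. open (B x)" "\<And>x. convex (B x)" "\<And>x. x \<in> X \<Longrightarrow> B x \<subseteq> X"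
    "\<And>x. x \<in> X \<Longrightarrow> primitive_on (B x - \<Union>\<P>) z (\<phi> x)"
    using r\<phi> unfolding B_def by auto
  \<comment> \<open>\<open>\<phi> y - \<phi> x\<close> is constant on the overlap, a convex set
    minus subspaces of codimension two, so any point of it determines \<open>k x y\<close>.\<close>
  define k where "k = (\<lambda>x y. let p = (SOME p. p \<in> B x \<inter> B y - \<Union>\<P>) in \<phi> y p - \<phi> x p)"
  have k: "k x y = \<phi> y p - \<phi> x p" if xy: "x \<in> X" "y \<in> X" and p: "p \<in> B x \<inter> B y - \<Union>\<P>" for x y p
  proof -
    define p' where "p' = (SOME p. p \<in> B x \<inter> B y - \<Union>\<P>)"
    have p': "p' \<in> B x \<inter> B y - \<Union>\<P>" unfolding p'_def using p by (rule someI)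
    have "connected (B x \<inter> B y - \<Union>\<P>)"
      using B(2,3) by (intro connected_convex_diff_subspaces fin \<P> open_Int convex_Int) auto
    moreover have "primitive_on (B x \<inter> B y - \<Union>\<P>) z (\<phi> x)" "primitive_on (B x \<inter> B y - \<Union>\<P>) z (\<phi> y)"
      using B(5) xy by (auto intro: primitive_on_subset)
    ultimately have "\<phi> y p' - \<phi> x p' = \<phi> y p - \<phi> x p"
      using primitive_on_unique p' p by blast
    then show ?thesis unfolding k_def Let_def p'_def by simp
  qed
  \<comment> \<open>Additivity is checked at a point off \<open>\<Union>\<P>\<close> in the triple
    overlap with \<open>B a\<close>, since \<open>a\<close> itself may lie on a subspace.\<close>
  have k3: "k x a - k y a = k x y" if "x \<in> X" "y \<in> X" "a \<in> X" "a \<in> B x" "a \<in> B y" for x y a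
  proof -
    have "open (B a \<inter> B x \<inter> B y)" "B a \<inter> B x \<inter> B y \<noteq> {}" using B(1,2) that by blast+
    moreover have "dim S < DIM('a)" if "S \<in> \<P>" for S using \<P>(2)[OF that] by simp
    ultimately obtain p where p: "p \<in> B a \<inter> B x \<inter> B y" "p \<notin> \<Union>\<P>"
      using open_not_subset_Union_subspaces[OF fin] by blast
    then show ?thesis using k[of x a p] k[of y a p] k[of x y p] that by auto
  qed
  define w where "w = (\<lambda>a b. let x = (SOME x. x \<in> X \<and> a \<in> B x \<and> b \<in> B x) in k x a - k x b)"
  have w: "w a b = k x a - k x b" if "x \<in> X" "a \<in> B x" "b \<in> B x" for x a b
  proof -
    define y where "y = (SOME x. x \<in> X \<and> a \<in> B x \<and> b \<in> B x)"
    have y: "y \<in> X \<and> a \<in> B y \<and> b \<in> B y" unfolding y_def by (rule someI[of _ x]) (use that in auto)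
    have "a \<in> X" "b \<in> X" using that B(4) by auto
    then have "k x a - k y a = k x b - k y b" using k3[of x y] that y by metis
    then show ?thesis unfolding w_def Let_def y_def[symmetric] by (simp add: algebra_simps)
  qed
  have "cocycle_on X w"
  proof (rule cocycle_onI)
    fix x assume "x \<in> X"
    then show "\<exists>N F. open N \<and> x \<in> N \<and> (\<forall>a\<in>N \<inter> X. \<forall>b\<in>N \<inter> X. w a b = F b - F a)"
      using B(1,2) w[of x] by (intro exI[of _ "B x"] exI[of _ "\<lambda>a. - k x a"]) auto
  qed
  \<comment> \<open>On \<open>B x\<close> the diagonal \<open>\<lambda>a. \<phi> a a\<close> differs
    from \<open>\<phi> x\<close> by \<open>k x\<close>, and there \<open>w\<close> is the increment
    of \<open>- k x\<close>.\<close>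
  moreover have "primitive_on (X - \<Union>\<P>) (\<lambda>a b. z a b - w a b) (\<lambda>a. \<phi> a a)"
  proof (rule primitive_onI)
    fix x assume x: "x \<in> X - \<Union>\<P>"
    then obtain N where N: "open N" "x \<in> N"
      "\<And>a b. a \<in> N \<Longrightarrow> a \<in> B x - \<Union>\<P> \<Longrightarrow> b \<in> N \<Longrightarrow> b \<in> B x - \<Union>\<P> \<Longrightarrow> z a b = \<phi> x b - \<phi> x a"
      using primitive_onE[OF B(5), of x x] B(1) by blast
    have "z a b - w a b = \<phi> b b - \<phi> a a" if a: "a \<in> N \<inter> B x \<inter> (X - \<Union>\<P>)" and b: "b \<in> N \<inter> B x \<inter> (X - \<Union>\<P>)" for a b
    proof -
      have "k x a = \<phi> a a - \<phi> x a" "k x b = \<phi> b b - \<phi> x b"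
        using k[of x a a] k[of x b b] a b B(1) x by auto
      then show ?thesis using N(3)[of a b] w[of x a b] a b x by auto
    qed
    then show "\<exists>N. open N \<and> x \<in> N \<and> (\<forall>a\<in>N \<inter> (X - \<Union>\<P>). \<forall>b\<in>N \<inter> (X - \<Union>\<P>). z a b - w a b = \<phi> b b - \<phi> a a)"
      using N(1,2) B(1,2) x by (intro exI[of _ "N \<inter> B x"]) auto
  qed
  ultimately show ?thesis using that unfolding exact_on_def by blast
qed

text \<open>
  The points visible from a base point form an open starlike set, which contains the complement of
  finitely many subspaces of codimension two.  Hence any two of these sets meet in a connected set,
  any three have a common point, and their primitives can be normalised to agree.
\<close>

lemma cocycle_codim3_exact:
  fixes \<S> :: "'a::euclidean_space set set"
  assumes fin: "finite \<S>" and \<S>: "\<And>S. S \<in> \<S> \<Longrightarrow> subspace S" "\<And>S. S \<in> \<S> \<Longrightarrow> dim S + 3 \<le> DIM('a)"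
    and z: "cocycle_on (- \<Union>\<S>) z"
  shows "exact_on (- \<Union>\<S>) z"
proof (cases "- \<Union>\<S> = {}")
  case True
  then show ?thesis unfolding exact_on_def primitive_on_def by auto
next
  case False
  define X where "X = - \<Union>\<S>"
  obtain b0 where b0: "b0 \<in> X" using False unfolding X_def by blast
  define st where "st = (\<lambda>b. {x. closed_segment b x \<inter> \<Union>\<S> = {}})"
  have cl: "closed (\<Union>\<S>)" using closed_Union_subspaces fin \<S>(1) .
  have st_sub: "st b \<subseteq> X" for b unfolding st_def X_def using ends_in_segment(2) by blast
  have st_self: "b \<in> st b" if "b \<in> X" for b using that unfolding st_def X_def by simp
  have st_star: "closed_segment b x \<subseteq> st b" if "x \<in> st b" for b x
  proof
    fix y assume "y \<in> closed_segment b x"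
    then have "closed_segment b y \<subseteq> closed_segment b x" by (simp add: subset_closed_segment)
    then show "y \<in> st b" using that unfolding st_def by blast
  qed
  have st_open: "open (st b)" for b
  proof (rule openI)
    fix x assume "x \<in> st b"
    then have dis: "closed_segment b x \<inter> \<Union>\<S> = {}" unfolding st_def by blast
    obtain e where e: "e > 0" "\<And>p q. p \<in> closed_segment b x \<Longrightarrow> q \<in> \<Union>\<S> \<Longrightarrow> e \<le> dist p q"
      using separate_compact_closed[OF compact_segment cl dis] by blast
    have "y \<in> st b" if y: "y \<in> ball x e" for y
    proof -
      have False if q: "q \<in> closed_segment b y" "q \<in> \<Union>\<S>" for q
      proof -
        obtain t where t: "0 \<le> t" "t \<le> 1" "q = (1 - t) *\<^sub>R b + t *\<^sub>R y" using q(1) unfolding in_segment by blast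
        define p where "p = (1 - t) *\<^sub>R b + t *\<^sub>R x"
        have "p \<in> closed_segment b x" unfolding p_def in_segment using t by blast
        then have "e \<le> dist p q" using e(2) q(2) by blast
        also have "dist p q = t * dist x y" unfolding p_def t(3) dist_norm
          using t(1) by (simp flip: scaleR_diff_right)
        also have "\<dots> \<le> dist x y" using t by (simp add: mult_left_le_one_le)
        also have "\<dots> < e" using y by simp
        finally show False by simp
      qed
      then show ?thesis unfolding st_def by blast
    qed
    then show "\<exists>e>0. ball x e \<subseteq> st b" using e(1) by blast
  qed
  \<comment> \<open>A point invisible from \<open>b\<close> lies in the span of \<open>b\<close> and
    some \<open>S\<close>. This is where codimension three enters: with one dimension more,
    codimension two is left.\<close>
  have gen: "\<exists>\<Q>. finite \<Q> \<and> (\<forall>S\<in>\<Q>. subspace S \<and> dim S + 2 \<le> DIM('a)) \<and> - \<Union>\<Q> \<subseteq> st b" if "b \<in> X" for b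
  proof (intro exI conjI)
    show "finite ((\<lambda>S. span (insert b S)) ` \<S>)" using fin by simp
    show "\<forall>S\<in>(\<lambda>S. span (insert b S)) ` \<S>. subspace S \<and> dim S + 2 \<le> DIM('a)"
    proof
      fix T assume "T \<in> (\<lambda>S. span (insert b S)) ` \<S>"
      then obtain S where "S \<in> \<S>" "T = span (insert b S)" by blast
      then show "subspace T \<and> dim T + 2 \<le> DIM('a)" using \<S>(2)[of S] dim_span_insert_le[of b S] by auto
    qed
    show "- \<Union> ((\<lambda>S. span (insert b S)) ` \<S>) \<subseteq> st b"
      using closed_segment_avoids_subspace \<S>(1) that unfolding st_def X_def by blast
  qed
  have conn: "connected (st b \<inter> st c)" and dense3: "\<exists>p. p \<in> st b0 \<inter> st b \<inter> st c" if bc: "b \<in> X" "c \<in> X" for b c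
  proof -
    obtain \<Q>1 \<Q>2 \<Q>0 where Q: "finite \<Q>1" "\<forall>S\<in>\<Q>1. subspace S \<and> dim S + 2 \<le> DIM('a)" "- \<Union>\<Q>1 \<subseteq> st b"
      "finite \<Q>2" "\<forall>S\<in>\<Q>2. subspace S \<and> dim S + 2 \<le> DIM('a)" "- \<Union>\<Q>2 \<subseteq> st c"
      "finite \<Q>0" "\<forall>S\<in>\<Q>0. subspace S \<and> dim S + 2 \<le> DIM('a)" "- \<Union>\<Q>0 \<subseteq> st b0"
      using gen bc b0 by metis
    define \<Q> where "\<Q> = \<Q>1 \<union> \<Q>2"
    have Q': "finite \<Q>" "\<And>S. S \<in> \<Q> \<Longrightarrow> subspace S" "\<And>S. S \<in> \<Q> \<Longrightarrow> dim S + 2 \<le> DIM('a)"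
      unfolding \<Q>_def using Q by auto
    have "connected (UNIV - \<Union>\<Q>)" by (rule connected_convex_diff_subspaces[OF Q']) auto
    moreover have "UNIV - \<Union>\<Q> \<subseteq> st b \<inter> st c" using Q unfolding \<Q>_def by blast
    \<comment> \<open>Lying between a connected set and its closure makes the intersection
      connected.\<close>
    moreover have "st b \<inter> st c \<subseteq> closure (UNIV - \<Union>\<Q>)"
    proof
      fix x show "x \<in> closure (UNIV - \<Union>\<Q>)"
        unfolding closure_approachable
      proof (intro allI impI)
        fix e :: real assume "e > 0"
        moreover have "dim S < DIM('a)" if "S \<in> \<Q>" for S using Q'(3)[OF that] by simp
        ultimately obtain p where "p \<in> ball x e" "p \<notin> \<Union>\<Q>"
          using open_not_subset_Union_subspaces[OF Q'(1), of "ball x e"] by auto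
        then show "\<exists>y\<in>UNIV - \<Union>\<Q>. dist y x < e" by (auto simp: dist_commute)
      qed
    qed
    ultimately show "connected (st b \<inter> st c)" using connected_intermediate_closure by blast
    have "dim S < DIM('a)" if "S \<in> \<Q>0 \<union> \<Q>1 \<union> \<Q>2" for S using that Q(2,5,8) by force
    then obtain p where "p \<notin> \<Union>(\<Q>0 \<union> \<Q>1 \<union> \<Q>2)"
      using open_not_subset_Union_subspaces[of "\<Q>0 \<union> \<Q>1 \<union> \<Q>2" UNIV] Q(1,4,7) by auto
    then show "\<exists>p. p \<in> st b0 \<inter> st b \<inter> st c" using Q(3,6,9) by blast
  qed
  have "\<exists>F. primitive_on (st b) z F" if "b \<in> X" for b
    using cocycle_on_starlike_exact[of b "st b" z] st_self[OF that] st_star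
      cocycle_on_subset[OF z, of "st b"] st_sub[of b] unfolding exact_on_def X_def by blast
  then obtain F where F: "\<And>b. b \<in> X \<Longrightarrow> primitive_on (st b) z (F b)" by metis
  have diff: "F b p - F c p = F b q - F c q" if "b \<in> X" "c \<in> X" "p \<in> st b \<inter> st c" "q \<in> st b \<inter> st c" for b c p q
    using primitive_on_unique[OF conn[OF that(1,2)], of z "F b" "F c" p q] F that
    by (meson inf_le1 inf_le2 primitive_on_subset)
  define k where "k = (\<lambda>b. let p = (SOME p. p \<in> st b0 \<inter> st b) in F b0 p - F b p)"
  have k: "k b = F b0 p - F b p" if "b \<in> X" "p \<in> st b0 \<inter> st b" for b p
    using diff[of b0 b p "SOME p. p \<in> st b0 \<inter> st b"] someI[of "\<lambda>p. p \<in> st b0 \<inter> st b", OF that(2)] that b0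
    unfolding k_def Let_def by auto
  \<comment> \<open>Adding \<open>k x\<close> normalises \<open>F x\<close> to agree with
    \<open>F b0\<close>; the normalised primitives then agree with each other, and on
    \<open>st x\<close> the diagonal is one of them.\<close>
  define H where "H = (\<lambda>x. F x x + k x)"
  have H: "H y = F x y + k x" if "x \<in> X" "y \<in> st x" for x y
  proof -
    have y: "y \<in> X" using st_sub that(2) by blast
    have "\<exists>p. p \<in> st b0 \<inter> st x \<inter> st y" by (rule dense3[OF that(1) y])
    then obtain p where p: "p \<in> st b0 \<inter> st x \<inter> st y" by blast
    have "F y y - F x y = F y p - F x p" using diff[OF y that(1), of y p] st_self[OF y] that(2) p by blast
    then show ?thesis using k[of x p] k[of y p] that(1) y p unfolding H_def by auto
  qed
  have "primitive_on X z H"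
  proof (rule primitive_onI)
    fix x assume x: "x \<in> X"
    have dz: "\<And>y. y \<in> st x \<Longrightarrow> H y = F x y + k x" by (rule H[OF x])
    obtain N where N: "open N" "x \<in> N" "\<And>a b. a \<in> N \<Longrightarrow> a \<in> st x \<Longrightarrow> b \<in> N \<Longrightarrow> b \<in> st x \<Longrightarrow> z a b = F x b - F x a"
      using primitive_onE[OF F[OF x] st_self[OF x]] by blast
    then show "\<exists>N. open N \<and> x \<in> N \<and> (\<forall>a\<in>N \<inter> X. \<forall>b\<in>N \<inter> X. z a b = H b - H a)"
      using st_open[of x] st_self[OF x] dz by (intro exI[of _ "N \<inter> st x"]) (simp add: open_Int)
  qed
  then show ?thesis unfolding exact_on_def X_def by blast
qed

text \<open>Points on a single member are harmless by \<open>loc\<close>, so up to an exact part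
  \<open>z\<close> is a cocycle on the complement of the pairwise intersections. These have
  codimension three and obstruct nothing.\<close>

lemma cocycle_codim2_exact:
  fixes \<P> :: "'a::euclidean_space set set"
  assumes fin: "finite \<P>" and \<P>: "\<And>S. S \<in> \<P> \<Longrightarrow> subspace S" "\<And>S. S \<in> \<P> \<Longrightarrow> dim S + 2 \<le> DIM('a)"
    and int: "\<And>S T. S \<in> \<P> \<Longrightarrow> T \<in> \<P> \<Longrightarrow> S \<noteq> T \<Longrightarrow> dim (S \<inter> T) + 3 \<le> DIM('a)"
    and z: "cocycle_on (- \<Union>\<P>) z"
    and loc: "\<And>S q. S \<in> \<P> \<Longrightarrow> q \<in> S \<Longrightarrow> (\<And>T. T \<in> \<P> \<Longrightarrow> q \<in> T \<Longrightarrow> T = S) \<Longrightarrow>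
               \<exists>N. open N \<and> q \<in> N \<and> exact_on (N - \<Union>\<P>) z"
  shows "exact_on (- \<Union>\<P>) z"
proof -
  define \<S> where "\<S> = {S \<inter> T | S T. S \<in> \<P> \<and> T \<in> \<P> \<and> S \<noteq> T}"
  have "\<S> \<subseteq> (\<lambda>(S,T). S \<inter> T) ` (\<P> \<times> \<P>)" unfolding \<S>_def by auto
  then have fS: "finite \<S>" by (rule finite_subset) (use fin in simp)
  have S: "subspace R" "dim R + 3 \<le> DIM('a)" if "R \<in> \<S>" for R
  proof -
    obtain A B where "A \<in> \<P>" "B \<in> \<P>" "A \<noteq> B" "R = A \<inter> B" using \<open>R \<in> \<S>\<close> unfolding \<S>_def by blast
    then show "subspace R" "dim R + 3 \<le> DIM('a)" using subspace_inter[OF \<P>(1) \<P>(1)] int by blast+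
  qed
  have cl: "closed (\<Union>\<P>)" using closed_Union_subspaces fin \<P>(1) .
  have "open (- \<Union>\<S>)" using closed_Union_subspaces[OF fS S(1)] by (simp add: open_Compl)
  moreover have "\<exists>N. open N \<and> x \<in> N \<and> exact_on (N - \<Union>\<P>) z" if x: "x \<in> - \<Union>\<S>" for x
  proof (cases "x \<in> \<Union>\<P>")
    case True
    then obtain S where "S \<in> \<P>" "x \<in> S" by blast
    moreover have "T = S" if "T \<in> \<P>" "x \<in> T" for T
      using that \<open>S \<in> \<P>\<close> \<open>x \<in> S\<close> x unfolding \<S>_def by blast
    ultimately show ?thesis using loc by blast
  next
    case False
    then obtain N F where N: "open N" "x \<in> N" "\<And>a b. a \<in> N \<Longrightarrow> a \<in> - \<Union>\<P> \<Longrightarrow> b \<in> N \<Longrightarrow> b \<in> - \<Union>\<P> \<Longrightarrow> z a b = F b - F a"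
      using cocycle_onE[OF z, of x] by blast
    have "primitive_on (N - \<Union>\<P>) z F" using N by (intro primitive_onI exI[of _ N]) auto
    then show ?thesis using N(1,2) unfolding exact_on_def by blast
  qed
  ultimately obtain w where w: "cocycle_on (- \<Union>\<S>) w" "exact_on (- \<Union>\<S> - \<Union>\<P>) (\<lambda>a b. z a b - w a b)"
    using cocycle_extension[OF fin \<P>, of "- \<Union>\<S>" z] by blast
  have sub: "- \<Union>\<S> - \<Union>\<P> = - \<Union>\<P>" unfolding \<S>_def by blast
  have "exact_on (- \<Union>\<P>) w"
    using cocycle_codim3_exact[OF fS S w(1)] exact_on_subset sub by blast
  then show ?thesis using exact_on_add[OF w(2)[unfolded sub]] by fastforce
qed

section \<open>Winding around a subspace of codimension two\<close>

text \<open>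
  Counts signed crossings of the hypersurface \<open>K \<inter> {x. x \<bullet> n = 0}\<close>; a cocycle away from the
  boundary of that hypersurface.
\<close>

definition jump_cocycle :: "'a::real_inner set \<Rightarrow> 'a \<Rightarrow> 'a \<Rightarrow> 'a \<Rightarrow> rat" where
  "jump_cocycle K n x y =
     (if x \<in> K \<and> y \<in> K then of_bool (0 < y \<bullet> n) - of_bool (0 < x \<bullet> n) else 0)"

text \<open>Represents the winding class around \<open>perp2 a b\<close>, counted by crossings of a
  half-hyperplane with that boundary.\<close>

definition angle_cocycle :: "'a::real_inner \<Rightarrow> 'a \<Rightarrow> 'a \<Rightarrow> 'a \<Rightarrow> rat" where
  "angle_cocycle a b = jump_cocycle {x. 0 < x \<bullet> a} b"

definition perp2 :: "'a::real_inner \<Rightarrow> 'a \<Rightarrow> 'a set" where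
  "perp2 a b = {x. x \<bullet> a = 0 \<and> x \<bullet> b = 0}"

lemma open_inner_pos: "open {x::'a::real_inner. 0 < x \<bullet> a}"
  and open_inner_neg: "open {x::'a::real_inner. x \<bullet> a < 0}"
  by (auto intro!: open_Collect_less continuous_intros)

lemma inner_sign_nhd:
  fixes x n :: "'a::real_inner"
  assumes "x \<bullet> n \<noteq> 0"
  shows "\<exists>N s. open N \<and> x \<in> N \<and> (\<forall>y\<in>N. y \<bullet> n \<noteq> 0 \<and> (0 < y \<bullet> n \<longleftrightarrow> s))"
proof (cases "0 < x \<bullet> n")
  case True
  then show ?thesis using open_inner_pos[of n] by (intro exI[of _ "{x. 0 < x \<bullet> n}"] exI[of _ True]) auto
next
  case False
  then show ?thesis using open_inner_neg[of n] assms by (intro exI[of _ "{x. x \<bullet> n < 0}"] exI[of _ False]) auto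
qed

lemma primitive_onI2:
  assumes "\<And>x. x \<in> X \<Longrightarrow> \<exists>N. open N \<and> x \<in> N \<and> (\<forall>a\<in>N. \<forall>b\<in>N. z a b = F b - F a)"
  shows "primitive_on X z F"
  using assms by (intro primitive_onI) (meson Int_iff)

text \<open>Inside \<open>K\<close> the value is the increment of an indicator, off the hyperplane
  this indicator is locally constant, and away from \<open>K\<close> the value is 0. Only boundary
  points of \<open>K\<close> on the hyperplane have to be excluded.\<close>

lemma jump_cocycle_cocycle:
  assumes "open K" and "\<And>x. x \<in> X \<Longrightarrow> x \<in> K \<or> x \<bullet> n \<noteq> 0 \<or> (\<exists>N. open N \<and> x \<in> N \<and> N \<inter> K = {})"
  shows "cocycle_on X (jump_cocycle K n)"
proof (rule cocycle_onI)
  fix x assume "x \<in> X"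
  then consider "x \<in> K" | "x \<bullet> n \<noteq> 0" | N where "open N" "x \<in> N" "N \<inter> K = {}" using assms(2) by blast
  then show "\<exists>N F. open N \<and> x \<in> N \<and> (\<forall>a\<in>N \<inter> X. \<forall>b\<in>N \<inter> X. jump_cocycle K n a b = F b - F a)"
  proof cases
    case 1
    then show ?thesis using assms(1)
      by (intro exI[of _ K] exI[of _ "\<lambda>x. of_bool (0 < x \<bullet> n)"]) (auto simp: jump_cocycle_def)
  next
    case 2
    obtain N s where N: "open N" "x \<in> N" "\<And>y. y \<in> N \<Longrightarrow> y \<bullet> n \<noteq> 0 \<and> (0 < y \<bullet> n \<longleftrightarrow> s)"
      using inner_sign_nhd[OF 2] by blast
    then show ?thesis by (intro exI[of _ N] exI[of _ "\<lambda>x. 0"]) (simp add: jump_cocycle_def)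
  next
    case 3
    then show ?thesis by (intro exI[of _ N] exI[of _ "\<lambda>x. 0"]) (auto simp: jump_cocycle_def)
  qed
qed

lemma angle_cocycle_cocycle: "cocycle_on (- perp2 a b) (angle_cocycle a b)"
  unfolding angle_cocycle_def
proof (rule jump_cocycle_cocycle[OF open_inner_pos])
  fix x assume "x \<in> - perp2 a b"
  then consider "0 < x \<bullet> a" | "x \<bullet> b \<noteq> 0" | "x \<bullet> a < 0" unfolding perp2_def by fastforce
  then show "x \<in> {x. 0 < x \<bullet> a} \<or> x \<bullet> b \<noteq> 0 \<or> (\<exists>N. open N \<and> x \<in> N \<and> N \<inter> {x. 0 < x \<bullet> a} = {})"
    using open_inner_neg[of a] by cases (auto intro!: exI[of _ "{x. x \<bullet> a < 0}"])
qed

section \<open>The winding class under a change of the two covectors\<close>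

lemma exact_onI: "primitive_on X z F \<Longrightarrow> exact_on X z"
  unfolding exact_on_def by blast

text \<open>Product rule for the indicators of \<open>0 < x \<bullet> a\<close> and
  \<open>0 < x \<bullet> b\<close>; off \<open>perp2 a b\<close> one of them is locally
  constant.\<close>

lemma angle_cocycle_swap:
  "exact_on (- perp2 a b) (\<lambda>x y. angle_cocycle a b x y + angle_cocycle b a x y)"
proof (rule exact_onI[of _ _ "\<lambda>x. of_bool (0 < x \<bullet> a \<and> 0 < x \<bullet> b)"], rule primitive_onI2)
  fix x assume "x \<in> - perp2 a b"
  then consider "x \<bullet> a \<noteq> 0" | "x \<bullet> b \<noteq> 0" unfolding perp2_def by blast
  then show "\<exists>N. open N \<and> x \<in> N \<and> (\<forall>c\<in>N. \<forall>y\<in>N. angle_cocycle a b c y + angle_cocycle b a c y =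
      of_bool (0 < y \<bullet> a \<and> 0 < y \<bullet> b) - of_bool (0 < c \<bullet> a \<and> 0 < c \<bullet> b))"
  proof cases
    case 1
    obtain N s where N: "open N" "x \<in> N" "\<And>y. y \<in> N \<Longrightarrow> y \<bullet> a \<noteq> 0 \<and> (0 < y \<bullet> a \<longleftrightarrow> s)"
      using inner_sign_nhd[OF 1] by blast
    then show ?thesis by (intro exI[of _ N]) (simp add: angle_cocycle_def jump_cocycle_def)
  next
    case 2
    obtain N s where N: "open N" "x \<in> N" "\<And>y. y \<in> N \<Longrightarrow> y \<bullet> b \<noteq> 0 \<and> (0 < y \<bullet> b \<longleftrightarrow> s)"
      using inner_sign_nhd[OF 2] by blast
    then show ?thesis by (intro exI[of _ N]) (simp add: angle_cocycle_def jump_cocycle_def)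
  qed
qed

text \<open>On \<open>x \<bullet> b = 0\<close> the covectors \<open>a\<close> and
  \<open>a + k *\<^sub>R b\<close> take the same value, so both classes count crossings of the same
  set and agree near every point.\<close>

lemma angle_cocycle_shear:
  "exact_on (- perp2 a b) (\<lambda>x y. angle_cocycle (a + k *\<^sub>R b) b x y - angle_cocycle a b x y)"
proof (rule exact_onI[of _ _ "\<lambda>x. 0"], rule primitive_onI2)
  fix x assume x: "x \<in> - perp2 a b"
  then consider "x \<bullet> b \<noteq> 0" | "x \<bullet> b = 0" "0 < x \<bullet> a" | "x \<bullet> b = 0" "x \<bullet> a < 0"
    unfolding perp2_def by fastforce
  then show "\<exists>N. open N \<and> x \<in> N \<and> (\<forall>c\<in>N. \<forall>y\<in>N. angle_cocycle (a + k *\<^sub>R b) b c y - angle_cocycle a b c y = 0 - 0)"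
  proof cases
    case 1
    obtain N s where N: "open N" "x \<in> N" "\<And>y. y \<in> N \<Longrightarrow> y \<bullet> b \<noteq> 0 \<and> (0 < y \<bullet> b \<longleftrightarrow> s)"
      using inner_sign_nhd[OF 1] by blast
    then show ?thesis by (intro exI[of _ N]) (simp add: angle_cocycle_def jump_cocycle_def)
  next
    case 2
    then show ?thesis using open_inner_pos[of a] open_inner_pos[of "a + k *\<^sub>R b"]
      by (intro exI[of _ "{x. 0 < x \<bullet> a} \<inter> {x. 0 < x \<bullet> (a + k *\<^sub>R b)}"])
        (auto simp: angle_cocycle_def jump_cocycle_def inner_add_right)
  next
    case 3
    then show ?thesis using open_inner_neg[of a] open_inner_neg[of "a + k *\<^sub>R b"]
      by (intro exI[of _ "{x. x \<bullet> a < 0} \<inter> {x. x \<bullet> (a + k *\<^sub>R b) < 0}"])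
        (auto simp: angle_cocycle_def jump_cocycle_def inner_add_right)
  qed
qed

text \<open>Reversing \<open>b\<close> reverses the direction of crossing. The indicators of
  \<open>0 < x \<bullet> b\<close> and \<open>x \<bullet> b < 0\<close> fail to add up to 1 only on
  the hyperplane, which the primitive corrects.\<close>

lemma angle_cocycle_neg_right:
  "exact_on (- perp2 a b) (\<lambda>x y. angle_cocycle a (- b) x y + angle_cocycle a b x y)"
proof (rule exact_onI[of _ _ "\<lambda>x. - of_bool (0 < x \<bullet> a \<and> x \<bullet> b = 0)"], rule primitive_onI2)
  fix x assume x: "x \<in> - perp2 a b"
  then consider "x \<bullet> b \<noteq> 0" | "0 < x \<bullet> a" | "x \<bullet> a < 0"
    unfolding perp2_def by fastforce
  then show "\<exists>N. open N \<and> x \<in> N \<and> (\<forall>c\<in>N. \<forall>y\<in>N. angle_cocycle a (- b) c y + angle_cocycle a b c y =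
     - of_bool (0 < y \<bullet> a \<and> y \<bullet> b = 0) - - of_bool (0 < c \<bullet> a \<and> c \<bullet> b = 0))"
  proof cases
    case 1
    obtain N s where N: "open N" "x \<in> N" "\<And>y. y \<in> N \<Longrightarrow> y \<bullet> b \<noteq> 0 \<and> (0 < y \<bullet> b \<longleftrightarrow> s)"
      using inner_sign_nhd[OF 1] by blast
    have "y \<bullet> b < 0 \<longleftrightarrow> \<not> s" if "y \<in> N" for y using N(3)[OF that] by linarith
    then show ?thesis using N by (intro exI[of _ N]) (simp add: angle_cocycle_def jump_cocycle_def)
  next
    case 2
    then show ?thesis using open_inner_pos[of a]
      by (intro exI[of _ "{x. 0 < x \<bullet> a}"])
        (auto simp: angle_cocycle_def jump_cocycle_def of_bool_def)
  next
    case 3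
    then show ?thesis using open_inner_neg[of a]
      by (intro exI[of _ "{x. x \<bullet> a < 0}"]) (auto simp: angle_cocycle_def jump_cocycle_def)
  qed
qed

text \<open>The two half-hyperplanes together form the whole hyperplane
  \<open>x \<bullet> b = 0\<close>, and crossing that is the increment of an indicator.\<close>

lemma angle_cocycle_neg_left:
  "exact_on (- perp2 a b) (\<lambda>x y. angle_cocycle (- a) b x y + angle_cocycle a b x y)"
proof (rule exact_onI[of _ _ "\<lambda>x. of_bool (0 < x \<bullet> b)"], rule primitive_onI2)
  fix x assume x: "x \<in> - perp2 a b"
  then consider "x \<bullet> b \<noteq> 0" | "x \<bullet> a \<noteq> 0" unfolding perp2_def by blast
  then show "\<exists>N. open N \<and> x \<in> N \<and> (\<forall>c\<in>N. \<forall>y\<in>N. angle_cocycle (- a) b c y + angle_cocycle a b c y =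
     of_bool (0 < y \<bullet> b) - of_bool (0 < c \<bullet> b))"
  proof cases
    case 1
    obtain N s where N: "open N" "x \<in> N" "\<And>y. y \<in> N \<Longrightarrow> y \<bullet> b \<noteq> 0 \<and> (0 < y \<bullet> b \<longleftrightarrow> s)"
      using inner_sign_nhd[OF 1] by blast
    then show ?thesis by (intro exI[of _ N]) (simp add: angle_cocycle_def jump_cocycle_def)
  next
    case 2
    then consider "0 < x \<bullet> a" | "x \<bullet> a < 0" by linarith
    then show ?thesis
    proof cases
      case 1
      then show ?thesis using open_inner_pos[of a]
        by (intro exI[of _ "{x. 0 < x \<bullet> a}"]) (auto simp: angle_cocycle_def jump_cocycle_def)
    next
      case 2
      then show ?thesis using open_inner_neg[of a]
        by (intro exI[of _ "{x. x \<bullet> a < 0}"]) (auto simp: angle_cocycle_def jump_cocycle_def)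
    qed
  qed
qed

definition rat_sgn :: "real \<Rightarrow> rat" where
  "rat_sgn r = (if 0 < r then 1 else if r < 0 then -1 else 0)"

lemma rat_sgn_mult: "rat_sgn (r * s) = rat_sgn r * rat_sgn s"
  unfolding rat_sgn_def by (auto simp: zero_less_mult_iff mult_less_0_iff)

lemma rat_sgn_minus: "rat_sgn (- r) = - rat_sgn r"
  unfolding rat_sgn_def by auto

lemma angle_cocycle_scale_pos: "0 < s \<Longrightarrow> 0 < t \<Longrightarrow> angle_cocycle (s *\<^sub>R a) (t *\<^sub>R b) = angle_cocycle a b"
  unfolding angle_cocycle_def jump_cocycle_def by (intro ext) (simp add: zero_less_mult_iff)

lemma perp2_scale: "s \<noteq> 0 \<Longrightarrow> t \<noteq> 0 \<Longrightarrow> perp2 (s *\<^sub>R a) (t *\<^sub>R b) = perp2 a b"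
  unfolding perp2_def by auto

lemma exact_on_eq: "exact_on X z \<Longrightarrow> (\<And>x y. z x y = w x y) \<Longrightarrow> exact_on X w"
  by (metis (no_types, lifting) ext)

lemma angle_cocycle_scale:
  assumes "s \<noteq> 0" "t \<noteq> 0"
  shows "exact_on (- perp2 a b) (\<lambda>x y. angle_cocycle (s *\<^sub>R a) (t *\<^sub>R b) x y - rat_sgn (s * t) * angle_cocycle a b x y)"
proof -
  have s: "angle_cocycle (s *\<^sub>R a) (t *\<^sub>R b) = angle_cocycle (if 0 < s then a else - a) (if 0 < t then b else - b)"
    using angle_cocycle_scale_pos[of "\<bar>s\<bar>" "\<bar>t\<bar>" "if 0 < s then a else - a" "if 0 < t then b else - b"] assms
    by (auto split: if_splits)
  have "exact_on (- perp2 a b) (\<lambda>x y. angle_cocycle (- a) (- b) x y - angle_cocycle a b x y)"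
  proof -
    have "perp2 (- a) b = perp2 a b" unfolding perp2_def by auto
    then have "exact_on (- perp2 a b) (\<lambda>x y. angle_cocycle (- a) (- b) x y + angle_cocycle (- a) b x y)"
      using angle_cocycle_neg_right[of "- a" b] by simp
    from exact_on_diff[OF this angle_cocycle_neg_left[of a b]] show ?thesis by simp
  qed
  then show ?thesis using s assms angle_cocycle_neg_left[of a b] angle_cocycle_neg_right[of a b] exact_on_zero
    by (cases "0 < s"; cases "0 < t") (auto simp: rat_sgn_def zero_less_mult_iff mult_less_0_iff)
qed

lemma angle_cocycle_triangular:
  assumes "\<alpha> \<noteq> 0" "\<delta> \<noteq> 0"
  shows "exact_on (- perp2 a b) (\<lambda>x y. angle_cocycle (\<alpha> *\<^sub>R a + \<beta> *\<^sub>R b) (\<delta> *\<^sub>R b) x y - rat_sgn (\<alpha> * \<delta>) * angle_cocycle a b x y)"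
proof -
  have "\<alpha> *\<^sub>R a + \<beta> *\<^sub>R b = \<alpha> *\<^sub>R a + (\<beta> / \<delta>) *\<^sub>R (\<delta> *\<^sub>R b)" using assms by simp
  then have "exact_on (- perp2 a b) (\<lambda>x y. angle_cocycle (\<alpha> *\<^sub>R a + \<beta> *\<^sub>R b) (\<delta> *\<^sub>R b) x y - angle_cocycle (\<alpha> *\<^sub>R a) (\<delta> *\<^sub>R b) x y)"
    using angle_cocycle_shear[of "\<alpha> *\<^sub>R a" "\<delta> *\<^sub>R b" "\<beta> / \<delta>"] perp2_scale[of \<alpha> \<delta> a b] assms by metis
  from exact_on_add[OF this angle_cocycle_scale[OF assms, of a b]] show ?thesis by simp
qed

lemma perp2_change:
  assumes "\<alpha> * \<delta> - \<beta> * \<gamma> \<noteq> 0"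
  shows "perp2 (\<alpha> *\<^sub>R a + \<beta> *\<^sub>R b) (\<gamma> *\<^sub>R a + \<delta> *\<^sub>R b) = perp2 a b"
proof -
  have "p = 0 \<and> q = 0" if "\<alpha> * p + \<beta> * q = 0" "\<gamma> * p + \<delta> * q = 0" for p q :: real
  proof -
    have "(\<alpha> * \<delta> - \<beta> * \<gamma>) * p = \<delta> * (\<alpha> * p + \<beta> * q) - \<beta> * (\<gamma> * p + \<delta> * q)" by (simp add: algebra_simps)
    moreover have "(\<alpha> * \<delta> - \<beta> * \<gamma>) * q = \<alpha> * (\<gamma> * p + \<delta> * q) - \<gamma> * (\<alpha> * p + \<beta> * q)" by (simp add: algebra_simps)
    ultimately have "(\<alpha> * \<delta> - \<beta> * \<gamma>) * p = 0" "(\<alpha> * \<delta> - \<beta> * \<gamma>) * q = 0"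
      by (simp_all only: that mult_zero_right diff_0_right)
    then show ?thesis using assms by (metis mult_eq_0_iff)
  qed
  then have "(\<alpha> * p + \<beta> * q = 0 \<and> \<gamma> * p + \<delta> * q = 0) = (p = 0 \<and> q = 0)" for p q :: real
    by (metis add_0 mult_zero_right)
  then show ?thesis unfolding perp2_def by (simp add: inner_add_right)
qed

text \<open>Elimination as for matrices: a shear removes \<open>a\<close> from the first covector, a
  swap makes the pair triangular, and only the sign of the determinant survives.\<close>

lemma angle_cocycle_change:
  assumes det: "\<alpha> * \<delta> - \<beta> * \<gamma> \<noteq> 0"
  shows "exact_on (- perp2 a b) (\<lambda>x y. angle_cocycle (\<alpha> *\<^sub>R a + \<beta> *\<^sub>R b) (\<gamma> *\<^sub>R a + \<delta> *\<^sub>R b) x y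
           - rat_sgn (\<alpha> * \<delta> - \<beta> * \<gamma>) * angle_cocycle a b x y)"
proof (cases "\<gamma> = 0")
  case True
  then show ?thesis using angle_cocycle_triangular[of \<alpha> \<delta> a b \<beta>] det by auto
next
  case False
  define a' b' where "a' = \<alpha> *\<^sub>R a + \<beta> *\<^sub>R b" and "b' = \<gamma> *\<^sub>R a + \<delta> *\<^sub>R b"
  \<comment> \<open>\<open>\<mu>\<close> is the coefficient of \<open>b\<close> that remains when
    \<open>a\<close> is eliminated from \<open>a'\<close> by means of \<open>b'\<close>.\<close>
  define \<mu> where "\<mu> = - (\<alpha> * \<delta> - \<beta> * \<gamma>) / \<gamma>"
  have \<mu>: "\<mu> \<noteq> 0" unfolding \<mu>_def using det False by simp
  have P: "perp2 a' b' = perp2 a b" unfolding a'_def b'_def using perp2_change[OF det] .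
  have e: "a' + (- \<alpha> / \<gamma>) *\<^sub>R b' = \<mu> *\<^sub>R b"
    unfolding a'_def b'_def \<mu>_def using False by (simp add: scaleR_add_right diff_divide_distrib flip: scaleR_add_left)
      (simp add: algebra_simps)
  have P2: "perp2 b' (\<mu> *\<^sub>R b) = perp2 a b"
    using perp2_change[of \<gamma> \<mu> \<delta> 0 a b] False \<mu> unfolding b'_def by simp
  have P3: "perp2 (\<mu> *\<^sub>R b) b' = perp2 a b" using P2 unfolding perp2_def by blast
  have 1: "exact_on (- perp2 a b) (\<lambda>x y. angle_cocycle (\<mu> *\<^sub>R b) b' x y - angle_cocycle a' b' x y)"
    using angle_cocycle_shear[of a' b' "- \<alpha> / \<gamma>"] P e by metis
  have 2: "exact_on (- perp2 a b) (\<lambda>x y. angle_cocycle (\<mu> *\<^sub>R b) b' x y + angle_cocycle b' (\<mu> *\<^sub>R b) x y)"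
    using angle_cocycle_swap[of "\<mu> *\<^sub>R b" b'] P3 by metis
  have 3: "exact_on (- perp2 a b) (\<lambda>x y. angle_cocycle b' (\<mu> *\<^sub>R b) x y - rat_sgn (\<gamma> * \<mu>) * angle_cocycle a b x y)"
    unfolding b'_def by (rule angle_cocycle_triangular[OF False \<mu>])
  have "\<gamma> * \<mu> = - (\<alpha> * \<delta> - \<beta> * \<gamma>)" unfolding \<mu>_def using False by simp
  then have s: "rat_sgn (\<gamma> * \<mu>) = - rat_sgn (\<alpha> * \<delta> - \<beta> * \<gamma>)" using rat_sgn_minus by metis
  show ?thesis
    by (rule exact_on_eq[OF exact_on_diff[OF exact_on_diff[OF 2 1] 3]])
      (simp add: s a'_def b'_def)
qed

section \<open>Weights around a subspace of codimension two\<close>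

definition indep_pair :: "'a::real_inner \<Rightarrow> 'a \<Rightarrow> bool" where
  "indep_pair a b \<longleftrightarrow> (\<forall>s t. s *\<^sub>R a + t *\<^sub>R b = 0 \<longrightarrow> s = 0 \<and> t = 0)"

lemma indep_pair_dual:
  assumes "indep_pair a b"
  obtains d e where "d \<bullet> a = 1" "d \<bullet> b = 0" "e \<bullet> a = 0" "e \<bullet> b = 1"
proof -
  have a0: "a \<noteq> 0" using assms unfolding indep_pair_def
    by (metis add_0 scaleR_zero_left scaleR_zero_right zero_neq_one)
  have b0: "b \<noteq> 0" using assms unfolding indep_pair_def
    by (metis add_0 scaleR_zero_left scaleR_zero_right zero_neq_one)
  define u where "u = a - ((a \<bullet> b) / (b \<bullet> b)) *\<^sub>R b"
  define v where "v = b - ((a \<bullet> b) / (a \<bullet> a)) *\<^sub>R a"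
  have u0: "u \<noteq> 0"
  proof
    assume "u = 0"
    then have "1 *\<^sub>R a + (- ((a \<bullet> b) / (b \<bullet> b))) *\<^sub>R b = 0" unfolding u_def by simp
    then show False using assms unfolding indep_pair_def by fastforce
  qed
  have v0: "v \<noteq> 0"
  proof
    assume "v = 0"
    then have "(- ((a \<bullet> b) / (a \<bullet> a))) *\<^sub>R a + 1 *\<^sub>R b = 0" unfolding v_def by simp
    then show False using assms unfolding indep_pair_def by fastforce
  qed
  have ub: "u \<bullet> b = 0" unfolding u_def using b0 by (simp add: inner_diff_left)
  have va: "v \<bullet> a = 0" unfolding v_def using a0 by (simp add: inner_diff_left inner_commute[of b a])
  have ua: "u \<bullet> a = u \<bullet> u" using ub unfolding u_def by (simp add: inner_diff_right)
  have vb: "v \<bullet> b = v \<bullet> v" using va unfolding v_def by (simp add: inner_diff_right)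
  show ?thesis
    by (rule that[of "(1 / (u \<bullet> u)) *\<^sub>R u" "(1 / (v \<bullet> v)) *\<^sub>R v"]) (use u0 v0 ub va ua vb in auto)
qed

text \<open>
  The weight at \<open>q \<in> perp2 a b\<close> is the coordinate of the germ of \<open>z\<close> in the first cohomology of a
  punctured neighbourhood, which is generated by \<open>angle_cocycle a b\<close>.
\<close>

definition is_weight :: "('a::euclidean_space \<Rightarrow> 'a \<Rightarrow> rat) \<Rightarrow> 'a \<Rightarrow> 'a \<Rightarrow> 'a \<Rightarrow> rat \<Rightarrow> bool" where
  "is_weight z a b q c \<longleftrightarrow>
     (\<exists>N. open N \<and> q \<in> N \<and> exact_on (N - perp2 a b) (\<lambda>x y. z x y - c * angle_cocycle a b x y))"

definition weight :: "('a::euclidean_space \<Rightarrow> 'a \<Rightarrow> rat) \<Rightarrow> 'a \<Rightarrow> 'a \<Rightarrow> 'a \<Rightarrow> rat" where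
  "weight z a b q = (THE c. is_weight z a b q c)"

text \<open>The centre lies just behind the edge of the slit, on the hyperplane
  \<open>x \<bullet> b = 0\<close>. A segment from it leaves this hyperplane at once, or stays in it
  with \<open>x \<bullet> a\<close> negative.\<close>

lemma slit_starlike:
  fixes a b d :: "'a::euclidean_space"
  assumes N: "open N" "convex N" and q: "q \<in> N" "q \<in> perp2 a b" and d: "d \<bullet> a = 1" "d \<bullet> b = 0"
  obtains c0 where "c0 \<in> N - {x. x \<bullet> b = 0 \<and> 0 \<le> x \<bullet> a}"
    "\<And>x. x \<in> N - {x. x \<bullet> b = 0 \<and> 0 \<le> x \<bullet> a} \<Longrightarrow> closed_segment c0 x \<subseteq> N - {x. x \<bullet> b = 0 \<and> 0 \<le> x \<bullet> a}"
proof -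
  obtain r where r: "r > 0" "cball q r \<subseteq> N" using N(1) q(1) open_contains_cball by blast
  have d0: "d \<noteq> 0" using d by auto
  define \<epsilon> where "\<epsilon> = r / norm d"
  have \<epsilon>: "\<epsilon> > 0" unfolding \<epsilon>_def using r d0 by simp
  define c0 where "c0 = q - \<epsilon> *\<^sub>R d"
  have "c0 \<in> cball q r" unfolding c0_def \<epsilon>_def using d0 r by (simp add: dist_norm)
  then have c0N: "c0 \<in> N" using r by blast
  have c0: "c0 \<bullet> a = - \<epsilon>" "c0 \<bullet> b = 0" using q(2) d unfolding c0_def perp2_def by (auto simp: inner_diff_left)
  show ?thesis
  proof (rule that[of c0])
    show "c0 \<in> N - {x. x \<bullet> b = 0 \<and> 0 \<le> x \<bullet> a}" using c0N c0 \<epsilon> by auto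
    fix x assume x: "x \<in> N - {x. x \<bullet> b = 0 \<and> 0 \<le> x \<bullet> a}"
    show "closed_segment c0 x \<subseteq> N - {x. x \<bullet> b = 0 \<and> 0 \<le> x \<bullet> a}"
    proof
      fix y assume y: "y \<in> closed_segment c0 x"
      then obtain t where t: "0 \<le> t" "t \<le> 1" "y = (1 - t) *\<^sub>R c0 + t *\<^sub>R x" unfolding in_segment by blast
      have yN: "y \<in> N" using y closed_segment_subset[OF c0N _ N(2), of x] x by blast
      have ya: "y \<bullet> a = - (1 - t) * \<epsilon> + t * (x \<bullet> a)" and yb: "y \<bullet> b = t * (x \<bullet> b)"
        unfolding t(3) using c0 by (auto simp: inner_add_left algebra_simps)
      have False if "y \<bullet> b = 0" "0 \<le> y \<bullet> a"
      proof (cases "t = 0")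
        case True
        then show False using ya that(2) \<epsilon> by simp
      next
        case False
        then have "x \<bullet> b = 0" using yb that(1) by simp
        then have "x \<bullet> a < 0" using x by auto
        then have "t * (x \<bullet> a) < 0" using False t(1) by (simp add: mult_less_0_iff)
        moreover have "(1 - t) * \<epsilon> \<ge> 0" using t(2) \<epsilon> by simp
        ultimately show False using ya that(2) by simp
      qed
      then show "y \<in> N - {x. x \<bullet> b = 0 \<and> 0 \<le> x \<bullet> a}" using yN by blast
    qed
  qed
qed

text \<open>Mayer-Vietoris by hand: on the slit neighbourhood \<open>S\<close> and on the half
  \<open>R\<close> every cocycle is exact, their overlap consists of the pieces
  \<open>0 < x \<bullet> b\<close> and \<open>x \<bullet> b < 0\<close>, and the weight is the
  difference of the two gluing constants.\<close>

lemma weight_exists_convex: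
  fixes a b :: "'a::euclidean_space"
  assumes ind: "indep_pair a b" and N: "open N" "convex N" and q: "q \<in> N" "q \<in> perp2 a b"
    and z: "cocycle_on (N - perp2 a b) z"
  obtains c where "exact_on (N - perp2 a b) (\<lambda>x y. z x y - c * angle_cocycle a b x y)"
proof -
  obtain d e where d: "d \<bullet> a = 1" "d \<bullet> b = 0" using indep_pair_dual[OF ind] .
  define S where "S = N - {x. x \<bullet> b = 0 \<and> 0 \<le> x \<bullet> a}"
  define R where "R = N \<inter> {x. 0 < x \<bullet> a}"
  have subS: "S \<subseteq> N - perp2 a b" and subR: "R \<subseteq> N - perp2 a b" unfolding S_def R_def perp2_def by auto
  obtain c0 where "c0 \<in> S" "\<And>x. x \<in> S \<Longrightarrow> closed_segment c0 x \<subseteq> S"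
    using slit_starlike[OF N q d] unfolding S_def by blast
  then obtain G where G: "primitive_on S z G"
    using cocycle_on_starlike_exact[of c0 S z] cocycle_on_subset[OF z subS] unfolding exact_on_def by blast
  have cR: "convex (R \<inter> {x. 0 < x \<bullet> b})" "convex (R \<inter> {x. x \<bullet> b < 0})" "convex R" "open R"
    unfolding R_def using convex_halfspace_gt[of 0 a] convex_halfspace_gt[of 0 b] convex_halfspace_lt[of b 0] N open_inner_pos[of a]
    by (auto simp: inner_commute intro!: convex_Int open_Int)
  obtain F where F: "primitive_on R z F"
    using cocycle_on_convex_exact[OF cR(3) cocycle_on_subset[OF z subR]] unfolding exact_on_def by blast
  have pc: "\<exists>c. \<forall>x\<in>T. G x = F x + c" if T: "convex T" "T \<subseteq> R" "T \<subseteq> S" for T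
  proof (cases "T = {}")
    case False
    then obtain p where p: "p \<in> T" by blast
    have "G x - F x = G p - F p" if "x \<in> T" for x
      using primitive_on_unique[OF convex_connected[OF T(1)] primitive_on_subset[OF G T(3)] primitive_on_subset[OF F T(2)] that p] .
    then have "\<forall>x\<in>T. G x = F x + (G p - F p)" by (simp add: algebra_simps)
    then show ?thesis by blast
  qed auto
  have RS: "R \<inter> {x. 0 < x \<bullet> b} \<subseteq> R" "R \<inter> {x. 0 < x \<bullet> b} \<subseteq> S"
    "R \<inter> {x. x \<bullet> b < 0} \<subseteq> R" "R \<inter> {x. x \<bullet> b < 0} \<subseteq> S"
    unfolding S_def R_def by auto
  obtain cp where cp: "\<forall>x\<in>R \<inter> {x. 0 < x \<bullet> b}. G x = F x + cp"
    using pc[OF cR(1) RS(1,2)] by blast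
  obtain cm where cm: "\<forall>x\<in>R \<inter> {x. x \<bullet> b < 0}. G x = F x + cm"
    using pc[OF cR(2) RS(3,4)] by blast
  \<comment> \<open>On the slit \<open>G\<close> carries no information. The value
    \<open>F x + cm\<close> continues the side \<open>x \<bullet> b < 0\<close>, in accordance with
    the strict inequality in \<open>jump_cocycle\<close>.\<close>
  define H where "H = (\<lambda>x. if x \<bullet> b = 0 \<and> 0 < x \<bullet> a then F x + cm else G x)"
  have HR: "H x = F x + cm + (cp - cm) * of_bool (0 < x \<bullet> b)" if "x \<in> R" for x
    using cp cm that unfolding H_def R_def by (auto simp: not_less_iff_gr_or_eq)
  have "primitive_on (N - perp2 a b) (\<lambda>x y. z x y - (cm - cp) * angle_cocycle a b x y) H"
  proof (rule primitive_onI)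
    fix x assume x: "x \<in> N - perp2 a b"
    show "\<exists>M. open M \<and> x \<in> M \<and> (\<forall>c\<in>M \<inter> (N - perp2 a b). \<forall>y\<in>M \<inter> (N - perp2 a b).
        z c y - (cm - cp) * angle_cocycle a b c y = H y - H c)"
    proof (cases "x \<in> R")
      case True
      obtain M where M: "open M" "x \<in> M" "\<And>c y. c \<in> M \<Longrightarrow> c \<in> R \<Longrightarrow> y \<in> M \<Longrightarrow> y \<in> R \<Longrightarrow> z c y = F y - F c"
        using primitive_onE[OF F True] by blast
      have "z c y - (cm - cp) * angle_cocycle a b c y = H y - H c" if "c \<in> M \<inter> R" "y \<in> M \<inter> R" for c y
        using that M(3)[of c y] HR[of c] HR[of y] unfolding angle_cocycle_def jump_cocycle_def R_def
        by (simp add: algebra_simps)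
      then show ?thesis using M(1,2) cR(4) True by (intro exI[of _ "M \<inter> R"]) auto
    next
      case False
      then have xS: "x \<in> S" using x unfolding S_def R_def perp2_def by auto
      obtain M where M: "open M" "x \<in> M" "\<And>c y. c \<in> M \<Longrightarrow> c \<in> S \<Longrightarrow> y \<in> M \<Longrightarrow> y \<in> S \<Longrightarrow> z c y = G y - G c"
        using primitive_onE[OF G xS] by blast
      consider "x \<bullet> b \<noteq> 0" | "x \<bullet> a < 0" using xS unfolding S_def by force
      then obtain L where L: "open L" "x \<in> L" "\<And>c y. c \<in> L \<Longrightarrow> y \<in> L \<Longrightarrow> angle_cocycle a b c y = 0"
        "\<And>y. y \<in> L \<Longrightarrow> H y = G y" "L \<inter> N \<subseteq> S"
      proof cases
        case 1
        obtain L s where L: "open L" "x \<in> L" "\<And>y. y \<in> L \<Longrightarrow> y \<bullet> b \<noteq> 0 \<and> (0 < y \<bullet> b \<longleftrightarrow> s)"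
          using inner_sign_nhd[OF 1] by blast
        then show ?thesis
          by (intro that[of L]) (auto simp: angle_cocycle_def jump_cocycle_def H_def S_def)
      next
        case 2
        then show ?thesis using open_inner_neg[of a]
          by (intro that[of "{x. x \<bullet> a < 0}"]) (auto simp: angle_cocycle_def jump_cocycle_def H_def S_def)
      qed
      have "z c y - (cm - cp) * angle_cocycle a b c y = H y - H c" if "c \<in> M \<inter> L \<inter> N" "y \<in> M \<inter> L \<inter> N" for c y
        using that M(3)[of c y] L(3)[of c y] L(4)[of c] L(4)[of y] L(5) by auto
      then show ?thesis using M(1,2) L(1,2) by (intro exI[of _ "M \<inter> L"]) auto
    qed
  qed
  then show ?thesis using that exact_onI by blast
qed

lemma is_weight_lincomb:
  assumes "is_weight z a b x c" "is_weight w a b x d"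
  shows "is_weight (\<lambda>u v. p * z u v + q * w u v) a b x (p * c + q * d)"
proof -
  obtain N M where N: "open N" "x \<in> N" "exact_on (N - perp2 a b) (\<lambda>u v. z u v - c * angle_cocycle a b u v)"
    and M: "open M" "x \<in> M" "exact_on (M - perp2 a b) (\<lambda>u v. w u v - d * angle_cocycle a b u v)"
    using assms unfolding is_weight_def by blast
  have "exact_on (N \<inter> M - perp2 a b) (\<lambda>u v. p * (z u v - c * angle_cocycle a b u v) + q * (w u v - d * angle_cocycle a b u v))"
    by (intro exact_on_lincomb exact_on_subset[OF N(3)] exact_on_subset[OF M(3)]) auto
  then have "exact_on (N \<inter> M - perp2 a b) (\<lambda>u v. (p * z u v + q * w u v) - (p * c + q * d) * angle_cocycle a b u v)"
    by (rule exact_on_eq) (simp add: algebra_simps)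
  then show ?thesis unfolding is_weight_def using N(1,2) M(1,2) by (intro exI[of _ "N \<inter> M"]) auto
qed

lemma is_weight_zero_iff:
  "is_weight z a b q 0 \<longleftrightarrow> (\<exists>N. open N \<and> q \<in> N \<and> exact_on (N - perp2 a b) z)"
  unfolding is_weight_def by simp

lemma is_weight_angle: "is_weight (angle_cocycle a b) a b q 1"
  unfolding is_weight_def using exact_on_zero by (intro exI[of _ UNIV]) simp

text \<open>On the slit neighbourhood the multiple has primitive 0, on the half
  \<open>0 < x \<bullet> a\<close> its primitive jumps by \<open>c\<close>. A global primitive,
  compared at one point on either side of the slit, forces \<open>c = 0\<close>.\<close>

lemma angle_cocycle_not_exact:
  fixes a b :: "'a::euclidean_space"
  assumes ind: "indep_pair a b" and q: "q \<in> perp2 a b" and N: "open N" "q \<in> N"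
    and ex: "exact_on (N - perp2 a b) (\<lambda>x y. c * angle_cocycle a b x y)"
  shows "c = 0"
proof -
  obtain d e where d: "d \<bullet> a = 1" "d \<bullet> b = 0" "e \<bullet> a = 0" "e \<bullet> b = 1" using indep_pair_dual[OF ind] .
  obtain r where r: "r > 0" "ball q r \<subseteq> N" using openE[OF N] by blast
  define B where "B = ball q r"
  have B: "open B" "convex B" "q \<in> B" "B \<subseteq> N" unfolding B_def using r by auto
  obtain G where "primitive_on (N - perp2 a b) (\<lambda>x y. c * angle_cocycle a b x y) G"
    using ex unfolding exact_on_def by blast
  then have G: "primitive_on (B - perp2 a b) (\<lambda>x y. c * angle_cocycle a b x y) G"
    using primitive_on_subset B(4) by blast
  define S where "S = B - {x. x \<bullet> b = 0 \<and> 0 \<le> x \<bullet> a}"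
  define R where "R = B \<inter> {x. 0 < x \<bullet> a}"
  obtain c0 where c0: "c0 \<in> S" "\<And>x. x \<in> S \<Longrightarrow> closed_segment c0 x \<subseteq> S"
    using slit_starlike[OF B(1,2,3) q d(1,2)] unfolding S_def by blast
  have "connected S" using c0 by (intro starlike_imp_connected) (auto simp: starlike_def)
  have pS: "primitive_on S (\<lambda>x y. c * angle_cocycle a b x y) (\<lambda>x. 0)"
  proof (rule primitive_onI2)
    fix x assume x: "x \<in> S"
    then consider "x \<bullet> b \<noteq> 0" | "x \<bullet> a < 0" unfolding S_def by force
    then show "\<exists>N. open N \<and> x \<in> N \<and> (\<forall>u\<in>N. \<forall>v\<in>N. c * angle_cocycle a b u v = 0 - 0)"
    proof cases
      case 1
      obtain L s where L: "open L" "x \<in> L" "\<And>y. y \<in> L \<Longrightarrow> y \<bullet> b \<noteq> 0 \<and> (0 < y \<bullet> b \<longleftrightarrow> s)"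
        using inner_sign_nhd[OF 1] by blast
      then show ?thesis by (intro exI[of _ L]) (auto simp: angle_cocycle_def jump_cocycle_def)
    next
      case 2
      then show ?thesis using open_inner_neg[of a]
        by (intro exI[of _ "{x. x \<bullet> a < 0}"]) (auto simp: angle_cocycle_def jump_cocycle_def)
    qed
  qed
  have pR: "primitive_on R (\<lambda>x y. c * angle_cocycle a b x y) (\<lambda>x. c * of_bool (0 < x \<bullet> b))"
    using open_inner_pos[of a]
    by (intro primitive_onI exI[of _ "{x. 0 < x \<bullet> a}"]) (auto simp: R_def angle_cocycle_def jump_cocycle_def algebra_simps)
  have "convex R" unfolding R_def using B(2) convex_halfspace_gt[of 0 a] by (simp add: convex_Int inner_commute)
  \<comment> \<open>Small enough to keep both test points below in \<open>B\<close>; the summand 1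
    keeps the denominator positive.\<close>
  define \<epsilon> where "\<epsilon> = r / (2 * (norm d + norm e + 1))"
  have pos: "norm d + norm e + 1 > 0" by (simp add: add_nonneg_pos)
  have \<epsilon>: "\<epsilon> > 0" unfolding \<epsilon>_def using r pos by simp
  have small: "\<epsilon> * (norm d + norm e) < r"
  proof -
    have "\<epsilon> * (norm d + norm e) \<le> \<epsilon> * (norm d + norm e + 1)" using \<epsilon> by (simp add: mult_left_mono)
    also have "\<dots> = r / 2" unfolding \<epsilon>_def using pos by (simp add: field_simps)
    finally show ?thesis using r by simp
  qed
  define p1 p2 where "p1 = q + \<epsilon> *\<^sub>R (d + e)" and "p2 = q + \<epsilon> *\<^sub>R (d - e)"
  have "norm (\<epsilon> *\<^sub>R (d + e)) < r" "norm (\<epsilon> *\<^sub>R (d - e)) < r"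
    using small \<epsilon> norm_triangle_ineq[of d e] norm_triangle_ineq4[of d e]
    by (auto intro!: le_less_trans[OF _ small])
  then have inB: "p1 \<in> B" "p2 \<in> B" unfolding p1_def p2_def B_def by (auto simp: dist_norm norm_minus_commute)
  have pa: "p1 \<bullet> a = \<epsilon>" "p1 \<bullet> b = \<epsilon>" "p2 \<bullet> a = \<epsilon>" "p2 \<bullet> b = - \<epsilon>"
    using q d unfolding p1_def p2_def perp2_def by (auto simp: inner_add_left inner_diff_left)
  have pin: "p1 \<in> S" "p2 \<in> S" "p1 \<in> R" "p2 \<in> R" using pa inB \<epsilon> unfolding S_def R_def by auto
  have subS: "S \<subseteq> B - perp2 a b" and subR: "R \<subseteq> B - perp2 a b" unfolding S_def R_def perp2_def by auto
  have "G p1 - 0 = G p2 - 0"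
    by (rule primitive_on_unique[OF \<open>connected S\<close> primitive_on_subset[OF G subS] pS pin(1,2)])
  moreover have "G p1 - c * of_bool (0 < p1 \<bullet> b) = G p2 - c * of_bool (0 < p2 \<bullet> b)"
    by (rule primitive_on_unique[OF convex_connected[OF \<open>convex R\<close>] primitive_on_subset[OF G subR] pR pin(3,4)])
  ultimately show "c = 0" using pa \<epsilon> by simp
qed

lemma is_weight_unique:
  assumes "indep_pair a b" "q \<in> perp2 a b" "is_weight z a b q c" "is_weight z a b q d"
  shows "c = d"
proof -
  have "is_weight (\<lambda>u v. 1 * z u v + (-1) * z u v) a b q (1 * c + (-1) * d)"
    by (rule is_weight_lincomb[OF assms(3,4)])
  then obtain N where "open N" "q \<in> N" "exact_on (N - perp2 a b) (\<lambda>x y. (d - c) * angle_cocycle a b x y)"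
    unfolding is_weight_def by (auto simp: algebra_simps)
  then show ?thesis using angle_cocycle_not_exact[OF assms(1,2)] by fastforce
qed

lemma weight_eqI:
  assumes "indep_pair a b" "q \<in> perp2 a b" "is_weight z a b q c"
  shows "weight z a b q = c"
  unfolding weight_def using assms is_weight_unique by (intro the_equality) blast+

lemma is_weight_exists:
  assumes "indep_pair a b" "q \<in> perp2 a b" "open N" "q \<in> N" "cocycle_on (N - perp2 a b) z"
  shows "is_weight z a b q (weight z a b q)"
proof -
  obtain r where r: "r > 0" "ball q r \<subseteq> N" using openE[OF assms(3,4)] by blast
  have "cocycle_on (ball q r - perp2 a b) z" using cocycle_on_subset[OF assms(5)] r(2) by blast
  then obtain c where "exact_on (ball q r - perp2 a b) (\<lambda>x y. z x y - c * angle_cocycle a b x y)"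
    using weight_exists_convex[OF assms(1), of "ball q r" q z] r(1) assms(2) by auto
  then have "is_weight z a b q c" unfolding is_weight_def using r(1) by (intro exI[of _ "ball q r"]) auto
  then show ?thesis using weight_eqI assms by metis
qed

lemma is_weight_nearby:
  assumes "is_weight z a b q c"
  obtains N where "open N" "q \<in> N" "\<And>p. p \<in> N \<Longrightarrow> is_weight z a b p c"
  using assms unfolding is_weight_def by blast

text \<open>One neighbourhood witnesses the same weight at all of its points, so weights are locally
  constant.\<close>

lemma weight_const_on_connected:
  assumes "indep_pair a b" "connected K" "K \<subseteq> perp2 a b" "\<And>q. q \<in> K \<Longrightarrow> is_weight z a b q (weight z a b q)"
    and "p \<in> K" "q \<in> K"
  shows "weight z a b p = weight z a b q"
proof (rule connected_local_const[OF assms(2,5,6)], rule ballI)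
  fix x assume x: "x \<in> K"
  then obtain N where N: "open N" "x \<in> N" "\<And>p. p \<in> N \<Longrightarrow> is_weight z a b p (weight z a b x)"
    using is_weight_nearby[OF assms(4)] by metis
  then have "weight z a b x = weight z a b y" if "y \<in> N" "y \<in> K" for y
    using weight_eqI[OF assms(1), of y z] that assms(3) by (metis subsetD)
  then show "eventually (\<lambda>y. weight z a b x = weight z a b y) (at x within K)"
    unfolding eventually_at_topological using N(1,2) by blast
qed

lemma is_weight_change:
  assumes det: "\<alpha> * \<delta> - \<beta> * \<gamma> \<noteq> 0"
    and w: "is_weight z (\<alpha> *\<^sub>R a + \<beta> *\<^sub>R b) (\<gamma> *\<^sub>R a + \<delta> *\<^sub>R b) q c"
  shows "is_weight z a b q (c * rat_sgn (\<alpha> * \<delta> - \<beta> * \<gamma>))"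
proof -
  define a' b' s where "a' = \<alpha> *\<^sub>R a + \<beta> *\<^sub>R b" and "b' = \<gamma> *\<^sub>R a + \<delta> *\<^sub>R b" and "s = rat_sgn (\<alpha> * \<delta> - \<beta> * \<gamma>)"
  have "is_weight z a' b' q c" using w unfolding a'_def b'_def .
  then obtain N where N: "open N" "q \<in> N" "exact_on (N - perp2 a' b') (\<lambda>x y. z x y - c * angle_cocycle a' b' x y)"
    unfolding is_weight_def by blast
  have P: "perp2 a' b' = perp2 a b" unfolding a'_def b'_def by (rule perp2_change[OF det])
  note N = N(1,2) N(3)[unfolded P]
  have "exact_on (- perp2 a b) (\<lambda>x y. angle_cocycle a' b' x y - s * angle_cocycle a b x y)"
    unfolding a'_def b'_def s_def by (rule angle_cocycle_change[OF det])
  then have "exact_on (N - perp2 a b) (\<lambda>x y. angle_cocycle a' b' x y - s * angle_cocycle a b x y)"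
    by (rule exact_on_subset) auto
  from exact_on_lincomb[OF N(3) this, of 1 c]
  have "exact_on (N - perp2 a b) (\<lambda>x y. z x y - c * s * angle_cocycle a b x y)"
    by (rule exact_on_eq) (simp add: algebra_simps)
  then show ?thesis unfolding is_weight_def s_def using N(1,2) by blast
qed

section \<open>Oriented volume in dimension four\<close>

definition vol :: "real^4 \<Rightarrow> real^4 \<Rightarrow> real^4 \<Rightarrow> real^4 \<Rightarrow> real" where
  "vol w x y z = det (\<chi> i. if i = 1 then w else if i = 2 then x else if i = 3 then y else z)"

text \<open>Each variant tests one row index first, the shape in which \<open>det_row_add\<close>
  and \<open>det_row_mul\<close> expect the row.\<close>

lemma vol_slots:
  "vol w x y z = det (\<chi> i. if i = 1 then w else if i = 2 then x else if i = 3 then y else z)"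
  "vol w x y z = det (\<chi> i. if i = 2 then x else if i = 1 then w else if i = 3 then y else z)"
  "vol w x y z = det (\<chi> i. if i = 3 then y else if i = 1 then w else if i = 2 then x else z)"
  "vol w x y z = det (\<chi> i. if i = 4 then z else if i = 1 then w else if i = 2 then x else y)"
  unfolding vol_def by (intro arg_cong[where f=det], simp add: vec_eq_iff forall_4)+

lemma vol_add:
  "vol (w + w') x y z = vol w x y z + vol w' x y z"
  "vol w (x + x') y z = vol w x y z + vol w x' y z"
  "vol w x (y + y') z = vol w x y z + vol w x y' z"
  "vol w x y (z + z') = vol w x y z + vol w x y z'"
  using det_row_add[of 1 "\<lambda>i. w" "\<lambda>i. w'" "\<lambda>i. if i = 2 then x else if i = 3 then y else z"]
    det_row_add[of 2 "\<lambda>i. x" "\<lambda>i. x'" "\<lambda>i. if i = 1 then w else if i = 3 then y else z"]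
    det_row_add[of 3 "\<lambda>i. y" "\<lambda>i. y'" "\<lambda>i. if i = 1 then w else if i = 2 then x else z"]
    det_row_add[of 4 "\<lambda>i. z" "\<lambda>i. z'" "\<lambda>i. if i = 1 then w else if i = 2 then x else y"]
  unfolding vol_slots(1)[symmetric] vol_slots(2)[symmetric] vol_slots(3)[symmetric] vol_slots(4)[symmetric] by blast+

lemma vol_scale:
  "vol (c *\<^sub>R w) x y z = c * vol w x y z"
  "vol w (c *\<^sub>R x) y z = c * vol w x y z"
  "vol w x (c *\<^sub>R y) z = c * vol w x y z"
  "vol w x y (c *\<^sub>R z) = c * vol w x y z"
  using det_row_mul[of 1 c "\<lambda>i. w" "\<lambda>i. if i = 2 then x else if i = 3 then y else z"]
    det_row_mul[of 2 c "\<lambda>i. x" "\<lambda>i. if i = 1 then w else if i = 3 then y else z"]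
    det_row_mul[of 3 c "\<lambda>i. y" "\<lambda>i. if i = 1 then w else if i = 2 then x else z"]
    det_row_mul[of 4 c "\<lambda>i. z" "\<lambda>i. if i = 1 then w else if i = 2 then x else y"]
  unfolding vol_slots(1)[symmetric] vol_slots(2)[symmetric] vol_slots(3)[symmetric] vol_slots(4)[symmetric]
    scalar_mult_eq_scaleR by blast+

lemma vol_same:
  "vol w w y z = 0" "vol w x w z = 0" "vol w x y w = 0" "vol w x x z = 0" "vol w x y x = 0" "vol w x y y = 0"
  unfolding vol_def
  by (rule det_identical_rows[of 1 2], simp_all add: row_def)
     (rule det_identical_rows[of 1 3], simp_all add: row_def,
      rule det_identical_rows[of 1 4], simp_all add: row_def,
      rule det_identical_rows[of 2 3], simp_all add: row_def,
      rule det_identical_rows[of 2 4], simp_all add: row_def,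
      rule det_identical_rows[of 3 4], simp_all add: row_def)

text \<open>Polarisation: expand a volume in which both entries are \<open>x + y\<close>.\<close>

lemma vol_swap23: "vol w y x z = - vol w x y z"
proof -
  have "vol w (x + y) (x + y) z = vol w x x z + vol w y x z + (vol w x y z + vol w y y z)"
    unfolding vol_add(2) vol_add(3) by simp
  from this[unfolded vol_same] show ?thesis by simp
qed

lemma vol_swap34: "vol w x z y = - vol w x y z"
proof -
  have "vol w x (y + z) (y + z) = vol w x y y + vol w x z y + (vol w x y z + vol w x z z)"
    unfolding vol_add(3) vol_add(4) by simp
  from this[unfolded vol_same] show ?thesis by simp
qed

lemma vol_nonzero:
  assumes "\<And>c1 c2 c3 c4. c1 *\<^sub>R w + c2 *\<^sub>R x + c3 *\<^sub>R y + c4 *\<^sub>R z = 0 \<Longrightarrow> c1 = 0 \<and> c2 = 0 \<and> c3 = 0 \<and> c4 = 0"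
  shows "vol w x y z \<noteq> 0"
proof -
  define A :: "real^4^4" where "A = (\<chi> i. if i = 1 then w else if i = 2 then x else if i = 3 then y else z)"
  have "\<forall>c. sum (\<lambda>i. c i *s row i A) UNIV = 0 \<longrightarrow> (\<forall>i. c i = 0)"
    using assms unfolding sum_4 forall_4 by (simp add: A_def row_def scalar_mult_eq_scaleR)
  then have "\<exists>B. A ** B = mat 1" using matrix_right_invertible_independent_rows by blast
  then have "invertible A" using invertible_right_inverse by blast
  then show ?thesis unfolding vol_def A_def[symmetric] using invertible_det_nz by blast
qed

lemma vol_change:
  "vol w x (\<alpha> *\<^sub>R a + \<beta> *\<^sub>R b) (\<gamma> *\<^sub>R a + \<delta> *\<^sub>R b) = (\<alpha> * \<delta> - \<beta> * \<gamma>) * vol w x a b"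
  by (simp add: vol_add vol_scale vol_same vol_swap34[of w x b a] algebra_simps)

text \<open>Subtracting from \<open>x\<close> its components along the dual vectors lands in
  \<open>perp2 a b\<close>, where \<open>c\<close> vanishes. So the coefficients are the values of
  \<open>c\<close> at \<open>d\<close> and \<open>e\<close>.\<close>

lemma annihilator_perp2:
  assumes ind: "indep_pair a b" and c: "\<And>x. x \<in> perp2 a b \<Longrightarrow> x \<bullet> c = 0"
  obtains \<alpha> \<beta> where "c = \<alpha> *\<^sub>R a + \<beta> *\<^sub>R b"
proof -
  obtain d e where d: "d \<bullet> a = 1" "d \<bullet> b = 0" "e \<bullet> a = 0" "e \<bullet> b = 1" using indep_pair_dual[OF ind] .
  have "x \<bullet> c = x \<bullet> ((d \<bullet> c) *\<^sub>R a + (e \<bullet> c) *\<^sub>R b)" for x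
  proof -
    have "x - (x \<bullet> a) *\<^sub>R d - (x \<bullet> b) *\<^sub>R e \<in> perp2 a b"
      unfolding perp2_def using d by (simp add: inner_diff_left)
    from c[OF this] show ?thesis by (simp add: inner_diff_left inner_add_right algebra_simps)
  qed
  then have "c = (d \<bullet> c) *\<^sub>R a + (e \<bullet> c) *\<^sub>R b" using vector_eq_ldot by blast
  then show ?thesis using that by blast
qed

text \<open>Recursion over the breakpoints to the left of \<open>x\<close>: \<open>W x\<close> is
  the value at distance \<open>\<epsilon>\<close> after the last of them, while the value at
  distance \<open>\<epsilon>\<close> before it sees one breakpoint fewer.\<close>

lemma step_function_repr:
  fixes W :: "real \<Rightarrow> rat" and t :: "'i \<Rightarrow> real"
  assumes fin: "finite I" and \<epsilon>: "0 < \<epsilon>"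
    and sep: "\<And>i j. i \<in> I \<Longrightarrow> j \<in> I \<Longrightarrow> i \<noteq> j \<Longrightarrow> \<epsilon> < \<bar>t i - t j\<bar>"
    and const: "\<And>x y. x \<le> y \<Longrightarrow> {x..y} \<inter> t ` I = {} \<Longrightarrow> W x = W y"
    and A: "\<And>x. (\<And>i. i \<in> I \<Longrightarrow> x < t i) \<Longrightarrow> W x = A"
    and x: "x \<notin> t ` I"
  shows "W x = A + (\<Sum>i | i \<in> I \<and> t i < x. W (t i + \<epsilon>) - W (t i - \<epsilon>))"
  using x
proof (induction "card {i \<in> I. t i < x}" arbitrary: x rule: less_induct)
  case less
  show ?case
  proof (cases "{i \<in> I. t i < x} = {}")
    case True
    then have "W x = A" using A[of x] less.prems by (metis (mono_tags, lifting) empty_Collect_eq image_eqI linorder_less_linear)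
    then show ?thesis by (simp only: True sum.empty add_0_right)
  next
    case False
    define L where "L = {i \<in> I. t i < x}"
    have fL: "finite L" "L \<noteq> {}" using fin False unfolding L_def by auto
    obtain i where i: "i \<in> L" "\<And>j. j \<in> L \<Longrightarrow> t j \<le> t i"
      using finite_imageI[OF fL(1), of t] Max_in[of "t ` L"] Max_ge[of "t ` L"] fL by fastforce
    have iI: "i \<in> I" "t i < x" using i(1) unfolding L_def by auto
    \<comment> \<open>The maximum covers both orders of \<open>x\<close> and
      \<open>t i + \<epsilon>\<close>: no breakpoint separates these two points.\<close>
    have gap: "t j \<notin> {t i <.. max x (t i + \<epsilon>)}" if "j \<in> I" for j
    proof
      assume j: "t j \<in> {t i <.. max x (t i + \<epsilon>)}"
      then have "j \<noteq> i" by auto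
      then have "\<epsilon> < \<bar>t j - t i\<bar>" using sep iI(1) that by blast
      then have "t j \<le> x" using j by auto
      then have "t j < x" using less.prems that by (metis image_eqI order_le_less)
      then show False using i(2)[of j] that j unfolding L_def by auto
    qed
    have "W x = W (t i + \<epsilon>)"
    proof (cases "x \<le> t i + \<epsilon>")
      case True
      then show ?thesis using gap iI(2) by (intro const) fastforce+
    next
      case False
      then show ?thesis using gap \<epsilon> by (intro const[symmetric]) fastforce+
    qed
    moreover have L': "{j \<in> I. t j < t i - \<epsilon>} = L - {i}"
    proof (rule equalityI; rule subsetI)
      fix j assume "j \<in> {j \<in> I. t j < t i - \<epsilon>}"
      then show "j \<in> L - {i}" using iI \<epsilon> unfolding L_def by auto
    next
      fix j assume j: "j \<in> L - {i}"
      then have "\<epsilon> < \<bar>t j - t i\<bar>" using sep iI(1) unfolding L_def by blast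
      then show "j \<in> {j \<in> I. t j < t i - \<epsilon>}" using i(2)[of j] j unfolding L_def by auto
    qed
    moreover have "t i - \<epsilon> \<notin> t ` I"
    proof
      assume "t i - \<epsilon> \<in> t ` I"
      then obtain j where j: "j \<in> I" "t j = t i - \<epsilon>" by force
      then have "j \<noteq> i" using \<epsilon> by auto
      then show False using sep[OF j(1) iI(1)] j(2) \<epsilon> by auto
    qed
    moreover have "card (L - {i}) < card L" using fL i(1) by (intro psubset_card_mono) auto
    ultimately have "W (t i - \<epsilon>) = A + (\<Sum>i\<in>L - {i}. W (t i + \<epsilon>) - W (t i - \<epsilon>))"
      using less.hyps[of "t i - \<epsilon>"] L' unfolding L_def by simp
    moreover have "(\<Sum>i\<in>L. W (t i + \<epsilon>) - W (t i - \<epsilon>)) = (W (t i + \<epsilon>) - W (t i - \<epsilon>)) + (\<Sum>i\<in>L - {i}. W (t i + \<epsilon>) - W (t i - \<epsilon>))"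
      using fL(1) i(1) by (simp add: sum.remove)
    ultimately show ?thesis using \<open>W x = W (t i + \<epsilon>)\<close> unfolding L_def[symmetric] by simp
  qed
qed

section \<open>Weights of a cocycle along the planes of an arrangement\<close>

text \<open>
  \<open>\<eta>\<close> is transversal to all planes and lines, and splits every line into its halves through \<open>q l\<close> and
  \<open>- q l\<close>.  On a plane \<open>S\<close> the coordinates are \<open>s *\<^sub>R p S + t *\<^sub>R r S\<close>, with \<open>r S\<close> on the level \<open>0\<close> of \<open>\<eta>\<close>;
  the line \<open>l\<close> meets the levels \<open>s = 1\<close> and \<open>s = -1\<close> at \<open>t = \<tau> S l\<close> and \<open>t = - \<tau> S l\<close>.
\<close>

locale framed_planes =
  fixes \<P> :: "(real^4) set set" and \<eta> :: "real^4"
    and p r a b :: "(real^4) set \<Rightarrow> real^4" and q :: "(real^4) set \<Rightarrow> real^4"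
    and \<L> :: "(real^4) set set" and \<epsilon> :: real and \<tau> :: "(real^4) set \<Rightarrow> (real^4) set \<Rightarrow> real"
  assumes finite_P: "finite \<P>"
    and L_eq: "\<L> = {S \<inter> T | S T. S \<in> \<P> \<and> T \<in> \<P> \<and> S \<noteq> T \<and> S \<inter> T \<noteq> {0}}"
    and frame: "\<And>S. S \<in> \<P> \<Longrightarrow> p S \<bullet> \<eta> = 1" "\<And>S. S \<in> \<P> \<Longrightarrow> r S \<bullet> \<eta> = 0" "\<And>S. S \<in> \<P> \<Longrightarrow> r S \<noteq> 0"
      "\<And>S. S \<in> \<P> \<Longrightarrow> S = {s *\<^sub>R p S + t *\<^sub>R r S | s t. True}"
    and coframe: "\<And>S. S \<in> \<P> \<Longrightarrow> S = perp2 (a S) (b S)" "\<And>S. S \<in> \<P> \<Longrightarrow> indep_pair (a S) (b S)"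
      "\<And>S. S \<in> \<P> \<Longrightarrow> 0 < vol (p S) (r S) (a S) (b S)"
    and line: "\<And>l. l \<in> \<L> \<Longrightarrow> q l \<bullet> \<eta> = 1" "\<And>l. l \<in> \<L> \<Longrightarrow> l = {s *\<^sub>R q l | s. True}"
    and tau: "\<And>S l. S \<in> \<P> \<Longrightarrow> l \<in> \<L> \<Longrightarrow> l \<subseteq> S \<Longrightarrow> q l = p S + \<tau> S l *\<^sub>R r S"
    and eps: "0 < \<epsilon>" "\<And>S l m. S \<in> \<P> \<Longrightarrow> l \<in> \<L> \<Longrightarrow> m \<in> \<L> \<Longrightarrow> l \<subseteq> S \<Longrightarrow> m \<subseteq> S \<Longrightarrow> l \<noteq> m \<Longrightarrow> \<epsilon> < \<bar>\<tau> S l - \<tau> S m\<bar>"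
begin

abbreviation "U \<equiv> - \<Union>\<P>"

definition regular :: "(real^4) set \<Rightarrow> real^4 \<Rightarrow> bool" where
  "regular S x \<longleftrightarrow> S \<in> \<P> \<and> x \<in> S \<and> (\<forall>T\<in>\<P>. x \<in> T \<longrightarrow> T = S)"

definition wt :: "(real^4 \<Rightarrow> real^4 \<Rightarrow> rat) \<Rightarrow> (real^4) set \<Rightarrow> real^4 \<Rightarrow> rat" where
  "wt z S x = weight z (a S) (b S) x"

lemma finite_L: "finite \<L>"
proof -
  have "\<L> \<subseteq> (\<lambda>(S,T). S \<inter> T) ` (\<P> \<times> \<P>)" unfolding L_eq by auto
  then show ?thesis by (rule finite_subset) (use finite_P in simp)
qed

lemma subspace_P: "S \<in> \<P> \<Longrightarrow> subspace S"
proof -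
  assume S: "S \<in> \<P>"
  have "subspace (perp2 (a S) (b S))" unfolding perp2_def subspace_def by (auto simp: inner_add_left)
  then show ?thesis using coframe(1)[OF S] by simp
qed

lemma plane_in: "S \<in> \<P> \<Longrightarrow> s *\<^sub>R p S + t *\<^sub>R r S \<in> S"
  using frame(4)[of S] by blast

lemma planeE:
  assumes "S \<in> \<P>" "x \<in> S"
  obtains t where "x = (x \<bullet> \<eta>) *\<^sub>R p S + t *\<^sub>R r S"
proof -
  obtain s t where x: "x = s *\<^sub>R p S + t *\<^sub>R r S" using frame(4)[OF assms(1)] assms(2) by blast
  then have "x \<bullet> \<eta> = s" using frame(1,2) assms(1) by (simp add: inner_add_left)
  then show ?thesis using that x by blast
qed

lemma plane_coords_unique:
  assumes "S \<in> \<P>" "s *\<^sub>R p S + t *\<^sub>R r S = s' *\<^sub>R p S + t' *\<^sub>R r S"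
  shows "s = s'" "t = t'"
proof -
  have "(s *\<^sub>R p S + t *\<^sub>R r S) \<bullet> \<eta> = (s' *\<^sub>R p S + t' *\<^sub>R r S) \<bullet> \<eta>" using assms(2) by simp
  then show s: "s = s'" using frame(1,2) assms(1) by (simp add: inner_add_left)
  then have "(t - t') *\<^sub>R r S = 0" using assms(2) by (simp add: scaleR_diff_left)
  then show "t = t'" using frame(3)[OF assms(1)] by simp
qed

lemma lineE: "l \<in> \<L> \<Longrightarrow> x \<in> l \<Longrightarrow> x = (x \<bullet> \<eta>) *\<^sub>R q l"
proof -
  assume l: "l \<in> \<L>" "x \<in> l"
  then obtain s where "x = s *\<^sub>R q l" using line(2) by blast
  then show ?thesis using line(1)[OF l(1)] by simp
qed

lemma line_in: "l \<in> \<L> \<Longrightarrow> s *\<^sub>R q l \<in> l"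
  using line(2)[of l] by blast

lemma q_in: "l \<in> \<L> \<Longrightarrow> q l \<in> l"
  using line_in[of l 1] by simp

lemma line_eq: "l \<in> \<L> \<Longrightarrow> m \<in> \<L> \<Longrightarrow> x \<in> l \<Longrightarrow> x \<in> m \<Longrightarrow> x \<noteq> 0 \<Longrightarrow> l = m"
proof -
  assume h: "l \<in> \<L>" "m \<in> \<L>" "x \<in> l" "x \<in> m" "x \<noteq> 0"
  then have "x = (x \<bullet> \<eta>) *\<^sub>R q l" "x = (x \<bullet> \<eta>) *\<^sub>R q m" using lineE by blast+
  then have "(x \<bullet> \<eta>) \<noteq> 0" "(x \<bullet> \<eta>) *\<^sub>R q l = (x \<bullet> \<eta>) *\<^sub>R q m" using h(5) by (metis scaleR_zero_left, metis)
  then have "q l = q m" by simp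
  then show ?thesis using line(2) h(1,2) by metis
qed

lemma planes_meet_line: "S \<in> \<P> \<Longrightarrow> T \<in> \<P> \<Longrightarrow> S \<noteq> T \<Longrightarrow> x \<in> S \<Longrightarrow> x \<in> T \<Longrightarrow> x \<noteq> 0 \<Longrightarrow> S \<inter> T \<in> \<L>"
  unfolding L_eq by blast

lemma regular_scale: "regular S x \<Longrightarrow> c \<noteq> 0 \<Longrightarrow> regular S (c *\<^sub>R x)"
  unfolding regular_def using subspace_P subspace_scale
  by (metis (no_types, lifting) inverse_nonzero_iff_nonzero left_inverse scaleR_one scaleR_scaleR)

lemma regular_minus_iff: "regular S (- x) \<longleftrightarrow> regular S x"
  using regular_scale[of S x "-1"] regular_scale[of S "-x" "-1"] by auto

text \<open>A second plane through a point of level 1 meets \<open>S\<close> in a line through it,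
  and a line \<open>l\<close> meets level 1 of \<open>\<eta>\<close> exactly at
  \<open>q l\<close>.\<close>

lemma regular_upper_iff:
  assumes "S \<in> \<P>"
  shows "regular S (p S + t *\<^sub>R r S) \<longleftrightarrow> (\<forall>l\<in>\<L>. l \<subseteq> S \<longrightarrow> t \<noteq> \<tau> S l)"
proof
  assume R: "regular S (p S + t *\<^sub>R r S)"
  show "\<forall>l\<in>\<L>. l \<subseteq> S \<longrightarrow> t \<noteq> \<tau> S l"
  proof (intro ballI impI notI)
    fix l assume l: "l \<in> \<L>" "l \<subseteq> S" "t = \<tau> S l"
    then have "q l = p S + t *\<^sub>R r S" using tau assms by blast
    then have "p S + t *\<^sub>R r S \<in> l" using q_in[OF l(1)] by simp
    moreover obtain A B where "A \<in> \<P>" "B \<in> \<P>" "A \<noteq> B" "l = A \<inter> B" using l(1) unfolding L_eq by blast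
    ultimately show False using R unfolding regular_def by blast
  qed
next
  assume N: "\<forall>l\<in>\<L>. l \<subseteq> S \<longrightarrow> t \<noteq> \<tau> S l"
  define x where "x = p S + t *\<^sub>R r S"
  have x: "x \<in> S" "x \<bullet> \<eta> = 1" unfolding x_def using plane_in[OF assms, of 1 t] frame(1,2)[OF assms] by (auto simp: inner_add_left)
  then have x0: "x \<noteq> 0" by auto
  have "T = S" if T: "T \<in> \<P>" "x \<in> T" for T
  proof (rule ccontr)
    assume "T \<noteq> S"
    then have l: "S \<inter> T \<in> \<L>" using planes_meet_line assms T x x0 by blast
    then have "x = q (S \<inter> T)" using lineE[OF l, of x] x T by simp
    also have "\<dots> = p S + \<tau> S (S \<inter> T) *\<^sub>R r S" using tau[OF assms l] by blast
    finally have "t = \<tau> S (S \<inter> T)" unfolding x_def using plane_coords_unique(2)[OF assms, of 1 t 1 "\<tau> S (S \<inter> T)"] by simp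
    then show False using N l by blast
  qed
  then show "regular S (p S + t *\<^sub>R r S)" unfolding regular_def x_def[symmetric] using assms x by blast
qed

lemma regular_lower_iff:
  assumes "S \<in> \<P>"
  shows "regular S (- p S + t *\<^sub>R r S) \<longleftrightarrow> (\<forall>l\<in>\<L>. l \<subseteq> S \<longrightarrow> t \<noteq> - \<tau> S l)"
proof -
  have eq: "- p S + t *\<^sub>R r S = - (p S + (-t) *\<^sub>R r S)" by simp
  show ?thesis unfolding eq regular_minus_iff regular_upper_iff[OF assms] by (metis add.inverse_inverse)
qed

text \<open>Every line of \<open>\<L>\<close> is transversal to \<open>\<eta>\<close>, so no nonzero
  vector of level 0 lies on it.\<close>

lemma regular_r: "S \<in> \<P> \<Longrightarrow> regular S (r S)"
  unfolding regular_def
proof (intro conjI ballI impI)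
  assume S: "S \<in> \<P>"
  show r: "r S \<in> S" using plane_in[OF S, of 0 1] by simp
  fix T assume T: "T \<in> \<P>" "r S \<in> T"
  show "T = S"
  proof (rule ccontr)
    assume "T \<noteq> S"
    then have "S \<inter> T \<in> \<L>" using planes_meet_line[OF S T(1) _ r T(2) frame(3)[OF S]] by blast
    then show False using lineE[of "S \<inter> T" "r S"] r T frame(2,3)[OF S] by simp
  qed
qed

text \<open>Discarding the other planes gives a neighbourhood on which \<open>U\<close> looks like
  the complement of \<open>S\<close> alone.\<close>

lemma regular_nhd:
  assumes "regular S x"
  shows "open (- \<Union>(\<P> - {S}))" "x \<in> - \<Union>(\<P> - {S})" "- \<Union>(\<P> - {S}) - perp2 (a S) (b S) = U"
proof -
  have "closed (\<Union>(\<P> - {S}))" using closed_Union_subspaces[of "\<P> - {S}"] finite_P subspace_P by blast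
  then show "open (- \<Union>(\<P> - {S}))" by (rule open_Compl)
  show "x \<in> - \<Union>(\<P> - {S})" using assms unfolding regular_def by blast
  show "- \<Union>(\<P> - {S}) - perp2 (a S) (b S) = U"
    using coframe(1)[of S] assms unfolding regular_def by blast
qed

lemma is_weight_wt:
  assumes "cocycle_on U z" "regular S x"
  shows "is_weight z (a S) (b S) x (wt z S x)"
  unfolding wt_def
proof (rule is_weight_exists)
  have S: "S \<in> \<P>" "x \<in> S" using assms(2) unfolding regular_def by auto
  show "indep_pair (a S) (b S)" "x \<in> perp2 (a S) (b S)" using coframe(1,2)[OF S(1)] S(2) by blast+
  show "open (- \<Union>(\<P> - {S}))" "x \<in> - \<Union>(\<P> - {S})" using regular_nhd[OF assms(2)] by blast+
  show "cocycle_on (- \<Union>(\<P> - {S}) - perp2 (a S) (b S)) z" using regular_nhd(3)[OF assms(2)] assms(1) by simp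
qed

lemma wt_eqI:
  assumes "S \<in> \<P>" "x \<in> S" "is_weight z (a S) (b S) x c"
  shows "wt z S x = c"
  unfolding wt_def using weight_eqI[OF coframe(2)[OF assms(1)] _ assms(3)] assms(1,2) coframe(1) by blast

lemma wt_eq_0I:
  assumes "regular S x" "open N" "x \<in> N" "exact_on (N - \<Union>\<P>) z"
  shows "wt z S x = 0"
proof (rule wt_eqI)
  show "S \<in> \<P>" "x \<in> S" using assms(1) unfolding regular_def by auto
  have "N \<inter> - \<Union>(\<P> - {S}) - perp2 (a S) (b S) = N - \<Union>\<P>"
    using regular_nhd(3)[OF assms(1)] by blast
  then show "is_weight z (a S) (b S) x 0"
    unfolding is_weight_zero_iff using assms(2-4) regular_nhd(1,2)[OF assms(1)]
    by (intro exI[of _ "N \<inter> - \<Union>(\<P> - {S})"]) (simp add: open_Int)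
qed

lemma wt_lincomb:
  assumes "cocycle_on U z" "cocycle_on U w" "regular S x"
  shows "wt (\<lambda>u v. c * z u v + d * w u v) S x = c * wt z S x + d * wt w S x"
  using assms(3) is_weight_lincomb[OF is_weight_wt[OF assms(1,3)] is_weight_wt[OF assms(2,3)]]
  unfolding regular_def by (intro wt_eqI) auto

lemma wt_zero: "regular S x \<Longrightarrow> wt (\<lambda>u v. 0) S x = 0"
  using wt_eq_0I[of S x UNIV] exact_on_zero by blast

lemma wt_sum:
  assumes "finite I" "\<And>i. i \<in> I \<Longrightarrow> cocycle_on U (z i)" "regular S x"
  shows "wt (\<lambda>u v. \<Sum>i\<in>I. c i * z i u v) S x = (\<Sum>i\<in>I. c i * wt (z i) S x)"
  using assms(1,2)
proof (induction I rule: finite_induct)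
  case empty
  then show ?case using wt_zero[OF assms(3)] by simp
next
  case (insert i I)
  have "cocycle_on U (\<lambda>u v. \<Sum>i\<in>I. c i * z i u v)"
    using insert.prems by (intro cocycle_on_sum cocycle_on_scale) auto
  then show ?case
    using wt_lincomb[of "z i" "\<lambda>u v. \<Sum>i\<in>I. c i * z i u v" S x "c i" 1] insert assms(3) by simp
qed

lemma wt_diff:
  assumes "cocycle_on U z" "cocycle_on U w" "regular S x"
  shows "wt (\<lambda>u v. z u v - w u v) S x = wt z S x - wt w S x"
  using wt_lincomb[OF assms, of 1 "-1"] by simp

lemma wt_const:
  assumes "cocycle_on U z" "connected K" "\<And>x. x \<in> K \<Longrightarrow> regular S x" "x \<in> K" "y \<in> K"
  shows "wt z S x = wt z S y"
proof -
  have S: "S \<in> \<P>" using assms(3,4) unfolding regular_def by blast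
  have K: "K \<subseteq> perp2 (a S) (b S)" using assms(3) coframe(1)[OF S] unfolding regular_def by blast
  show ?thesis unfolding wt_def
    using is_weight_wt[OF assms(1,3)]
    by (intro weight_const_on_connected[OF coframe(2)[OF S] assms(2) K _ assms(4,5)]) (auto simp: wt_def)
qed

text \<open>The segment between two positive multiples of a regular point stays on its ray.\<close>

lemma wt_scale:
  assumes "cocycle_on U z" "regular S x" "0 < c"
  shows "wt z S (c *\<^sub>R x) = wt z S x"
proof (rule wt_const[OF assms(1), of "closed_segment (c *\<^sub>R x) x"])
  fix y assume "y \<in> closed_segment (c *\<^sub>R x) x"
  then obtain u where u: "0 \<le> u" "u \<le> 1" "y = (1 - u) *\<^sub>R c *\<^sub>R x + u *\<^sub>R x" unfolding in_segment by blast
  then have "y = ((1 - u) * c + u) *\<^sub>R x" by (simp add: algebra_simps)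
  moreover have "(1 - u) * c + u > 0" using u assms(3) by (cases "u = 1") (auto intro: add_pos_nonneg)
  ultimately show "regular S y" using regular_scale[OF assms(2)] by simp
qed auto

lemma dim_P: "S \<in> \<P> \<Longrightarrow> dim S \<le> 2"
proof -
  assume S: "S \<in> \<P>"
  have "S \<subseteq> span {p S, r S}"
  proof
    fix x assume "x \<in> S"
    then obtain t where "x = (x \<bullet> \<eta>) *\<^sub>R p S + t *\<^sub>R r S" using planeE[OF S] by blast
    moreover have "(x \<bullet> \<eta>) *\<^sub>R p S + t *\<^sub>R r S \<in> span {p S, r S}"
      by (intro span_add span_scale span_base) auto
    ultimately show "x \<in> span {p S, r S}" by simp
  qed
  then have "dim S \<le> card {p S, r S}" using dim_le_card by blast
  also have "\<dots> \<le> 2" by (simp add: card_insert_if)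
  finally show ?thesis .
qed

lemma dim_L: "l \<in> \<L> \<Longrightarrow> dim l \<le> 1"
proof -
  assume l: "l \<in> \<L>"
  have "l \<subseteq> span {q l}"
  proof
    fix x assume "x \<in> l"
    then have "x = (x \<bullet> \<eta>) *\<^sub>R q l" using lineE[OF l] by blast
    moreover have "(x \<bullet> \<eta>) *\<^sub>R q l \<in> span {q l}" by (intro span_scale span_base) auto
    ultimately show "x \<in> span {q l}" by simp
  qed
  then show ?thesis using dim_le_card[of l "{q l}"] by simp
qed

text \<open>Weight 0 means local exactness at regular points. Distinct planes meet in dimension at
  most one, so the remaining points lie in codimension three.\<close>

lemma exact_if_wt_zero:
  assumes z: "cocycle_on U z" and w: "\<And>S x. regular S x \<Longrightarrow> wt z S x = 0"
  shows "exact_on U z"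
proof (rule cocycle_codim2_exact[OF finite_P subspace_P])
  show "dim S + 2 \<le> DIM(real^4)" if "S \<in> \<P>" for S using dim_P[OF that] by simp
  show "dim (S \<inter> T) + 3 \<le> DIM(real^4)" if "S \<in> \<P>" "T \<in> \<P>" "S \<noteq> T" for S T
  proof (cases "S \<inter> T = {0}")
    case False
    then have "S \<inter> T \<in> \<L>" using that unfolding L_eq by blast
    from dim_L[OF this] show ?thesis by simp
  qed simp
  show "cocycle_on U z" by (rule z)
  fix S x assume "S \<in> \<P>" "x \<in> S" "\<And>T. T \<in> \<P> \<Longrightarrow> x \<in> T \<Longrightarrow> T = S"
  then have R: "regular S x" unfolding regular_def by blast
  then have "is_weight z (a S) (b S) x 0" using is_weight_wt[OF z R] w by metis
  then obtain N where N: "open N" "x \<in> N" "exact_on (N - perp2 (a S) (b S)) z" unfolding is_weight_zero_iff by blast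
  have "exact_on (N - \<Union>\<P>) z"
    by (rule exact_on_subset[OF N(3)]) (use coframe(1)[OF \<open>S \<in> \<P>\<close>] \<open>S \<in> \<P>\<close> in blast)
  then show "\<exists>N. open N \<and> x \<in> N \<and> exact_on (N - \<Union>\<P>) z" using N by blast
qed auto

text \<open>
  The direction \<open>- r S\<close> is the common left end of the levels \<open>s = 1\<close> and \<open>s = -1\<close> of \<open>S\<close>.
\<close>

definition base_wt :: "(real^4 \<Rightarrow> real^4 \<Rightarrow> rat) \<Rightarrow> (real^4) set \<Rightarrow> rat" where
  "base_wt z S = wt z S (- r S)"

text \<open>
  By \<open>\<epsilon>\<close>-separation no other line of \<open>S\<close> lies between the two arguments; \<open>s = 1\<close> selects the upper half
  of \<open>l\<close>, \<open>s = -1\<close> the lower one.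
\<close>

definition jump :: "real \<Rightarrow> (real^4 \<Rightarrow> real^4 \<Rightarrow> rat) \<Rightarrow> (real^4) set \<Rightarrow> (real^4) set \<Rightarrow> rat" where
  "jump s z S l = wt z S (s *\<^sub>R q l + \<epsilon> *\<^sub>R r S) - wt z S (s *\<^sub>R q l - \<epsilon> *\<^sub>R r S)"

definition lines_in :: "(real^4) set \<Rightarrow> (real^4) set set" where
  "lines_in S = {l \<in> \<L>. l \<subseteq> S}"

lemma finite_lines_in: "finite (lines_in S)" unfolding lines_in_def using finite_L by simp

lemma regular_side_iff:
  assumes "S \<in> \<P>" "s \<in> {1,-1}"
  shows "regular S (s *\<^sub>R p S + t *\<^sub>R r S) \<longleftrightarrow> t \<notin> (\<lambda>l. s * \<tau> S l) ` lines_in S"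
proof -
  have "t \<notin> (\<lambda>l. s * \<tau> S l) ` lines_in S \<longleftrightarrow> (\<forall>l\<in>\<L>. l \<subseteq> S \<longrightarrow> t \<noteq> s * \<tau> S l)"
    unfolding lines_in_def by blast
  then show ?thesis
    using assms(2) regular_upper_iff[OF assms(1), of t] regular_lower_iff[OF assms(1), of t]
    by (elim insertE) (simp_all only: scaleR_one scaleR_minus1_left mult_1 mult_minus1, simp_all)
qed

lemma wt_segment:
  assumes "cocycle_on U z" "\<And>u. 0 \<le> u \<Longrightarrow> u \<le> 1 \<Longrightarrow> regular S ((1 - u) *\<^sub>R x + u *\<^sub>R y)"
  shows "wt z S x = wt z S y"
  by (rule wt_const[OF assms(1), of "closed_segment x y"]) (auto simp: in_segment intro: assms(2))

text \<open>Beyond all breakpoints of its level a point can be turned into the end direction: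
  brought back to the level, the points of the connecting segment only move further out.\<close>

lemma wt_ends:
  assumes z: "cocycle_on U z" and S: "S \<in> \<P>" and s: "s \<in> {1,-1}"
  shows "(\<And>l. l \<in> lines_in S \<Longrightarrow> s * \<tau> S l < t) \<Longrightarrow> wt z S (s *\<^sub>R p S + t *\<^sub>R r S) = wt z S (r S)"
    and "(\<And>l. l \<in> lines_in S \<Longrightarrow> t < s * \<tau> S l) \<Longrightarrow> wt z S (s *\<^sub>R p S + t *\<^sub>R r S) = wt z S (- r S)"
proof -
  have aux: "wt z S (s *\<^sub>R p S + t *\<^sub>R r S) = wt z S (\<sigma> *\<^sub>R r S)"
    if \<sigma>: "\<sigma> \<in> {1,-1}" and t: "\<And>l. l \<in> lines_in S \<Longrightarrow> \<sigma> * (s * \<tau> S l) < \<sigma> * t" for \<sigma> :: real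
  proof (rule wt_segment[OF z])
    fix u :: real assume u: "0 \<le> u" "u \<le> 1"
    show "regular S ((1 - u) *\<^sub>R (s *\<^sub>R p S + t *\<^sub>R r S) + u *\<^sub>R (\<sigma> *\<^sub>R r S))"
    proof (cases "u = 1")
      case True
      then show ?thesis using regular_scale[OF regular_r[OF S], of \<sigma>] \<sigma> by auto
    next
      case False
      \<comment> \<open>Dividing a point of the segment by \<open>1 - u\<close> puts it back on
        level \<open>s\<close>, displaced by \<open>v * \<sigma>\<close>.\<close>
      define v where "v = u / (1 - u)"
      have v: "v \<ge> 0" unfolding v_def using u False by simp
      have "t + v * \<sigma> \<noteq> s * \<tau> S l" if "l \<in> lines_in S" for l
      proof
        assume e: "t + v * \<sigma> = s * \<tau> S l"
        have "\<sigma> * (s * \<tau> S l) = \<sigma> * t + v * (\<sigma> * \<sigma>)" unfolding e[symmetric] by (simp add: algebra_simps)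
        moreover have "\<sigma> * \<sigma> = 1" using \<sigma> by auto
        ultimately show False using t[OF that] v by simp
      qed
      then have "regular S (s *\<^sub>R p S + (t + v * \<sigma>) *\<^sub>R r S)" unfolding regular_side_iff[OF S s] by blast
      then have Rv: "regular S ((1 - u) *\<^sub>R (s *\<^sub>R p S + (t + v * \<sigma>) *\<^sub>R r S))" using regular_scale False by simp
      have vu: "(1 - u) * v = u" unfolding v_def using False by simp
      have vu': "(1 - u) * (v * \<sigma>) = u * \<sigma>" by (simp only: mult.assoc[symmetric] vu)
      have "(1 - u) *\<^sub>R (s *\<^sub>R p S + (t + v * \<sigma>) *\<^sub>R r S) = (1 - u) *\<^sub>R (s *\<^sub>R p S + t *\<^sub>R r S) + u *\<^sub>R (\<sigma> *\<^sub>R r S)"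
        by (simp only: scaleR_add_right scaleR_scaleR scaleR_add_left vu' add.assoc)
      then show ?thesis using Rv by (simp only:)
    qed
  qed
  show "(\<And>l. l \<in> lines_in S \<Longrightarrow> s * \<tau> S l < t) \<Longrightarrow> wt z S (s *\<^sub>R p S + t *\<^sub>R r S) = wt z S (r S)"
    using aux[of 1] by simp
  show "(\<And>l. l \<in> lines_in S \<Longrightarrow> t < s * \<tau> S l) \<Longrightarrow> wt z S (s *\<^sub>R p S + t *\<^sub>R r S) = wt z S (- r S)"
    using aux[of "-1"] by simp
qed

text \<open>Along a level of \<open>S\<close> the weight is a step function with breakpoints at the
  lines, and its leftmost value is the base weight by \<open>wt_ends\<close>.\<close>

lemma wt_formula:
  assumes z: "cocycle_on U z" and S: "S \<in> \<P>" and s: "s \<in> {1,-1}" and R: "regular S (s *\<^sub>R p S + t *\<^sub>R r S)"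
  shows "wt z S (s *\<^sub>R p S + t *\<^sub>R r S) = base_wt z S + (\<Sum>l | l \<in> lines_in S \<and> s * \<tau> S l < t. jump s z S l)"
proof -
  define W where "W = (\<lambda>t. wt z S (s *\<^sub>R p S + t *\<^sub>R r S))"
  have "W t = base_wt z S + (\<Sum>l | l \<in> lines_in S \<and> s * \<tau> S l < t. W (s * \<tau> S l + \<epsilon>) - W (s * \<tau> S l - \<epsilon>))"
  proof (rule step_function_repr[OF finite_lines_in eps(1)])
    show "\<epsilon> < \<bar>s * \<tau> S l - s * \<tau> S m\<bar>" if "l \<in> lines_in S" "m \<in> lines_in S" "l \<noteq> m" for l m
      using eps(2)[OF S, of l m] that s unfolding lines_in_def by auto
    show "W x = W y" if xy: "x \<le> y" "{x..y} \<inter> (\<lambda>l. s * \<tau> S l) ` lines_in S = {}" for x y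
      unfolding W_def
    proof (rule wt_segment[OF z])
      fix u :: real assume u: "0 \<le> u" "u \<le> 1"
      have "(1 - u) * x + u * y \<in> {x..y}" using convexD_alt[of "{x..y}" x y u] xy(1) u by simp
      then have "regular S (s *\<^sub>R p S + ((1 - u) * x + u * y) *\<^sub>R r S)"
        unfolding regular_side_iff[OF S s] using xy(2) by blast
      then show "regular S ((1 - u) *\<^sub>R (s *\<^sub>R p S + x *\<^sub>R r S) + u *\<^sub>R (s *\<^sub>R p S + y *\<^sub>R r S))"
        by (simp add: algebra_simps)
    qed
    show "W x = base_wt z S" if "\<And>l. l \<in> lines_in S \<Longrightarrow> x < s * \<tau> S l" for x
      unfolding W_def base_wt_def using wt_ends(2)[OF z S s that] by blast
    show "t \<notin> (\<lambda>l. s * \<tau> S l) ` lines_in S" using R regular_side_iff[OF S s] by blast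
  qed
  moreover have "W (s * \<tau> S l + \<epsilon>) - W (s * \<tau> S l - \<epsilon>) = jump s z S l" if "l \<in> lines_in S" for l
  proof -
    have "q l = p S + \<tau> S l *\<^sub>R r S" using tau[OF S] that unfolding lines_in_def by blast
    then show ?thesis unfolding W_def jump_def by (simp add: algebra_simps)
  qed
  ultimately show ?thesis unfolding W_def by simp
qed

text \<open>The total jump from one end to the other. As the left side does not depend on
  \<open>s\<close>, the upper and the lower jumps in a plane have equal sums.\<close>

lemma wt_r:
  assumes z: "cocycle_on U z" and S: "S \<in> \<P>" and s: "s \<in> {1,-1}"
  shows "wt z S (r S) = base_wt z S + (\<Sum>l\<in>lines_in S. jump s z S l)"
proof -
  define t where "t = Max (insert 0 ((\<lambda>l. s * \<tau> S l) ` lines_in S)) + 1"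
  have t: "s * \<tau> S l < t" if "l \<in> lines_in S" for l
  proof -
    have "s * \<tau> S l \<le> Max (insert 0 ((\<lambda>l. s * \<tau> S l) ` lines_in S))"
      using finite_lines_in that by (intro Max_ge) auto
    then show ?thesis unfolding t_def by simp
  qed
  then have "regular S (s *\<^sub>R p S + t *\<^sub>R r S)" unfolding regular_side_iff[OF S s] by fastforce
  from wt_formula[OF z S s this]
  have "wt z S (s *\<^sub>R p S + t *\<^sub>R r S) = base_wt z S + (\<Sum>l | l \<in> lines_in S \<and> s * \<tau> S l < t. jump s z S l)" .
  moreover have "{l \<in> lines_in S. s * \<tau> S l < t} = lines_in S" using t by blast
  ultimately show ?thesis using wt_ends(1)[OF z S s t] by simp
qed

text \<open>Rescaling moves a point off level 0 to level 1 or -1, where \<open>wt_formula\<close>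
  applies. On level 0 only the rays of \<open>r S\<close> and \<open>- r S\<close> and the origin
  remain.\<close>

lemma exact_if_base_wt_jump_zero:
  assumes z: "cocycle_on U z" and base: "\<And>S. S \<in> \<P> \<Longrightarrow> base_wt z S = 0"
    and jumps: "\<And>s S l. s \<in> {1,-1} \<Longrightarrow> S \<in> \<P> \<Longrightarrow> l \<in> lines_in S \<Longrightarrow> jump s z S l = 0"
  shows "exact_on U z"
proof (rule exact_if_wt_zero[OF z])
  fix S x assume R: "regular S x"
  then have S: "S \<in> \<P>" "x \<in> S" unfolding regular_def by auto
  obtain t where x: "x = (x \<bullet> \<eta>) *\<^sub>R p S + t *\<^sub>R r S" using planeE[OF S] .
  have r0: "wt z S (r S) = 0" "wt z S (- r S) = 0"
    using wt_r[OF z S(1), of 1] base[OF S(1)] jumps S(1) unfolding base_wt_def by auto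
  consider "x \<bullet> \<eta> \<noteq> 0" | "x \<bullet> \<eta> = 0" "t > 0" | "x \<bullet> \<eta> = 0" "t < 0" | "x = 0" using x by fastforce
  then show "wt z S x = 0"
  proof cases
    case 1
    define c where "c = \<bar>x \<bullet> \<eta>\<bar>"
    define s where "s = sgn (x \<bullet> \<eta>)"
    have c: "c > 0" "s \<in> {1,-1}" "x \<bullet> \<eta> = c * s" unfolding c_def s_def using 1 by (auto simp: sgn_if abs_if)
    define y where "y = s *\<^sub>R p S + (t / c) *\<^sub>R r S"
    have xy: "x = c *\<^sub>R y" using x c unfolding y_def by (simp add: scaleR_add_right)
    then have "y = (1 / c) *\<^sub>R x" using c(1) by simp
    then have Ry: "regular S y" using regular_scale[OF R, of "1 / c"] c(1) by simp
    have "wt z S y = 0"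
      using wt_formula[OF z S(1) c(2) Ry[unfolded y_def]] base[OF S(1)] jumps[OF c(2) S(1)]
      unfolding y_def by simp
    then show ?thesis using wt_scale[OF z Ry c(1)] xy by simp
  next
    case 2
    then have "x = t *\<^sub>R r S" using x by simp
    then show ?thesis using wt_scale[OF z regular_r[OF S(1)] 2(2)] r0 by simp
  next
    case 3
    then have "x = (- t) *\<^sub>R (- r S)" using x by simp
    then show ?thesis using wt_scale[OF z, of S "- r S" "- t"] regular_r[OF S(1)] 3 r0 regular_minus_iff by simp
  next
    case 4
    \<comment> \<open>The origin lies on every plane, so if it is regular there is no other plane
      and all of \<open>S\<close> is regular.\<close>
    have "regular S y" if "y \<in> S" for y
      using R that subspace_0[OF subspace_P] unfolding regular_def 4 by blast
    then have "wt z S x = wt z S (r S)"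
      using regular_r[OF S(1)] S unfolding regular_def
      by (intro wt_const[OF z, of S]) (auto intro: convex_connected subspace_imp_convex subspace_P simp: regular_def)
    then show ?thesis using r0 by simp
  qed
qed

lemma sum_jumps_eq:
  assumes "cocycle_on U z" "S \<in> \<P>"
  shows "(\<Sum>l\<in>lines_in S. jump 1 z S l) = (\<Sum>l\<in>lines_in S. jump (-1) z S l)"
  using wt_r[OF assms, of 1] wt_r[OF assms, of "-1"] by simp

end

lemma exact_on_zeroI: "(\<And>x y. x \<in> X \<Longrightarrow> y \<in> X \<Longrightarrow> z x y = 0) \<Longrightarrow> exact_on X z"
  unfolding exact_on_def primitive_on_def by (intro exI[of _ "\<lambda>x. 0"] ballI exI[of _ UNIV]) auto

lemma cocycle_locally_exact:
  assumes "cocycle_on X z" "x \<in> X" "- A \<subseteq> X"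
  shows "\<exists>N. open N \<and> x \<in> N \<and> exact_on (N - A) z"
proof -
  obtain N F where N: "open N" "x \<in> N" "\<And>a b. a \<in> N \<Longrightarrow> a \<in> X \<Longrightarrow> b \<in> N \<Longrightarrow> b \<in> X \<Longrightarrow> z a b = F b - F a"
    using cocycle_onE[OF assms(1,2)] by blast
  have "primitive_on (N - A) z F"
  proof (rule primitive_onI)
    fix y assume "y \<in> N - A"
    then show "\<exists>M. open M \<and> y \<in> M \<and> (\<forall>a\<in>M \<inter> (N - A). \<forall>b\<in>M \<inter> (N - A). z a b = F b - F a)"
      using N assms(3) by (intro exI[of _ N]) (simp add: subset_eq)
  qed
  then show ?thesis using N(1,2) exact_onI by blast
qed

context framed_planes
begin

section \<open>Classes of bent planes and the Kirchhoff law\<close>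

text \<open>Two covectors that vanish on \<open>S\<close> and have nonzero volume with its frame
  form another coframe. The weight changes by the sign of that volume, as the fixed coframe is
  positively oriented.\<close>

lemma coframe_change:
  assumes S: "S \<in> \<P>" and perp: "\<And>x. x \<in> S \<Longrightarrow> x \<bullet> c = 0" "\<And>x. x \<in> S \<Longrightarrow> x \<bullet> d = 0"
    and v: "vol (p S) (r S) c d \<noteq> 0"
  shows "perp2 c d = S"
    and "is_weight z c d x k \<Longrightarrow> is_weight z (a S) (b S) x (k * rat_sgn (vol (p S) (r S) c d))"
proof -
  have perp': "x \<bullet> c = 0" "x \<bullet> d = 0" if "x \<in> perp2 (a S) (b S)" for x
    using perp that coframe(1)[OF S] by blast+
  obtain \<alpha> \<beta> where c: "c = \<alpha> *\<^sub>R a S + \<beta> *\<^sub>R b S" using annihilator_perp2[OF coframe(2)[OF S] perp'(1)] .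
  obtain \<gamma> \<delta> where d: "d = \<gamma> *\<^sub>R a S + \<delta> *\<^sub>R b S" using annihilator_perp2[OF coframe(2)[OF S] perp'(2)] .
  have vc: "vol (p S) (r S) c d = (\<alpha> * \<delta> - \<beta> * \<gamma>) * vol (p S) (r S) (a S) (b S)"
    unfolding c d by (rule vol_change)
  then have det: "\<alpha> * \<delta> - \<beta> * \<gamma> \<noteq> 0" using v by auto
  have "rat_sgn (vol (p S) (r S) (a S) (b S)) = 1" using coframe(3)[OF S] by (simp add: rat_sgn_def)
  then have "rat_sgn (vol (p S) (r S) c d) = rat_sgn (\<alpha> * \<delta> - \<beta> * \<gamma>)"
    unfolding vc rat_sgn_mult by simp
  then show "is_weight z c d x k \<Longrightarrow> is_weight z (a S) (b S) x (k * rat_sgn (vol (p S) (r S) c d))"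
    using is_weight_change[OF det, of z "a S" "b S" x k] c d by simp
  show "perp2 c d = S" using perp2_change[OF det, of "a S" "b S"] c d coframe(1)[OF S] by simp
qed

text \<open>The component of \<open>v\<close> orthogonal to \<open>S\<close>.\<close>

definition normal_part :: "(real^4) set \<Rightarrow> real^4 \<Rightarrow> real^4" where
  "normal_part S v = (SOME w. v - w \<in> S \<and> (\<forall>x\<in>S. x \<bullet> w = 0))"

lemma normal_part:
  assumes "S \<in> \<P>"
  shows "v - normal_part S v \<in> S" "x \<in> S \<Longrightarrow> x \<bullet> normal_part S v = 0"
proof -
  obtain y w where "y \<in> span S" "\<And>x. x \<in> span S \<Longrightarrow> orthogonal w x" "v = y + w"
    using orthogonal_subspace_decomp_exists[of S v] by metis
  moreover have "span S = S" using subspace_P[OF assms] by (simp add: span_eq_iff)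
  ultimately have "v - w \<in> S \<and> (\<forall>x\<in>S. x \<bullet> w = 0)" by (auto simp: orthogonal_def inner_commute)
  then have "v - normal_part S v \<in> S \<and> (\<forall>x\<in>S. x \<bullet> normal_part S v = 0)"
    unfolding normal_part_def by (rule someI)
  then show "v - normal_part S v \<in> S" "x \<in> S \<Longrightarrow> x \<bullet> normal_part S v = 0" by blast+
qed

text \<open>
  Vanishes on \<open>T\<close> and is positive exactly on the half of \<open>S\<close>, cut by \<open>T\<close>, that contains \<open>r S\<close>.
\<close>

definition side :: "(real^4) set \<Rightarrow> (real^4) set \<Rightarrow> real^4" where
  "side S T = normal_part T (r S)"

lemma side_zero: "T \<in> \<P> \<Longrightarrow> x \<in> T \<Longrightarrow> x \<bullet> side S T = 0"
  unfolding side_def using normal_part(2) by blast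

text \<open>\<open>r S\<close> and \<open>side S T\<close> differ by an element of \<open>T\<close>,
  on which \<open>side S T\<close> vanishes, so the value is a squared length. It is nonzero because
  \<open>r S\<close> lies on no other plane.\<close>

lemma side_pos:
  assumes "S \<in> \<P>" "T \<in> \<P>" "S \<noteq> T"
  shows "0 < r S \<bullet> side S T"
proof -
  have d: "r S - side S T \<in> T" unfolding side_def using normal_part(1)[OF assms(2)] .
  have "side S T \<noteq> 0"
  proof
    assume "side S T = 0"
    then have "r S \<in> T" using d by simp
    then show False using regular_r[OF assms(1)] assms unfolding regular_def by blast
  qed
  moreover have "r S \<bullet> side S T = side S T \<bullet> side S T"
    using side_zero[OF assms(2) d, of S] by (simp add: inner_diff_left)
  ultimately show ?thesis by simp
qed

lemma plane_lineE:
  assumes "S \<in> \<P>" "l \<in> \<L>" "l \<subseteq> S" "x \<in> S"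
  obtains t where "x = (x \<bullet> \<eta>) *\<^sub>R q l + t *\<^sub>R r S"
proof -
  obtain t where t: "x = (x \<bullet> \<eta>) *\<^sub>R p S + t *\<^sub>R r S" using planeE[OF assms(1,4)] .
  have pS: "p S = q l - \<tau> S l *\<^sub>R r S" using tau[OF assms(1-3)] by simp
  have "(x \<bullet> \<eta>) *\<^sub>R p S + t *\<^sub>R r S = (x \<bullet> \<eta>) *\<^sub>R q l + (t - (x \<bullet> \<eta>) * \<tau> S l) *\<^sub>R r S"
    unfolding pS by (simp add: algebra_simps)
  from trans[OF t this] show ?thesis using that by blast
qed

lemma plane_line_in:
  assumes "S \<in> \<P>" "l \<in> \<L>" "l \<subseteq> S"
  shows "h *\<^sub>R q l + t *\<^sub>R r S \<in> S"
  using assms line_in[OF assms(2), of h] plane_in[OF assms(1), of 0 t] subspace_add[OF subspace_P[OF assms(1)]] by auto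

lemma vol_frame:
  assumes "S \<in> \<P>" "l \<in> \<L>" "l \<subseteq> S"
  shows "vol (p S) (r S) x y = vol (q l) (r S) x y"
  unfolding tau[OF assms] by (simp add: vol_add vol_scale vol_same)

text \<open>The two planes span a hyperplane with basis \<open>q (S \<inter> T)\<close>,
  \<open>r S\<close>, \<open>r T\<close>; \<open>n\<close> is its normal vector with the sign
  adjusted.\<close>

lemma normal_exists:
  assumes "S \<in> \<P>" "T \<in> \<P>" "S \<noteq> T" "S \<inter> T \<in> \<L>"
  obtains n where "\<And>x. x \<in> S \<Longrightarrow> x \<bullet> n = 0" "\<And>x. x \<in> T \<Longrightarrow> x \<bullet> n = 0" "0 < vol (q (S \<inter> T)) (r S) (r T) n"
proof -
  let ?q = "q (S \<inter> T)"
  have indep: "c1 = 0 \<and> c2 = 0 \<and> c3 = 0" if c: "c1 *\<^sub>R ?q + c2 *\<^sub>R r S + c3 *\<^sub>R r T = 0" for c1 c2 c3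
  proof -
    have "(c1 *\<^sub>R ?q + c2 *\<^sub>R r S + c3 *\<^sub>R r T) \<bullet> \<eta> = 0" using c by simp
    then have c1: "c1 = 0" using line(1)[OF assms(4)] frame(2) assms(1,2) by (simp add: inner_add_left)
    have c2: "c2 = 0"
    proof -
      have "(c2 *\<^sub>R r S + c3 *\<^sub>R r T) \<bullet> side S T = 0" using c c1 by simp
      moreover have "r T \<bullet> side S T = 0" using side_zero[OF assms(2)] regular_r[OF assms(2)] unfolding regular_def by blast
      ultimately show ?thesis using side_pos[OF assms(1-3)] by (simp add: inner_add_left)
    qed
    then show ?thesis using c c1 frame(3)[OF assms(2)] by simp
  qed
  have "dim {?q, r S, r T} \<le> card {?q, r S, r T}" by (rule dim_le_card) (auto simp: span_superset)
  also have "\<dots> \<le> 3" by (simp add: card_insert_if)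
  finally have "dim {?q, r S, r T} < DIM(real^4)" by simp
  then obtain n where n: "n \<noteq> 0" "\<And>x. x \<in> span {?q, r S, r T} \<Longrightarrow> orthogonal n x"
    using orthogonal_to_subspace_exists by (metis dim_span)
  have n0: "?q \<bullet> n = 0" "r S \<bullet> n = 0" "r T \<bullet> n = 0"
  proof -
    have "y \<bullet> n = 0" if "y \<in> {?q, r S, r T}" for y
      using n(2)[OF span_base[OF that]] by (simp add: orthogonal_def inner_commute)
    then show "?q \<bullet> n = 0" "r S \<bullet> n = 0" "r T \<bullet> n = 0" by blast+
  qed
  have perp: "x \<bullet> n = 0" if xR: "x \<in> R" "R \<in> {S,T}" for x R
  proof -
    have "R \<in> \<P>" "S \<inter> T \<subseteq> R" using xR assms by auto
    then obtain t where t: "x = (x \<bullet> \<eta>) *\<^sub>R ?q + t *\<^sub>R r R" using plane_lineE[OF _ assms(4) _ xR(1)] by blast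
    have "((x \<bullet> \<eta>) *\<^sub>R ?q + t *\<^sub>R r R) \<bullet> n = 0" using n0 xR(2) by (auto simp: inner_add_left)
    then show ?thesis unfolding t[symmetric] .
  qed
  have "vol ?q (r S) (r T) n \<noteq> 0"
  proof (rule vol_nonzero)
    fix c1 c2 c3 c4 assume c: "c1 *\<^sub>R ?q + c2 *\<^sub>R r S + c3 *\<^sub>R r T + c4 *\<^sub>R n = 0"
    then have "(c1 *\<^sub>R ?q + c2 *\<^sub>R r S + c3 *\<^sub>R r T + c4 *\<^sub>R n) \<bullet> n = 0" by simp
    then have "c4 = 0" using n0 n(1) by (simp add: inner_add_left)
    then show "c1 = 0 \<and> c2 = 0 \<and> c3 = 0 \<and> c4 = 0" using indep[of c1 c2 c3] c by simp
  qed
  then consider "0 < vol ?q (r S) (r T) n" | "0 < vol ?q (r S) (r T) ((-1) *\<^sub>R n)"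
    unfolding vol_scale by linarith
  then show ?thesis
  proof cases
    case 1
    then show ?thesis using that[of n] perp by blast
  next
    case 2
    then show ?thesis using that[of "(-1) *\<^sub>R n"] perp by simp
  qed
qed

text \<open>The sign condition is the orientation that gives \<open>bent S T\<close> weight 1 on
  \<open>S\<close> and -1 on \<open>T\<close>.\<close>

definition normal :: "(real^4) set \<Rightarrow> (real^4) set \<Rightarrow> real^4" where
  "normal S T = (SOME n. (\<forall>x\<in>S. x \<bullet> n = 0) \<and> (\<forall>x\<in>T. x \<bullet> n = 0) \<and> 0 < vol (q (S \<inter> T)) (r S) (r T) n)"

lemma normal:
  assumes "S \<in> \<P>" "T \<in> \<P>" "S \<noteq> T" "S \<inter> T \<in> \<L>"
  shows "x \<in> S \<Longrightarrow> x \<bullet> normal S T = 0" "x \<in> T \<Longrightarrow> x \<bullet> normal S T = 0"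
    "0 < vol (q (S \<inter> T)) (r S) (r T) (normal S T)"
proof -
  obtain n where "(\<forall>x\<in>S. x \<bullet> n = 0) \<and> (\<forall>x\<in>T. x \<bullet> n = 0) \<and> 0 < vol (q (S \<inter> T)) (r S) (r T) n"
    using normal_exists[OF assms] by metis
  then have "(\<forall>x\<in>S. x \<bullet> normal S T = 0) \<and> (\<forall>x\<in>T. x \<bullet> normal S T = 0) \<and> 0 < vol (q (S \<inter> T)) (r S) (r T) (normal S T)"
    unfolding normal_def by (rule someI)
  then show "x \<in> S \<Longrightarrow> x \<bullet> normal S T = 0" "x \<in> T \<Longrightarrow> x \<bullet> normal S T = 0"
    "0 < vol (q (S \<inter> T)) (r S) (r T) (normal S T)" by blast+
qed

text \<open>\<open>side Q R\<close> and \<open>r Q\<close> differ by a vector of \<open>R\<close>,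
  that is, by a combination of the first two entries.\<close>

lemma vol_side:
  assumes "S \<in> \<P>" "T \<in> \<P>" "S \<inter> T \<in> \<L>" and R: "R \<in> {S,T}" "Q \<in> {S,T}"
  shows "vol (p R) (r R) (side Q R) n = vol (q (S \<inter> T)) (r R) (r Q) n"
proof -
  have R': "R \<in> \<P>" "S \<inter> T \<subseteq> R" using R assms by auto
  have "r Q - side Q R \<in> R" unfolding side_def using normal_part(1)[OF R'(1)] .
  then obtain t where t: "r Q - side Q R = ((r Q - side Q R) \<bullet> \<eta>) *\<^sub>R q (S \<inter> T) + t *\<^sub>R r R"
    using plane_lineE[OF R'(1) assms(3) R'(2)] by blast
  define h where "h = (r Q - side Q R) \<bullet> \<eta>"
  have "side Q R = r Q + (- h) *\<^sub>R q (S \<inter> T) + (- t) *\<^sub>R r R"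
    using t unfolding h_def[symmetric] by (simp add: algebra_simps)
  then have "vol (q (S \<inter> T)) (r R) (side Q R) n = vol (q (S \<inter> T)) (r R) (r Q) n"
    by (simp add: vol_add vol_scale vol_same del: scaleR_minus_left)
  then show ?thesis unfolding vol_frame[OF R'(1) assms(3) R'(2)] .
qed

text \<open>
  The crossing number with a chamber in the hyperplane spanned by \<open>S\<close> and \<open>T\<close>, bounded by \<open>half S T\<close> and
  \<open>half T S\<close>.
\<close>

definition bent :: "(real^4) set \<Rightarrow> (real^4) set \<Rightarrow> real^4 \<Rightarrow> real^4 \<Rightarrow> rat" where
  "bent S T = jump_cocycle ({x. 0 < x \<bullet> side S T} \<inter> {x. 0 < x \<bullet> side T S}) (normal S T)"

definition half :: "(real^4) set \<Rightarrow> (real^4) set \<Rightarrow> (real^4) set" where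
  "half S T = {x \<in> S. 0 \<le> x \<bullet> side S T}"

context
  fixes S T
  assumes S: "S \<in> \<P>" and T: "T \<in> \<P>" and ST: "S \<noteq> T" "S \<inter> T \<in> \<L>"
begin

lemma vol_pos: "0 < vol (p S) (r S) (side T S) (normal S T)"
  using vol_side[OF S T ST(2), of S T] normal(3)[OF S T ST] by simp

text \<open>Passing from \<open>S\<close> to \<open>T\<close> exchanges \<open>r S\<close> and
  \<open>r T\<close>, whence the opposite orientation.\<close>

lemma vol_neg: "vol (p T) (r T) (side S T) (normal S T) < 0"
  using vol_side[OF S T ST(2), of T S] normal(3)[OF S T ST] vol_swap23[of _ "r S" "r T"] by simp

lemma perp2_side: "perp2 (side T S) (normal S T) = S" "perp2 (side S T) (normal S T) = T"
  using coframe_change(1)[OF S side_zero[OF S] normal(1)[OF S T ST]] vol_pos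
    coframe_change(1)[OF T side_zero[OF T] normal(2)[OF S T ST]] vol_neg by force+

text \<open>A point of the hyperplane spanned by \<open>S\<close> and \<open>T\<close> is inside the
  chamber, or strictly outside one of the two half-spaces that bound it, or on one of the two
  removed halves.\<close>

lemma bent_cocycle: "cocycle_on (- (half S T \<union> half T S)) (bent S T)"
  unfolding bent_def
proof (rule jump_cocycle_cocycle)
  show "open ({x. 0 < x \<bullet> side S T} \<inter> {x. 0 < x \<bullet> side T S})"
    by (intro open_Int open_inner_pos)
  fix x assume x: "x \<in> - (half S T \<union> half T S)"
  define K where "K = {x. 0 < x \<bullet> side S T} \<inter> {x. 0 < x \<bullet> side T S}"
  have "x \<in> S \<longleftrightarrow> x \<bullet> side T S = 0 \<and> x \<bullet> normal S T = 0" "x \<in> T \<longleftrightarrow> x \<bullet> side S T = 0 \<and> x \<bullet> normal S T = 0"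
    using perp2_side unfolding perp2_def by blast+
  then consider "x \<in> K" | "x \<bullet> normal S T \<noteq> 0" | "x \<bullet> side S T < 0" | "x \<bullet> side T S < 0"
    using x unfolding half_def K_def by fastforce
  then have "x \<in> K \<or> x \<bullet> normal S T \<noteq> 0 \<or> (\<exists>N. open N \<and> x \<in> N \<and> N \<inter> K = {})"
  proof cases
    case 3
    then have "\<exists>N. open N \<and> x \<in> N \<and> N \<inter> K = {}"
      using open_inner_neg[of "side S T"] by (intro exI[of _ "{x. x \<bullet> side S T < 0}"]) (auto simp: K_def)
    then show ?thesis by blast
  next
    case 4
    then have "\<exists>N. open N \<and> x \<in> N \<and> N \<inter> K = {}"
      using open_inner_neg[of "side T S"] by (intro exI[of _ "{x. x \<bullet> side T S < 0}"]) (auto simp: K_def)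
    then show ?thesis by blast
  qed blast+
  then show "x \<in> {x. 0 < x \<bullet> side S T} \<inter> {x. 0 < x \<bullet> side T S} \<or> x \<bullet> normal S T \<noteq> 0 \<or>
     (\<exists>N. open N \<and> x \<in> N \<and> N \<inter> ({x. 0 < x \<bullet> side S T} \<inter> {x. 0 < x \<bullet> side T S}) = {})"
    unfolding K_def .
qed

lemma half_subset: "half S T \<union> half T S \<subseteq> \<Union>\<P>"
  unfolding half_def using S T by blast

lemma bent_cocycle_U: "cocycle_on U (bent S T)"
  by (rule cocycle_on_subset[OF bent_cocycle]) (use half_subset in blast)

lemma wt_bent_0:
  assumes "regular R x" "x \<notin> half S T" "x \<notin> half T S"
  shows "wt (bent S T) R x = 0"
proof -
  obtain N where "open N" "x \<in> N" "exact_on (N - \<Union>\<P>) (bent S T)"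
    using cocycle_locally_exact[OF bent_cocycle, of x "\<Union>\<P>"] half_subset assms(2,3) by blast
  then show ?thesis using wt_eq_0I[OF assms(1)] by blast
qed

text \<open>Near \<open>x\<close> the condition on \<open>side S T\<close> holds automatically, and
  what is left of \<open>bent S T\<close> is the winding class for the coframe
  \<open>side T S\<close>, \<open>normal S T\<close>.\<close>

lemma wt_bent_left: "regular S x \<Longrightarrow> 0 < x \<bullet> side S T \<Longrightarrow> wt (bent S T) S x = 1"
proof -
  assume x: "regular S x" "0 < x \<bullet> side S T"
  have "is_weight (bent S T) (side T S) (normal S T) x 1"
    unfolding is_weight_def
    using open_inner_pos[of "side S T"] x(2)
    by (intro exI[of _ "{x. 0 < x \<bullet> side S T}"] conjI exact_on_zeroI)
      (auto simp: bent_def angle_cocycle_def jump_cocycle_def)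
  from coframe_change(2)[OF S side_zero[OF S] normal(1)[OF S T ST] _ this] vol_pos
  have w: "is_weight (bent S T) (a S) (b S) x 1" by (simp add: rat_sgn_def)
  show ?thesis by (rule wt_eqI[OF S _ w]) (use x(1) in \<open>simp add: regular_def\<close>)
qed

lemma wt_bent_right: "regular T x \<Longrightarrow> 0 < x \<bullet> side T S \<Longrightarrow> wt (bent S T) T x = -1"
proof -
  assume x: "regular T x" "0 < x \<bullet> side T S"
  have "is_weight (bent S T) (side S T) (normal S T) x 1"
    unfolding is_weight_def
    using open_inner_pos[of "side T S"] x(2)
    by (intro exI[of _ "{x. 0 < x \<bullet> side T S}"] conjI exact_on_zeroI)
      (auto simp: bent_def angle_cocycle_def jump_cocycle_def)
  from coframe_change(2)[OF T side_zero[OF T] normal(2)[OF S T ST] _ this] vol_neg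
  have w: "is_weight (bent S T) (a T) (b T) x (-1)" by (simp add: rat_sgn_def)
  show ?thesis by (rule wt_eqI[OF T _ w]) (use x(1) in \<open>simp add: regular_def\<close>)
qed

lemma wt_bent:
  assumes "regular R x"
  shows "wt (bent S T) R x = (if R = S then of_bool (0 < x \<bullet> side S T) else if R = T then - of_bool (0 < x \<bullet> side T S) else 0)"
proof -
  have R: "R \<in> \<P>" "x \<in> R" "\<And>Q. Q \<in> \<P> \<Longrightarrow> x \<in> Q \<Longrightarrow> Q = R" using assms unfolding regular_def by blast+
  have iff: "x \<in> S \<longleftrightarrow> R = S" "x \<in> T \<longleftrightarrow> R = T" using R S T by blast+
  have nz: "R = S \<Longrightarrow> x \<bullet> side S T \<noteq> 0" "R = T \<Longrightarrow> x \<bullet> side T S \<noteq> 0"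
  proof -
    have *: "u \<in> S \<longleftrightarrow> u \<bullet> side T S = 0 \<and> u \<bullet> normal S T = 0" "u \<in> T \<longleftrightarrow> u \<bullet> side S T = 0 \<and> u \<bullet> normal S T = 0" for u
      using perp2_side unfolding perp2_def by blast+
    show "x \<bullet> side S T \<noteq> 0" if "R = S" using *[of x] iff ST(1) that by metis
    show "x \<bullet> side T S \<noteq> 0" if "R = T" using *[of x] iff ST(1) that by metis
  qed
  show ?thesis
  proof (cases "x \<in> half S T \<union> half T S")
    case False
    then show ?thesis using wt_bent_0[OF assms] iff unfolding half_def by auto
  next
    case True
    then consider "x \<in> half S T" | "x \<in> half T S" by blast
    then show ?thesis
    proof cases
      case 1
      then have "R = S" using iff unfolding half_def by blast
      moreover have "0 < x \<bullet> side S T" using 1 nz(1)[OF \<open>R = S\<close>] unfolding half_def by simp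
      ultimately show ?thesis using wt_bent_left assms by simp
    next
      case 2
      then have "R = T" using iff unfolding half_def by blast
      moreover have "0 < x \<bullet> side T S" using 2 nz(2)[OF \<open>R = T\<close>] unfolding half_def by simp
      ultimately show ?thesis using wt_bent_right assms ST by simp
    qed
  qed
qed

end

text \<open>Offsets up to \<open>\<epsilon>\<close> from \<open>l\<close> along a level reach no
  other line of \<open>S\<close>.\<close>

lemma regular_jump:
  assumes "S \<in> \<P>" "l \<in> lines_in S" "s \<in> {1,-1}" "0 < \<bar>d\<bar>" "\<bar>d\<bar> \<le> \<epsilon>"
  shows "regular S (s *\<^sub>R q l + d *\<^sub>R r S)"
proof -
  have l: "l \<in> \<L>" "l \<subseteq> S" using assms(2) unfolding lines_in_def by auto
  have "s * \<tau> S l + d \<noteq> s * \<tau> S m" if m: "m \<in> lines_in S" for m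
  proof
    assume e: "s * \<tau> S l + d = s * \<tau> S m"
    then have "m \<noteq> l" using assms(4) by auto
    then have "\<epsilon> < \<bar>\<tau> S m - \<tau> S l\<bar>" using eps(2)[OF assms(1)] m l unfolding lines_in_def by blast
    moreover have "\<bar>\<tau> S m - \<tau> S l\<bar> = \<bar>d\<bar>" using e assms(3) by auto
    ultimately show False using assms(5) by simp
  qed
  then have "regular S (s *\<^sub>R p S + (s * \<tau> S l + d) *\<^sub>R r S)" unfolding regular_side_iff[OF assms(1,3)] by fastforce
  moreover have "s *\<^sub>R p S + (s * \<tau> S l + d) *\<^sub>R r S = s *\<^sub>R q l + d *\<^sub>R r S"
    unfolding tau[OF assms(1) l] by (simp add: algebra_simps)
  ultimately show ?thesis by simp
qed

lemma regular_jump_eps: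
  assumes "S \<in> \<P>" "l \<in> lines_in S" "s \<in> {1,-1}"
  shows "regular S (s *\<^sub>R q l + \<epsilon> *\<^sub>R r S)" "regular S (s *\<^sub>R q l - \<epsilon> *\<^sub>R r S)"
  using regular_jump[OF assms, of \<epsilon>] regular_jump[OF assms, of "- \<epsilon>"] eps(1) by auto

text \<open>\<open>- r S\<close> is on the negative side of \<open>side S T\<close>, and likewise
  for \<open>T\<close>: the left ends belong to the halves that do not bound the chamber.\<close>

lemma base_wt_bent:
  assumes "S \<in> \<P>" "T \<in> \<P>" "S \<noteq> T" "S \<inter> T \<in> \<L>" "R \<in> \<P>"
  shows "base_wt (bent S T) R = 0"
proof -
  have "regular R (- r R)" using regular_r[OF assms(5)] regular_minus_iff by blast
  then show ?thesis unfolding base_wt_def wt_bent[OF assms(1-4) \<open>regular R (- r R)\<close>]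
    using side_pos[OF assms(1-3)] side_pos[OF assms(2,1)] assms(3) by auto
qed

text \<open>Crossing \<open>S \<inter> T\<close> in direction \<open>r S\<close> enters the positive
  half of \<open>S\<close>, at the upper as at the lower half of the line. At any other line of
  \<open>S\<close> the \<open>\<epsilon>\<close>-gap keeps both test points on one side.\<close>

lemma jump_bent:
  assumes "S \<in> \<P>" "T \<in> \<P>" "S \<noteq> T" "S \<inter> T \<in> \<L>" "R \<in> \<P>" "m \<in> lines_in R" "s \<in> {1,-1}"
  shows "jump s (bent S T) R m = (if m = S \<inter> T then of_bool (R = S) - of_bool (R = T) else 0)"
proof -
  have sgn: "of_bool (0 < (s *\<^sub>R q m + \<epsilon> *\<^sub>R r A) \<bullet> side A B) - of_bool (0 < (s *\<^sub>R q m - \<epsilon> *\<^sub>R r A) \<bullet> side A B)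
      = (of_bool (m = S \<inter> T) :: rat)" if AB: "A \<in> \<P>" "B \<in> \<P>" "A \<noteq> B" "A \<inter> B = S \<inter> T" and m: "m \<in> lines_in A" for A B
  proof (cases "m = S \<inter> T")
    case True
    have "q m \<in> B" using q_in[OF assms(4)] AB(4) True by blast
    then have "q m \<bullet> side A B = 0" using side_zero[OF AB(2)] by blast
    moreover have "0 < \<epsilon> * (r A \<bullet> side A B)" using side_pos[OF AB(1-3)] eps(1) by simp
    ultimately show ?thesis using True by (simp add: inner_add_left inner_diff_left)
  next
    case False
    define l where "l = S \<inter> T"
    have l: "l \<in> \<L>" "l \<subseteq> A" "l \<subseteq> B" unfolding l_def using assms(4) AB(4) by auto
    have mA: "m \<in> \<L>" "m \<subseteq> A" using m unfolding lines_in_def by auto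
    have gap: "\<epsilon> < \<bar>\<tau> A m - \<tau> A l\<bar>" using eps(2)[OF AB(1) mA(1) l(1) mA(2) l(2)] False unfolding l_def by blast
    have "q l \<in> B" using q_in[OF l(1)] l(3) by blast
    then have ql: "q l \<bullet> side A B = 0" using side_zero[OF AB(2)] by blast
    have "q m = q l + (\<tau> A m - \<tau> A l) *\<^sub>R r A"
      unfolding tau[OF AB(1) mA] tau[OF AB(1) l(1,2)] by (simp add: algebra_simps)
    then have qm: "q m \<bullet> side A B = (\<tau> A m - \<tau> A l) * (r A \<bullet> side A B)" using ql by (simp add: inner_add_left)
    have "(s *\<^sub>R q m + d *\<^sub>R r A) \<bullet> side A B = (s * (\<tau> A m - \<tau> A l) + d) * (r A \<bullet> side A B)" for d
      unfolding inner_add_left inner_scaleR_left qm by (simp add: algebra_simps)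
    then have e: "0 < (s *\<^sub>R q m + d *\<^sub>R r A) \<bullet> side A B \<longleftrightarrow> 0 < s * (\<tau> A m - \<tau> A l) + d" for d
      using side_pos[OF AB(1-3)] by (simp add: zero_less_mult_iff)
    have "\<epsilon> < \<bar>s * (\<tau> A m - \<tau> A l)\<bar>" using gap assms(7) by auto
    then have "0 < s * (\<tau> A m - \<tau> A l) + \<epsilon> \<longleftrightarrow> 0 < s * (\<tau> A m - \<tau> A l) + - \<epsilon>" using eps(1) by linarith
    then have "0 < (s *\<^sub>R q m + \<epsilon> *\<^sub>R r A) \<bullet> side A B \<longleftrightarrow> 0 < (s *\<^sub>R q m + (- \<epsilon>) *\<^sub>R r A) \<bullet> side A B"
      unfolding e .
    then show ?thesis using False by simp
  qed
  have j: "jump s (bent S T) R m = (if R = S then of_bool (0 < (s *\<^sub>R q m + \<epsilon> *\<^sub>R r R) \<bullet> side S T)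
        else if R = T then - of_bool (0 < (s *\<^sub>R q m + \<epsilon> *\<^sub>R r R) \<bullet> side T S) else 0)
      - (if R = S then of_bool (0 < (s *\<^sub>R q m - \<epsilon> *\<^sub>R r R) \<bullet> side S T)
        else if R = T then - of_bool (0 < (s *\<^sub>R q m - \<epsilon> *\<^sub>R r R) \<bullet> side T S) else 0)"
    unfolding jump_def wt_bent[OF assms(1-4) regular_jump_eps(1)[OF assms(5-7)]]
      wt_bent[OF assms(1-4) regular_jump_eps(2)[OF assms(5-7)]] ..
  consider "R = S" | "R = T" "R \<noteq> S" | "R \<noteq> S" "R \<noteq> T" by blast
  then show ?thesis
  proof cases
    case 1
    have "jump s (bent S T) R m = of_bool (m = S \<inter> T)"
      unfolding j if_P[OF 1] using sgn[OF assms(1-3) refl assms(6)[unfolded 1]] unfolding 1 .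
    then show ?thesis using 1 assms(3) by simp
  next
    case 2
    have "jump s (bent S T) R m = - of_bool (m = S \<inter> T)"
      unfolding j if_not_P[OF 2(2)] if_P[OF 2(1)]
      using sgn[OF assms(2,1) assms(3)[symmetric] Int_commute assms(6)[unfolded 2(1)]] unfolding 2(1) by linarith
    then show ?thesis using 2 assms(3) by simp
  next
    case 3
    then show ?thesis unfolding j by simp
  qed
qed

section \<open>Winding classes and the planes through a line\<close>

definition wind :: "(real^4) set \<Rightarrow> real^4 \<Rightarrow> real^4 \<Rightarrow> rat" where
  "wind S = angle_cocycle (a S) (b S)"

lemma wind_cocycle: "S \<in> \<P> \<Longrightarrow> cocycle_on U (wind S)"
  unfolding wind_def
  by (rule cocycle_on_subset[OF angle_cocycle_cocycle]) (use coframe(1) in blast)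

lemma wt_wind:
  assumes "S \<in> \<P>" "regular R x"
  shows "wt (wind S) R x = of_bool (R = S)"
proof (cases "R = S")
  case True
  have "wt (angle_cocycle (a S) (b S)) S x = 1"
  proof (rule wt_eqI[OF assms(1) _ is_weight_angle])
    show "x \<in> S" using assms(2) True unfolding regular_def by blast
  qed
  then show ?thesis using True by (simp add: wind_def)
next
  case False
  then have x: "x \<in> - perp2 (a S) (b S)" using assms coframe(1)[OF assms(1)] unfolding regular_def by blast
  have "- \<Union>\<P> \<subseteq> - perp2 (a S) (b S)" using coframe(1)[OF assms(1)] assms(1) by blast
  then obtain N where "open N" "x \<in> N" "exact_on (N - \<Union>\<P>) (wind S)"
    using cocycle_locally_exact[OF angle_cocycle_cocycle x] unfolding wind_def by blast
  then have "wt (wind S) R x = 0" using wt_eq_0I[OF assms(2)] by blast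
  then show ?thesis using False by simp
qed

lemma base_wt_wind: "S \<in> \<P> \<Longrightarrow> R \<in> \<P> \<Longrightarrow> base_wt (wind S) R = of_bool (R = S)"
  unfolding base_wt_def using wt_wind regular_r regular_minus_iff by blast

lemma jump_wind: "S \<in> \<P> \<Longrightarrow> R \<in> \<P> \<Longrightarrow> m \<in> lines_in R \<Longrightarrow> s \<in> {1,-1} \<Longrightarrow> jump s (wind S) R m = 0"
  unfolding jump_def by (simp only: wt_wind regular_jump_eps diff_self)

definition planes_thr :: "(real^4) set \<Rightarrow> (real^4) set set" where
  "planes_thr l = {S \<in> \<P>. l \<subseteq> S}"

lemma finite_planes_thr: "finite (planes_thr l)" unfolding planes_thr_def using finite_P by simp

lemma planes_thr_meet:
  assumes "l \<in> \<L>" "S \<in> planes_thr l" "T \<in> planes_thr l" "S \<noteq> T"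
  shows "S \<inter> T = l"
proof -
  have "q l \<noteq> 0" using line(1)[OF assms(1)] by auto
  moreover have "q l \<in> S \<inter> T" using q_in[OF assms(1)] assms(2,3) unfolding planes_thr_def by blast
  ultimately show ?thesis
    using line_eq[of "S \<inter> T" l "q l"] planes_meet_line[of S T "q l"] q_in assms unfolding planes_thr_def by blast
qed

lemma planes_thr_two:
  assumes "l \<in> \<L>" "T \<in> planes_thr l"
  obtains S where "S \<in> planes_thr l" "S \<noteq> T"
proof -
  obtain A B where "A \<in> \<P>" "B \<in> \<P>" "A \<noteq> B" "l = A \<inter> B" using assms(1) unfolding L_eq by blast
  then have "A \<in> planes_thr l" "B \<in> planes_thr l" unfolding planes_thr_def by auto
  then show ?thesis using that \<open>A \<noteq> B\<close> by metis
qed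

text \<open>Tested by \<open>side S A\<close> for a second plane \<open>A\<close> through
  \<open>l\<close>: it vanishes on \<open>l\<close> and is positive on \<open>r S\<close>.\<close>

lemma line_mem_iff:
  assumes "S \<in> \<P>" "l \<in> \<L>" "l \<subseteq> S" 
  shows "h *\<^sub>R q l + t *\<^sub>R r S \<in> l \<longleftrightarrow> t = 0"
proof
  assume m: "h *\<^sub>R q l + t *\<^sub>R r S \<in> l"
  have "S \<in> planes_thr l" using assms unfolding planes_thr_def by blast
  then obtain A where "A \<in> planes_thr l" "A \<noteq> S" using planes_thr_two[OF assms(2)] by blast
  then have A: "A \<in> \<P>" "A \<noteq> S" "l \<subseteq> A" unfolding planes_thr_def by auto
  have "(h *\<^sub>R q l + t *\<^sub>R r S) \<bullet> side S A = 0" using side_zero[OF A(1)] m A(3) by blast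
  moreover have "q l \<bullet> side S A = 0" using side_zero[OF A(1)] q_in[OF assms(2)] A(3) by blast
  ultimately show "t = 0" using side_pos[OF assms(1) A(1)] A(2) by (simp add: inner_add_left)
qed (use line_in[OF assms(2)] in simp)

text \<open>In \<open>B\<close> the plane \<open>S\<close> minus \<open>l\<close> consists of
  regular points, so the weight depends only on the side. The path first reaches offset
  \<open>d\<close> inside \<open>B\<close>, then runs out to offset \<open>\<epsilon>\<close> in the
  gap around \<open>l\<close>.\<close>

lemma wt_near_line:
  assumes z: "cocycle_on U z" and l: "l \<in> \<L>" and s: "s \<in> {1,-1}" and S: "S \<in> planes_thr l"
    and B: "convex B" "open B" "s *\<^sub>R q l \<in> B" "\<And>R. R \<in> \<P> \<Longrightarrow> R \<inter> B \<noteq> {} \<Longrightarrow> R \<in> planes_thr l"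
    and x: "x \<in> B" "x = h *\<^sub>R q l + t *\<^sub>R r S" "t \<noteq> 0"
  shows "wt z S x = wt z S (s *\<^sub>R q l + (sgn t * \<epsilon>) *\<^sub>R r S)"
proof -
  have SP: "S \<in> \<P>" "l \<subseteq> S" using S unfolding planes_thr_def by auto
  have reg: "regular S y" if y: "y \<in> B" "y = h' *\<^sub>R q l + t' *\<^sub>R r S" "t' \<noteq> 0" for y h' t'
  proof -
    have yS: "y \<in> S" using plane_line_in[OF SP(1) l SP(2)] y(2) by simp
    have yl: "y \<notin> l" using line_mem_iff[OF SP(1) l SP(2)] y(2,3) by simp
    have "R = S" if R: "R \<in> \<P>" "y \<in> R" for R
    proof (rule ccontr)
      assume "R \<noteq> S"
      moreover have "R \<in> planes_thr l" using B(4) R y(1) by blast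
      ultimately have "R \<inter> S = l" using planes_thr_meet[OF l _ S] by blast
      then show False using yl yS R by blast
    qed
    then show ?thesis unfolding regular_def using SP yS by blast
  qed
  have "open ((\<lambda>d. s *\<^sub>R q l + (sgn t * d) *\<^sub>R r S) -` B)" by (intro open_vimage B(2) continuous_intros)
  moreover have "0 \<in> (\<lambda>d. s *\<^sub>R q l + (sgn t * d) *\<^sub>R r S) -` B" using B(3) by simp
  ultimately obtain \<delta> where \<delta>: "\<delta> > 0" "ball 0 \<delta> \<subseteq> (\<lambda>d. s *\<^sub>R q l + (sgn t * d) *\<^sub>R r S) -` B"
    using openE by blast
  define d where "d = min (\<delta> / 2) \<epsilon>"
  have d: "0 < d" "d \<le> \<epsilon>" "d < \<delta>" unfolding d_def using \<delta>(1) eps(1) by auto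
  define y where "y = s *\<^sub>R q l + (sgn t * d) *\<^sub>R r S"
  have "d \<in> ball 0 \<delta>" using d by (simp add: dist_real_def)
  then have yB: "y \<in> B" unfolding y_def using \<delta>(2) by blast
  have "wt z S x = wt z S y"
  proof (rule wt_segment[OF z])
    fix u :: real assume u: "0 \<le> u" "u \<le> 1"
    have "(1 - u) *\<^sub>R x + u *\<^sub>R y \<in> B" using convexD_alt[OF B(1) x(1) yB u] .
    moreover have "(1 - u) *\<^sub>R x + u *\<^sub>R y = ((1 - u) * h + u * s) *\<^sub>R q l + ((1 - u) * t + u * (sgn t * d)) *\<^sub>R r S"
      unfolding x(2) y_def by (simp add: algebra_simps)
    moreover have "(1 - u) * t + u * (sgn t * d) \<noteq> 0"
    proof -
      have "(1 - u) * t + u * (sgn t * d) = sgn t * ((1 - u) * \<bar>t\<bar> + u * d)"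
        by (simp add: sgn_if abs_if algebra_simps)
      moreover have "(1 - u) * \<bar>t\<bar> + u * d > 0" using u d(1) x(3) by (cases "u = 1") (auto intro: add_pos_nonneg)
      ultimately show ?thesis using x(3) by (simp add: sgn_if)
    qed
    ultimately show "regular S ((1 - u) *\<^sub>R x + u *\<^sub>R y)" using reg by blast
  qed
  also have "\<dots> = wt z S (s *\<^sub>R q l + (sgn t * \<epsilon>) *\<^sub>R r S)"
  proof (rule wt_segment[OF z])
    fix u :: real assume u: "0 \<le> u" "u \<le> 1"
    define e where "e = (1 - u) * d + u * \<epsilon>"
    have "e \<in> {d..\<epsilon>}" unfolding e_def using convexD_alt[of "{d..\<epsilon>}" d \<epsilon> u] d u by simp
    then have "regular S (s *\<^sub>R q l + (sgn t * e) *\<^sub>R r S)"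
      using SP l d x(3) by (intro regular_jump s) (auto simp: lines_in_def abs_mult sgn_if)
    moreover have "(1 - u) *\<^sub>R y + u *\<^sub>R (s *\<^sub>R q l + (sgn t * \<epsilon>) *\<^sub>R r S) = s *\<^sub>R q l + (sgn t * e) *\<^sub>R r S"
      unfolding y_def e_def by (simp add: algebra_simps)
    ultimately show "regular S ((1 - u) *\<^sub>R y + u *\<^sub>R (s *\<^sub>R q l + (sgn t * \<epsilon>) *\<^sub>R r S))" by simp
  qed
  finally show ?thesis .
qed

text \<open>
  Subtract from \<open>z\<close>, near a point of \<open>l\<close>, multiples of winding classes and of the bent classes joining
  each plane to a fixed plane \<open>T\<close>, so that weights remain only on one half of \<open>T\<close>, where they equal the
  sum in question.  The result extends to the starlike complement of that half in a ball, so it is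
  exact and the remaining weight vanishes.
\<close>

lemma kirchhoff:
  assumes z: "cocycle_on U z" and l: "l \<in> \<L>" and s: "s \<in> {1,-1}"
  shows "(\<Sum>S\<in>planes_thr l. jump s z S l) = 0"
proof -
  define x0 where "x0 = s *\<^sub>R q l"
  have x0l: "x0 \<in> l" unfolding x0_def using line_in[OF l] .
  obtain T where T: "T \<in> planes_thr l" using l unfolding L_eq planes_thr_def by blast
  obtain Q where Q: "Q \<in> planes_thr l" "Q \<noteq> T" using planes_thr_two[OF l T] .
  have PP: "\<And>S. S \<in> planes_thr l \<Longrightarrow> S \<in> \<P>" "\<And>S. S \<in> planes_thr l \<Longrightarrow> l \<subseteq> S"
    "\<And>S. S \<in> planes_thr l \<Longrightarrow> l \<in> lines_in S" unfolding planes_thr_def lines_in_def using l by auto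
  have "open (- \<Union>(\<P> - planes_thr l))"
    using closed_Union_subspaces[of "\<P> - planes_thr l"] finite_P subspace_P by blast
  moreover have "x0 \<in> - \<Union>(\<P> - planes_thr l)"
  proof -
    have "R \<in> planes_thr l" if R: "R \<in> \<P>" "x0 \<in> R" for R
    proof -
      have "s *\<^sub>R x0 \<in> R" using R subspace_scale[OF subspace_P] by blast
      then have "q l \<in> R" unfolding x0_def using s by auto
      have "l \<subseteq> R"
      proof
        fix y assume "y \<in> l"
        then have "y = (y \<bullet> \<eta>) *\<^sub>R q l" using lineE[OF l] by blast
        then show "y \<in> R" using subspace_scale[OF subspace_P[OF R(1)] \<open>q l \<in> R\<close>] by metis
      qed
      then show ?thesis unfolding planes_thr_def using R by blast
    qed
    then show ?thesis by blast
  qed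
  ultimately obtain \<rho> where \<rho>: "\<rho> > 0" "ball x0 \<rho> \<subseteq> - \<Union>(\<P> - planes_thr l)" using openE by blast
  define B where "B = ball x0 \<rho>"
  have B: "convex B" "open B" "s *\<^sub>R q l \<in> B" "\<And>R. R \<in> \<P> \<Longrightarrow> R \<inter> B \<noteq> {} \<Longrightarrow> R \<in> planes_thr l"
    using \<rho> unfolding B_def x0_def by auto
  define wp wm where "wp = (\<lambda>S. wt z S (s *\<^sub>R q l + \<epsilon> *\<^sub>R r S))" and "wm = (\<lambda>S. wt z S (s *\<^sub>R q l - \<epsilon> *\<^sub>R r S))"
  define \<zeta>1 where "\<zeta>1 = (\<lambda>x y. \<Sum>S\<in>planes_thr l. wm S * wind S x y)"
  \<comment> \<open>After subtraction of \<open>\<zeta>1\<close> each plane has weight 0 on its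
    negative side and \<open>wp S - wm S\<close> on the positive one. Each bent class clears one
    plane and moves its weight onto \<open>T\<close>.\<close>
  define \<zeta>2 where "\<zeta>2 = (\<lambda>x y. \<Sum>S\<in>planes_thr l - {T}. (wp S - wm S) * bent S T x y)"
  define \<zeta> where "\<zeta> = (\<lambda>x y. (z x y - \<zeta>1 x y) - \<zeta>2 x y)"
  have bent: "S \<in> \<P>" "T \<in> \<P>" "S \<noteq> T" "S \<inter> T \<in> \<L>" if "S \<in> planes_thr l - {T}" for S
    using that T PP planes_thr_meet[OF l _ T] l by auto
  have bc: "cocycle_on U (bent S T)" if "S \<in> planes_thr l - {T}" for S using bent_cocycle_U bent[OF that] by blast
  have c1: "cocycle_on U \<zeta>1" unfolding \<zeta>1_def using PP(1) wind_cocycle by (intro cocycle_on_sum cocycle_on_scale) blast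
  have c2: "cocycle_on U \<zeta>2" unfolding \<zeta>2_def using bc by (intro cocycle_on_sum cocycle_on_scale) blast
  have c3: "cocycle_on U (\<lambda>x y. z x y - \<zeta>1 x y)" using cocycle_on_diff[OF z c1] .
  have c\<zeta>: "cocycle_on U \<zeta>" unfolding \<zeta>_def by (rule cocycle_on_diff[OF c3 c2])
  have wt\<zeta>: "wt \<zeta> S x = (if S = T \<and> t > 0 then (\<Sum>S\<in>planes_thr l. wp S - wm S) else 0)"
    if S: "S \<in> planes_thr l" and R: "regular S x" and x: "x \<in> B" "x = h *\<^sub>R q l + t *\<^sub>R r S" "t \<noteq> 0" for S x h t
  proof -
    have wz: "wt z S x = (if t > 0 then wp S else wm S)"
      using wt_near_line[OF z l s S B x] x(3) unfolding wp_def wm_def by (auto simp: sgn_if)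
    have w1: "wt \<zeta>1 S x = wm S"
    proof -
      have "wt \<zeta>1 S x = (\<Sum>A\<in>planes_thr l. wm A * of_bool (S = A))"
        unfolding \<zeta>1_def using wt_sum[OF finite_planes_thr, of l wind S x wm] wind_cocycle PP(1) R wt_wind by simp
      also have "\<dots> = wm S" using S finite_planes_thr by (simp add: of_bool_def if_distrib cong: if_cong)
      finally show ?thesis .
    qed
    have side: "0 < x \<bullet> side S A \<longleftrightarrow> t > 0" if A: "A \<in> planes_thr l" "A \<noteq> S" for A
    proof -
      have "q l \<bullet> side S A = 0" using side_zero[OF PP(1)[OF A(1)]] q_in[OF l] PP(2)[OF A(1)] by blast
      then have "x \<bullet> side S A = t * (r S \<bullet> side S A)" unfolding x(2) by (simp add: inner_add_left)
      then show ?thesis using side_pos[OF PP(1)[OF S] PP(1)[OF A(1)]] A(2) by (simp add: zero_less_mult_iff)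
    qed
    have "wt \<zeta>2 S x = (\<Sum>A\<in>planes_thr l - {T}. (wp A - wm A) * wt (bent A T) S x)"
      unfolding \<zeta>2_def using wt_sum[of "planes_thr l - {T}" "\<lambda>A. bent A T" S x "\<lambda>A. wp A - wm A"] finite_planes_thr bc R by simp
    also have "\<dots> = (\<Sum>A\<in>planes_thr l - {T}. (wp A - wm A) * (if S = A then of_bool (t > 0) else if S = T then - of_bool (t > 0) else 0))"
    proof (rule sum.cong[OF refl])
      fix A assume A: "A \<in> planes_thr l - {T}"
      show "(wp A - wm A) * wt (bent A T) S x = (wp A - wm A) * (if S = A then of_bool (t > 0) else if S = T then - of_bool (t > 0) else 0)"
        unfolding wt_bent[OF bent[OF A] R] using side[of T] side[of A] A T by auto
    qed
    finally have w2: "wt \<zeta>2 S x = (\<Sum>A\<in>planes_thr l - {T}. (wp A - wm A) * (if S = A then of_bool (t > 0) else if S = T then - of_bool (t > 0) else 0))" .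
    have w: "wt \<zeta> S x = wt z S x - wt \<zeta>1 S x - wt \<zeta>2 S x"
      unfolding \<zeta>_def using wt_diff[OF c3 c2 R] wt_diff[OF z c1 R] by simp
    show ?thesis
    proof (cases "S = T")
      case True
      have "wt \<zeta>2 S x = (\<Sum>A\<in>planes_thr l - {T}. (wp A - wm A) * (- of_bool (t > 0)))"
        unfolding w2 using True by (intro sum.cong) auto
      also have "\<dots> = - of_bool (t > 0) * (\<Sum>A\<in>planes_thr l - {T}. wp A - wm A)"
        by (simp add: sum_distrib_right mult.commute flip: sum_negf)
      finally have "wt \<zeta>2 S x = - of_bool (t > 0) * (\<Sum>A\<in>planes_thr l - {T}. wp A - wm A)" .
      moreover have "(\<Sum>S\<in>planes_thr l. wp S - wm S) = (wp T - wm T) + (\<Sum>A\<in>planes_thr l - {T}. wp A - wm A)"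
        using T finite_planes_thr by (simp add: sum.remove)
      ultimately show ?thesis using w wz w1 True by simp
    next
      case False
      have "wt \<zeta>2 S x = (\<Sum>A\<in>planes_thr l - {T}. if S = A then (wp A - wm A) * of_bool (t > 0) else 0)"
        unfolding w2 using False by (intro sum.cong) auto
      also have "\<dots> = (wp S - wm S) * of_bool (t > 0)" using S False finite_planes_thr by simp
      finally show ?thesis using w wz w1 False by simp
    qed
  qed
  \<comment> \<open>\<open>\<kappa>\<close> cuts \<open>T\<close> along \<open>l\<close>; the half
    \<open>0 \<le> y \<bullet> \<kappa>\<close> contains all remaining weight.\<close>
  define \<kappa> where "\<kappa> = side T Q"
  have \<kappa>: "\<And>x. x \<in> l \<Longrightarrow> x \<bullet> \<kappa> = 0" "0 < r T \<bullet> \<kappa>"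
    unfolding \<kappa>_def using side_zero[OF PP(1)[OF Q(1)]] PP(2)[OF Q(1)] side_pos[OF PP(1)[OF T] PP(1)[OF Q(1)]] Q(2) by auto
  define C where "C = B - {y \<in> T. 0 \<le> y \<bullet> \<kappa>}"
  have "closed {y \<in> T. 0 \<le> y \<bullet> \<kappa>}"
  proof -
    have "closed (T \<inter> {y. 0 \<le> y \<bullet> \<kappa>})"
      using closed_subspace[OF subspace_P[OF PP(1)[OF T]]] by (intro closed_Int closed_Collect_le continuous_intros)
    then show ?thesis by (simp add: Int_def)
  qed
  then have oC: "open C" unfolding C_def using B(2) by (simp add: open_Diff)
  have loc: "\<exists>N. open N \<and> x \<in> N \<and> exact_on (N - \<Union>\<P>) \<zeta>" if x: "x \<in> C" for x
  proof (cases "x \<in> \<Union>\<P>")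
    case False
    then show ?thesis using cocycle_locally_exact[OF c\<zeta>, of x "\<Union>\<P>"] by blast
  next
    case True
    then obtain S where S: "S \<in> \<P>" "x \<in> S" by blast
    then have Sl: "S \<in> planes_thr l" using B(4) x unfolding C_def by blast
    have xl: "x \<notin> l" using x \<kappa>(1) PP(2)[OF T] unfolding C_def by fastforce
    have R: "regular S x"
      unfolding regular_def
    proof (intro conjI ballI impI S)
      fix A assume A: "A \<in> \<P>" "x \<in> A"
      then have "A \<in> planes_thr l" using B(4) x unfolding C_def by blast
      then show "A = S" using planes_thr_meet[OF l _ Sl, of A] A S xl by blast
    qed
    obtain t where t: "x = (x \<bullet> \<eta>) *\<^sub>R q l + t *\<^sub>R r S" using plane_lineE[OF S(1) l PP(2)[OF Sl] S(2)] .
    have t0: "t \<noteq> 0" using t xl line_mem_iff[OF S(1) l PP(2)[OF Sl]] by metis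
    have "\<not> (S = T \<and> t > 0)"
    proof
      assume h: "S = T \<and> t > 0"
      have "x \<bullet> \<kappa> = ((x \<bullet> \<eta>) *\<^sub>R q l + t *\<^sub>R r S) \<bullet> \<kappa>" using t by simp
      then have "x \<bullet> \<kappa> = t * (r T \<bullet> \<kappa>)" using \<kappa>(1)[OF q_in[OF l]] h by (simp add: inner_add_left)
      then show False using x h S(2) \<kappa>(2) unfolding C_def by auto
    qed
    moreover have xB: "x \<in> B" using x unfolding C_def by blast
    ultimately have "wt \<zeta> S x = 0" using wt\<zeta>[OF Sl R xB t t0] by (simp only: if_False)
    then have "is_weight \<zeta> (a S) (b S) x 0" using is_weight_wt[OF c\<zeta> R] by metis
    then obtain N where N: "open N" "x \<in> N" "exact_on (N - perp2 (a S) (b S)) \<zeta>" unfolding is_weight_zero_iff by blast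
    have "exact_on (N - \<Union>\<P>) \<zeta>"
      by (rule exact_on_subset[OF N(3)]) (use coframe(1)[OF S(1)] S(1) in blast)
    then show ?thesis using N by blast
  qed
  have "dim S + 2 \<le> DIM(real^4)" if "S \<in> \<P>" for S using dim_P[OF that] by simp
  then obtain w where w: "cocycle_on C w" "exact_on (C - \<Union>\<P>) (\<lambda>x y. \<zeta> x y - w x y)"
    using cocycle_extension[OF finite_P subspace_P _ oC loc] by blast
  have "open ((\<lambda>d. x0 + d *\<^sub>R r T) -` B)" by (intro open_vimage B(2) continuous_intros)
  moreover have "0 \<in> (\<lambda>d. x0 + d *\<^sub>R r T) -` B" using B(3) unfolding x0_def by simp
  ultimately obtain \<delta> where \<delta>: "\<delta> > 0" "ball 0 \<delta> \<subseteq> (\<lambda>d. x0 + d *\<^sub>R r T) -` B"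
    using openE by blast
  define d where "d = min (\<delta> / 2) \<epsilon>"
  have d: "0 < d" "d \<le> \<epsilon>" "d \<in> ball 0 \<delta>" "- d \<in> ball 0 \<delta>" unfolding d_def using \<delta>(1) eps(1) by (auto simp: dist_real_def)
  \<comment> \<open>The base point lies on the opposite half of \<open>T\<close>, so a segment from
    it reaches the removed half only if its other end lies there.\<close>
  define c0 where "c0 = x0 + (- d) *\<^sub>R r T"
  have c0: "c0 \<in> B" "c0 \<in> T" "c0 \<bullet> \<kappa> < 0"
  proof -
    show "c0 \<in> B" unfolding c0_def using \<delta>(2) d(4) by blast
    show "c0 \<in> T" unfolding c0_def x0_def by (rule plane_line_in[OF PP(1)[OF T] l PP(2)[OF T]])
    show "c0 \<bullet> \<kappa> < 0" unfolding c0_def using \<kappa>(1)[OF x0l] \<kappa>(2) d(1) by (simp add: inner_diff_left)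
  qed
  have subT: "subspace T" using subspace_P PP(1)[OF T] by blast
  have star: "closed_segment c0 y \<subseteq> C" if y: "y \<in> C" for y
  proof
    fix v assume v: "v \<in> closed_segment c0 y"
    then obtain u where u: "0 \<le> u" "u \<le> 1" "v = (1 - u) *\<^sub>R c0 + u *\<^sub>R y" unfolding in_segment by blast
    have "v \<in> B" using v closed_segment_subset[OF c0(1) _ B(1), of y] y unfolding C_def by blast
    moreover have False if vT: "v \<in> T" "0 \<le> v \<bullet> \<kappa>"
    proof (cases "u = 0")
      case True
      then show False using u(3) vT(2) c0(3) by simp
    next
      case False
      have "y = (1 / u) *\<^sub>R (v - (1 - u) *\<^sub>R c0)" unfolding u(3) using False by simp
      then have "y \<in> T" using vT(1) c0(2) subspace_scale[OF subT] subspace_diff[OF subT] by metis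
      then have "y \<bullet> \<kappa> < 0" using y unfolding C_def by auto
      then have "u * (y \<bullet> \<kappa>) < 0" using u(1) False by (simp add: mult_less_0_iff)
      moreover have "(1 - u) * (c0 \<bullet> \<kappa>) \<le> 0" using u(2) c0(3) by (simp add: mult_le_0_iff)
      ultimately show False using vT(2) unfolding u(3) by (simp add: inner_add_left)
    qed
    ultimately show "v \<in> C" unfolding C_def by blast
  qed
  have "c0 \<in> C" unfolding C_def using c0 by auto
  from cocycle_on_starlike_exact[OF this star w(1)] have "exact_on (C - \<Union>\<P>) w"
    by (rule exact_on_subset) auto
  from exact_on_add[OF w(2) this] have "exact_on (C - \<Union>\<P>) \<zeta>" by simp
  moreover have "C - \<Union>\<P> = B - \<Union>\<P>" unfolding C_def using PP(1)[OF T] by blast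
  ultimately have "exact_on (B - \<Union>\<P>) \<zeta>" by simp
  moreover have y: "x0 + d *\<^sub>R r T \<in> B" using \<delta>(2) d(3) by blast
  moreover have R: "regular T (x0 + d *\<^sub>R r T)"
    unfolding x0_def using d by (intro regular_jump PP(1,3)[OF T] s) auto
  ultimately have "wt \<zeta> T (x0 + d *\<^sub>R r T) = 0" using wt_eq_0I[OF R B(2)] by blast
  then have "(\<Sum>S\<in>planes_thr l. wp S - wm S) = 0"
    using wt\<zeta>[OF T R y, of s d] d(1) unfolding x0_def by simp
  then show ?thesis unfolding jump_def wp_def wm_def .
qed

end

context framed_planes
begin

section \<open>Realising cycles of the incidence graph\<close>

definition ref_plane :: "(real^4) set \<Rightarrow> (real^4) set" where
  "ref_plane l = (SOME T. T \<in> planes_thr l)"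

definition incidences :: "((real^4) set \<times> (real^4) set) set" where
  "incidences = {(S,l). l \<in> \<L> \<and> S \<in> planes_thr l}"

text \<open>By the Kirchhoff law the jump at the reference plane is determined by the others, which
  leaves one parameter fewer than there are planes through \<open>l\<close>.\<close>

definition free_incidences :: "((real^4) set \<times> (real^4) set) set" where
  "free_incidences = {(S,l). l \<in> \<L> \<and> S \<in> planes_thr l \<and> S \<noteq> ref_plane l}"

lemma ref_plane: "l \<in> \<L> \<Longrightarrow> ref_plane l \<in> planes_thr l"
  unfolding ref_plane_def by (rule someI_ex) (auto simp: L_eq planes_thr_def)

lemma planes_thrD: "S \<in> planes_thr l \<Longrightarrow> S \<in> \<P>" "S \<in> planes_thr l \<Longrightarrow> l \<subseteq> S"
  unfolding planes_thr_def by auto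

lemma lines_in_iff: "S \<in> \<P> \<Longrightarrow> l \<in> lines_in S \<longleftrightarrow> l \<in> \<L> \<and> S \<in> planes_thr l"
  unfolding planes_thr_def lines_in_def by auto

lemma finite_incidences: "finite incidences" "finite free_incidences"
proof -
  have "incidences \<subseteq> \<P> \<times> \<L>" "free_incidences \<subseteq> \<P> \<times> \<L>"
    unfolding incidences_def free_incidences_def planes_thr_def by auto
  then show "finite incidences" "finite free_incidences"
    using finite_subset[OF _ finite_cartesian_product[OF finite_P finite_L]] by blast+
qed

lemma free_bent:
  assumes "(S,l) \<in> free_incidences"
  shows "S \<in> \<P>" "ref_plane l \<in> \<P>" "S \<noteq> ref_plane l" "S \<inter> ref_plane l = l" "S \<inter> ref_plane l \<in> \<L>"
proof -
  have h: "l \<in> \<L>" "S \<in> planes_thr l" "S \<noteq> ref_plane l" using assms unfolding free_incidences_def by auto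
  then show "S \<in> \<P>" "ref_plane l \<in> \<P>" "S \<noteq> ref_plane l" using ref_plane planes_thrD(1) by blast+
  show "S \<inter> ref_plane l = l" using planes_thr_meet[OF h(1,2) ref_plane[OF h(1)] h(3)] .
  then show "S \<inter> ref_plane l \<in> \<L>" using h(1) by simp
qed

section \<open>Bent classes with prescribed jumps\<close>

definition line_class :: "(real^4) set \<times> (real^4) set \<Rightarrow> real^4 \<Rightarrow> real^4 \<Rightarrow> rat" where
  "line_class i = bent (fst i) (ref_plane (snd i))"

lemma line_class_cocycle: "i \<in> free_incidences \<Longrightarrow> cocycle_on U (line_class i)"
  unfolding line_class_def using bent_cocycle_U free_bent by (metis prod.collapse)

lemma base_wt_line_class: "i \<in> free_incidences \<Longrightarrow> S \<in> \<P> \<Longrightarrow> base_wt (line_class i) S = 0"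
  unfolding line_class_def using base_wt_bent free_bent by (metis prod.collapse)

lemma jump_line_class:
  assumes "(A,m) \<in> free_incidences" "S \<in> \<P>" "l \<in> lines_in S" "s \<in> {1,-1}"
  shows "jump s (line_class (A,m)) S l = (if l = m then of_bool (S = A) - of_bool (S = ref_plane m) else 0)"
  unfolding line_class_def using jump_bent[OF free_bent(1-3,5)[OF assms(1)] assms(2-4)] free_bent(4)[OF assms(1)] by simp

lemma base_wt_sum:
  assumes "finite I" "\<And>i. i \<in> I \<Longrightarrow> cocycle_on U (z i)" "S \<in> \<P>"
  shows "base_wt (\<lambda>u v. \<Sum>i\<in>I. c i * z i u v) S = (\<Sum>i\<in>I. c i * base_wt (z i) S)"
proof -
  have R: "regular S (- r S)" using regular_r[OF assms(3)] regular_minus_iff by blast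
  show ?thesis unfolding base_wt_def by (rule wt_sum[OF assms(1,2) R])
qed

lemma jump_sum:
  assumes "finite I" "\<And>i. i \<in> I \<Longrightarrow> cocycle_on U (z i)" "S \<in> \<P>" "l \<in> lines_in S" "s \<in> {1,-1}"
  shows "jump s (\<lambda>u v. \<Sum>i\<in>I. c i * z i u v) S l = (\<Sum>i\<in>I. c i * jump s (z i) S l)"
  unfolding jump_def
  by (simp only: wt_sum[OF assms(1,2)] regular_jump_eps[OF assms(3-5)] right_diff_distrib sum_subtractf)

lemma base_wt_diff:
  assumes "cocycle_on U z" "cocycle_on U w" "S \<in> \<P>"
  shows "base_wt (\<lambda>u v. z u v - w u v) S = base_wt z S - base_wt w S"
proof -
  have R: "regular S (- r S)" using regular_r[OF assms(3)] regular_minus_iff by blast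
  show ?thesis unfolding base_wt_def by (rule wt_diff[OF assms(1,2) R])
qed

lemma jump_diff:
  assumes "cocycle_on U z" "cocycle_on U w" "S \<in> \<P>" "l \<in> lines_in S" "s \<in> {1,-1}"
  shows "jump s (\<lambda>u v. z u v - w u v) S l = jump s z S l - jump s w S l"
  unfolding jump_def using wt_diff[OF assms(1,2)] regular_jump_eps[OF assms(3-5)] by simp

lemma base_wt_jump_exact:
  assumes "exact_on U z" "S \<in> \<P>"
  shows "base_wt z S = 0" "l \<in> lines_in S \<Longrightarrow> s \<in> {1,-1} \<Longrightarrow> jump s z S l = 0"
proof -
  have "wt z S x = 0" if "regular S x" for x
    using wt_eq_0I[OF that, of UNIV] assms(1) by (simp add: Compl_eq_Diff_UNIV)
  then show "base_wt z S = 0" "l \<in> lines_in S \<Longrightarrow> s \<in> {1,-1} \<Longrightarrow> jump s z S l = 0"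
    unfolding base_wt_def jump_def using regular_r[OF assms(2)] regular_minus_iff regular_jump_eps[OF assms(2)] by auto
qed

text \<open>Realises data \<open>u\<close> that satisfy the Kirchhoff law, with equal jumps at both
  halves of each line.\<close>

definition line_sum :: "((real^4) set \<Rightarrow> (real^4) set \<Rightarrow> rat) \<Rightarrow> real^4 \<Rightarrow> real^4 \<Rightarrow> rat" where
  "line_sum u x y = (\<Sum>i\<in>free_incidences. u (fst i) (snd i) * line_class i x y)"

lemma line_sum_cocycle: "cocycle_on U (line_sum u)"
  unfolding line_sum_def by (intro cocycle_on_sum cocycle_on_scale line_class_cocycle)

lemma base_wt_line_sum: "S \<in> \<P> \<Longrightarrow> base_wt (line_sum u) S = 0"
  unfolding line_sum_def
  by (subst base_wt_sum) (auto simp: finite_incidences line_class_cocycle base_wt_line_class)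

text \<open>Only the classes of the line \<open>l\<close> contribute, each with 1 at its own plane
  and -1 at the reference plane.\<close>

lemma sum_free_incidences:
  assumes S: "S \<in> \<P>" and l: "l \<in> lines_in S"
  shows "(\<Sum>i\<in>free_incidences. f i * (if l = snd i then of_bool (S = fst i) - of_bool (S = ref_plane (snd i)) else 0))
      = (if S = ref_plane l then - (\<Sum>A\<in>planes_thr l - {ref_plane l}. f (A,l)) else (f (S,l) :: rat))"
proof -
  have l': "l \<in> \<L>" "S \<in> planes_thr l" using l lines_in_iff[OF S] by auto
  have "(\<Sum>i\<in>free_incidences. f i * (if l = snd i then of_bool (S = fst i) - of_bool (S = ref_plane (snd i)) else 0))
     = (\<Sum>i\<in>(\<lambda>A. (A,l)) ` (planes_thr l - {ref_plane l}). f i * (if l = snd i then of_bool (S = fst i) - of_bool (S = ref_plane (snd i)) else 0))"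
  proof (rule sum.mono_neutral_right[OF finite_incidences(2)])
    show "(\<lambda>A. (A,l)) ` (planes_thr l - {ref_plane l}) \<subseteq> free_incidences"
      using l' unfolding free_incidences_def by auto
    show "\<forall>i\<in>free_incidences - (\<lambda>A. (A,l)) ` (planes_thr l - {ref_plane l}).
       f i * (if l = snd i then of_bool (S = fst i) - of_bool (S = ref_plane (snd i)) else 0) = 0"
    proof
      fix i assume i: "i \<in> free_incidences - (\<lambda>A. (A,l)) ` (planes_thr l - {ref_plane l})"
      have "l \<noteq> snd i"
      proof
        assume "l = snd i"
        then have "i = (fst i, l)" by simp
        moreover have "fst i \<in> planes_thr l - {ref_plane l}" using i \<open>l = snd i\<close> unfolding free_incidences_def by auto
        ultimately show False using i by blast
      qed
      then show "f i * (if l = snd i then of_bool (S = fst i) - of_bool (S = ref_plane (snd i)) else 0) = 0" by simp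
    qed
  qed
  also have "\<dots> = (\<Sum>A\<in>planes_thr l - {ref_plane l}. f (A,l) * (of_bool (S = A) - of_bool (S = ref_plane l)))"
    by (subst sum.reindex) (auto simp: inj_on_def)
  also have "\<dots> = (if S = ref_plane l then - (\<Sum>A\<in>planes_thr l - {ref_plane l}. f (A,l)) else f (S,l))"
  proof (cases "S = ref_plane l")
    case True
    have "(\<Sum>A\<in>planes_thr l - {ref_plane l}. f (A,l) * (of_bool (S = A) - of_bool (S = ref_plane l)))
       = (\<Sum>A\<in>planes_thr l - {ref_plane l}. - f (A,l))" using True by (intro sum.cong) auto
    then show ?thesis using True by (simp add: sum_negf)
  next
    case False
    have "(\<Sum>A\<in>planes_thr l - {ref_plane l}. f (A,l) * (of_bool (S = A) - of_bool (S = ref_plane l)))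
       = (\<Sum>A\<in>planes_thr l - {ref_plane l}. if S = A then f (A,l) else 0)" using False by (intro sum.cong) auto
    then show ?thesis using False l' finite_planes_thr by simp
  qed
  finally show ?thesis .
qed

lemma jump_line_sum':
  assumes S: "S \<in> \<P>" and l: "l \<in> lines_in S" and s: "s \<in> {1,-1}"
  shows "jump s (\<lambda>x y. \<Sum>i\<in>free_incidences. f i * line_class i x y) S l
      = (if S = ref_plane l then - (\<Sum>A\<in>planes_thr l - {ref_plane l}. f (A,l)) else f (S,l))"
proof -
  have "jump s (\<lambda>x y. \<Sum>i\<in>free_incidences. f i * line_class i x y) S l = (\<Sum>i\<in>free_incidences. f i * jump s (line_class i) S l)"
    by (rule jump_sum[OF finite_incidences(2) line_class_cocycle S l s])
  also have "\<dots> = (\<Sum>i\<in>free_incidences. f i * (if l = snd i then of_bool (S = fst i) - of_bool (S = ref_plane (snd i)) else 0))"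
  proof (rule sum.cong[OF refl])
    fix i assume i: "i \<in> free_incidences"
    obtain A m where "i = (A,m)" by (cases i)
    then show "f i * jump s (line_class i) S l = f i * (if l = snd i then of_bool (S = fst i) - of_bool (S = ref_plane (snd i)) else 0)"
      using jump_line_class[OF _ S l s, of A m] i by simp
  qed
  finally show ?thesis unfolding sum_free_incidences[OF S l] .
qed

lemma jump_line_sum:
  assumes S: "S \<in> \<P>" and l: "l \<in> lines_in S" and s: "s \<in> {1,-1}"
    and u: "(\<Sum>A\<in>planes_thr l. u A l) = 0"
  shows "jump s (line_sum u) S l = u S l"
proof -
  have "l \<in> \<L>" using l unfolding lines_in_def by blast
  then have "(\<Sum>A\<in>planes_thr l. u A l) = u (ref_plane l) l + (\<Sum>A\<in>planes_thr l - {ref_plane l}. u A l)"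
    using sum.remove[OF finite_planes_thr ref_plane] by blast
  then have "u (ref_plane l) l = - (\<Sum>A\<in>planes_thr l - {ref_plane l}. u A l)" using u by linarith
  then have "(if S = ref_plane l then - (\<Sum>A\<in>planes_thr l - {ref_plane l}. u A l) else u S l) = u S l"
    by (simp only: if_distrib) simp
  then show ?thesis
    using jump_line_sum'[OF S l s, of "\<lambda>i. u (fst i) (snd i)"] unfolding line_sum_def fst_conv snd_conv by (simp only:)
qed

lemma eta_nonzero: "S \<in> \<P> \<Longrightarrow> \<eta> \<noteq> 0"
  using frame(1) by force

text \<open>
  In the hyperplane \<open>\<eta> = 0\<close> the planes become the lines spanned by the \<open>r S\<close>, and only the weights at
  their two ends \<open>r S\<close> and \<open>- r S\<close> are felt.
\<close>

lemma exact_on_hyperplane: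
  assumes y: "cocycle_on U y" and ne: "\<L> \<noteq> {}"
    and wt0: "\<And>S. S \<in> \<P> \<Longrightarrow> wt y S (r S) = 0 \<and> wt y S (- r S) = 0"
    and i: "linear (i :: real^3 \<Rightarrow> real^4)" "inj i" "range i = {x. x \<bullet> \<eta> = 0}"
  shows "exact_on (i -` U) (\<lambda>a b. y (i a) (i b))"
proof -
  define \<Q> where "\<Q> = (\<lambda>S. i -` S) ` \<P>"
  have ci: "continuous_on A i" for A using linear_continuous_on linear_conv_bounded_linear i(1) by blast
  have eq: "i -` U = - \<Union>\<Q>" unfolding \<Q>_def by blast
  have i0: "i x = 0 \<longleftrightarrow> x = 0" for x using i(1,2) linear_injective_0 linear_0 by metis
  have ieta: "i x \<bullet> \<eta> = 0" for x using i(3) by blast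
  have sub: "subspace Q" if "Q \<in> \<Q>" for Q using that subspace_P linear_subspace_vimage[OF i(1)] unfolding \<Q>_def by blast
  have on: "\<exists>t. i x = t *\<^sub>R r S" if "S \<in> \<P>" "i x \<in> S" for S x
    using planeE[OF that] ieta[of x] by (metis add_0 scaleR_zero_left)
  have "exact_on (- \<Union>\<Q>) (\<lambda>a b. y (i a) (i b))"
  proof (rule cocycle_codim2_exact)
    show "finite \<Q>" unfolding \<Q>_def using finite_P by simp
    show "dim Q + 2 \<le> DIM(real^3)" if Q: "Q \<in> \<Q>" for Q
    proof -
      obtain S where S: "S \<in> \<P>" "Q = i -` S" using Q unfolding \<Q>_def by blast
      obtain v where v: "i v = r S" using i(3) frame(2)[OF S(1)] by (metis (mono_tags) mem_Collect_eq rangeE)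
      have "Q \<subseteq> span {v}"
      proof
        fix x assume "x \<in> Q"
        then obtain t where "i x = t *\<^sub>R r S" using on S by blast
        then have "i x = i (t *\<^sub>R v)" using v linear_scale[OF i(1)] by simp
        then have "x = t *\<^sub>R v" using i(2) by (simp add: inj_eq)
        then show "x \<in> span {v}" by (simp add: span_scale span_base)
      qed
      then have "dim Q \<le> card {v}" by (rule dim_le_card) simp
      then show ?thesis by simp
    qed
    show "dim (Q \<inter> R) + 3 \<le> DIM(real^3)" if QR: "Q \<in> \<Q>" "R \<in> \<Q>" "Q \<noteq> R" for Q R
    proof -
      obtain S T where S: "S \<in> \<P>" "T \<in> \<P>" "Q = i -` S" "R = i -` T" using QR unfolding \<Q>_def by blast
      have "x = 0" if x: "x \<in> Q \<inter> R" for x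
      proof (rule ccontr)
        assume "x \<noteq> 0"
        then have "S \<inter> T \<in> \<L>" using planes_meet_line[OF S(1,2), of "i x"] x S QR(3) i0 by blast
        then show False using lineE[of "S \<inter> T" "i x"] x S ieta[of x] i0 \<open>x \<noteq> 0\<close> by auto
      qed
      then have "Q \<inter> R \<subseteq> {0}" by blast
      then have "dim (Q \<inter> R) = 0" by (simp add: dim_eq_0)
      then show ?thesis by simp
    qed
    show "cocycle_on (- \<Union>\<Q>) (\<lambda>a b. y (i a) (i b))"
      by (rule cocycle_on_pullback[OF y ci]) (use eq in blast)
    fix Q x assume Q: "Q \<in> \<Q>" "x \<in> Q" and un: "\<And>R. R \<in> \<Q> \<Longrightarrow> x \<in> R \<Longrightarrow> R = Q"
    obtain S where S: "S \<in> \<P>" "Q = i -` S" using Q(1) unfolding \<Q>_def by blast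
    obtain t where t: "i x = t *\<^sub>R r S" using on S Q(2) by blast
    \<comment> \<open>The origin lies on the trace of every plane. If \<open>Q\<close> were the only
      trace through it, the two planes of some line in \<open>\<L>\<close> would have the same
      trace, against the regularity of \<open>r A\<close>.\<close>
    have x0: "x \<noteq> 0"
    proof
      assume x0: "x = 0"
      obtain A B where AB: "A \<in> \<P>" "B \<in> \<P>" "A \<noteq> B" using ne unfolding L_eq by blast
      have "i 0 \<in> R" if "R \<in> \<P>" for R using that subspace_0[OF subspace_P] i0[of 0] by simp
      then have e: "i -` A = i -` B" using un[of "i -` A"] un[of "i -` B"] AB x0 unfolding \<Q>_def by blast
      obtain v where v: "i v = r A" using i(3) frame(2)[OF AB(1)] by (metis (mono_tags) mem_Collect_eq rangeE)
      have rA: "regular A (r A)" using regular_r[OF AB(1)] .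
      then have "v \<in> i -` A" using v unfolding regular_def by simp
      then have "r A \<in> B" using e v by auto
      then show False using rA AB unfolding regular_def by blast
    qed
    then have t0: "t \<noteq> 0" using t i0[of x] by auto
    have R: "regular S (i x)" unfolding t using regular_scale[OF regular_r[OF S(1)] t0] .
    have "wt y S (i x) = 0"
    proof (cases "t > 0")
      case True
      then show ?thesis unfolding t using wt_scale[OF y regular_r[OF S(1)]] wt0[OF S(1)] by simp
    next
      case False
      then have "wt y S ((- t) *\<^sub>R (- r S)) = wt y S (- r S)"
        using t0 regular_r[OF S(1)] regular_minus_iff by (intro wt_scale[OF y]) auto
      then show ?thesis unfolding t using wt0[OF S(1)] by simp
    qed
    then have "is_weight y (a S) (b S) (i x) 0" using is_weight_wt[OF y R] by metis
    then obtain N where N: "open N" "i x \<in> N" "exact_on (N - perp2 (a S) (b S)) y" unfolding is_weight_zero_iff by blast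
    then obtain F where F: "primitive_on (N - perp2 (a S) (b S)) y F" unfolding exact_on_def by blast
    have "i ` (i -` N - \<Union>\<Q>) \<subseteq> N - perp2 (a S) (b S)"
      using coframe(1)[OF S(1)] S unfolding \<Q>_def by blast
    from primitive_on_pullback[OF F ci this]
    have "exact_on (i -` N - \<Union>\<Q>) (\<lambda>a b. y (i a) (i b))" by (rule exact_onI)
    moreover have "open (i -` N)" using N(1) ci[of UNIV] by (simp add: open_vimage)
    ultimately show "\<exists>N. open N \<and> x \<in> N \<and> exact_on (N - \<Union>\<Q>) (\<lambda>a b. y (i a) (i b))"
      using N(2) by blast
  qed (rule sub)
  then show ?thesis unfolding eq .
qed

lemma open_U: "open U"
  using closed_Union_subspaces[OF finite_P subspace_P] by (simp add: open_Compl)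

text \<open>A primitive on the hyperplane, a copy of \<open>real^3\<close>, is carried to
  neighbourhoods in \<open>real^4\<close> by the orthogonal projection \<open>P\<close>: add the
  increment of \<open>y\<close> from the foot point \<open>P x\<close> to \<open>x\<close>.\<close>

lemma hyperplane_primitive:
  assumes y: "cocycle_on U y" and ne: "\<L> \<noteq> {}"
    and wt0: "\<And>S. S \<in> \<P> \<Longrightarrow> wt y S (r S) = 0 \<and> wt y S (- r S) = 0"
  obtains \<Phi> where "\<And>x. x \<in> U \<Longrightarrow> x \<bullet> \<eta> = 0 \<Longrightarrow>
      \<exists>N. open N \<and> x \<in> N \<and> N \<subseteq> U \<and> (\<forall>a\<in>N. \<forall>b\<in>N. y a b = \<Phi> b - \<Phi> a)"
proof -
  define H where "H = {x. x \<bullet> \<eta> = 0}"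
  obtain S where "S \<in> \<P>" using ne unfolding L_eq by blast
  then have eta0: "\<eta> \<noteq> 0" by (rule eta_nonzero)
  have "subspace H" unfolding H_def by (auto simp: subspace_def inner_add_left)
  moreover have "dim H = dim (UNIV :: (real^3) set)"
    using dim_hyperplane[OF eta0] unfolding H_def by (simp add: inner_commute)
  ultimately obtain i g where ig: "linear (i :: real^3 \<Rightarrow> real^4)" "linear (g :: real^4 \<Rightarrow> real^3)" "i ` UNIV = H"
    "\<And>x. g (i x) = x" "\<And>x. x \<in> H \<Longrightarrow> i (g x) = x"
    using isometries_subspaces[of "UNIV :: (real^3) set" H] by (metis UNIV_I subspace_UNIV)
  have "inj i" using ig(4) by (metis injI)
  then have "exact_on (i -` U) (\<lambda>a b. y (i a) (i b))"
    using exact_on_hyperplane[OF y ne wt0 ig(1)] ig(3) unfolding H_def by blast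
  then obtain \<phi> where \<phi>: "primitive_on (i -` U) (\<lambda>a b. y (i a) (i b)) \<phi>" unfolding exact_on_def by blast
  define P where "P = (\<lambda>x. x - ((x \<bullet> \<eta>) / (\<eta> \<bullet> \<eta>)) *\<^sub>R \<eta>)"
  have PH: "P x \<in> H" for x unfolding P_def H_def using eta0 by (simp add: inner_diff_left)
  have Pid: "P x = x" if "x \<bullet> \<eta> = 0" for x using that unfolding P_def by simp
  have cP: "continuous_on UNIV P" unfolding P_def by (intro continuous_intros) (use eta0 in auto)
  have cg: "continuous_on UNIV (\<lambda>x. g (P x))"
    using linear_continuous_on[of g UNIV] ig(2) linear_conv_bounded_linear
    by (intro continuous_on_compose2[OF _ cP]) auto
  have iP: "i (g (P x)) = P x" for x using ig(5) PH by blast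
  define \<Phi> where "\<Phi> = (\<lambda>x. \<phi> (g (P x)) + y (P x) x)"
  have "\<exists>N. open N \<and> x \<in> N \<and> N \<subseteq> U \<and> (\<forall>a\<in>N. \<forall>b\<in>N. y a b = \<Phi> b - \<Phi> a)" if x: "x \<in> U" "x \<bullet> \<eta> = 0" for x
  proof -
    obtain N K where N: "open N" "x \<in> N" "\<And>a b. a \<in> N \<Longrightarrow> a \<in> U \<Longrightarrow> b \<in> N \<Longrightarrow> b \<in> U \<Longrightarrow> y a b = K b - K a"
      using cocycle_onE[OF y x(1)] by blast
    have "i (g (P x)) = x" using trans[OF iP Pid[OF x(2)]] .
    then have "i (g (P x)) \<in> U" using x(1) by (simp only:)
    then have "g (P x) \<in> i -` U" by (rule vimageI2)
    then obtain M where M: "open M" "g (P x) \<in> M"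
      "\<And>a b. a \<in> M \<Longrightarrow> a \<in> i -` U \<Longrightarrow> b \<in> M \<Longrightarrow> b \<in> i -` U \<Longrightarrow> y (i a) (i b) = \<phi> b - \<phi> a"
      using primitive_onE[OF \<phi>] by blast
    \<comment> \<open>The foot points have to lie in \<open>U\<close> as well, hence the preimages
      under \<open>P\<close>.\<close>
    define N' where "N' = N \<inter> U \<inter> P -` (N \<inter> U) \<inter> (\<lambda>x. g (P x)) -` M"
    have "open N'" unfolding N'_def using N(1) M(1) open_U cP cg by (intro open_Int open_vimage)
    moreover have "x \<in> N'" unfolding N'_def using N(2) M(2) x Pid by simp
    moreover have "y a b = \<Phi> b - \<Phi> a" if ab: "a \<in> N'" "b \<in> N'" for a b
    proof -
      have h: "a \<in> N" "a \<in> U" "P a \<in> N" "P a \<in> U" "g (P a) \<in> M" "b \<in> N" "b \<in> U" "P b \<in> N" "P b \<in> U" "g (P b) \<in> M"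
        using ab unfolding N'_def by auto
      have "y (i (g (P a))) (i (g (P b))) = \<phi> (g (P b)) - \<phi> (g (P a))"
        by (rule M(3)) (use h iP in auto)
      then have "y (P a) (P b) = \<phi> (g (P b)) - \<phi> (g (P a))" unfolding iP .
      moreover have "y (P a) (P b) = K (P b) - K (P a)" "y a b = K b - K a" "y (P a) a = K a - K (P a)" "y (P b) b = K b - K (P b)"
        by (rule N(3); (rule h))+
      ultimately show ?thesis unfolding \<Phi>_def by simp
    qed
    ultimately show ?thesis unfolding N'_def by (intro exI[of _ N']) (auto simp: N'_def)
  qed
  then show ?thesis using that by blast
qed

text \<open>\<open>line_sum u\<close> has the required jumps, but at both halves of each line. The
  zero sum in each plane makes its weight at \<open>r S\<close> vanish, so a primitive
  \<open>\<Phi>\<close> exists near level 0 and the lower part can be switched off.\<close>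

lemma cycle_class_exists:
  assumes u1: "\<And>l. l \<in> \<L> \<Longrightarrow> (\<Sum>S\<in>planes_thr l. u S l) = 0"
    and u2: "\<And>S. S \<in> \<P> \<Longrightarrow> (\<Sum>l\<in>lines_in S. u S l) = 0"
  obtains C where "cocycle_on U C" "\<And>S. S \<in> \<P> \<Longrightarrow> base_wt C S = 0"
    "\<And>S l. S \<in> \<P> \<Longrightarrow> l \<in> lines_in S \<Longrightarrow> jump 1 C S l = u S l"
    "\<And>S l. S \<in> \<P> \<Longrightarrow> l \<in> lines_in S \<Longrightarrow> jump (-1) C S l = 0"
proof (cases "\<L> = {}")
  case True
  then have "lines_in S = {}" for S unfolding lines_in_def by blast
  moreover have "base_wt (\<lambda>x y. 0) S = 0" if "S \<in> \<P>" for S using base_wt_jump_exact(1)[OF exact_on_zero that] .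
  ultimately show ?thesis using that[OF cocycle_on_zero] by blast
next
  case False
  define y where "y = line_sum u"
  have y: "cocycle_on U y" unfolding y_def by (rule line_sum_cocycle)
  have jy: "jump s y S l = u S l" if "S \<in> \<P>" "l \<in> lines_in S" "s \<in> {1,-1}" for s S l
  proof -
    have "l \<in> \<L>" using that(2) unfolding lines_in_def by blast
    from jump_line_sum[OF that, of u, OF u1[OF this]] show ?thesis unfolding y_def .
  qed
  have by0: "base_wt y S = 0" if "S \<in> \<P>" for S unfolding y_def using base_wt_line_sum[OF that] .
  have "wt y S (r S) = 0 \<and> wt y S (- r S) = 0" if S: "S \<in> \<P>" for S
  proof -
    have "wt y S (r S) = base_wt y S + (\<Sum>l\<in>lines_in S. jump 1 y S l)" by (rule wt_r[OF y S]) simp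
    also have "(\<Sum>l\<in>lines_in S. jump 1 y S l) = (\<Sum>l\<in>lines_in S. u S l)" using jy[OF S] by (intro sum.cong) auto
    finally show ?thesis using by0[OF S] u2[OF S] unfolding base_wt_def by simp
  qed
  then obtain \<Phi> where \<Phi>: "\<And>x. x \<in> U \<Longrightarrow> x \<bullet> \<eta> = 0 \<Longrightarrow>
      \<exists>N. open N \<and> x \<in> N \<and> N \<subseteq> U \<and> (\<forall>a\<in>N. \<forall>b\<in>N. y a b = \<Phi> b - \<Phi> a)"
    using hyperplane_primitive[OF y False] by blast
  \<comment> \<open>The upper branch vanishes near level 0, since there \<open>y\<close> is the
    increment of \<open>\<Phi>\<close>; so it fits with 0 below.\<close>
  define C where "C = (\<lambda>a b. if 0 < a \<bullet> \<eta> \<and> 0 < b \<bullet> \<eta> then y a b - (\<Phi> b - \<Phi> a) else 0)"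
  have pos: "open {x. 0 < x \<bullet> \<eta>}" and neg: "open {x. x \<bullet> \<eta> < 0}" by (rule open_inner_pos, rule open_inner_neg)
  have C: "cocycle_on U C"
  proof (rule cocycle_onI)
    fix x assume x: "x \<in> U"
    consider "0 < x \<bullet> \<eta>" | "x \<bullet> \<eta> < 0" | "x \<bullet> \<eta> = 0" by linarith
    then show "\<exists>N F. open N \<and> x \<in> N \<and> (\<forall>a\<in>N \<inter> U. \<forall>b\<in>N \<inter> U. C a b = F b - F a)"
    proof cases
      case 1
      obtain N K where "open N" "x \<in> N" "\<And>a b. a \<in> N \<Longrightarrow> a \<in> U \<Longrightarrow> b \<in> N \<Longrightarrow> b \<in> U \<Longrightarrow> y a b = K b - K a"
        using cocycle_onE[OF y x] by blast
      then show ?thesis using pos 1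
        by (intro exI[of _ "N \<inter> {x. 0 < x \<bullet> \<eta>}"] exI[of _ "\<lambda>a. K a - \<Phi> a"]) (simp add: C_def open_Int)
    next
      case 2
      then show ?thesis using neg
        by (intro exI[of _ "{x. x \<bullet> \<eta> < 0}"] exI[of _ "\<lambda>a. 0"]) (simp add: C_def)
    next
      case 3
      then obtain N where "open N" "x \<in> N" "\<forall>a\<in>N. \<forall>b\<in>N. y a b = \<Phi> b - \<Phi> a" using \<Phi>[OF x] by blast
      then show ?thesis by (intro exI[of _ N] exI[of _ "\<lambda>a. 0"]) (simp add: C_def)
    qed
  qed
  have wpos: "wt C S x = wt y S x" if R: "regular S x" "0 < x \<bullet> \<eta>" for S x
  proof -
    have "primitive_on ({x. 0 < x \<bullet> \<eta>} - \<Union>\<P>) (\<lambda>a b. C a b - y a b) (\<lambda>x. - \<Phi> x)"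
      by (intro primitive_onI exI[of _ UNIV]) (simp add: C_def)
    then have "wt (\<lambda>a b. C a b - y a b) S x = 0"
      using wt_eq_0I[OF R(1) pos] R(2) exact_onI by blast
    then show ?thesis using wt_diff[OF C y R(1)] by simp
  qed
  have wneg: "wt C S x = 0" if R: "regular S x" "x \<bullet> \<eta> < 0" for S x
  proof -
    have "exact_on ({x. x \<bullet> \<eta> < 0} - \<Union>\<P>) C" by (rule exact_on_zeroI) (simp add: C_def)
    then show ?thesis using wt_eq_0I[OF R(1) neg] R(2) by blast
  qed
  show ?thesis
  proof (rule that[OF C])
    fix S assume S: "S \<in> \<P>"
    \<comment> \<open>The base direction lies on level 0, where \<open>C\<close> is glued. Its
      weight is read off on level -1, to the left of all lines, where \<open>C\<close> is 0.\<close>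
    define t where "t = Min (insert 0 ((\<lambda>l. (-1) * \<tau> S l) ` lines_in S)) - 1"
    have t: "t < (-1) * \<tau> S l" if "l \<in> lines_in S" for l
    proof -
      have "Min (insert 0 ((\<lambda>l. (-1) * \<tau> S l) ` lines_in S)) \<le> (-1) * \<tau> S l"
        using finite_lines_in that by (intro Min_le) auto
      then show ?thesis unfolding t_def by simp
    qed
    have s: "(-1::real) \<in> {1,-1}" by simp
    have "base_wt C S = wt C S ((-1) *\<^sub>R p S + t *\<^sub>R r S)"
      unfolding base_wt_def using wt_ends(2)[OF C S s t] by simp
    also have "\<dots> = 0"
    proof (rule wneg)
      show "regular S ((-1) *\<^sub>R p S + t *\<^sub>R r S)" unfolding regular_side_iff[OF S s] using t by fastforce
      show "((-1) *\<^sub>R p S + t *\<^sub>R r S) \<bullet> \<eta> < 0" using frame(1,2)[OF S] by (simp add: inner_diff_left inner_add_left)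
    qed
    finally show "base_wt C S = 0" .
  next
    fix S l assume S: "S \<in> \<P>" and l: "l \<in> lines_in S"
    have ql: "q l \<bullet> \<eta> = 1" using line(1) l unfolding lines_in_def by blast
    have e: "(s *\<^sub>R q l + \<epsilon> *\<^sub>R r S) \<bullet> \<eta> = s" "(s *\<^sub>R q l - \<epsilon> *\<^sub>R r S) \<bullet> \<eta> = s" for s
      using ql frame(2)[OF S] by (simp_all add: inner_add_left inner_diff_left)
    have 1: "(1::real) \<in> {1,-1}" and m1: "(-1::real) \<in> {1,-1}" by auto
    have "jump 1 C S l = jump 1 y S l"
      unfolding jump_def using wpos[OF regular_jump_eps(1)[OF S l 1]] wpos[OF regular_jump_eps(2)[OF S l 1]] e[of 1] by simp
    then show "jump 1 C S l = u S l" using jy[OF S l 1] by simp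
    have w: "wt C S ((-1) *\<^sub>R q l + \<epsilon> *\<^sub>R r S) = 0" "wt C S ((-1) *\<^sub>R q l - \<epsilon> *\<^sub>R r S) = 0"
      by (rule wneg[OF regular_jump_eps(1)[OF S l m1]], unfold e, simp,
          rule wneg[OF regular_jump_eps(2)[OF S l m1]], unfold e, simp)
    show "jump (-1) C S l = 0" unfolding jump_def w by simp
  qed
qed

end

section \<open>Comparison with singular cohomology\<close>

lemma cochain_eval_superset:
  assumes "finite S" "Poly_Mapping.keys a \<subseteq> S"
  shows "cochain_eval c a = (\<Sum>f\<in>S. of_int (Poly_Mapping.lookup a f) * c f)"
  unfolding cochain_eval_def using assms
  by (intro sum.mono_neutral_left) (auto simp: in_keys_iff)

lemma cochain_eval_add: "cochain_eval c (a + b) = cochain_eval c a + cochain_eval c b"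
proof -
  define S where "S = Poly_Mapping.keys a \<union> Poly_Mapping.keys b"
  have S: "finite S" "Poly_Mapping.keys a \<subseteq> S" "Poly_Mapping.keys b \<subseteq> S" 
    "Poly_Mapping.keys (a + b) \<subseteq> S"
    unfolding S_def using Poly_Mapping.keys_add[of a b] by auto
  have "cochain_eval c (a + b) = (\<Sum>f\<in>S. of_int (Poly_Mapping.lookup (a + b) f) * c f)"
    by (rule cochain_eval_superset[OF S(1,4)])
  also have "\<dots> = (\<Sum>f\<in>S. of_int (Poly_Mapping.lookup a f) * c f) + (\<Sum>f\<in>S. of_int (Poly_Mapping.lookup b f) * c f)"
    by (simp add: lookup_add distrib_right sum.distrib)
  also have "\<dots> = cochain_eval c a + cochain_eval c b"
    by (simp only: cochain_eval_superset[OF S(1,2)] cochain_eval_superset[OF S(1,3)])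
  finally show ?thesis .
qed

lemma cochain_eval_cmul_of: "cochain_eval c (frag_cmul k (frag_of f)) = of_int k * c f"
  using keys_cmul[of k "frag_of f"] by (subst cochain_eval_superset[of "{f}"]) auto

lemma cochain_eval_uminus_of: "cochain_eval c (- frag_of f) = - c f"
  using cochain_eval_cmul_of[of c "-1" f] by simp

lemma cochain_eval_of: "cochain_eval c (frag_of f) = c f"
  using cochain_eval_cmul_of[of c 1 f] by simp

lemma cochain_eval_boundary_1:
  "cochain_eval c (chain_boundary (Suc 0) (frag_of f)) = c (singular_face 1 0 f) - c (singular_face 1 1 f)"
  by (simp add: chain_boundary_of cochain_eval_add cochain_eval_of cochain_eval_uminus_of
      del: add_uminus_conv_diff)

lemma cochain_eval_boundary_2:
  "cochain_eval c (chain_boundary 2 (frag_of f)) =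
     c (singular_face 2 0 f) - c (singular_face 2 1 f) + c (singular_face 2 2 f)"
proof -
  have "(\<Sum>k\<le>2. frag_cmul ((-1) ^ k) (frag_of (singular_face 2 k f))) =
      frag_of (singular_face 2 0 f) + - frag_of (singular_face 2 1 f) + frag_of (singular_face 2 2 f)"
    by (simp add: numeral_2_eq_2)
  then show ?thesis
    by (simp add: chain_boundary_of cochain_eval_add cochain_eval_of cochain_eval_uminus_of
        del: add_uminus_conv_diff)
qed

lemma singular_simplex_top_of_set_iff:
  "singular_simplex p (top_of_set U) f \<longleftrightarrow>
     continuous_on (standard_simplex p) f \<and> f ` standard_simplex p \<subseteq> U \<and> f \<in> extensional (standard_simplex p)"
  unfolding singular_simplex_def by (auto simp: euclidean_product_topology continuous_map_in_subtopology)

section \<open>Singular simplices of dimension one and two as paths and triangles\<close>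

definition edge_point :: "real \<Rightarrow> nat \<Rightarrow> real" where
  "edge_point t = (\<lambda>i. if i = 0 then 1 - t else if i = 1 then t else 0)"

definition path_simplex :: "(real \<Rightarrow> 'a) \<Rightarrow> (nat \<Rightarrow> real) \<Rightarrow> 'a" where
  "path_simplex g = restrict (\<lambda>x. g (x 1)) (standard_simplex 1)"

definition point_simplex :: "'a \<Rightarrow> (nat \<Rightarrow> real) \<Rightarrow> 'a" where
  "point_simplex v = restrict (\<lambda>x. v) (standard_simplex 0)"

lemma standard_simplex_1_iff: "x \<in> standard_simplex 1 \<longleftrightarrow> (\<exists>t\<in>{0..1}. x = edge_point t)"
proof
  assume x: "x \<in> standard_simplex 1"
  then have "x i = edge_point (x 1) i" for i
    unfolding standard_simplex_def edge_point_def by auto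
  then have "x = edge_point (x 1)" by blast
  moreover have "x 1 \<in> {0..1}" using x unfolding standard_simplex_def by auto
  ultimately show "\<exists>t\<in>{0..1}. x = edge_point t" by blast
qed (auto simp: standard_simplex_def edge_point_def)

lemma edge_point_1 [simp]: "edge_point t (Suc 0) = t" by (simp add: edge_point_def)

lemma edge_point_in: "t \<in> {0..1} \<Longrightarrow> edge_point t \<in> standard_simplex (Suc 0)"
  using standard_simplex_1_iff by auto

lemma continuous_on_coord: "continuous_on S (\<lambda>x::nat \<Rightarrow> real. x i)"
  by (rule continuous_on_subset[OF continuous_on_product_coordinates]) simp

lemma continuous_on_edge_point: "continuous_on S edge_point"
  proof (rule continuous_on_coordinatewise_then_product)
  fix i show "continuous_on S (\<lambda>x. edge_point x i)"
    unfolding edge_point_def by (cases "i = 0"; cases "i = 1") (auto intro!: continuous_intros)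
qed

lemma singular_simplex_path_simplex:
  assumes "continuous_on {0..1} g" "g ` {0..1} \<subseteq> U"
  shows "singular_simplex (Suc 0) (top_of_set U) (path_simplex g)"
proof -
  have sub: "(\<lambda>x. x 1) ` standard_simplex (Suc 0) \<subseteq> {0..1::real}" 
    by (auto simp: standard_simplex_def)
  have "continuous_on (standard_simplex (Suc 0)) (\<lambda>x. g (x 1))"
    by (rule continuous_on_compose2[OF assms(1) continuous_on_coord sub])
  then show ?thesis using assms(2) sub
    unfolding singular_simplex_top_of_set_iff path_simplex_def by auto
qed

lemma path_simplex_edge: "t \<in> {0..1} \<Longrightarrow> path_simplex g (edge_point t) = g t"
  using edge_point_in[of t] by (simp add: path_simplex_def)

lemma singular_simplex_1E:
  assumes "singular_simplex (Suc 0) (top_of_set U) f"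
  obtains g where "f = path_simplex g" "continuous_on {0..1} g" "g ` {0..1} \<subseteq> U"
proof (rule that[of "f \<circ> edge_point"])
  have f: "continuous_on (standard_simplex (Suc 0)) f" "f ` standard_simplex (Suc 0) \<subseteq> U" "f \<in> extensional (standard_simplex (Suc 0))"
    using assms unfolding singular_simplex_top_of_set_iff by auto
  show "f = path_simplex (f \<circ> edge_point)"
  proof (rule ext)
    fix x show "f x = path_simplex (f \<circ> edge_point) x"
    proof (cases "x \<in> standard_simplex (Suc 0)")
      case True
      then obtain t where "t \<in> {0..1}" "x = edge_point t" using standard_simplex_1_iff[of x] by auto
      then show ?thesis by (simp add: path_simplex_edge)
    qed (use f(3) in \<open>auto simp: path_simplex_def extensional_def\<close>)
  qed
  have sub: "edge_point ` {0..1} \<subseteq> standard_simplex (Suc 0)" using edge_point_in by blast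
  show "continuous_on {0..1} (f \<circ> edge_point)"
    by (rule continuous_on_compose[OF continuous_on_edge_point continuous_on_subset[OF f(1) sub]])
  show "(f \<circ> edge_point) ` {0..1} \<subseteq> U" using f(2) sub by fastforce
qed

lemma singular_face_path_simplex:
  "singular_face 1 0 (path_simplex g) = point_simplex (g 1)"
  "singular_face 1 1 (path_simplex g) = point_simplex (g 0)"
proof -
  have e: "simplical_face 0 (\<lambda>j. if j = (0::nat) then 1 else 0) = edge_point 1"
    "simplical_face (Suc 0) (\<lambda>j. if j = (0::nat) then 1 else 0) = edge_point 0"
    by (auto simp: simplical_face_def edge_point_def fun_eq_iff)
  show "singular_face 1 0 (path_simplex g) = point_simplex (g 1)"
    "singular_face 1 1 (path_simplex g) = point_simplex (g 0)"
    unfolding singular_face_def point_simplex_def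
    using e by (auto simp: standard_simplex_0 path_simplex_edge intro!: restrict_ext)
qed

definition triangle2 :: "(real \<times> real) set" where
  "triangle2 = {(s,t). 0 \<le> s \<and> 0 \<le> t \<and> s + t \<le> 1}"

definition triangle_simplex :: "(real \<times> real \<Rightarrow> 'a) \<Rightarrow> (nat \<Rightarrow> real) \<Rightarrow> 'a" where
  "triangle_simplex q = restrict (\<lambda>x. q (x 1, x 2)) (standard_simplex 2)"

definition tri_point :: "real \<times> real \<Rightarrow> nat \<Rightarrow> real" where
  "tri_point = (\<lambda>(s,t) i. if i = 0 then 1 - s - t else if i = 1 then s else if i = 2 then t else 0)"

lemma sum_atMost_2: "(\<Sum>i\<le>(2::nat). x i) = x 0 + x 1 + (x 2 :: real)"
  by (simp add: numeral_2_eq_2)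

lemma standard_simplex_2_coords:
  assumes "x \<in> standard_simplex 2"
  shows "(x 1, x 2) \<in> triangle2" "x = tri_point (x 1, x 2)"
proof -
  have x: "\<And>i. 0 \<le> x i" "x 0 + x 1 + x 2 = 1" "\<And>i. i > 2 \<Longrightarrow> x i = 0"
    using assms unfolding standard_simplex_def by (auto simp: sum_atMost_2)
  then show "(x 1, x 2) \<in> triangle2" 
  proof -
    have "x 1 + x 2 \<le> 1" using x(1)[of 0] x(2) by linarith
    then show ?thesis using x(1) by (simp add: triangle2_def)
  qed
  show "x = tri_point (x 1, x 2)"
  proof (rule ext)
    fix i show "x i = tri_point (x 1, x 2) i"
      using x(2) x(3)[of i] by (auto simp: tri_point_def)
  qed
qed

lemma tri_point_in: "p \<in> triangle2 \<Longrightarrow> tri_point p \<in> standard_simplex 2"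
  by (auto simp: standard_simplex_def tri_point_def triangle2_def sum_atMost_2 split: prod.splits)

lemma singular_simplex_triangle_simplex:
  assumes "continuous_on triangle2 q" "q ` triangle2 \<subseteq> U"
  shows "singular_simplex 2 (top_of_set U) (triangle_simplex q)"
proof -
  have sub: "(\<lambda>x. (x 1, x 2)) ` standard_simplex 2 \<subseteq> triangle2"
    using standard_simplex_2_coords(1) by auto
  have "continuous_on (standard_simplex 2) (\<lambda>x. q (x 1, x 2))"
    by (rule continuous_on_compose2[OF assms(1) _ sub]) (intro continuous_on_Pair continuous_on_coord)
  then show ?thesis using assms(2) sub
    unfolding singular_simplex_top_of_set_iff triangle_simplex_def by auto
qed

lemma singular_simplex_2E:
  assumes "singular_simplex 2 (top_of_set U) f"
  obtains q where "f = triangle_simplex q" "continuous_on triangle2 q" "q ` triangle2 \<subseteq> U"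
proof (rule that[of "f \<circ> tri_point"])
  have f: "continuous_on (standard_simplex 2) f" "f ` standard_simplex 2 \<subseteq> U" "f \<in> extensional (standard_simplex 2)"
    using assms unfolding singular_simplex_top_of_set_iff by auto
  show "f = triangle_simplex (f \<circ> tri_point)"
  proof (rule ext)
    fix x show "f x = triangle_simplex (f \<circ> tri_point) x"
    proof (cases "x \<in> standard_simplex 2")
      case True
      then show ?thesis using standard_simplex_2_coords(2)[OF True] by (simp add: triangle_simplex_def)
    qed (use f(3) in \<open>auto simp: triangle_simplex_def extensional_def\<close>)
  qed
  have sub: "tri_point ` triangle2 \<subseteq> standard_simplex 2" using tri_point_in by blast
  have "continuous_on triangle2 tri_point"
  proof (rule continuous_on_coordinatewise_then_product)
    fix i show "continuous_on triangle2 (\<lambda>x. tri_point x i)"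
      unfolding tri_point_def case_prod_beta
      by (cases "i = 0"; cases "i = 1"; cases "i = 2") (auto intro!: continuous_intros)
  qed
  then show "continuous_on triangle2 (f \<circ> tri_point)"
    by (rule continuous_on_compose[OF _ continuous_on_subset[OF f(1) sub]])
  show "(f \<circ> tri_point) ` triangle2 \<subseteq> U" using f(2) sub by fastforce
qed

lemma singular_face_triangle_simplex:
  "singular_face 2 0 (triangle_simplex q) = path_simplex (\<lambda>t. q (1 - t, t))"
  "singular_face 2 1 (triangle_simplex q) = path_simplex (\<lambda>t. q (0, t))"
  "singular_face 2 2 (triangle_simplex q) = path_simplex (\<lambda>t. q (t, 0))"
proof -
  have s2: "simplical_face k (edge_point t) \<in> standard_simplex 2" if "k \<le> 2" "t \<in> {0..1}" for k t
    using simplical_face_in_standard_simplex[of 2 k "edge_point t"] edge_point_in[of t] that by simp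
  have aux: "singular_face 2 k (triangle_simplex q) = path_simplex h"
    if k: "k \<le> 2" and h: "\<And>t. q (simplical_face k (edge_point t) 1, simplical_face k (edge_point t) 2) = h t" for k h
  proof (rule ext)
    fix x show "singular_face 2 k (triangle_simplex q) x = path_simplex h x"
    proof (cases "x \<in> standard_simplex (Suc 0)")
      case True
      then obtain t where t: "t \<in> {0..1}" "x = edge_point t" using standard_simplex_1_iff[of x] by auto
      show ?thesis using True s2[OF k t(1)] h[of t] t unfolding singular_face_def
        by (simp add: triangle_simplex_def path_simplex_edge edge_point_in)
    qed (simp add: singular_face_def path_simplex_def)
  qed
  show "singular_face 2 0 (triangle_simplex q) = path_simplex (\<lambda>t. q (1 - t, t))"
    by (rule aux) (auto simp: simplical_face_def edge_point_def)
  show "singular_face 2 1 (triangle_simplex q) = path_simplex (\<lambda>t. q (0, t))"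
    by (rule aux) (auto simp: simplical_face_def edge_point_def)
  show "singular_face 2 2 (triangle_simplex q) = path_simplex (\<lambda>t. q (t, 0))"
    by (rule aux) (auto simp: simplical_face_def edge_point_def)
qed

lemma sing_cocycle_triangle:
  assumes "c \<in> sing_cocycles 1 (top_of_set U)" "continuous_on triangle2 q" "q ` triangle2 \<subseteq> U"
  shows "c (path_simplex (\<lambda>t. q (1 - t, t))) - c (path_simplex (\<lambda>t. q (0, t))) + c (path_simplex (\<lambda>t. q (t, 0))) = 0"
proof -
  have s: "singular_simplex 2 (top_of_set U) (triangle_simplex q)"
    using singular_simplex_triangle_simplex assms(2,3) by blast
  have "sing_coboundary 1 (top_of_set U) c = (\<lambda>f. 0)"
    using assms(1) unfolding sing_cocycles_def by blast
  then have "sing_coboundary 1 (top_of_set U) c (triangle_simplex q) = 0" by metis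
  then show ?thesis using s cochain_eval_boundary_2[of c "triangle_simplex q"]
    unfolding sing_coboundary_def singular_face_triangle_simplex by (simp add: numeral_2_eq_2)
qed

text \<open>For a constant triangle the three faces agree, and their alternating sum is a single
  value.\<close>

lemma sing_cocycle_const:
  assumes "c \<in> sing_cocycles 1 (top_of_set U)" "v \<in> U"
  shows "c (path_simplex (\<lambda>t. v)) = 0"
  using sing_cocycle_triangle[OF assms(1), of "\<lambda>p. v"] assms(2) by auto

text \<open>The straight-line homotopy stays in \<open>N\<close>. Its square is cut along the
  diagonal into two triangles, and the two sides on which an endpoint stays fixed are constant
  paths.\<close>

lemma sing_cocycle_homotopic:
  fixes U :: "'a::real_normed_vector set"
  assumes c: "c \<in> sing_cocycles 1 (top_of_set U)" and N: "convex N" "N \<subseteq> U"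
    and k: "continuous_on {0..1} k" "k ` {0..1} \<subseteq> N"
  shows "c (path_simplex k) = c (path_simplex (\<lambda>t. (1 - t) *\<^sub>R k 0 + t *\<^sub>R k 1))"
proof -
  define j where "j = (\<lambda>t. (1 - t) *\<^sub>R k 0 + t *\<^sub>R k 1)"
  define H where "H = (\<lambda>(s,t). (1 - s) *\<^sub>R k t + s *\<^sub>R j t)"
  have cj: "continuous_on {0..1} j" unfolding j_def by (intro continuous_intros)
  have jN: "j t \<in> N" if "t \<in> {0..1}" for t
    unfolding j_def using that k(2) by (intro convexD_alt[OF N(1)]) auto
  have HN: "H (s,t) \<in> N" if "s \<in> {0..1}" "t \<in> {0..1}" for s t
    unfolding H_def using that k(2) jN[OF that(2)] by (auto intro!: convexD_alt[OF N(1)])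
  have cH: "continuous_on ({0..1} \<times> {0..1}) H"
    unfolding H_def case_prod_beta
    by (intro continuous_intros continuous_on_compose2[OF k(1)] continuous_on_compose2[OF cj]) auto
  \<comment> \<open>Affine maps of the triangle onto the two halves of the square, both sending one
    edge to the diagonal.\<close>
  have tri1: "(\<lambda>(u,v). (v, u + v)) ` triangle2 \<subseteq> {0..1} \<times> {0..1::real}"
    and tri2: "(\<lambda>(u,v). (u + v, v)) ` triangle2 \<subseteq> {0..1} \<times> {0..1::real}"
    unfolding triangle2_def by auto
  have "c (path_simplex (\<lambda>t. H (t, 1))) - c (path_simplex (\<lambda>t. H (t, t))) + c (path_simplex (\<lambda>t. H (0, t))) = 0"
  proof -
    have "continuous_on triangle2 (\<lambda>p. H ((\<lambda>(u,v). (v, u + v)) p))"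
      by (rule continuous_on_compose2[OF cH _ tri1]) (auto simp: case_prod_beta intro!: continuous_intros)
    moreover have "(\<lambda>p. H ((\<lambda>(u,v). (v, u + v)) p)) ` triangle2 \<subseteq> U"
      using HN N(2) by (auto simp: triangle2_def subset_iff)
    ultimately show ?thesis using sing_cocycle_triangle[OF c, of "\<lambda>p. H ((\<lambda>(u,v). (v, u + v)) p)"] by simp
  qed
  moreover have "c (path_simplex (\<lambda>t. H (1, t))) - c (path_simplex (\<lambda>t. H (t, t))) + c (path_simplex (\<lambda>t. H (t, 0))) = 0"
  proof -
    have "continuous_on triangle2 (\<lambda>p. H ((\<lambda>(u,v). (u + v, v)) p))"
      by (rule continuous_on_compose2[OF cH _ tri2]) (auto simp: case_prod_beta intro!: continuous_intros)
    moreover have "(\<lambda>p. H ((\<lambda>(u,v). (u + v, v)) p)) ` triangle2 \<subseteq> U"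
      using HN N(2) by (auto simp: triangle2_def subset_iff)
    ultimately show ?thesis using sing_cocycle_triangle[OF c, of "\<lambda>p. H ((\<lambda>(u,v). (u + v, v)) p)"] by simp
  qed
  moreover have "(\<lambda>t. H (t, 1)) = (\<lambda>t. k 1)" "(\<lambda>t. H (t, 0)) = (\<lambda>t. k 0)" "(\<lambda>t. H (0, t)) = k" "(\<lambda>t. H (1, t)) = j"
    unfolding H_def j_def by (auto simp: fun_eq_iff algebra_simps)
  moreover have "c (path_simplex (\<lambda>t. k 1)) = 0" "c (path_simplex (\<lambda>t. k 0)) = 0"
    by (rule sing_cocycle_const[OF c], use k(2) N(2) in force)+
  ultimately show ?thesis unfolding j_def by simp
qed

text \<open>
  The primitive exists for continuous paths, by pulling back the cocycle to the interval; it is unique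
  up to a constant there.
\<close>

definition path_integral :: "('a \<Rightarrow> 'a \<Rightarrow> rat) \<Rightarrow> (real \<Rightarrow> 'a) \<Rightarrow> rat" where
  "path_integral z g = (SOME r. \<exists>F. primitive_on {0..1} (\<lambda>s t. z (g s) (g t)) F \<and> r = F 1 - F 0)"

lemma path_integral_eq:
  assumes "primitive_on {0..1} (\<lambda>s t. z (g s) (g t)) F"
  shows "path_integral z g = F 1 - F 0"
proof -
  have "\<exists>r. \<exists>F. primitive_on {0..1} (\<lambda>s t. z (g s) (g t)) F \<and> r = F 1 - F 0" using assms by blast
  then have "\<exists>F. primitive_on {0..1} (\<lambda>s t. z (g s) (g t)) F \<and> path_integral z g = F 1 - F 0"
    unfolding path_integral_def by (rule someI_ex)
  then obtain G where G: "primitive_on {0..1} (\<lambda>s t. z (g s) (g t)) G" "path_integral z g = G 1 - G 0"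
    by blast
  have "G 1 - F 1 = G 0 - F 0"
    using primitive_on_unique[OF _ G(1) assms, of 1 0] by simp
  then show ?thesis using G(2) by simp
qed

lemma primitive_on_cong:
  assumes "primitive_on X z F" "\<And>a b. a \<in> X \<Longrightarrow> b \<in> X \<Longrightarrow> z a b = w a b" "\<And>a. a \<in> X \<Longrightarrow> F a = G a"
  shows "primitive_on X w G"
proof (rule primitive_onI)
  fix x assume "x \<in> X"
  then obtain N where "open N" "x \<in> N" "\<And>a b. a \<in> N \<Longrightarrow> a \<in> X \<Longrightarrow> b \<in> N \<Longrightarrow> b \<in> X \<Longrightarrow> z a b = F b - F a"
    using primitive_onE[OF assms(1)] by blast
  then show "\<exists>N. open N \<and> x \<in> N \<and> (\<forall>a\<in>N \<inter> X. \<forall>b\<in>N \<inter> X. w a b = G b - G a)"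
    using assms(2,3) by (intro exI[of _ N]) auto
qed

lemma path_integral_path_simplex_eq:
  assumes "primitive_on {0..1} (\<lambda>s t. z (g s) (g t)) F"
  shows "path_integral z (path_simplex g \<circ> edge_point) = F 1 - F 0"
  by (rule path_integral_eq, rule primitive_on_cong[OF assms]) (auto simp: path_simplex_edge)

section \<open>From functions of two points to singular cochains\<close>

definition sing_of :: "'a::topological_space set \<Rightarrow> ('a \<Rightarrow> 'a \<Rightarrow> rat) \<Rightarrow> ((nat \<Rightarrow> real) \<Rightarrow> 'a) \<Rightarrow> rat" where
  "sing_of U z = (\<lambda>f. if singular_simplex 1 (top_of_set U) f then path_integral z (f \<circ> edge_point) else 0)"

lemma sing_of_path_simplex:
  assumes "continuous_on {0..1} g" "g ` {0..1} \<subseteq> U" "primitive_on {0..1} (\<lambda>s t. z (g s) (g t)) F"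
  shows "sing_of U z (path_simplex g) = F 1 - F 0"
  using singular_simplex_path_simplex[OF assms(1,2)] path_integral_path_simplex_eq[of z g F] assms(3)
  unfolding sing_of_def by simp

lemma path_pullback_primitive:
  assumes "cocycle_on U z" "continuous_on {0..1} g" "g ` {0..1} \<subseteq> U"
  obtains F where "primitive_on {0..1::real} (\<lambda>s t. z (g s) (g t)) F"
  using cocycle_on_interval_exact[OF cocycle_on_pullback[OF assms]] unfolding exact_on_def by blast

lemma convex_triangle2: "convex triangle2"
  unfolding convex_alt
proof (intro ballI allI impI)
  fix p q :: "real \<times> real" and u :: real
  assume "p \<in> triangle2" "q \<in> triangle2" "0 \<le> u \<and> u \<le> 1"
  moreover obtain a b c d where "p = (a,b)" "q = (c,d)" by (cases p, cases q)
  ultimately have h: "0 \<le> a" "0 \<le> b" "a + b \<le> 1" "0 \<le> c" "0 \<le> d" "c + d \<le> 1" "0 \<le> u" "u \<le> 1" "p = (a,b)" "q = (c,d)"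
    by (auto simp: triangle2_def)
  have "(1 - u) * (a + b) + u * (c + d) \<le> (1 - u) * 1 + u * 1"
    using h by (intro add_mono mult_left_mono) auto
  moreover have "0 \<le> (1 - u) * a + u * c" "0 \<le> (1 - u) * b + u * d" using h by auto
  ultimately show "(1 - u) *\<^sub>R p + u *\<^sub>R q \<in> triangle2"
    unfolding triangle2_def h(9,10) by (simp add: algebra_simps)
qed

text \<open>The triangle is convex, so the pulled-back function has a primitive on it, and the
  contributions of the three edges cancel.\<close>

lemma sing_of_in_cocycles:
  assumes z: "cocycle_on U z"
  shows "sing_of U z \<in> sing_cocycles 1 (top_of_set U)"
proof -
  have "sing_coboundary 1 (top_of_set U) (sing_of U z) f = 0" for f
  proof (cases "singular_simplex 2 (top_of_set U) f")
    case False
    then show ?thesis unfolding sing_coboundary_def by (simp add: numeral_2_eq_2)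
  next
    case True
    then obtain q where q: "f = triangle_simplex q" "continuous_on triangle2 q" "q ` triangle2 \<subseteq> U"
      using singular_simplex_2E by blast
    obtain F where F: "primitive_on triangle2 (\<lambda>a b. z (q a) (q b)) F"
      using cocycle_on_convex_exact[OF convex_triangle2 cocycle_on_pullback[OF z q(2,3)]]
      unfolding exact_on_def by blast
    have aux: "sing_of U z (path_simplex (\<lambda>t. q (e t))) = F (e 1) - F (e 0)"
      if e: "continuous_on {0..1} e" "e ` {0..1} \<subseteq> triangle2" for e
    proof -
      have "primitive_on {0..1} (\<lambda>s t. z (q (e s)) (q (e t))) (F \<circ> e)"
        using primitive_on_pullback[OF F e] .
      moreover have "continuous_on {0..1} (\<lambda>t. q (e t))" 
        using continuous_on_compose2[OF q(2) e(1) e(2)] .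
      moreover have "(\<lambda>t. q (e t)) ` {0..1} \<subseteq> U" using q(3) e(2) by blast
      ultimately show ?thesis using sing_of_path_simplex[of "\<lambda>t. q (e t)" U z "F \<circ> e"] by simp
    qed
    have aux': "\<lbrakk>continuous_on {0..1} e; \<And>t. t \<in> {0..1} \<Longrightarrow> e t \<in> triangle2\<rbrakk> \<Longrightarrow>
        sing_of U z (path_simplex (\<lambda>t. q (e t))) = F (e 1) - F (e 0)" for e
      using aux by blast
    have "sing_of U z (path_simplex (\<lambda>t. q (1 - t, t))) = F (0,1) - F (1,0)"
      by (subst aux'[of "\<lambda>t. (1 - t, t)"]) (auto simp: triangle2_def intro!: continuous_intros)
    moreover have "sing_of U z (path_simplex (\<lambda>t. q (0, t))) = F (0,1) - F (0,0)"
      by (subst aux'[of "\<lambda>t. (0, t)"]) (auto simp: triangle2_def intro!: continuous_intros)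
    moreover have "sing_of U z (path_simplex (\<lambda>t. q (t, 0))) = F (1,0) - F (0,0)"
      by (subst aux'[of "\<lambda>t. (t, 0)"]) (auto simp: triangle2_def intro!: continuous_intros)
    ultimately show ?thesis using True cochain_eval_boundary_2[of "sing_of U z" f]
      unfolding sing_coboundary_def q(1) singular_face_triangle_simplex by (simp add: numeral_2_eq_2)
  qed
  then show ?thesis unfolding sing_cocycles_def sing_cochains_def sing_of_def by auto
qed

lemma sing_of_lincomb:
  assumes "cocycle_on U z" "cocycle_on U w"
  shows "sing_of U (\<lambda>a b. p * z a b + q * w a b) = (\<lambda>f. p * sing_of U z f + q * sing_of U w f)"
proof (rule ext)
  fix f show "sing_of U (\<lambda>a b. p * z a b + q * w a b) f = p * sing_of U z f + q * sing_of U w f"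
  proof (cases "singular_simplex (Suc 0) (top_of_set U) f")
    case True
    then obtain g where g: "f = path_simplex g" "continuous_on {0..1} g" "g ` {0..1} \<subseteq> U"
      using singular_simplex_1E by blast
    obtain F where F: "primitive_on {0..1} (\<lambda>s t. z (g s) (g t)) F" using path_pullback_primitive[OF assms(1) g(2,3)] .
    obtain G where G: "primitive_on {0..1} (\<lambda>s t. w (g s) (g t)) G" using path_pullback_primitive[OF assms(2) g(2,3)] .
    have "primitive_on {0..1} (\<lambda>s t. p * z (g s) (g t) + q * w (g s) (g t)) (\<lambda>t. p * F t + q * G t)"
      using primitive_on_lincomb[OF F G] .
    from sing_of_path_simplex[OF g(2,3), of "\<lambda>a b. p * z a b + q * w a b", OF this]
      sing_of_path_simplex[OF g(2,3), of z, OF F] sing_of_path_simplex[OF g(2,3), of w, OF G]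
    show ?thesis unfolding g(1) by (simp only: right_diff_distrib)
  qed (simp add: sing_of_def)
qed

lemma sing_of_zero: "sing_of U (\<lambda>a b. 0) = (\<lambda>f. 0)"
proof (rule ext)
  fix f show "sing_of U (\<lambda>a b. 0) f = 0"
    unfolding sing_of_def using path_integral_eq[of "\<lambda>a b. 0" "f \<circ> edge_point" "\<lambda>t. 0", OF primitive_on_zero] by simp
qed

lemma sing_of_sum:
  assumes "finite I" "\<And>i. i \<in> I \<Longrightarrow> cocycle_on U (z i)"
  shows "sing_of U (\<lambda>a b. \<Sum>i\<in>I. c i * z i a b) = (\<lambda>f. \<Sum>i\<in>I. c i * sing_of U (z i) f)"
  using assms
proof (induction I rule: finite_induct)
  case empty
  then show ?case by (simp add: sing_of_zero)
next
  case (insert i I)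
  have "cocycle_on U (\<lambda>a b. \<Sum>i\<in>I. c i * z i a b)"
    using insert.prems by (intro cocycle_on_sum cocycle_on_scale) auto
  then show ?case
    using sing_of_lincomb[of U "z i" "\<lambda>a b. \<Sum>i\<in>I. c i * z i a b" "c i" 1] insert by simp
qed

text \<open>\<open>z\<close> evaluates \<open>c\<close> on straight segments. Additivity on a small
  ball comes from affine triangles; agreement on an arbitrary path comes from comparing its short
  pieces with segments.\<close>

lemma sing_of_surj:
  fixes U :: "'a::real_normed_vector set"
  assumes "open U" and c: "c \<in> sing_cocycles 1 (top_of_set U)"
  obtains z where "cocycle_on U z" "sing_of U z = c"
proof -
  define z where "z = (\<lambda>a b. c (path_simplex (\<lambda>t. (1 - t) *\<^sub>R a + t *\<^sub>R b)))"
  have tri: "z a b + z b d = z a d" if N: "convex N" "N \<subseteq> U" "a \<in> N" "b \<in> N" "d \<in> N" for N a b d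
  proof -
    define q where "q = (\<lambda>(s,t). (1 - s - t) *\<^sub>R a + s *\<^sub>R b + t *\<^sub>R d)"
    have "continuous_on triangle2 q" unfolding q_def case_prod_beta by (intro continuous_intros)
    moreover have "q p \<in> N" if "p \<in> triangle2" for p
    proof -
      obtain s t where p: "p = (s,t)" by (cases p)
      have st: "0 \<le> s" "0 \<le> t" "s + t \<le> 1" using that p unfolding triangle2_def by auto
      have "q p \<in> convex hull {a,b,d}"
        unfolding convex_hull_3 q_def p using st
        by - (rule CollectI, rule exI[of _ "1 - s - t"], rule exI[of _ s], rule exI[of _ t], simp)
      then show ?thesis using hull_minimal[of "{a,b,d}" N convex] N by auto
    qed
    ultimately have "c (path_simplex (\<lambda>t. q (1 - t, t))) - c (path_simplex (\<lambda>t. q (0, t))) + c (path_simplex (\<lambda>t. q (t, 0))) = 0"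
      using sing_cocycle_triangle[OF c, of q] N(2) by blast
    then show ?thesis unfolding q_def z_def by (simp add: algebra_simps)
  qed
  have co: "cocycle_on U z"
  proof (rule cocycle_onI)
    fix x assume "x \<in> U"
    then obtain e where e: "e > 0" "ball x e \<subseteq> U" using assms(1) openE by blast
    then show "\<exists>N F. open N \<and> x \<in> N \<and> (\<forall>a\<in>N \<inter> U. \<forall>b\<in>N \<inter> U. z a b = F b - F a)"
      using tri[of "ball x e" x] by (intro exI[of _ "ball x e"] exI[of _ "z x"]) (auto simp: algebra_simps)
  qed
  moreover have "sing_of U z f = c f" for f
  proof (cases "singular_simplex (Suc 0) (top_of_set U) f")
    case False
    then show ?thesis using c unfolding sing_of_def sing_cocycles_def sing_cochains_def by simp
  next
    case True
    then obtain g where g: "f = path_simplex g" "continuous_on {0..1} g" "g ` {0..1} \<subseteq> U"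
      using singular_simplex_1E by blast
    \<comment> \<open>\<open>P s t\<close> is the value of \<open>c\<close> on the piece of
      \<open>g\<close> between \<open>s\<close> and \<open>t\<close>. It is additive, and for nearby
      parameters it equals \<open>z (g s) (g t)\<close>.\<close>
    define P where "P = (\<lambda>s t. c (path_simplex (\<lambda>u. g ((1 - u) * s + u * t))))"
    have cvx: "(1 - u) * s + u * t \<in> {0..1}" if "s \<in> {0..1}" "t \<in> {0..1}" "u \<in> {0..1}" for s t u :: real
      using convexD_alt[of "{0..1::real}" s t u] that by simp
    have P_add: "P r s + P s t = P r t" if "r \<in> {0..1}" "s \<in> {0..1}" "t \<in> {0..1}" for r s t
    proof -
      define e where "e = (\<lambda>(u,v). (1 - u - v) * r + u * s + v * t)"
      have e: "e p \<in> {0..1}" if "p \<in> triangle2" for p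
      proof -
        obtain u v where p: "p = (u,v)" by (cases p)
        have uv: "0 \<le> u" "0 \<le> v" "u + v \<le> 1" using that p unfolding triangle2_def by auto
        have "e p \<in> convex hull {r,s,t}"
          unfolding convex_hull_3 e_def p using uv
        by - (rule CollectI, rule exI[of _ "1 - u - v"], rule exI[of _ u], rule exI[of _ v], simp)
        then show ?thesis using hull_minimal[of "{r,s,t}" "{0..1}" convex] \<open>r \<in> _\<close> \<open>s \<in> _\<close> \<open>t \<in> _\<close> by auto
      qed
      have "continuous_on triangle2 e" unfolding e_def case_prod_beta by (intro continuous_intros)
      then have "continuous_on triangle2 (\<lambda>p. g (e p))" using e by (intro continuous_on_compose2[OF g(2)]) auto
      moreover have "(\<lambda>p. g (e p)) ` triangle2 \<subseteq> U" using e g(3) by blast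
      ultimately have "c (path_simplex (\<lambda>t. g (e (1 - t, t)))) - c (path_simplex (\<lambda>t. g (e (0, t)))) + c (path_simplex (\<lambda>t. g (e (t, 0)))) = 0"
        using sing_cocycle_triangle[OF c, of "\<lambda>p. g (e p)"] by blast
      then show ?thesis unfolding e_def P_def by (simp add: algebra_simps)
    qed
    have "primitive_on {0..1} (\<lambda>s t. z (g s) (g t)) (P 0)"
    proof (rule primitive_onI)
      fix t :: real assume t: "t \<in> {0..1}"
      then obtain e where e: "e > 0" "ball (g t) e \<subseteq> U" using assms(1) openE g(3) by blast
      obtain d where d: "d > 0" "\<And>s. s \<in> {0..1} \<Longrightarrow> dist s t < d \<Longrightarrow> dist (g s) (g t) < e"
        using g(2) t e(1) unfolding continuous_on_iff by meson
      have "z (g r) (g s) = P 0 s - P 0 r" if r: "r \<in> ball t d" "r \<in> {0..1}" and s: "s \<in> ball t d" "s \<in> {0..1}" for r s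
      proof -
        have sub: "(1 - u) * r + u * s \<in> ball t d \<inter> {0..1}" if "u \<in> {0..1}" for u
        proof -
          have "(1 - u) *\<^sub>R r + u *\<^sub>R s \<in> ball t d"
            by (rule convexD_alt[OF convex_ball r(1) s(1)]) (use that in auto)
          then show ?thesis using cvx[OF r(2) s(2) that] by (simp only: real_scaleR_def Int_iff)
        qed
        have "continuous_on {0..1} (\<lambda>u. g ((1 - u) * r + u * s))"
        proof (rule continuous_on_compose2[OF g(2)])
          show "continuous_on {0..1} (\<lambda>u. (1 - u) * r + u * s)" by (intro continuous_intros)
          show "(\<lambda>u. (1 - u) * r + u * s) ` {0..1} \<subseteq> {0..1}" using cvx[OF r(2) s(2)] by blast
        qed
        moreover have "(\<lambda>u. g ((1 - u) * r + u * s)) ` {0..1} \<subseteq> ball (g t) e"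
        proof
          fix y assume "y \<in> (\<lambda>u. g ((1 - u) * r + u * s)) ` {0..1}"
          then obtain u where u: "u \<in> {0..1}" "y = g ((1 - u) * r + u * s)" by blast
          then show "y \<in> ball (g t) e" using sub[OF u(1)] d(2)[of "(1 - u) * r + u * s"]
            by (simp only: u(2) mem_ball dist_commute Int_iff)
        qed
        ultimately have "P r s = z (g r) (g s)"
          using sing_cocycle_homotopic[OF c convex_ball e(2), of "\<lambda>u. g ((1 - u) * r + u * s)"]
          unfolding P_def z_def by simp
        then show ?thesis using P_add[of 0 r s] r s by simp
      qed
      then show "\<exists>N. open N \<and> t \<in> N \<and> (\<forall>a\<in>N \<inter> {0..1}. \<forall>b\<in>N \<inter> {0..1}. z (g a) (g b) = P 0 b - P 0 a)"
        using d(1) by (intro exI[of _ "ball t d"]) auto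
    qed
    then have "sing_of U z f = P 0 1 - P 0 0" using sing_of_path_simplex[OF g(2,3), of z] g(1) by blast
    also have "P 0 0 = 0" using P_add[of 0 0 0] by simp
    also have "P 0 1 = c f" unfolding P_def g(1) by simp
    finally show ?thesis by simp
  qed
  ultimately show ?thesis using that by blast
qed

text \<open>A 0-cochain and a primitive are the same data, since 0-simplices are points. Short
  segments lead from the cochain to the primitive, pullback to arbitrary paths leads back.\<close>

lemma sing_of_coboundary_iff:
  fixes U :: "'a::real_normed_vector set"
  assumes "open U" and z: "cocycle_on U z"
  shows "sing_of U z \<in> reduced_sing_coboundaries 1 (top_of_set U) \<longleftrightarrow> exact_on U z"
proof
  assume "sing_of U z \<in> reduced_sing_coboundaries 1 (top_of_set U)"
  then obtain \<phi> where \<phi>: "sing_of U z = sing_coboundary 0 (top_of_set U) \<phi>" by auto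
  define F where "F = (\<lambda>v. \<phi> (point_simplex v))"
  have "primitive_on U z F"
  proof (rule primitive_onI)
    fix x assume x: "x \<in> U"
    obtain M K where M: "open M" "x \<in> M" "\<And>a b. a \<in> M \<Longrightarrow> a \<in> U \<Longrightarrow> b \<in> M \<Longrightarrow> b \<in> U \<Longrightarrow> z a b = K b - K a"
      using cocycle_onE[OF z x] by blast
    obtain e where e: "e > 0" "ball x e \<subseteq> U \<inter> M" using assms(1) M(1,2) x openE[of "U \<inter> M" x] by blast
    have "z a b = F b - F a" if ab: "a \<in> ball x e" "b \<in> ball x e" for a b
    proof -
      define g where "g = (\<lambda>t. (1 - t) *\<^sub>R a + t *\<^sub>R b)"
      have gb: "g ` {0..1} \<subseteq> ball x e" unfolding g_def using ab by (auto intro!: convexD_alt[OF convex_ball] simp del: mem_ball)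
      have g: "continuous_on {0..1} g" unfolding g_def by (intro continuous_intros)
      have gU: "g ` {0..1} \<subseteq> U" using gb e(2) by blast
      have "primitive_on (ball x e) z K"
        using M(3) e(2) by (intro primitive_onI exI[of _ "ball x e"]) (auto simp del: mem_ball)
      from primitive_on_pullback[OF this g gb]
      have "primitive_on {0..1} (\<lambda>s t. z (g s) (g t)) (K \<circ> g)" .
      from sing_of_path_simplex[OF g gU, of z, OF this]
      have "sing_of U z (path_simplex g) = K b - K a" by (simp add: g_def)
      moreover have "sing_of U z (path_simplex g) = F b - F a"
        unfolding \<phi> F_def sing_coboundary_def
        using singular_simplex_path_simplex[OF g gU] cochain_eval_boundary_1[of \<phi> "path_simplex g"]
          singular_face_path_simplex[of g] by (simp add: g_def)
      ultimately show ?thesis using M(3)[of a b] ab e(2) by (auto simp del: mem_ball)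
    qed
    then show "\<exists>N. open N \<and> x \<in> N \<and> (\<forall>a\<in>N \<inter> U. \<forall>b\<in>N \<inter> U. z a b = F b - F a)"
      using e(1) by (intro exI[of _ "ball x e"]) auto
  qed
  then show "exact_on U z" unfolding exact_on_def by blast
next
  assume "exact_on U z"
  then obtain F where F: "primitive_on U z F" unfolding exact_on_def by blast
  define \<phi> where "\<phi> = (\<lambda>f. if singular_simplex 0 (top_of_set U) f then F (f (\<lambda>i. if i = 0 then 1 else 0)) else 0)"
  have "\<phi> \<in> sing_cochains 0 (top_of_set U)" unfolding \<phi>_def sing_cochains_def by auto
  moreover have "sing_of U z f = sing_coboundary 0 (top_of_set U) \<phi> f" for f
  proof (cases "singular_simplex (Suc 0) (top_of_set U) f")
    case True
    then obtain g where g: "f = path_simplex g" "continuous_on {0..1} g" "g ` {0..1} \<subseteq> U"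
      using singular_simplex_1E by blast
    have pt: "\<phi> (point_simplex v) = F v" if "v \<in> U" for v
      using that unfolding \<phi>_def singular_simplex_top_of_set_iff point_simplex_def
      by (auto simp: standard_simplex_0)
    have "sing_of U z f = F (g 1) - F (g 0)"
      using sing_of_path_simplex[OF g(2,3), of z, OF primitive_on_pullback[OF F g(2,3)]] g(1) by simp
    moreover have "g 1 \<in> U" "g 0 \<in> U" using g(3) by auto
    ultimately show ?thesis 
      unfolding sing_coboundary_def
      using True cochain_eval_boundary_1[of \<phi> f] singular_face_path_simplex[of g] pt g(1) by simp
  qed (simp add: sing_of_def sing_coboundary_def)
  ultimately show "sing_of U z \<in> reduced_sing_coboundaries 1 (top_of_set U)" by auto
qed

section \<open>Dimensions of quotients\<close>

definition lincomb_closed :: "('b \<Rightarrow> rat) set \<Rightarrow> bool" where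
  "lincomb_closed V \<longleftrightarrow> (\<lambda>x. 0) \<in> V \<and> (\<forall>f\<in>V. \<forall>g\<in>V. \<forall>p q. (\<lambda>x. p * f x + q * g x) \<in> V)"

lemma lincomb_closedD:
  assumes "lincomb_closed V"
  shows "(\<lambda>x. 0) \<in> V" "f \<in> V \<Longrightarrow> g \<in> V \<Longrightarrow> (\<lambda>x. p * f x + q * g x) \<in> V"
  using assms unfolding lincomb_closed_def by blast+

lemma lincomb_closed_sum:
  assumes V: "lincomb_closed V" and "finite I" "\<And>i. i \<in> I \<Longrightarrow> f i \<in> V"
  shows "(\<lambda>x. \<Sum>i\<in>I. c i * f i x) \<in> V"
  using assms(2,3)
proof (induction I rule: finite_induct)
  case empty
  then show ?case using lincomb_closedD(1)[OF V] by simp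
next
  case (insert i I)
  have "(\<lambda>x. c i * f i x + 1 * (\<Sum>i\<in>I. c i * f i x)) \<in> V"
    using insert by (intro lincomb_closedD(2)[OF V]) auto
  then show ?case using insert by simp
qed

text \<open>More unknowns than equations: Gaussian elimination with pivot
  \<open>M a0 b\<close>.\<close>

lemma homogeneous_system:
  fixes M :: "'a \<Rightarrow> 'b \<Rightarrow> rat"
  assumes "finite B" "finite A" "card B < card A"
  shows "\<exists>x. (\<exists>a\<in>A. x a \<noteq> 0) \<and> (\<forall>b\<in>B. (\<Sum>a\<in>A. x a * M a b) = 0)"
  using assms
proof (induction B arbitrary: A M rule: finite_induct)
  case empty
  then obtain a where "a \<in> A" by (metis all_not_in_conv card.empty less_irrefl)
  then show ?case by (intro exI[of _ "\<lambda>a. 1"]) auto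
next
  case (insert b B)
  show ?case
  proof (cases "\<forall>a\<in>A. M a b = 0")
    case True
    have "card B < card A" using insert by simp
    from insert.IH[OF insert.prems(1) this, of M]
    obtain x where "(\<exists>a\<in>A. x a \<noteq> 0) \<and> (\<forall>b\<in>B. (\<Sum>a\<in>A. x a * M a b) = 0)" by blast
    then show ?thesis using True by (intro exI[of _ x]) auto
  next
    case False
    then obtain a0 where a0: "a0 \<in> A" "M a0 b \<noteq> 0" by blast
    define A' where "A' = A - {a0}"
    define M' where "M' = (\<lambda>a c. M a c - M a b / M a0 b * M a0 c)"
    have fA: "finite A'" "card B < card A'" "a0 \<notin> A'" "A = insert a0 A'"
      unfolding A'_def using insert a0 by auto
    obtain x where x: "\<exists>a\<in>A'. x a \<noteq> 0" "\<And>c. c \<in> B \<Longrightarrow> (\<Sum>a\<in>A'. x a * M' a c) = 0"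
      using insert.IH[OF fA(1,2), of M'] by blast
    define s where "s = (\<Sum>a\<in>A'. x a * M a b)"
    \<comment> \<open>The unknown \<open>a0\<close> is chosen to satisfy equation \<open>b\<close>;
      the other equations hold because \<open>M'\<close> is the eliminated system.\<close>
    define y where "y = x(a0 := - s / M a0 b)"
    have sum: "(\<Sum>a\<in>A. y a * M a c) = (\<Sum>a\<in>A'. x a * M a c) - s / M a0 b * M a0 c" for c
    proof -
      have "(\<Sum>a\<in>A. y a * M a c) = y a0 * M a0 c + (\<Sum>a\<in>A'. y a * M a c)"
        unfolding fA(4) using fA(1,3) by simp
      also have "(\<Sum>a\<in>A'. y a * M a c) = (\<Sum>a\<in>A'. x a * M a c)"
        using fA(3) by (intro sum.cong) (auto simp: y_def)
      finally show ?thesis by (simp add: y_def)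
    qed
    have "(\<Sum>a\<in>A. y a * M a c) = 0" if "c \<in> insert b B" for c
    proof (cases "c = b")
      case True
      then show ?thesis unfolding sum using a0(2) by (simp add: s_def)
    next
      case False
      define d where "d = M a0 c / M a0 b"
      have "0 = (\<Sum>a\<in>A'. x a * M' a c)" using x(2) that False by simp
      also have "\<dots> = (\<Sum>a\<in>A'. x a * M a c - x a * M a b * d)"
        unfolding M'_def d_def by (intro sum.cong) (auto simp: right_diff_distrib)
      also have "\<dots> = (\<Sum>a\<in>A'. x a * M a c) - s * d"
        unfolding s_def by (simp add: sum_subtractf sum_distrib_right)
      finally show ?thesis unfolding sum d_def by simp
    qed
    moreover have "\<exists>a\<in>A. y a \<noteq> 0" using x(1) fA unfolding y_def by auto
    ultimately show ?thesis by blast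
  qed
qed

text \<open>If \<open>S\<close> were larger, expressing its members through \<open>T\<close> modulo
  \<open>B\<close> would give a nontrivial relation, against the uniqueness of the coefficients of
  0.\<close>

lemma quotient_basis_card_le:
  assumes B: "lincomb_closed B" and Z: "(\<lambda>x. 0) \<in> Z"
    and S: "quotient_basis Z B S" and T: "quotient_basis Z B T"
  shows "card S \<le> card T"
proof (rule ccontr)
  assume "\<not> card S \<le> card T"
  have fin: "finite S" "finite T" "S \<subseteq> Z" using S T unfolding quotient_basis_def by auto
  have "\<forall>s\<in>S. \<exists>u. u \<in> extensional T \<and> (\<lambda>x. s x - (\<Sum>t\<in>T. u t * t x)) \<in> B"
  proof
    fix s assume "s \<in> S"
    then have "s \<in> Z" using fin(3) by blast
    then show "\<exists>u. u \<in> extensional T \<and> (\<lambda>x. s x - (\<Sum>t\<in>T. u t * t x)) \<in> B"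
      using T unfolding quotient_basis_def by (meson ex1_implies_ex)
  qed
  from bchoice[OF this] obtain u where u: "\<And>s. s \<in> S \<Longrightarrow> (\<lambda>x. s x - (\<Sum>t\<in>T. u s t * t x)) \<in> B" by blast
  obtain x where x: "\<exists>s\<in>S. x s \<noteq> 0" "\<And>t. t \<in> T \<Longrightarrow> (\<Sum>s\<in>S. x s * u s t) = 0"
    using homogeneous_system[OF fin(2,1), of u] \<open>\<not> card S \<le> card T\<close> by auto
  have "(\<lambda>y. \<Sum>s\<in>S. x s * (s y - (\<Sum>t\<in>T. u s t * t y))) \<in> B"
    by (rule lincomb_closed_sum[OF B fin(1) u])
  moreover have "(\<Sum>s\<in>S. x s * (s y - (\<Sum>t\<in>T. u s t * t y))) = (\<Sum>s\<in>S. x s * s y)" for y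
  proof -
    have "(\<Sum>s\<in>S. x s * (s y - (\<Sum>t\<in>T. u s t * t y))) = (\<Sum>s\<in>S. x s * s y) - (\<Sum>s\<in>S. \<Sum>t\<in>T. x s * u s t * t y)"
      by (simp add: right_diff_distrib sum_subtractf sum_distrib_left mult.assoc)
    also have "(\<Sum>s\<in>S. \<Sum>t\<in>T. x s * u s t * t y) = (\<Sum>t\<in>T. (\<Sum>s\<in>S. x s * u s t) * t y)"
      by (subst sum.swap) (simp add: sum_distrib_right)
    also have "\<dots> = 0" using x(2) by simp
    finally show ?thesis by simp
  qed
  ultimately have "(\<lambda>y. \<Sum>s\<in>S. x s * s y) \<in> B" by simp
  from lincomb_closedD(2)[OF B this this, of "-1" 0]
  have "(\<lambda>y. 0 - (\<Sum>s\<in>S. x s * s y)) \<in> B" by simp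
  \<comment> \<open>Uniqueness is available only for families in \<open>extensional S\<close>, hence
    the restriction.\<close>
  then have 1: "(\<lambda>y. 0 - (\<Sum>s\<in>S. restrict x S s * s y)) \<in> B" by (simp cong: sum.cong)
  have 2: "(\<lambda>y. 0 - (\<Sum>s\<in>S. restrict (\<lambda>s. 0) S s * s y)) \<in> B"
    using lincomb_closedD(1)[OF B] by (simp cong: sum.cong)
  have "\<forall>z\<in>Z. \<exists>!v. v \<in> extensional S \<and> (\<lambda>y. z y - (\<Sum>s\<in>S. v s * s y)) \<in> B"
    using S unfolding quotient_basis_def by blast
  from bspec[OF this Z] have "\<exists>!v. v \<in> extensional S \<and> (\<lambda>y. 0 - (\<Sum>s\<in>S. v s * s y)) \<in> B" .
  then obtain v where v: "\<And>w. w \<in> extensional S \<Longrightarrow> (\<lambda>y. 0 - (\<Sum>s\<in>S. w s * s y)) \<in> B \<Longrightarrow> w = v"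
    unfolding Ex1_def by blast
  have "restrict x S = restrict (\<lambda>s. 0) S"
    using v[OF restrict_extensional 1] v[OF restrict_extensional 2] by (rule trans[OF _ sym])
  then have "restrict x S s = restrict (\<lambda>s. 0) S s" for s by (rule fun_cong)
  then have "x s = 0" if "s \<in> S" for s using that by (metis restrict_apply')
  then show False using x(1) by blast
qed

lemma quotient_dim_eq:
  assumes "lincomb_closed B" "(\<lambda>x. 0) \<in> Z" "quotient_basis Z B S"
  shows "quotient_dim Z B = enat (card S)"
proof -
  have "enat (card T) = enat (card S)" if "quotient_basis Z B T" for T
    using quotient_basis_card_le[OF assms(1,2) that assms(3)] quotient_basis_card_le[OF assms(1,2) assms(3) that] by simp
  then have "(\<lambda>S. enat (card S)) ` {S. quotient_basis Z B S} \<subseteq> {enat (card S)}" by (simp add: image_subset_iff)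
  moreover have "enat (card S) \<in> (\<lambda>S. enat (card S)) ` {S. quotient_basis Z B S}"
    using assms(3) by (intro imageI CollectI)
  ultimately have "(\<lambda>S. enat (card S)) ` {S. quotient_basis Z B S} = {enat (card S)}"
    by (intro equalityI) simp_all
  then show ?thesis unfolding quotient_dim_def by (simp only: cInf_singleton)
qed

text \<open>Splits off one coordinate: either all members vanish at \<open>k\<close>, or any
  \<open>v0\<close> with \<open>v0 k \<noteq> 0\<close> completes a basis of those that do.\<close>

lemma finite_quotient_basis_exists:
  assumes "finite K" "lincomb_closed V" "\<And>v. v \<in> V \<Longrightarrow> (\<And>k. k \<in> K \<Longrightarrow> v k = 0) \<Longrightarrow> v = (\<lambda>x. 0)"
  shows "\<exists>S. quotient_basis V {\<lambda>x. 0} S"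
  using assms
proof (induction K arbitrary: V rule: finite_induct)
  case empty
  then have "quotient_basis V {\<lambda>x. 0} {}"
    unfolding quotient_basis_def by (auto simp: extensional_def)
  then show ?case by blast
next
  case (insert k K)
  define V' where "V' = {v \<in> V. v k = 0}"
  have "lincomb_closed V'" unfolding lincomb_closed_def V'_def
    using lincomb_closedD[OF insert.prems(1)] by auto
  moreover have "v = (\<lambda>x. 0)" if "v \<in> V'" "\<And>k. k \<in> K \<Longrightarrow> v k = 0" for v
    using insert.prems(2)[of v] that unfolding V'_def by auto
  ultimately obtain S where S: "quotient_basis V' {\<lambda>x. 0} S" using insert.IH by blast
  show ?case
  proof (cases "V' = V")
    case True
    then show ?thesis using S by blast
  next
    case False
    then obtain v0 where v0: "v0 \<in> V" "v0 k \<noteq> 0" unfolding V'_def by blast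
    have fS: "finite S" "S \<subseteq> V'" using S unfolding quotient_basis_def by auto
    have v0S: "v0 \<notin> S" using v0 fS(2) unfolding V'_def by blast
    have Sk: "v k = 0" if "v \<in> S" for v using that fS(2) unfolding V'_def by blast
    have "\<exists>!u. u \<in> extensional (insert v0 S) \<and> (\<lambda>x. z x - (\<Sum>v\<in>insert v0 S. u v * v x)) \<in> {\<lambda>x. 0}" if z: "z \<in> V" for z
    proof -
      define c where "c = z k / v0 k"
      define z' where "z' = (\<lambda>x. 1 * z x + (- c) * v0 x)"
      have "z' \<in> V" unfolding z'_def by (rule lincomb_closedD(2)[OF insert.prems(1) z v0(1)])
      moreover have "z' k = 0" unfolding z'_def c_def using v0(2) by simp
      ultimately have "z' \<in> V'" unfolding V'_def by blast
      then have ex1: "\<exists>!u. u \<in> extensional S \<and> (\<lambda>x. z' x - (\<Sum>v\<in>S. u v * v x)) \<in> {\<lambda>x. 0}"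
        using S unfolding quotient_basis_def by blast
      then obtain u where u: "u \<in> extensional S" "\<And>x. z' x = (\<Sum>v\<in>S. u v * v x)"
        by (auto simp: fun_eq_iff)
      have split: "(\<Sum>v\<in>insert v0 S. w v * v x) = w v0 * v0 x + (\<Sum>v\<in>S. w v * v x)" for w x
        using fS(1) v0S by simp
      show ?thesis
      proof (rule ex1I[of _ "u(v0 := c)"])
        have "(\<Sum>v\<in>S. (u(v0 := c)) v * v x) = (\<Sum>v\<in>S. u v * v x)" for x
          using v0S by (intro sum.cong) auto
        then show "u(v0 := c) \<in> extensional (insert v0 S) \<and>
          (\<lambda>x. z x - (\<Sum>v\<in>insert v0 S. (u(v0 := c)) v * v x)) \<in> {\<lambda>x. 0}"
          unfolding split using u by (auto simp: extensional_def z'_def fun_eq_iff algebra_simps)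
      next
        fix w assume w: "w \<in> extensional (insert v0 S) \<and>
          (\<lambda>x. z x - (\<Sum>v\<in>insert v0 S. w v * v x)) \<in> {\<lambda>x. 0}"
        then have wz: "z x = w v0 * v0 x + (\<Sum>v\<in>S. w v * v x)" for x unfolding split by (auto simp: fun_eq_iff)
        have "(\<Sum>v\<in>S. w v * v k) = 0" by (intro sum.neutral ballI) (simp add: Sk)
        then have w0: "w v0 = c" using wz[of k] v0(2) unfolding c_def by simp
        have "z' x - (\<Sum>v\<in>S. restrict w S v * v x) = 0" for x
          using wz[of x] w0 unfolding z'_def by (simp cong: sum.cong)
        then have rw: "(\<lambda>x. z' x - (\<Sum>v\<in>S. restrict w S v * v x)) \<in> {\<lambda>x. 0}" by blast
        have ru: "(\<lambda>x. z' x - (\<Sum>v\<in>S. u v * v x)) \<in> {\<lambda>x. 0}" using u(2) by simp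
        obtain u' where u': "\<And>w. w \<in> extensional S \<Longrightarrow> (\<lambda>x. z' x - (\<Sum>v\<in>S. w v * v x)) \<in> {\<lambda>x. 0} \<Longrightarrow> w = u'"
          using ex1 unfolding Ex1_def by blast
        have "restrict w S = u" using u'[OF restrict_extensional rw] u'[OF u(1) ru] by (rule trans[OF _ sym])
        have wu: "w v = u v" if "v \<in> S" for v
          using fun_cong[OF \<open>restrict w S = u\<close>, of v] that by (simp only: restrict_apply')
        show "w = u(v0 := c)"
        proof (rule ext)
          fix v show "w v = (u(v0 := c)) v"
          proof (cases "v = v0 \<or> v \<in> S")
            case True
            then show ?thesis using w0 wu v0S by auto
          next
            case False
            then show ?thesis using w u(1) by (simp add: extensional_def)
          qed
        qed
      qed
    qed
    then have "quotient_basis V {\<lambda>x. 0} (insert v0 S)"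
      unfolding quotient_basis_def using fS v0 unfolding V'_def by blast
    then show ?thesis by blast
  qed
qed

section \<open>Counting the first cohomology by a basis of classes\<close>

lemma sing_coboundary_lincomb:
  "sing_coboundary p X (\<lambda>f. r * c f + s * d f) = (\<lambda>f. r * sing_coboundary p X c f + s * sing_coboundary p X d f)"
  unfolding sing_coboundary_def cochain_eval_def
  by (rule ext) (simp add: sum_distrib_left sum.distrib algebra_simps)

lemma lincomb_closed_coboundaries: "lincomb_closed (reduced_sing_coboundaries 1 X)"
proof -
  have "(\<lambda>f. 0) = sing_coboundary 0 X (\<lambda>f. 0)"
    unfolding sing_coboundary_def cochain_eval_def by auto
  moreover have "(\<lambda>f. 0) \<in> sing_cochains 0 X" unfolding sing_cochains_def by auto
  moreover have "(\<lambda>x. p * sing_coboundary 0 X c x + q * sing_coboundary 0 X d x) \<in> sing_coboundary 0 X ` sing_cochains 0 X"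
    if "c \<in> sing_cochains 0 X" "d \<in> sing_cochains 0 X" for p q c d
    unfolding sing_coboundary_lincomb[symmetric] using that unfolding sing_cochains_def by (intro imageI) auto
  ultimately show ?thesis unfolding lincomb_closed_def by auto
qed

lemma zero_sing_cocycle: "(\<lambda>f. 0) \<in> sing_cocycles p X"
  unfolding sing_cocycles_def sing_cochains_def sing_coboundary_def cochain_eval_def by auto

text \<open>\<open>sing_of\<close> is onto the cocycles and detects exactness, so a family that is
  spanning and independent modulo exact functions becomes a basis of singular cohomology.\<close>

lemma reduced_cohomology_dim_1_eq:
  fixes U :: "'a::real_normed_vector set"
  assumes U: "open U" and K: "finite K" and \<psi>: "\<And>i. i \<in> K \<Longrightarrow> cocycle_on U (\<psi> i)"
    and ex: "\<And>z. cocycle_on U z \<Longrightarrow> \<exists>k. exact_on U (\<lambda>a b. z a b - (\<Sum>i\<in>K. k i * \<psi> i a b))"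
    and indep: "\<And>k i. exact_on U (\<lambda>a b. \<Sum>i\<in>K. k i * \<psi> i a b) \<Longrightarrow> i \<in> K \<Longrightarrow> k i = 0"
  shows "reduced_cohomology_dim 1 (top_of_set U) = enat (card K)"
proof -
  define B where "B = reduced_sing_coboundaries 1 (top_of_set U)"
  define \<sigma> where "\<sigma> = (\<lambda>i. sing_of U (\<psi> i))"
  have Bl: "lincomb_closed B" unfolding B_def by (rule lincomb_closed_coboundaries)
  have so: "sing_of U (\<lambda>a b. z a b - (\<Sum>i\<in>K. k i * \<psi> i a b)) = (\<lambda>f. sing_of U z f - (\<Sum>i\<in>K. k i * \<sigma> i f))"
    if "cocycle_on U z" for z k
  proof -
    have c: "cocycle_on U (\<lambda>a b. \<Sum>i\<in>K. k i * \<psi> i a b)" using \<psi> by (intro cocycle_on_sum cocycle_on_scale)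
    show ?thesis using sing_of_lincomb[OF that c, of 1 "-1"] sing_of_sum[OF K \<psi>, where c=k] unfolding \<sigma>_def by simp
  qed
  have key: "(\<lambda>f. sing_of U z f - (\<Sum>i\<in>K. k i * \<sigma> i f)) \<in> B \<longleftrightarrow> exact_on U (\<lambda>a b. z a b - (\<Sum>i\<in>K. k i * \<psi> i a b))"
    if "cocycle_on U z" for z k
    unfolding so[OF that, symmetric] B_def
    using that \<psi> by (intro sing_of_coboundary_iff[OF U] cocycle_on_diff cocycle_on_sum cocycle_on_scale)
  have unique: "k i = k' i" if i: "i \<in> K" and e: "exact_on U (\<lambda>a b. z a b - (\<Sum>i\<in>K. k i * \<psi> i a b))"
      "exact_on U (\<lambda>a b. z a b - (\<Sum>i\<in>K. k' i * \<psi> i a b))" for z k k' i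
  proof -
    have "exact_on U (\<lambda>a b. \<Sum>i\<in>K. (k' i - k i) * \<psi> i a b)"
      by (rule exact_on_eq[OF exact_on_diff[OF e]]) (simp add: sum_subtractf left_diff_distrib)
    from indep[OF this i] show ?thesis by simp
  qed
  \<comment> \<open>A \<open>quotient_basis\<close> is a set, so distinct indices must give distinct
    cochains before the cardinality of \<open>K\<close> can be used.\<close>
  have inj: "inj_on \<sigma> K"
  proof (rule inj_onI, rule ccontr)
    fix i j assume ij: "i \<in> K" "j \<in> K" "\<sigma> i = \<sigma> j" "i \<noteq> j"
    define k where "k = (\<lambda>m. if m = i then 1 else 0 :: rat)"
    have s: "(\<Sum>m\<in>K. k m * \<sigma> m f) = \<sigma> i f" for f unfolding k_def using K ij(1) by (simp add: if_distrib[of "\<lambda>x. x * _"] cong: if_cong)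
    have "(\<lambda>f. sing_of U (\<psi> i) f - (\<Sum>m\<in>K. k m * \<sigma> m f)) \<in> B"
      "(\<lambda>f. sing_of U (\<psi> j) f - (\<Sum>m\<in>K. k m * \<sigma> m f)) \<in> B"
      unfolding s using lincomb_closedD(1)[OF Bl] ij(3) unfolding \<sigma>_def by simp_all
    then have e: "exact_on U (\<lambda>a b. \<psi> j a b - (\<Sum>m\<in>K. k m * \<psi> m a b))" using key \<psi> ij by blast
    define k' where "k' = (\<lambda>m. if m = j then 1 else 0 :: rat)"
    have "(\<Sum>m\<in>K. k' m * \<psi> m a b) = \<psi> j a b" for a b
      unfolding k'_def using K ij(2) by (simp add: if_distrib[of "\<lambda>x. x * _"] cong: if_cong)
    then have "exact_on U (\<lambda>a b. \<psi> j a b - (\<Sum>m\<in>K. k' m * \<psi> m a b))" using exact_on_zero by simp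
    then have "k i = k' i" using unique[OF ij(1) e] by blast
    then show False unfolding k_def k'_def using ij(4) by simp
  qed
  have "quotient_basis (sing_cocycles 1 (top_of_set U)) B (\<sigma> ` K)"
    unfolding quotient_basis_def
  proof (intro conjI ballI)
    show "finite (\<sigma> ` K)" using K by simp
    show "\<sigma> ` K \<subseteq> sing_cocycles 1 (top_of_set U)" unfolding \<sigma>_def using sing_of_in_cocycles \<psi> by blast
    fix c assume "c \<in> sing_cocycles 1 (top_of_set U)"
    then obtain z where z: "cocycle_on U z" "sing_of U z = c" using sing_of_surj[OF U] by blast
    obtain k where k: "exact_on U (\<lambda>a b. z a b - (\<Sum>i\<in>K. k i * \<psi> i a b))" using ex[OF z(1)] by blast
    have re: "(\<Sum>v\<in>\<sigma> ` K. u v * v x) = (\<Sum>i\<in>K. u (\<sigma> i) * \<sigma> i x)" for u x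
      by (simp add: sum.reindex[OF inj])
    define u where "u = restrict (\<lambda>v. k (the_inv_into K \<sigma> v)) (\<sigma> ` K)"
    have u: "u (\<sigma> i) = k i" if "i \<in> K" for i unfolding u_def using that the_inv_into_f_f[OF inj that] by simp
    show "\<exists>!u. u \<in> extensional (\<sigma> ` K) \<and> (\<lambda>x. c x - (\<Sum>v\<in>\<sigma> ` K. u v * v x)) \<in> B"
      unfolding re
    proof (rule ex1I[of _ u])
      have "(\<lambda>x. c x - (\<Sum>i\<in>K. u (\<sigma> i) * \<sigma> i x)) = (\<lambda>x. sing_of U z x - (\<Sum>i\<in>K. k i * \<sigma> i x))"
        using u z(2) by (simp cong: sum.cong)
      then show "u \<in> extensional (\<sigma> ` K) \<and> (\<lambda>x. c x - (\<Sum>i\<in>K. u (\<sigma> i) * \<sigma> i x)) \<in> B"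
        using key[OF z(1), of k] k unfolding u_def by simp
    next
      fix w assume w: "w \<in> extensional (\<sigma> ` K) \<and> (\<lambda>x. c x - (\<Sum>i\<in>K. w (\<sigma> i) * \<sigma> i x)) \<in> B"
      then have ew: "exact_on U (\<lambda>a b. z a b - (\<Sum>i\<in>K. w (\<sigma> i) * \<psi> i a b))"
        using key[OF z(1), of "\<lambda>i. w (\<sigma> i)"] z(2) by simp
      have "w (\<sigma> i) = u (\<sigma> i)" if "i \<in> K" for i using unique[OF that ew k] u[OF that] by simp
      then show "w = u" using w unfolding u_def by (intro extensionalityI[of _ "\<sigma> ` K"]) auto
    qed
  qed
  from quotient_dim_eq[OF Bl zero_sing_cocycle this] show ?thesis
    unfolding reduced_cohomology_dim_def B_def[symmetric] using card_image[OF inj] by simp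
qed

context framed_planes
begin

text \<open>The classes are separated in three stages: base weights see only \<open>wind\<close>,
  lower jumps only the line classes, and the differences of upper and lower jumps only the cycle
  classes.\<close>

lemma cohomology_dim:
  fixes E :: "'e set" and c :: "'e \<Rightarrow> (real^4) set \<Rightarrow> (real^4) set \<Rightarrow> rat"
  assumes E: "finite E"
    and cyc: "\<And>e l. e \<in> E \<Longrightarrow> l \<in> \<L> \<Longrightarrow> (\<Sum>S\<in>planes_thr l. c e S l) = 0"
      "\<And>e S. e \<in> E \<Longrightarrow> S \<in> \<P> \<Longrightarrow> (\<Sum>l\<in>lines_in S. c e S l) = 0"
    and span: "\<And>u. (\<And>l. l \<in> \<L> \<Longrightarrow> (\<Sum>S\<in>planes_thr l. u S l) = 0) \<Longrightarrow> (\<And>S. S \<in> \<P> \<Longrightarrow> (\<Sum>l\<in>lines_in S. u S l) = 0)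
       \<Longrightarrow> \<exists>k. \<forall>S\<in>\<P>. \<forall>l\<in>lines_in S. u S l = (\<Sum>e\<in>E. k e * c e S l)"
    and indep: "\<And>k e. (\<And>S l. S \<in> \<P> \<Longrightarrow> l \<in> lines_in S \<Longrightarrow> (\<Sum>e\<in>E. k e * c e S l) = 0) \<Longrightarrow> e \<in> E \<Longrightarrow> k e = 0"
  shows "reduced_cohomology_dim 1 (top_of_set U) = enat (card \<P> + card free_incidences + card E)"
proof -
  have "\<forall>e\<in>E. \<exists>C. cocycle_on U C \<and> (\<forall>S\<in>\<P>. base_wt C S = 0) \<and>
     (\<forall>S\<in>\<P>. \<forall>l\<in>lines_in S. jump 1 C S l = c e S l \<and> jump (-1) C S l = 0)"
  proof
    fix e assume e: "e \<in> E"
    obtain C where "cocycle_on U C" "\<And>S. S \<in> \<P> \<Longrightarrow> base_wt C S = 0"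
      "\<And>S l. S \<in> \<P> \<Longrightarrow> l \<in> lines_in S \<Longrightarrow> jump 1 C S l = c e S l"
      "\<And>S l. S \<in> \<P> \<Longrightarrow> l \<in> lines_in S \<Longrightarrow> jump (-1) C S l = 0"
      using cycle_class_exists[OF cyc[OF e]] by blast
    then show "\<exists>C. cocycle_on U C \<and> (\<forall>S\<in>\<P>. base_wt C S = 0) \<and>
     (\<forall>S\<in>\<P>. \<forall>l\<in>lines_in S. jump 1 C S l = c e S l \<and> jump (-1) C S l = 0)" by blast
  qed
  from bchoice[OF this] obtain C where C: "\<And>e. e \<in> E \<Longrightarrow> cocycle_on U (C e)"
    "\<And>e S. e \<in> E \<Longrightarrow> S \<in> \<P> \<Longrightarrow> base_wt (C e) S = 0"
    "\<And>e S l. e \<in> E \<Longrightarrow> S \<in> \<P> \<Longrightarrow> l \<in> lines_in S \<Longrightarrow> jump 1 (C e) S l = c e S l"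
    "\<And>e S l. e \<in> E \<Longrightarrow> S \<in> \<P> \<Longrightarrow> l \<in> lines_in S \<Longrightarrow> jump (-1) (C e) S l = 0" by blast
  define \<psi> where "\<psi> = case_sum wind (case_sum line_class C)"
  define K where "K = \<P> <+> (free_incidences <+> E)"
  have fin: "finite \<P>" "finite free_incidences" "finite E" using finite_P finite_incidences E by auto
  have K: "finite K" unfolding K_def using fin by simp
  have cardK: "card K = card \<P> + card free_incidences + card E"
    unfolding K_def using fin by (simp add: card_Plus)
  have \<psi>: "cocycle_on U (\<psi> i)" if "i \<in> K" for i
    using that wind_cocycle line_class_cocycle C(1) unfolding K_def \<psi>_def by auto
  have sumK: "(\<Sum>i\<in>K. g i) = (\<Sum>S\<in>\<P>. g (Inl S)) + ((\<Sum>j\<in>free_incidences. g (Inr (Inl j))) + (\<Sum>e\<in>E. g (Inr (Inr e))))"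
    for g :: "_ \<Rightarrow> rat"
    unfolding K_def using fin by (simp add: sum.Plus)
  have one: "(1::real) \<in> {1,-1}" "(-1::real) \<in> {1,-1}" by auto
  define Z where "Z = (\<lambda>k a b. \<Sum>i\<in>K. k i * \<psi> i a b)"
  have Zc: "cocycle_on U (Z k)" for k unfolding Z_def using \<psi> by (intro cocycle_on_sum cocycle_on_scale)
  have Zb: "base_wt (Z k) S = k (Inl S)" if S: "S \<in> \<P>" for k S
  proof -
    have "base_wt (Z k) S = (\<Sum>i\<in>K. k i * base_wt (\<psi> i) S)" unfolding Z_def by (rule base_wt_sum[OF K \<psi> S])
    also have "\<dots> = (\<Sum>A\<in>\<P>. k (Inl A) * base_wt (wind A) S) + ((\<Sum>j\<in>free_incidences. k (Inr (Inl j)) * base_wt (line_class j) S)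
        + (\<Sum>e\<in>E. k (Inr (Inr e)) * base_wt (C e) S))" unfolding sumK \<psi>_def by simp
    also have "(\<Sum>j\<in>free_incidences. k (Inr (Inl j)) * base_wt (line_class j) S) = 0"
      using base_wt_line_class[OF _ S] by simp
    also have "(\<Sum>e\<in>E. k (Inr (Inr e)) * base_wt (C e) S) = 0" using C(2)[OF _ S] by simp
    also have "(\<Sum>A\<in>\<P>. k (Inl A) * base_wt (wind A) S) = (\<Sum>A\<in>\<P>. if S = A then k (Inl A) else 0)"
      using base_wt_wind[OF _ S] by (intro sum.cong) auto
    also have "\<dots> = k (Inl S)" using S fin(1) by simp
    finally show ?thesis by simp
  qed
  have Zj: "jump s (Z k) S l = (\<Sum>j\<in>free_incidences. k (Inr (Inl j)) * jump s (line_class j) S l)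
      + (\<Sum>e\<in>E. k (Inr (Inr e)) * jump s (C e) S l)" if S: "S \<in> \<P>" "l \<in> lines_in S" "s \<in> {1,-1}" for k S l s
  proof -
    have "jump s (Z k) S l = (\<Sum>i\<in>K. k i * jump s (\<psi> i) S l)" unfolding Z_def by (rule jump_sum[OF K \<psi> S])
    also have "\<dots> = (\<Sum>A\<in>\<P>. k (Inl A) * jump s (wind A) S l) + ((\<Sum>j\<in>free_incidences. k (Inr (Inl j)) * jump s (line_class j) S l)
        + (\<Sum>e\<in>E. k (Inr (Inr e)) * jump s (C e) S l))" unfolding sumK \<psi>_def by simp
    also have "(\<Sum>A\<in>\<P>. k (Inl A) * jump s (wind A) S l) = 0" using jump_wind[OF _ S] by simp
    finally show ?thesis by simp
  qed
  have Zl: "(\<Sum>j\<in>free_incidences. k (Inr (Inl j)) * jump s (line_class j) S l)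
     = (if S = ref_plane l then - (\<Sum>A\<in>planes_thr l - {ref_plane l}. k (Inr (Inl (A,l)))) else k (Inr (Inl (S,l))))"
    if S: "S \<in> \<P>" "l \<in> lines_in S" "s \<in> {1,-1}" for k :: "_ \<Rightarrow> rat" and S l s
  proof -
    have "(\<Sum>j\<in>free_incidences. k (Inr (Inl j)) * jump s (line_class j) S l) = jump s (\<lambda>x y. \<Sum>j\<in>free_incidences. k (Inr (Inl j)) * line_class j x y) S l"
      by (rule jump_sum[OF fin(2) line_class_cocycle S, symmetric])
    then show ?thesis unfolding jump_line_sum'[OF S] .
  qed
  have Zm: "jump (-1) (Z k) S l = (if S = ref_plane l then - (\<Sum>A\<in>planes_thr l - {ref_plane l}. k (Inr (Inl (A,l)))) else k (Inr (Inl (S,l))))"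
    if S: "S \<in> \<P>" "l \<in> lines_in S" for k S l
  proof -
    have "(\<Sum>e\<in>E. k (Inr (Inr e)) * jump (-1) (C e) S l) = 0" using C(4)[OF _ S] by simp
    then show ?thesis unfolding Zj[OF S one(2)] Zl[OF S one(2)] by simp
  qed
  have Zd: "jump 1 (Z k) S l - jump (-1) (Z k) S l = (\<Sum>e\<in>E. k (Inr (Inr e)) * c e S l)"
    if S: "S \<in> \<P>" "l \<in> lines_in S" for k S l
  proof -
    have "(\<Sum>e\<in>E. k (Inr (Inr e)) * jump 1 (C e) S l) = (\<Sum>e\<in>E. k (Inr (Inr e)) * c e S l)"
      using C(3)[OF _ S] by (intro sum.cong) auto
    then show ?thesis unfolding Zm[OF S] unfolding Zj[OF S one(1)] Zl[OF S one(1)] by simp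
  qed
  have "reduced_cohomology_dim 1 (top_of_set U) = enat (card K)"
  proof (rule reduced_cohomology_dim_1_eq[OF open_U K \<psi>])
    fix z assume z: "cocycle_on U z"
    \<comment> \<open>The Kirchhoff law holds at both halves, and in each plane both halves have the
      same sum of jumps; so the difference satisfies the cycle conditions.\<close>
    define u where "u = (\<lambda>S l. jump 1 z S l - jump (-1) z S l)"
    have "(\<Sum>S\<in>planes_thr l. u S l) = 0" if "l \<in> \<L>" for l
      unfolding u_def sum_subtractf using kirchhoff[OF z that one(1)] kirchhoff[OF z that one(2)] by simp
    moreover have "(\<Sum>l\<in>lines_in S. u S l) = 0" if "S \<in> \<P>" for S
      unfolding u_def sum_subtractf using sum_jumps_eq[OF z that] by simp
    ultimately obtain k0 where k0: "\<And>S l. S \<in> \<P> \<Longrightarrow> l \<in> lines_in S \<Longrightarrow> u S l = (\<Sum>e\<in>E. k0 e * c e S l)"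
      using span[of u] by blast
    \<comment> \<open>The coefficients are the values of the separating invariants; at the reference
      plane the lower jumps then agree by the Kirchhoff law.\<close>
    define k where "k = case_sum (base_wt z) (case_sum (\<lambda>(S,l). jump (-1) z S l) k0)"
    have jm: "jump (-1) (Z k) S l = jump (-1) z S l" if S: "S \<in> \<P>" "l \<in> lines_in S" for S l
    proof (cases "S = ref_plane l")
      case True
      have l: "l \<in> \<L>" using S(2) unfolding lines_in_def by blast
      have "(\<Sum>A\<in>planes_thr l. jump (-1) z A l) = jump (-1) z (ref_plane l) l + (\<Sum>A\<in>planes_thr l - {ref_plane l}. jump (-1) z A l)"
        using sum.remove[OF finite_planes_thr ref_plane[OF l]] .
      then show ?thesis unfolding Zm[OF S] using True kirchhoff[OF z l one(2)] unfolding k_def by simp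
    qed (use Zm[OF S, of k] in \<open>simp add: k_def\<close>)
    have "exact_on U (\<lambda>a b. z a b - Z k a b)"
    proof (rule exact_if_base_wt_jump_zero)
      show "cocycle_on U (\<lambda>a b. z a b - Z k a b)" by (rule cocycle_on_diff[OF z Zc])
      fix S assume S: "S \<in> \<P>"
      show "base_wt (\<lambda>a b. z a b - Z k a b) S = 0"
        unfolding base_wt_diff[OF z Zc S] Zb[OF S] by (simp add: k_def)
      fix s :: real and l assume s: "s \<in> {1,-1}" and l: "l \<in> lines_in S"
      have "jump 1 (Z k) S l = jump 1 z S l"
        using Zd[OF S l, of k] jm[OF S l] k0[OF S l] unfolding u_def k_def by simp
      then show "jump s (\<lambda>a b. z a b - Z k a b) S l = 0"
        unfolding jump_diff[OF z Zc S l s] using jm[OF S l] s by auto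
    qed
    then show "\<exists>k. exact_on U (\<lambda>a b. z a b - (\<Sum>i\<in>K. k i * \<psi> i a b))" unfolding Z_def by blast
  next
    fix k i assume ex: "exact_on U (\<lambda>a b. \<Sum>i\<in>K. k i * \<psi> i a b)" and i: "i \<in> K"
    then have ex: "exact_on U (Z k)" unfolding Z_def by simp
    have j0: "jump s (Z k) S l = 0" if "S \<in> \<P>" "l \<in> lines_in S" "s \<in> {1,-1}" for S l s
      using base_wt_jump_exact(2)[OF ex that(1,2,3)] .
    consider S where "S \<in> \<P>" "i = Inl S" | S l where "(S,l) \<in> free_incidences" "i = Inr (Inl (S,l))" | e where "e \<in> E" "i = Inr (Inr e)"
      using i unfolding K_def by auto
    then show "k i = 0"
    proof cases
      case 1
      then show ?thesis using Zb[OF 1(1), of k] base_wt_jump_exact(1)[OF ex 1(1)] by simp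
    next
      case 2
      have S: "S \<in> \<P>" "l \<in> lines_in S" "S \<noteq> ref_plane l"
        using 2(1) unfolding free_incidences_def planes_thr_def lines_in_def by auto
      then show ?thesis using Zm[OF S(1,2), of k] j0[OF S(1,2) one(2)] 2(2) by simp
    next
      case 3
      have "(\<Sum>e\<in>E. k (Inr (Inr e)) * c e S l) = 0" if "S \<in> \<P>" "l \<in> lines_in S" for S l
        using Zd[OF that, of k] j0[OF that] by simp
      then show ?thesis using indep[of "\<lambda>e. k (Inr (Inr e))" e] 3 by simp
    qed
  qed
  then show ?thesis unfolding cardK .
qed

text \<open>Each line has its reference plane, so removing one plane per line never
  truncates.\<close>

lemma card_free_incidences:
  "card free_incidences + card \<L> = (\<Sum>l\<in>\<L>. card (planes_thr l))"
proof -
  have "free_incidences = (\<Union>l\<in>\<L>. (\<lambda>S. (S,l)) ` (planes_thr l - {ref_plane l}))"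
    unfolding free_incidences_def by auto
  then have "card free_incidences = (\<Sum>l\<in>\<L>. card ((\<lambda>S. (S,l)) ` (planes_thr l - {ref_plane l})))"
    using finite_L finite_planes_thr by (simp add: card_UN_disjoint disjoint_iff image_iff)
  also have "\<dots> = (\<Sum>l\<in>\<L>. card (planes_thr l) - 1)"
    using ref_plane by (intro sum.cong) (auto simp: card_image inj_on_def card_Diff_singleton)
  finally have "card free_incidences + card \<L> = (\<Sum>l\<in>\<L>. card (planes_thr l) - 1) + (\<Sum>l\<in>\<L>. 1)" by simp
  also have "\<dots> = (\<Sum>l\<in>\<L>. card (planes_thr l))"
    unfolding sum.distrib[symmetric]
  proof (rule sum.cong[OF refl])
    fix l assume "l \<in> \<L>"
    then have "card (planes_thr l) > 0" using ref_plane finite_planes_thr card_gt_0_iff by blast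
    then show "card (planes_thr l) - 1 + 1 = card (planes_thr l)" by simp
  qed
  finally show ?thesis .
qed

end

context framed_planes
begin

section \<open>Homology of the order complex\<close>

lemma plane_subset_eq: "S \<in> \<P> \<Longrightarrow> T \<in> \<P> \<Longrightarrow> S \<subseteq> T \<Longrightarrow> S = T"
  using regular_r[of S] unfolding regular_def by blast

lemma line_subset_eq: "l \<in> \<L> \<Longrightarrow> m \<in> \<L> \<Longrightarrow> l \<subseteq> m \<Longrightarrow> l = m"
  using line_eq[of l m "q l"] q_in[of l] line(1)[of l] by force

lemma plane_not_subset_line: "S \<in> \<P> \<Longrightarrow> l \<in> \<L> \<Longrightarrow> \<not> S \<subseteq> l"
proof
  assume h: "S \<in> \<P>" "l \<in> \<L>" "S \<subseteq> l"
  then have "r S \<in> l" using regular_r[of S] unfolding regular_def by blast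
  then show False using lineE[OF h(2), of "r S"] frame(2,3)[OF h(1)] by simp
qed

lemma plane_not_line: "S \<in> \<P> \<Longrightarrow> S \<notin> \<L>"
  using plane_not_subset_line by blast

lemma edge_eq_iff:
  assumes "S \<in> \<P>" "T \<in> \<P>" "l \<in> \<L>" "m \<in> \<L>"
  shows "{S,l} = {T,m} \<longleftrightarrow> S = T \<and> l = m"
  using plane_not_line[OF assms(1)] plane_not_line[OF assms(2)] assms(3,4) by (auto simp: doubleton_eq_iff)

section \<open>Order complexes on planes and lines, possibly without a common least element\<close>

context
  fixes V0 :: "(real^4) set set" and m :: "(real^4) set"
  assumes V0: "V0 \<subseteq> \<P> \<union> \<L>" and m_eq: "\<And>x. x \<in> \<P> \<union> \<L> \<Longrightarrow> x \<notin> V0 \<Longrightarrow> x = m"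
    and m_least: "\<And>x. x \<in> \<P> \<union> \<L> \<Longrightarrow> m \<subseteq> x"
begin

abbreviation "\<K> \<equiv> order_complex (\<supset>) V0"

lemma complex_pair:
  assumes "s \<in> \<K>" "x \<in> s" "y \<in> s" "x \<noteq> y"
  shows "(x \<in> \<P> \<and> y \<in> lines_in x) \<or> (y \<in> \<P> \<and> x \<in> lines_in y)"
proof -
  have "s \<subseteq> V0" "x \<supset> y \<or> y \<supset> x"
    using assms unfolding order_complex_def pred_on.chain_def by auto
  then have "x \<in> \<P> \<union> \<L>" "y \<in> \<P> \<union> \<L>" "x \<subset> y \<or> y \<subset> x" using assms V0 by auto
  then show ?thesis using plane_subset_eq line_subset_eq plane_not_subset_line unfolding lines_in_def by blast
qed

text \<open>The incidence graph is bipartite and so has no triangle.\<close>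

lemma complex_card_le: "s \<in> \<K> \<Longrightarrow> card s \<noteq> 3"
proof
  assume s: "s \<in> \<K>" "card s = 3"
  then obtain x y z where xyz: "s = {x,y,z}" "x \<noteq> y" "y \<noteq> z" "x \<noteq> z" by (metis card_3_iff)
  have "(x \<in> \<P> \<and> y \<in> \<L>) \<or> (y \<in> \<P> \<and> x \<in> \<L>)" "(y \<in> \<P> \<and> z \<in> \<L>) \<or> (z \<in> \<P> \<and> y \<in> \<L>)" "(x \<in> \<P> \<and> z \<in> \<L>) \<or> (z \<in> \<P> \<and> x \<in> \<L>)"
    using complex_pair[OF s(1)] xyz unfolding lines_in_def by blast+
  then show False using plane_not_line by blast
qed

lemma complex_edgeE:
  assumes "s \<in> \<K>" "card s = 2"
  obtains S l where "s = {S,l}" "S \<in> \<P>" "l \<in> lines_in S"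
proof -
  obtain x y where xy: "s = {x,y}" "x \<noteq> y" using assms(2) by (meson card_2_iff)
  then have "(x \<in> \<P> \<and> y \<in> lines_in x) \<or> (y \<in> \<P> \<and> x \<in> lines_in y)" using complex_pair[OF assms(1)] by blast
  then show ?thesis using that[of x y] that[of y x] xy(1) by auto
qed

lemma chain_edgeE:
  assumes "c \<in> simplicial_chains \<K> 1" "c s \<noteq> 0"
  obtains S l where "s = {S,l}" "S \<in> \<P>" "l \<in> lines_in S"
proof -
  have "s \<in> \<K>" "card s = 2" using assms unfolding simplicial_chains_def by auto
  then show ?thesis using complex_edgeE that by blast
qed

text \<open>In the order \<open>\<supset>\<close> the plane precedes the line, so the face that
  omits the plane has incidence number 1.\<close>

lemma boundary_at_line:
  assumes c: "c \<in> simplicial_chains \<K> 1" and l: "l \<in> \<L>"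
  shows "simplicial_boundary (\<supset>) c {l} = (\<Sum>S\<in>planes_thr l. c {S,l})"
proof -
  define X where "X = {x. x \<notin> {l} \<and> c (insert x {l}) \<noteq> 0}"
  have X: "x \<in> planes_thr l" if x: "x \<in> X" for x
  proof -
    have cx: "c {x,l} \<noteq> 0" using x unfolding X_def by simp
    obtain S k where S: "{x,l} = {S,k}" "S \<in> \<P>" "k \<in> lines_in S" using chain_edgeE[OF c cx] .
    have "l \<noteq> S" using plane_not_line[OF S(2)] l by blast
    then have "x = S" "l = k" using S(1) by (auto simp: doubleton_eq_iff)
    then show ?thesis using S lines_in_iff[OF S(2)] by simp
  qed
  have "simplicial_boundary (\<supset>) c {l} = (\<Sum>x\<in>X. (-1) ^ card {y \<in> {l}. x \<subset> y} * c (insert x {l}))"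
    unfolding simplicial_boundary_def X_def ..
  also have "\<dots> = (\<Sum>x\<in>X. c {x,l})"
  proof (rule sum.cong[OF refl])
    fix x assume "x \<in> X"
    then have "\<not> x \<subset> l" using X plane_not_subset_line[OF _ l] planes_thrD(1) by blast
    then have "{y \<in> {l}. x \<subset> y} = {}" by blast
    then show "(-1) ^ card {y \<in> {l}. x \<subset> y} * c (insert x {l}) = c {x,l}"
      by (simp only: card.empty power_0 mult_1)
  qed
  also have "\<dots> = (\<Sum>S\<in>planes_thr l. c {S,l})"
  proof (rule sum.mono_neutral_left[OF finite_planes_thr])
    show "X \<subseteq> planes_thr l" using X by blast
    show "\<forall>x\<in>planes_thr l - X. c {x,l} = 0"
      using planes_thrD(1) plane_not_line l unfolding X_def by fastforce
  qed
  finally show ?thesis .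
qed

text \<open>Here the omitted vertex is the line, which has the plane before it; this is the origin
  of the sign.\<close>

lemma boundary_at_plane:
  assumes c: "c \<in> simplicial_chains \<K> 1" and S: "S \<in> \<P>"
  shows "simplicial_boundary (\<supset>) c {S} = - (\<Sum>l\<in>lines_in S. c {S,l})"
proof -
  define X where "X = {x. x \<notin> {S} \<and> c (insert x {S}) \<noteq> 0}"
  have X: "x \<in> lines_in S" if x: "x \<in> X" for x
  proof -
    have cx: "c {x,S} \<noteq> 0" using x unfolding X_def by simp
    obtain T k where T: "{x,S} = {T,k}" "T \<in> \<P>" "k \<in> lines_in T" using chain_edgeE[OF c cx] .
    have "S \<noteq> k" using plane_not_line[OF S] T(3) unfolding lines_in_def by blast
    then have "x = k" "S = T" using T(1) by (auto simp: doubleton_eq_iff)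
    then show ?thesis using T by simp
  qed
  have "simplicial_boundary (\<supset>) c {S} = (\<Sum>x\<in>X. (-1) ^ card {y \<in> {S}. x \<subset> y} * c (insert x {S}))"
    unfolding simplicial_boundary_def X_def ..
  also have "\<dots> = (\<Sum>x\<in>X. - c {S,x})"
  proof (rule sum.cong[OF refl])
    fix x assume x: "x \<in> X"
    have "x \<subset> S" using X[OF x] plane_not_line[OF S] unfolding lines_in_def by blast
    then have "{y \<in> {S}. x \<subset> y} = {S}" by blast
    then have "(-1) ^ card {y \<in> {S}. x \<subset> y} = (-1 :: rat)" by (simp only: card.insert finite.emptyI card.empty) simp
    then show "(-1) ^ card {y \<in> {S}. x \<subset> y} * c (insert x {S}) = - c {S,x}" by (simp only: insert_commute mult_minus1)
  qed
  also have "\<dots> = (\<Sum>x\<in>lines_in S. - c {S,x})"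
  proof (rule sum.mono_neutral_left[OF finite_lines_in])
    show "X \<subseteq> lines_in S" using X by blast
    show "\<forall>x\<in>lines_in S - X. - c {S,x} = 0"
    proof
      fix x assume x: "x \<in> lines_in S - X"
      then have "x \<noteq> S" using plane_not_line[OF S] unfolding lines_in_def by blast
      then show "- c {S,x} = 0" using x unfolding X_def by (simp add: insert_commute)
    qed
  qed
  finally show ?thesis by (simp add: sum_negf)
qed

definition edge_cycles :: "((real^4) set set \<Rightarrow> rat) set" where
  "edge_cycles = {c \<in> simplicial_chains \<K> 1. simplicial_boundary (\<supset>) c = (\<lambda>t. 0)}"

text \<open>The facets of an edge are single vertices, so the boundary has to be tested only at
  lines and planes.\<close>

lemma edge_cycles_iff:
  "c \<in> edge_cycles \<longleftrightarrow> c \<in> simplicial_chains \<K> 1 \<and> (\<forall>l\<in>\<L>. (\<Sum>S\<in>planes_thr l. c {S,l}) = 0)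
     \<and> (\<forall>S\<in>\<P>. (\<Sum>l\<in>lines_in S. c {S,l}) = 0)"
proof
  assume "c \<in> edge_cycles"
  then have c: "c \<in> simplicial_chains \<K> 1" and b: "simplicial_boundary (\<supset>) c t = 0" for t
    unfolding edge_cycles_def by auto
  show "c \<in> simplicial_chains \<K> 1 \<and> (\<forall>l\<in>\<L>. (\<Sum>S\<in>planes_thr l. c {S,l}) = 0) \<and> (\<forall>S\<in>\<P>. (\<Sum>l\<in>lines_in S. c {S,l}) = 0)"
  proof (intro conjI ballI c)
    show "(\<Sum>S\<in>planes_thr l. c {S,l}) = 0" if "l \<in> \<L>" for l using boundary_at_line[OF c that] b by simp
    show "(\<Sum>l\<in>lines_in S. c {S,l}) = 0" if "S \<in> \<P>" for S using boundary_at_plane[OF c that] b by simp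
  qed
next
  assume h: "c \<in> simplicial_chains \<K> 1 \<and> (\<forall>l\<in>\<L>. (\<Sum>S\<in>planes_thr l. c {S,l}) = 0) \<and> (\<forall>S\<in>\<P>. (\<Sum>l\<in>lines_in S. c {S,l}) = 0)"
  then have c: "c \<in> simplicial_chains \<K> 1" by blast
  have "simplicial_boundary (\<supset>) c t = 0" for t
  proof (cases "{x. x \<notin> t \<and> c (insert x t) \<noteq> 0} = {}")
    case True
    show ?thesis unfolding simplicial_boundary_def True by simp
  next
    case False
    then obtain x where x: "x \<notin> t" "c (insert x t) \<noteq> 0" by blast
    obtain S l where S: "insert x t = {S,l}" "S \<in> \<P>" "l \<in> lines_in S" using chain_edgeE[OF c x(2)] .
    have l: "l \<in> \<L>" using S(3) unfolding lines_in_def by blast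
    have "t = {S} \<or> t = {l}" 
    proof -
      have "t = {S,l} - {x}" "x \<in> {S,l}" using S(1) x(1) by blast+
      moreover have "S \<noteq> l" using plane_not_line[OF S(2)] l by blast
      ultimately show ?thesis by auto
    qed
    then show ?thesis using boundary_at_line[OF c l] boundary_at_plane[OF c S(2)] h l S(2) by auto
  qed
  then show "c \<in> edge_cycles" unfolding edge_cycles_def using c by blast
qed

lemma zero_in_chains: "(\<lambda>s. 0) \<in> simplicial_chains K i"
  unfolding simplicial_chains_def by simp

lemma lincomb_closed_edge_cycles: "lincomb_closed edge_cycles"
  unfolding lincomb_closed_def
proof (intro conjI ballI allI)
  show "(\<lambda>x. 0) \<in> edge_cycles" unfolding edge_cycles_iff using zero_in_chains by simp
  fix f g :: "(real^4) set set \<Rightarrow> rat" and u v :: rat assume f: "f \<in> edge_cycles" and g: "g \<in> edge_cycles"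
  have ch: "f \<in> simplicial_chains \<K> 1" "g \<in> simplicial_chains \<K> 1" using f g unfolding edge_cycles_iff by auto
  have "(\<lambda>x. u * f x + v * g x) \<in> simplicial_chains \<K> 1"
  proof -
    have "{s. u * f s + v * g s \<noteq> 0} \<subseteq> {s. f s \<noteq> 0} \<union> {s. g s \<noteq> 0}" by auto
    moreover have "finite ({s. f s \<noteq> 0} \<union> {s. g s \<noteq> 0})" using ch unfolding simplicial_chains_def by auto
    ultimately have "finite {s. u * f s + v * g s \<noteq> 0}" by (rule finite_subset)
    moreover have "s \<in> \<K> \<and> finite s \<and> int (card s) = 1 + 1" if "u * f s + v * g s \<noteq> 0" for s
    proof -
      have "f s \<noteq> 0 \<or> g s \<noteq> 0" using that by auto
      then show ?thesis using ch unfolding simplicial_chains_def by auto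
    qed
    ultimately show ?thesis unfolding simplicial_chains_def by blast
  qed
  then show "(\<lambda>x. u * f x + v * g x) \<in> edge_cycles"
    using f g unfolding edge_cycles_iff by (simp add: sum.distrib flip: sum_distrib_left)
qed

lemma edge_cycles_determined:
  assumes "c \<in> edge_cycles" "\<And>S l. S \<in> \<P> \<Longrightarrow> l \<in> lines_in S \<Longrightarrow> c {S,l} = 0"
  shows "c = (\<lambda>s. 0)"
proof (rule ext, rule ccontr)
  fix s assume "c s \<noteq> 0"
  moreover have "c \<in> simplicial_chains \<K> 1" using assms(1) unfolding edge_cycles_iff by blast
  ultimately obtain S l where "s = {S,l}" "S \<in> \<P>" "l \<in> lines_in S" using chain_edgeE by metis
  then show False using assms(2) \<open>c s \<noteq> 0\<close> by blast
qed

text \<open>Without simplices on three vertices there are no nonzero boundaries in degree 1.\<close>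

lemma homology_dim_eq: "reduced_homology_dim (\<supset>) \<K> 1 = quotient_dim edge_cycles {\<lambda>s. 0}"
proof -
  have "c = (\<lambda>s. 0)" if "c \<in> simplicial_chains \<K> (1 + 1)" for c
  proof (rule ext, rule ccontr)
    fix s assume "c s \<noteq> 0"
    then have "s \<in> \<K>" "card s = 3" using that unfolding simplicial_chains_def by auto
    then show False using complex_card_le by blast
  qed
  then have "simplicial_chains \<K> (1 + 1) = {\<lambda>s. 0}" using zero_in_chains by blast
  moreover have "simplicial_boundary (\<supset>) (\<lambda>s. 0) = (\<lambda>t::(real^4) set set. 0)" unfolding simplicial_boundary_def by simp
  ultimately show ?thesis unfolding reduced_homology_dim_def edge_cycles_def by simp
qed

text \<open>The conditions force \<open>u\<close> to vanish on edges that use a removed vertex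
  \<open>m\<close>, so \<open>u\<close> is supported on simplices of the complex.\<close>

lemma cycle_of_incidence_weights:
  assumes u1: "\<And>l. l \<in> \<L> \<Longrightarrow> (\<Sum>S\<in>planes_thr l. u S l) = 0" and u2: "\<And>S. S \<in> \<P> \<Longrightarrow> (\<Sum>l\<in>lines_in S. u S l) = 0"
  obtains c where "c \<in> edge_cycles" "\<And>S l. S \<in> \<P> \<Longrightarrow> l \<in> lines_in S \<Longrightarrow> c {S,l} = u S l"
proof -
  define c where "c = (\<lambda>s. \<Sum>i\<in>incidences. if s = {fst i, snd i} then u (fst i) (snd i) else 0)"
  have inc: "(S,l) \<in> incidences \<longleftrightarrow> S \<in> \<P> \<and> l \<in> lines_in S" for S l
    unfolding incidences_def lines_in_def planes_thr_def by auto
  have cu: "c {S,l} = u S l" if S: "S \<in> \<P>" "l \<in> lines_in S" for S l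
  proof -
    have "c {S,l} = (\<Sum>i\<in>incidences. if i = (S,l) then u (fst i) (snd i) else 0)"
      unfolding c_def
    proof (rule sum.cong[OF refl])
      fix i assume i: "i \<in> incidences"
      obtain T k where Tk: "i = (T,k)" by (cases i)
      then have "T \<in> \<P>" "k \<in> \<L>" "l \<in> \<L>" using i inc S unfolding lines_in_def by auto
      then have "{S,l} = {T,k} \<longleftrightarrow> i = (S,l)" using edge_eq_iff[OF S(1)] Tk by auto
      then show "(if {S,l} = {fst i, snd i} then u (fst i) (snd i) else 0) = (if i = (S,l) then u (fst i) (snd i) else 0)"
        using Tk by simp
    qed
    also have "\<dots> = u S l" using finite_incidences(1) inc S by simp
    finally show ?thesis .
  qed
  have supp: "\<exists>S l. s = {S,l} \<and> S \<in> \<P> \<and> l \<in> lines_in S \<and> u S l \<noteq> 0" if "c s \<noteq> 0" for s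
  proof -
    obtain i where i: "i \<in> incidences" "(if s = {fst i, snd i} then u (fst i) (snd i) else 0) \<noteq> 0"
      using sum.not_neutral_contains_not_neutral[of "\<lambda>i. if s = {fst i, snd i} then u (fst i) (snd i) else 0" incidences]
        \<open>c s \<noteq> 0\<close> unfolding c_def by blast
    obtain S l where "i = (S,l)" by (cases i)
    then show ?thesis using i inc by (auto split: if_splits)
  qed
  have "c \<in> simplicial_chains \<K> 1"
    unfolding simplicial_chains_def
  proof (intro CollectI conjI allI impI)
    have "{s. c s \<noteq> 0} \<subseteq> (\<lambda>i. {fst i, snd i}) ` incidences"
    proof
      fix s assume "s \<in> {s. c s \<noteq> 0}"
      then obtain S l where "s = {S,l}" "S \<in> \<P>" "l \<in> lines_in S" using supp by blast
      then show "s \<in> (\<lambda>i. {fst i, snd i}) ` incidences" using inc by (intro image_eqI[of _ _ "(S,l)"]) auto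
    qed
    then show "finite {s. c s \<noteq> 0}" using finite_incidences(1) finite_subset by blast
    fix s assume "c s \<noteq> 0"
    then obtain S l where s: "s = {S,l}" "S \<in> \<P>" "l \<in> lines_in S" "u S l \<noteq> 0" using supp by blast
    have l: "l \<in> \<L>" "l \<subseteq> S" "l \<noteq> S" using s(3) plane_not_line[OF s(2)] unfolding lines_in_def by auto
    \<comment> \<open>If \<open>l\<close> is removed, it is contained in every line and is therefore
      the only line of \<open>S\<close>; the sum in \<open>S\<close> then reduces to
      \<open>u S l\<close>.\<close>
    have lV: "l \<in> V0"
    proof (rule ccontr)
      assume "l \<notin> V0"
      then have "l = m" using m_eq l(1) by blast
      then have "k = l" if "k \<in> lines_in S" for k
        using m_least[of k] line_subset_eq[OF l(1), of k] that unfolding lines_in_def by blast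
      then have "lines_in S = {l}" using s(3) by blast
      then show False using u2[OF s(2)] s(4) by simp
    qed
    \<comment> \<open>A removed plane would be contained in its own line \<open>l\<close>.\<close>
    have "S \<in> V0"
    proof (rule ccontr)
      assume "S \<notin> V0"
      then have "S = m" using m_eq s(2) by blast
      then show False using m_least[of l] l plane_not_subset_line[OF s(2) l(1)] by blast
    qed
    then show "s \<in> \<K>" unfolding order_complex_def pred_on.chain_def s(1) using lV l(2,3) by auto
    show "finite s" "int (card s) = 1 + 1" unfolding s(1) using l(3) by auto
  qed
  moreover have "(\<Sum>S\<in>planes_thr l. c {S,l}) = 0" if "l \<in> \<L>" for l
  proof -
    have "(\<Sum>S\<in>planes_thr l. c {S,l}) = (\<Sum>S\<in>planes_thr l. u S l)"
      using cu lines_in_iff planes_thrD(1) that by (intro sum.cong) auto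
    then show ?thesis using u1[OF that] by simp
  qed
  moreover have "(\<Sum>l\<in>lines_in S. c {S,l}) = 0" if "S \<in> \<P>" for S
  proof -
    have "(\<Sum>l\<in>lines_in S. c {S,l}) = (\<Sum>l\<in>lines_in S. u S l)" using cu[OF that] by (intro sum.cong) auto
    then show ?thesis using u2[OF that] by simp
  qed
  ultimately have "c \<in> edge_cycles" unfolding edge_cycles_iff by blast
  then show ?thesis using that cu by blast
qed

text \<open>The data left over by base weights and lower jumps are exactly the cycles of the
  incidence graph, so a basis of these serves as \<open>E\<close>.\<close>

theorem cohomology_dim_complement:
  "\<exists>n. reduced_homology_dim (\<supset>) \<K> 1 = enat n \<and>
     reduced_cohomology_dim 1 (top_of_set U) = enat (card \<P> + card free_incidences + n)"
proof -
  define K where "K = (\<lambda>i. {fst i, snd i}) ` incidences"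
  have "finite K" unfolding K_def using finite_incidences by simp
  moreover have "v = (\<lambda>s. 0)" if v: "v \<in> edge_cycles" "\<And>k. k \<in> K \<Longrightarrow> v k = 0" for v
  proof (rule edge_cycles_determined[OF v(1)])
    fix S l assume "S \<in> \<P>" "l \<in> lines_in S"
    then have "(S,l) \<in> incidences" unfolding incidences_def lines_in_def planes_thr_def by blast
    then have "{S,l} \<in> K" unfolding K_def by (rule rev_image_eqI) simp
    then show "v {S,l} = 0" using v(2) by blast
  qed
  ultimately obtain E where E: "quotient_basis edge_cycles {\<lambda>s. 0} E"
    using finite_quotient_basis_exists[OF _ lincomb_closed_edge_cycles] by blast
  have fE: "finite E" "E \<subseteq> edge_cycles" using E unfolding quotient_basis_def by auto
  have uq: "\<exists>!k. k \<in> extensional E \<and> (\<lambda>s. z s - (\<Sum>e\<in>E. k e * e s)) \<in> {\<lambda>s. 0}" if "z \<in> edge_cycles" for z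
  proof -
    have "\<forall>z\<in>edge_cycles. \<exists>!k. k \<in> extensional E \<and> (\<lambda>s. z s - (\<Sum>e\<in>E. k e * e s)) \<in> {\<lambda>s. 0}"
      using E unfolding quotient_basis_def by (elim conjE)
    from bspec[OF this that] show ?thesis .
  qed
  have Ecyc: "(\<Sum>S\<in>planes_thr l. e {S,l}) = 0" if "e \<in> E" "l \<in> \<L>" for e l
  proof -
    have "e \<in> edge_cycles" using fE(2) that(1) by (rule subsetD)
    then show ?thesis unfolding edge_cycles_iff using that(2) by (elim conjE) (rule bspec)
  qed
  have Ecyc2: "(\<Sum>l\<in>lines_in S. e {S,l}) = 0" if "e \<in> E" "S \<in> \<P>" for e S
  proof -
    have "e \<in> edge_cycles" using fE(2) that(1) by (rule subsetD)
    then show ?thesis unfolding edge_cycles_iff using that(2) by (elim conjE) (rule bspec)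
  qed
  have "reduced_homology_dim (\<supset>) \<K> 1 = enat (card E)"
    unfolding homology_dim_eq
    by (rule quotient_dim_eq[OF _ lincomb_closedD(1)[OF lincomb_closed_edge_cycles] E]) (simp add: lincomb_closed_def)
  moreover have "reduced_cohomology_dim 1 (top_of_set U) = enat (card \<P> + card free_incidences + card E)"
  proof (rule cohomology_dim[OF fE(1), of "\<lambda>e S l. e {S,l}"])
    show "(\<Sum>S\<in>planes_thr l. e {S,l}) = 0" if "e \<in> E" "l \<in> \<L>" for e l using Ecyc[OF that] .
    show "(\<Sum>l\<in>lines_in S. e {S,l}) = 0" if "e \<in> E" "S \<in> \<P>" for e S using Ecyc2[OF that] .
    fix u assume u: "\<And>l. l \<in> \<L> \<Longrightarrow> (\<Sum>S\<in>planes_thr l. u S l) = (0::rat)" "\<And>S. S \<in> \<P> \<Longrightarrow> (\<Sum>l\<in>lines_in S. u S l) = 0"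
    obtain c where c: "c \<in> edge_cycles" "\<And>S l. S \<in> \<P> \<Longrightarrow> l \<in> lines_in S \<Longrightarrow> c {S,l} = u S l"
      using cycle_of_incidence_weights[OF u] by blast
    obtain k where "(\<lambda>s. c s - (\<Sum>e\<in>E. k e * e s)) \<in> {\<lambda>s. 0}" using ex1_implies_ex[OF uq[OF c(1)]] by blast
    then have "(\<lambda>s. c s - (\<Sum>e\<in>E. k e * e s)) = (\<lambda>s. 0)" by (rule singletonD)
    then have "c s - (\<Sum>e\<in>E. k e * e s) = 0" for s by (rule fun_cong)
    then have "c s = (\<Sum>e\<in>E. k e * e s)" for s by simp
    then have "u S l = (\<Sum>e\<in>E. k e * e {S,l})" if "S \<in> \<P>" "l \<in> lines_in S" for S l
      using c(2)[OF that] by simp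
    then show "\<exists>k. \<forall>S\<in>\<P>. \<forall>l\<in>lines_in S. u S l = (\<Sum>e\<in>E. k e * e {S,l})" by (intro exI[of _ k]) blast
  next
    fix k e assume k: "\<And>S l. S \<in> \<P> \<Longrightarrow> l \<in> lines_in S \<Longrightarrow> (\<Sum>e\<in>E. k e * e {S,l}) = (0::rat)" and e: "e \<in> E"
    have "(\<lambda>s. \<Sum>e\<in>E. k e * e s) \<in> edge_cycles"
      by (rule lincomb_closed_sum[OF lincomb_closed_edge_cycles fE(1)]) (rule subsetD[OF fE(2)])
    then have z: "(\<lambda>s. \<Sum>e\<in>E. k e * e s) = (\<lambda>s. 0)" by (rule edge_cycles_determined) (rule k)
    define k1 k2 where "k1 = restrict k E" and "k2 = restrict (\<lambda>e. 0 :: rat) E"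
    have "(\<Sum>e\<in>E. k1 e * e s) = 0" for s using fun_cong[OF z, of s] unfolding k1_def by (simp cong: sum.cong)
    then have 1: "(\<lambda>s. 0 - (\<Sum>e\<in>E. k1 e * e s)) \<in> {\<lambda>s. 0}" by simp
    have 2: "(\<lambda>s. 0 - (\<Sum>e\<in>E. k2 e * e s)) \<in> {\<lambda>s. 0}" unfolding k2_def by (simp cong: sum.cong)
    obtain k' where k': "\<And>w. w \<in> extensional E \<Longrightarrow> (\<lambda>s. 0 - (\<Sum>e\<in>E. w e * e s)) \<in> {\<lambda>s. 0} \<Longrightarrow> w = k'"
      using uq[OF lincomb_closedD(1)[OF lincomb_closed_edge_cycles]] unfolding Ex1_def by blast
    have "k1 = k'" unfolding k1_def by (rule k'[OF restrict_extensional 1[unfolded k1_def]])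
    moreover have "k2 = k'" unfolding k2_def by (rule k'[OF restrict_extensional 2[unfolded k2_def]])
    ultimately have "k1 e = k2 e" by simp
    then show "k e = 0" using e unfolding k1_def k2_def by simp
  qed
  ultimately show ?thesis by blast
qed

end

end

section \<open>Existence of frames\<close>

text \<open>Each condition excludes one hyperplane, and finitely many hyperplanes do not fill the
  space.\<close>

lemma generic_vector:
  fixes X :: "'a::euclidean_space set"
  assumes "finite X" "0 \<notin> X"
  obtains \<eta> where "\<And>x. x \<in> X \<Longrightarrow> x \<bullet> \<eta> \<noteq> 0"
proof -
  have "dim S < DIM('a)" if S: "S \<in> (\<lambda>x. {y. x \<bullet> y = 0}) ` X" for S
  proof -
    obtain x where x: "x \<in> X" "S = {y. x \<bullet> y = 0}" using S by blast
    then have "x \<noteq> 0" using assms(2) by blast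
    then show ?thesis unfolding x(2) using dim_hyperplane[of x] DIM_positive[where 'a='a] by simp
  qed
  then obtain \<eta> where "\<eta> \<notin> \<Union>((\<lambda>x. {y. x \<bullet> y = 0}) ` X)"
    using open_not_subset_Union_subspaces[of "(\<lambda>x. {y. x \<bullet> y = 0}) ` X" UNIV] assms(1) by blast
  then show ?thesis using that by blast
qed

lemma span_pair: "span {x, y} = {s *\<^sub>R x + t *\<^sub>R y | s t. True}"
proof (intro equalityI subsetI)
  fix z assume "z \<in> span {x, y}"
  then obtain s where "z - s *\<^sub>R x \<in> span {y}" using span_breakdown_eq[of z x "{y}"] by blast
  then obtain t where "z - s *\<^sub>R x = t *\<^sub>R y" unfolding span_singleton by blast
  then have "z = s *\<^sub>R x + t *\<^sub>R y" by (simp add: algebra_simps)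
  then show "z \<in> {s *\<^sub>R x + t *\<^sub>R y | s t. True}" by blast
next
  fix z assume "z \<in> {s *\<^sub>R x + t *\<^sub>R y | s t. True}"
  then obtain s t where "z = s *\<^sub>R x + t *\<^sub>R y" by blast
  moreover have "s *\<^sub>R x + t *\<^sub>R y \<in> span {x, y}" by (intro span_add span_scale span_base) auto
  ultimately show "z \<in> span {x, y}" by simp
qed

lemma plane_frame_exists:
  fixes S :: "(real^4) set"
  assumes S: "subspace S" "dim S = 2" and v: "v \<in> S" "v \<bullet> \<eta> \<noteq> 0"
  obtains p r where "p \<bullet> \<eta> = 1" "r \<bullet> \<eta> = 0" "r \<noteq> 0" "S = {s *\<^sub>R p + t *\<^sub>R r | s t. True}"
proof -
  define p where "p = (1 / (v \<bullet> \<eta>)) *\<^sub>R v"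
  have p: "p \<in> S" "p \<bullet> \<eta> = 1" unfolding p_def using v S(1) by (auto simp: subspace_scale)
  have "\<not> S \<subseteq> span {p}"
  proof
    assume "S \<subseteq> span {p}"
    then have "dim S \<le> card {p}" by (rule dim_le_card) simp
    then show False using S(2) by simp
  qed
  then obtain w where w: "w \<in> S" "w \<notin> span {p}" by blast
  define r where "r = w - (w \<bullet> \<eta>) *\<^sub>R p"
  have r: "r \<in> S" "r \<bullet> \<eta> = 0" unfolding r_def using w p S(1) by (auto simp: subspace_diff subspace_scale inner_diff_left)
  have r0: "r \<noteq> 0"
  proof
    assume "r = 0"
    then have "w = (w \<bullet> \<eta>) *\<^sub>R p" unfolding r_def by simp
    also have "\<dots> \<in> span {p}" by (simp add: span_scale span_base)
    finally show False using w(2) by simp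
  qed
  have "r \<notin> span {p}"
  proof
    assume "r \<in> span {p}"
    then obtain c where "r = c *\<^sub>R p" unfolding span_singleton by blast
    then show False using p(2) r(2) r0 by auto
  qed
  then have "independent {r, p}" using p(2) by (auto simp: independent_insert)
  moreover have "r \<noteq> p" using p(2) r(2) by auto
  ultimately have "S \<subseteq> span {r, p}" using card_ge_dim_independent[of "{r,p}" S] S(2) p r by simp
  moreover have "span {r, p} \<subseteq> S" using span_minimal[of "{r,p}" S] p r S(1) by simp
  ultimately have "S = span {p, r}" by (simp add: insert_commute)
  then show ?thesis using that[OF p(2) r(2) r0] span_pair by blast
qed

lemma indep_pairI: "independent {x, y} \<Longrightarrow> x \<noteq> y \<Longrightarrow> indep_pair x y"
  unfolding indep_pair_def
proof (intro allI impI)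
  fix s t assume i: "independent {x, y}" "x \<noteq> y" and e: "s *\<^sub>R x + t *\<^sub>R y = 0"
  have "(\<Sum>v\<in>{x,y}. (if v = x then s else t) *\<^sub>R v) = 0" using i(2) e by simp
  from independentD[OF i(1) _ _ this, of x] independentD[OF i(1) _ _ this, of y] show "s = 0 \<and> t = 0"
    using i(2) by auto
qed

text \<open>A basis of the orthogonal complement is a coframe; replacing \<open>b\<close> by its
  negative adjusts the orientation.\<close>

lemma plane_coframe_exists:
  fixes S :: "(real^4) set"
  assumes S: "subspace S" "dim S = 2" and pr: "S = {s *\<^sub>R p + t *\<^sub>R r | s t. True}" "p \<bullet> \<eta> = 1" "r \<bullet> \<eta> = 0" "r \<noteq> 0"
  obtains a b where "S = perp2 a b" "indep_pair a b" "0 < vol p r a b"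
proof -
  define C where "C = {y. \<forall>x\<in>S. orthogonal x y}"
  have C: "subspace C" unfolding C_def subspace_def orthogonal_def by (auto simp: inner_add_right)
  have "dim {y \<in> UNIV. \<forall>x\<in>S. orthogonal x y} + dim S = dim (UNIV :: (real^4) set)"
    by (rule dim_subspace_orthogonal_to_vectors[OF S(1)]) auto
  then have dC: "dim C = 2" unfolding C_def using S(2) by simp
  obtain B where B: "B \<subseteq> C" "independent B" "C \<subseteq> span B" "card B = dim C" using basis_exists by blast
  then obtain a b where ab: "B = {a,b}" "a \<noteq> b" using dC by (metis card_2_iff)
  have ind: "indep_pair a b" using indep_pairI B(2) ab by blast
  have perp: "perp2 a b = S"
  proof (rule subspace_dim_equal[symmetric, OF S(1)])
    show "subspace (perp2 a b)" unfolding perp2_def subspace_def by (auto simp: inner_add_left)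
    show "S \<subseteq> perp2 a b" using B(1) ab unfolding C_def perp2_def orthogonal_def by auto
    have "dim {y \<in> UNIV. \<forall>x\<in>span {a,b}. orthogonal x y} + dim (span {a,b}) = dim (UNIV :: (real^4) set)"
      by (rule dim_subspace_orthogonal_to_vectors) auto
    moreover have "dim (span {a,b}) = card {a,b}" using B(2) unfolding ab(1) by (rule dim_span_eq_card_independent)
    then have "dim (span {a,b}) = 2" using ab(2) by simp
    moreover have "perp2 a b \<subseteq> {y \<in> UNIV. \<forall>x\<in>span {a,b}. orthogonal x y}"
    proof
      fix y assume y: "y \<in> perp2 a b"
      have "orthogonal x y" if x: "x \<in> span {a,b}" for x
      proof -
        obtain s t where "x = s *\<^sub>R a + t *\<^sub>R b" using x unfolding span_pair by blast
        then show ?thesis using y unfolding perp2_def orthogonal_def by (simp add: inner_add_left inner_commute[of a] inner_commute[of b])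
      qed
      then show "y \<in> {y \<in> UNIV. \<forall>x\<in>span {a,b}. orthogonal x y}" by blast
    qed
    then have "dim (perp2 a b) \<le> dim {y \<in> UNIV. \<forall>x\<in>span {a,b}. orthogonal x y}" by (rule dim_subset)
    ultimately show "dim (perp2 a b) \<le> dim S" using S(2) dim_UNIV[where 'a="real^4"] by (simp del: dim_UNIV)
  qed
  have "vol p r a b \<noteq> 0"
  proof (rule vol_nonzero)
    fix c1 c2 c3 c4 assume c: "c1 *\<^sub>R p + c2 *\<^sub>R r + c3 *\<^sub>R a + c4 *\<^sub>R b = 0"
    \<comment> \<open>A vanishing combination splits into a part in \<open>S\<close> and a part
      orthogonal to \<open>S\<close>, both of which must be 0.\<close>
    define u w where "u = c1 *\<^sub>R p + c2 *\<^sub>R r" and "w = c3 *\<^sub>R a + c4 *\<^sub>R b"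
    have uw: "u + w = 0" unfolding u_def w_def using c by (simp add: algebra_simps)
    have "u \<in> perp2 a b" unfolding perp u_def pr(1) by blast
    then have "u \<bullet> w = 0" unfolding w_def perp2_def by (simp add: inner_add_right)
    moreover have "u \<bullet> (u + w) = 0" using uw by simp
    ultimately have "u = 0" by (simp add: inner_add_right)
    then have "c3 = 0 \<and> c4 = 0" using uw ind unfolding w_def indep_pair_def by simp
    moreover have "u \<bullet> \<eta> = 0" using \<open>u = 0\<close> by simp
    then have "c1 = 0" using pr unfolding u_def by (simp add: inner_add_left)
    then have "c2 = 0" using \<open>u = 0\<close> pr(4) unfolding u_def by simp
    ultimately show "c1 = 0 \<and> c2 = 0 \<and> c3 = 0 \<and> c4 = 0" using \<open>c1 = 0\<close> by simp
  qed
  then consider "0 < vol p r a b" | "0 < vol p r a ((-1) *\<^sub>R b)" unfolding vol_scale by linarith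
  then show ?thesis
  proof cases
    case 1
    then show ?thesis using that perp ind by blast
  next
    case 2
    have "perp2 a ((-1) *\<^sub>R b) = S" using perp perp2_scale[of 1 "-1" a b] by simp
    moreover have "indep_pair a ((-1) *\<^sub>R b)"
      unfolding indep_pair_def
    proof (intro allI impI)
      fix s t assume "s *\<^sub>R a + t *\<^sub>R (-1) *\<^sub>R b = 0"
      then have "s *\<^sub>R a + (- t) *\<^sub>R b = 0" by simp
      then have "s = 0 \<and> - t = 0" using ind unfolding indep_pair_def by blast
      then show "s = 0 \<and> t = 0" by simp
    qed
    ultimately show ?thesis using that 2 by blast
  qed
qed

text \<open>It is enough that \<open>\<eta>\<close> does not vanish on one chosen nonzero vector of
  each plane and each line, so a generic vector serves. The remaining choices are made separately
  for each plane and line.\<close>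

lemma framed_planes_exists:
  fixes \<P> :: "(real^4) set set"
  assumes fin: "finite \<P>" and sub: "\<And>S. S \<in> \<P> \<Longrightarrow> subspace S" and dim2: "\<And>S. S \<in> \<P> \<Longrightarrow> dim S = 2"
    and L: "\<L> = {S \<inter> T | S T. S \<in> \<P> \<and> T \<in> \<P> \<and> S \<noteq> T \<and> S \<inter> T \<noteq> {0}}"
  obtains \<eta> p r a b q \<epsilon> \<tau> where "framed_planes \<P> \<eta> p r a b q \<L> \<epsilon> \<tau>"
proof -
  have "\<L> \<subseteq> (\<lambda>(S,T). S \<inter> T) ` (\<P> \<times> \<P>)" unfolding L by auto
  then have finL: "finite \<L>" by (rule finite_subset) (use fin in simp)
  have Lfact: "subspace l" "l \<noteq> {0}" "dim l \<le> 1" if l: "l \<in> \<L>" for l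
  proof -
    obtain S T where ST: "S \<in> \<P>" "T \<in> \<P>" "S \<noteq> T" "l = S \<inter> T" "S \<inter> T \<noteq> {0}" using l unfolding L by blast
    show "subspace l" unfolding ST(4) by (rule subspace_inter[OF sub[OF ST(1)] sub[OF ST(2)]])
    show "l \<noteq> {0}" using ST by simp
    show "dim l \<le> 1"
    proof (rule ccontr)
      assume "\<not> dim l \<le> 1"
      then have "2 \<le> dim (S \<inter> T)" unfolding ST(4) by simp
      then have d: "dim S \<le> dim (S \<inter> T)" "dim T \<le> dim (S \<inter> T)" using dim2 ST(1,2) by simp_all
      have sI: "subspace (S \<inter> T)" by (rule subspace_inter[OF sub[OF ST(1)] sub[OF ST(2)]])
      have "S \<inter> T = S" "S \<inter> T = T"
        by (rule subspace_dim_equal[OF sI sub[OF ST(1)] Int_lower1 d(1)],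
            rule subspace_dim_equal[OF sI sub[OF ST(2)] Int_lower2 d(2)])
      then show False using ST(3) by blast
    qed
  qed
  have "\<exists>v. v \<in> S \<and> v \<noteq> 0" if S: "S \<in> \<P> \<union> \<L>" for S
  proof -
    have "subspace S" "S \<noteq> {0}" using S sub dim2[of S] Lfact[of S] by auto
    then show ?thesis using subspace_0 by blast
  qed
  then obtain nz where nz: "\<And>S. S \<in> \<P> \<union> \<L> \<Longrightarrow> nz S \<in> S \<and> nz S \<noteq> 0" by metis
  have "finite (nz ` (\<P> \<union> \<L>))" "0 \<notin> nz ` (\<P> \<union> \<L>)" using fin finL nz by force+
  then obtain \<eta> where \<eta>: "\<And>x. x \<in> nz ` (\<P> \<union> \<L>) \<Longrightarrow> x \<bullet> \<eta> \<noteq> 0" using generic_vector by blast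
  have "\<exists>p r. p \<bullet> \<eta> = 1 \<and> r \<bullet> \<eta> = 0 \<and> r \<noteq> 0 \<and> S = {s *\<^sub>R p + t *\<^sub>R r | s t. True}" if S: "S \<in> \<P>" for S
  proof -
    have "nz S \<in> S" "nz S \<bullet> \<eta> \<noteq> 0" using nz \<eta> S by blast+
    then obtain p r where "p \<bullet> \<eta> = 1" "r \<bullet> \<eta> = 0" "r \<noteq> 0" "S = {s *\<^sub>R p + t *\<^sub>R r | s t. True}"
      by (rule plane_frame_exists[OF sub[OF S] dim2[OF S]])
    then show ?thesis by (intro exI[of _ p] exI[of _ r] conjI)
  qed
  then have "\<forall>S\<in>\<P>. \<exists>p r. p \<bullet> \<eta> = 1 \<and> r \<bullet> \<eta> = 0 \<and> r \<noteq> 0 \<and> S = {s *\<^sub>R p + t *\<^sub>R r | s t. True}" by (rule ballI)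
  from bchoice2[OF this] obtain p r where pr: "\<And>S. S \<in> \<P> \<Longrightarrow> p S \<bullet> \<eta> = 1 \<and> r S \<bullet> \<eta> = 0 \<and> r S \<noteq> 0 \<and> S = {s *\<^sub>R p S + t *\<^sub>R r S | s t. True}"
    by (elim exE) (rule that, rule bspec)
  have "\<exists>a b. S = perp2 a b \<and> indep_pair a b \<and> 0 < vol (p S) (r S) a b" if S: "S \<in> \<P>" for S
  proof -
    note prS = pr[OF S]
    from prS[THEN conjunct2, THEN conjunct2, THEN conjunct2] prS[THEN conjunct1]
      prS[THEN conjunct2, THEN conjunct1] prS[THEN conjunct2, THEN conjunct2, THEN conjunct1]
    obtain a b where "S = perp2 a b" "indep_pair a b" "0 < vol (p S) (r S) a b"
      by (rule plane_coframe_exists[OF sub[OF S] dim2[OF S]])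
    then show ?thesis by (intro exI[of _ a] exI[of _ b] conjI)
  qed
  then have "\<forall>S\<in>\<P>. \<exists>a b. S = perp2 a b \<and> indep_pair a b \<and> 0 < vol (p S) (r S) a b" by (rule ballI)
  from bchoice2[OF this] obtain a b where ab: "\<And>S. S \<in> \<P> \<Longrightarrow> S = perp2 (a S) (b S) \<and> indep_pair (a S) (b S) \<and> 0 < vol (p S) (r S) (a S) (b S)"
    by (elim exE) (rule that, rule bspec)
  define q where "q = (\<lambda>l. (1 / (nz l \<bullet> \<eta>)) *\<^sub>R nz l)"
  have q: "q l \<bullet> \<eta> = 1" "l = {s *\<^sub>R q l | s. True}" if l: "l \<in> \<L>" for l
  proof -
    have n: "nz l \<in> l" "nz l \<bullet> \<eta> \<noteq> 0" "nz l \<noteq> 0" using nz \<eta> l by blast+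
    then show q1: "q l \<bullet> \<eta> = 1" unfolding q_def by simp
    have ql: "q l \<in> l" unfolding q_def using n(1) Lfact(1)[OF l] subspace_scale by blast
    have "q l \<noteq> 0" using q1 by auto
    then have "independent {q l}" by simp
    then have "l \<subseteq> span {q l}" using card_ge_dim_independent[of "{q l}" l] ql Lfact(3)[OF l] by simp
    moreover have "span {q l} \<subseteq> l" using span_minimal[of "{q l}" l] ql Lfact(1)[OF l] by simp
    ultimately show "l = {s *\<^sub>R q l | s. True}" unfolding span_singleton by blast
  qed
  have "\<exists>t. q l = p S + t *\<^sub>R r S" if h: "S \<in> \<P>" "l \<in> \<L>" "l \<subseteq> S" for S l
  proof -
    have "1 *\<^sub>R q l \<in> l" using q(2)[OF h(2)] by blast
    then have "q l \<in> S" using h(3) by auto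
    then obtain s t where st: "q l = s *\<^sub>R p S + t *\<^sub>R r S" using pr[OF h(1)] by blast
    then have "s = 1" using q(1)[OF h(2)] pr[OF h(1)] by (simp add: inner_add_left)
    then show ?thesis using st by auto
  qed
  then obtain \<tau> where \<tau>: "\<And>S l. S \<in> \<P> \<Longrightarrow> l \<in> \<L> \<Longrightarrow> l \<subseteq> S \<Longrightarrow> q l = p S + \<tau> S l *\<^sub>R r S" by metis
  define D where "D = {\<bar>\<tau> S l - \<tau> S m\<bar> | S l m. S \<in> \<P> \<and> l \<in> \<L> \<and> m \<in> \<L> \<and> l \<subseteq> S \<and> m \<subseteq> S \<and> l \<noteq> m}"
  have "D \<subseteq> (\<lambda>(S,l,m). \<bar>\<tau> S l - \<tau> S m\<bar>) ` (\<P> \<times> \<L> \<times> \<L>)" unfolding D_def by force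
  then have finD: "finite D" by (rule finite_subset) (use fin finL in simp)
  have posD: "0 < x" if x: "x \<in> D" for x
  proof -
    obtain S l m where h: "x = \<bar>\<tau> S l - \<tau> S m\<bar>" "S \<in> \<P>" "l \<in> \<L>" "m \<in> \<L>" "l \<subseteq> S" "m \<subseteq> S" "l \<noteq> m"
      using x unfolding D_def by blast
    have "\<tau> S l \<noteq> \<tau> S m"
    proof
      assume "\<tau> S l = \<tau> S m"
      then have "q l = q m" using \<tau>[OF h(2,3,5)] \<tau>[OF h(2,4,6)] by simp
      then show False using q(2)[OF h(3)] q(2)[OF h(4)] h(7) by simp
    qed
    then show ?thesis unfolding h(1) by simp
  qed
  \<comment> \<open>Half of the least gap gives strict inequality; the entry 1 covers the case of no
    gaps.\<close>
  define \<epsilon> where "\<epsilon> = Min (insert 1 D) / 2"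
  have "0 < Min (insert 1 D)" using finD posD by (subst Min_gr_iff) auto
  then have \<epsilon>: "0 < \<epsilon>" unfolding \<epsilon>_def by simp
  have \<epsilon>D: "\<epsilon> < x" if "x \<in> D" for x
  proof -
    have "Min (insert 1 D) \<le> x" using finD that by (intro Min_le) auto
    then show ?thesis unfolding \<epsilon>_def using \<open>0 < Min (insert 1 D)\<close> by linarith
  qed
  have "framed_planes \<P> \<eta> p r a b q \<L> \<epsilon> \<tau>"
  proof
    show "\<epsilon> < \<bar>\<tau> S l - \<tau> S m\<bar>" if "S \<in> \<P>" "l \<in> \<L>" "m \<in> \<L>" "l \<subseteq> S" "m \<subseteq> S" "l \<noteq> m" for S l m
      using \<epsilon>D[of "\<bar>\<tau> S l - \<tau> S m\<bar>"] that unfolding D_def by blast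
    show "finite \<P>" by (rule fin)
    show "\<L> = {S \<inter> T | S T. S \<in> \<P> \<and> T \<in> \<P> \<and> S \<noteq> T \<and> S \<inter> T \<noteq> {0}}" by (rule L)
    fix S assume S: "S \<in> \<P>"
    show "p S \<bullet> \<eta> = 1" "r S \<bullet> \<eta> = 0" "r S \<noteq> 0" "S = {s *\<^sub>R p S + t *\<^sub>R r S | s t. True}" using pr[OF S] by blast+
    show "S = perp2 (a S) (b S)" "indep_pair (a S) (b S)" "0 < vol (p S) (r S) (a S) (b S)" using ab[OF S] by blast+
  next
    fix l assume "l \<in> \<L>"
    then show "q l \<bullet> \<eta> = 1" "l = {s *\<^sub>R q l | s. True}" using q by blast+
  next
    fix S l assume "S \<in> \<P>" "l \<in> \<L>" "l \<subseteq> S"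
    then show "q l = p S + \<tau> S l *\<^sub>R r S" by (rule \<tau>)
  next
    show "0 < \<epsilon>" by (rule \<epsilon>)
  qed
  then show ?thesis using that by blast
qed

section \<open>Determinants in finite linear groups\<close>

lemma det_rows_map:
  fixes A :: "real^'n^'n"
  shows "det (\<chi> i. A *v e i) = det A * det (\<chi> i. e i)"
proof -
  define E where "E = (\<chi> i. e i)"
  have "(\<chi> i. A *v e i) = E ** transpose A"
    by (simp add: E_def matrix_matrix_mult_def matrix_vector_mult_def transpose_def vec_eq_iff mult.commute)
  then show ?thesis unfolding E_def[symmetric] by (simp add: det_mul)
qed

text \<open>On a basis adapted to \<open>F\<close> and \<open>K\<close> the map multiplies vectors
  by 1 or -1, and the number of factors -1 is the codimension of \<open>F\<close>.\<close>

lemma det_involution: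
  fixes R :: "real^'n^'n"
  assumes F: "subspace F" "\<And>v. v \<in> F \<Longrightarrow> R *v v = v" and K: "subspace K" "\<And>v. v \<in> K \<Longrightarrow> R *v v = - v"
    and sum: "\<And>v. \<exists>x\<in>F. \<exists>y\<in>K. v = x + y"
  shows "det R = (-1) ^ (CARD('n) - dim F)"
proof -
  have FK: "v = 0" if "v \<in> F" "v \<in> K" for v
  proof -
    have "v = - v" using F(2)[OF that(1)] K(2)[OF that(2)] by simp
    then have "2 *\<^sub>R v = 0" by (simp add: scaleR_2 eq_neg_iff_add_eq_0)
    then show ?thesis by simp
  qed
  obtain B1 where B1: "B1 \<subseteq> F" "independent B1" "F \<subseteq> span B1" "card B1 = dim F" using basis_exists by blast
  obtain B2 where B2: "B2 \<subseteq> K" "independent B2" "K \<subseteq> span B2" "card B2 = dim K" using basis_exists by blast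
  have fin: "finite B1" "finite B2" using B1(2) B2(2) finiteI_independent by blast+
  have zero: "0 \<notin> B1" using B1(2) dependent_zero by blast
  have disj: "B1 \<inter> B2 = {}" using FK B1(1) B2(1) zero by blast
  have "{x + y | x y. x \<in> F \<and> y \<in> K} = UNIV" using sum by blast
  moreover have "dim (F \<inter> K) = 0" using FK by (subst dim_eq_0) blast
  ultimately have dims: "CARD('n) = dim F + dim K"
    using dim_sums_Int[OF F(1) K(1)] by (simp del: dim_eq_0)
  define B where "B = B1 \<union> B2"
  have cardB: "finite B" "card B = CARD('n)" unfolding B_def using card_Un_disjoint[OF fin disj] B1(4) B2(4) dims fin by auto
  have "UNIV \<subseteq> span B"
  proof
    fix v :: "real^'n"
    obtain x y where "x \<in> F" "y \<in> K" "v = x + y" using sum by blast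
    then have "x \<in> span B" "y \<in> span B" using B1(3) B2(3) span_mono[of B1 B] span_mono[of B2 B] unfolding B_def by blast+
    then show "v \<in> span B" using \<open>v = x + y\<close> span_add by blast
  qed
  then have ind: "independent B" by (intro card_le_dim_spanning[of B UNIV]) (auto simp: cardB)
  obtain e where e: "bij_betw e (UNIV :: 'n set) B"
    using finite_same_card_bij[of "UNIV :: 'n set" B] cardB by auto
  define E :: "real^'n^'n" where "E = (\<chi> i. e i)"
  have "\<forall>c. sum (\<lambda>i. c i *s row i E) UNIV = 0 \<longrightarrow> (\<forall>i. c i = 0)"
  proof (intro allI impI)
    fix c i assume "sum (\<lambda>i. c i *s row i E) UNIV = 0"
    then have s: "(\<Sum>i\<in>UNIV. c i *\<^sub>R e i) = 0" by (simp add: E_def row_def scalar_mult_eq_scaleR vec_lambda_eta)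
    have inv: "the_inv_into UNIV e (e i) = i" for i using e by (simp add: bij_betw_def the_inv_into_f_f)
    have "(\<Sum>v\<in>B. c (the_inv_into UNIV e v) *\<^sub>R v) = (\<Sum>i\<in>UNIV. c (the_inv_into UNIV e (e i)) *\<^sub>R e i)"
      using sum.reindex_bij_betw[OF e, of "\<lambda>v. c (the_inv_into UNIV e v) *\<^sub>R v"] by simp
    also have "\<dots> = 0" unfolding inv using s .
    finally have "c (the_inv_into UNIV e (e i)) = 0"
      using independentD[OF ind cardB(1), of "\<lambda>v. c (the_inv_into UNIV e v)" "e i"] e by (auto simp: bij_betw_def)
    then show "c i = 0" unfolding inv .
  qed
  then have "\<exists>C. E ** C = mat 1" using matrix_right_invertible_independent_rows by blast
  then have dE: "det E \<noteq> 0" using invertible_right_inverse invertible_det_nz by blast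
  define d :: "'n \<Rightarrow> real" where "d = (\<lambda>i. if e i \<in> B1 then 1 else -1)"
  have "R *v e i = d i *s e i" for i
  proof (cases "e i \<in> B1")
    case True
    then show ?thesis using F(2) B1(1) unfolding d_def by auto
  next
    case False
    then have "e i \<in> B2" using e unfolding B_def bij_betw_def by blast
    then show ?thesis using K(2) B2(1) False unfolding d_def by (auto simp: scalar_mult_eq_scaleR)
  qed
  then have "det R * det E = det (\<chi> i. d i *s e i)"
    unfolding E_def using det_rows_map[of R e] by simp
  also have "\<dots> = prod d UNIV * det E" unfolding E_def using det_rows_mul[of d e] by simp
  finally have "det R = prod d UNIV" using dE by simp
  also have "prod d UNIV = (\<Prod>v\<in>B. if v \<in> B1 then 1 else -1)"
    unfolding d_def using prod.reindex_bij_betw[OF e, of "\<lambda>v. if v \<in> B1 then 1 else (-1::real)"] by simp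
  also have "\<dots> = (\<Prod>v\<in>B2. -1)"
  proof -
    have "(\<Prod>v\<in>B2. if v \<in> B1 then 1 else -1) = (\<Prod>v\<in>B2. -1 :: real)"
      using disj by (intro prod.cong) auto
    then show ?thesis unfolding B_def using disj fin by (simp add: prod.union_disjoint)
  qed
  also have "\<dots> = (-1) ^ card B2" by simp
  also have "card B2 = CARD('n) - dim F" using B2(4) dims by simp
  finally show ?thesis .
qed

section \<open>Averaging in finite matrix groups\<close>

lemma GL_simps [simp]:
  "carrier (GL :: (real^'n^'n) monoid) = {A. invertible A}" "mult GL = (**)" "one GL = (mat 1 :: real^'n^'n)"
  by (simp_all add: GL_def)

lemma matrix_mult_scaleR_right: "A ** (k *\<^sub>R B) = k *\<^sub>R ((A :: real^'n^'n) ** B)"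
  by (simp add: matrix_matrix_mult_def sum_distrib_left mult_ac vec_eq_iff)

lemma matrix_mult_scaleR_left: "(k *\<^sub>R A) ** B = k *\<^sub>R ((A :: real^'n^'n) ** B)"
  by (simp add: matrix_matrix_mult_def sum_distrib_left mult_ac vec_eq_iff)

lemma matrix_add_rdistrib: "(A + B) ** C = A ** C + B ** (C :: real^'k^'n)"
  by (simp add: matrix_matrix_mult_def vec_eq_iff sum.distrib[symmetric] field_simps)

lemma matrix_diff_left_distrib: "A ** (B - C) = A ** B - A ** (C :: real^'n^'n)"
  by (simp add: matrix_matrix_mult_def vec_eq_iff sum_subtractf[symmetric] field_simps)

lemma matrix_diff_right_distrib: "(A - B) ** C = A ** C - B ** (C :: real^'n^'n)"
  by (simp add: matrix_matrix_mult_def vec_eq_iff sum_subtractf[symmetric] field_simps)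

lemma matrix_sum_mult_left: "A ** sum f I = (\<Sum>i\<in>I. A ** (f i :: real^'n^'n))"
  by (induction I rule: infinite_finite_induct) (simp_all add: matrix_add_ldistrib)

lemma matrix_sum_mult_right: "sum f I ** A = (\<Sum>i\<in>I. (f i :: real^'n^'n) ** A)"
  by (induction I rule: infinite_finite_induct) (simp_all add: matrix_add_rdistrib)

lemma matrix_sum_mult_vec: "sum f I *v v = (\<Sum>i\<in>I. (f i :: real^'n^'n) *v v)"
  by (induction I rule: infinite_finite_induct) (simp_all add: matrix_vector_mult_add_rdistrib)

lemma transpose_sum: "transpose (sum f I) = (\<Sum>i\<in>I. transpose (f i :: real^'n^'n))"
  by (simp add: transpose_def vec_eq_iff)

definition fix_of :: "real^'n^'n \<Rightarrow> (real^'n) set" where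
  "fix_of g = {v. g *v v = v}"

lemma subspace_fixed_space: "subspace (fixed_space H)"
  unfolding fixed_space_def subspace_def
  by (auto simp: matrix_vector_right_distrib matrix_vector_mult_scaleR)

lemma fix_of_eq: "fix_of g = fixed_space {g}"
  unfolding fix_of_def fixed_space_def by simp

lemma subspace_fix_of: "subspace (fix_of g)"
  unfolding fix_of_eq by (rule subspace_fixed_space)

context
  fixes G :: "(real^'n^'n) set"
  assumes G: "subgroup G GL" and finG: "finite G"
begin

lemma linear_group_closed:
  "mat 1 \<in> G" "\<And>g. g \<in> G \<Longrightarrow> invertible g" "\<And>g h. g \<in> G \<Longrightarrow> h \<in> G \<Longrightarrow> g ** h \<in> G"
  using subgroup.one_closed[OF G] subgroup.mem_carrier[OF G] subgroup.m_closed[OF G] by auto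

text \<open>
  Let \<open>P\<close> be the averaging projection onto the fixed space of \<open>g\<close> and \<open>R = 2 P - 1\<close> the corresponding
  reflection.  With \<open>M = g - 1 + P\<close>, which is invertible, and \<open>M' = g\<^sup>-\<^sup>1 - 1 + P\<close> one has \<open>g M' = M R\<close>; an
  invariant scalar product makes \<open>M'\<close> the adjoint of \<open>M\<close>, so \<open>det g = det R\<close>.
\<close>

lemma det_eq_codim_fix:
  assumes g: "g \<in> G"
  shows "det g = (-1) ^ (CARD('n) - dim (fix_of g))"
proof -
  interpret GLg: group "GL :: (real^'n^'n) monoid" by (rule group_GL)
  define H where "H = generate GL {g}"
  have HG: "H \<subseteq> G" unfolding H_def by (rule GLg.generate_subgroup_incl[OF _ G]) (use g in simp)
  have Hsub: "subgroup H GL" unfolding H_def by (rule GLg.generate_is_subgroup) (use linear_group_closed(2)[OF g] in simp)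
  have finH: "finite H" using HG finG finite_subset by blast
  have gH: "g \<in> H" unfolding H_def by (rule generate.incl) simp
  have oneH: "mat 1 \<in> H" using subgroup.one_closed[OF Hsub] by simp
  have Hm: "a ** b \<in> H" if "a \<in> H" "b \<in> H" for a b using subgroup.m_closed[OF Hsub that] by simp
  have Hi: "\<exists>a'\<in>H. a' ** a = mat 1 \<and> a ** a' = mat 1" if a: "a \<in> H" for a
  proof -
    have "inv\<^bsub>GL\<^esub> a \<in> H" using subgroup.m_inv_closed[OF Hsub a] .
    moreover have "invertible a" using a HG linear_group_closed(2) by blast
    then have "inv\<^bsub>GL\<^esub> a ** a = mat 1" "a ** inv\<^bsub>GL\<^esub> a = mat 1" using GLg.l_inv[of a] GLg.r_inv[of a] by auto
    ultimately show ?thesis by blast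
  qed
  define n where "n = real (card H)"
  have n: "n > 0" unfolding n_def using finH oneH by (simp add: card_gt_0_iff) blast
  have lbij: "bij_betw (\<lambda>h. a ** h) H H" if a: "a \<in> H" for a
  proof -
    obtain a' where a': "a' \<in> H" "a' ** a = mat 1" "a ** a' = mat 1" using Hi[OF a] by blast
    show ?thesis
      by (rule bij_betwI[where g="\<lambda>h. a' ** h"]) (use a a' Hm in \<open>auto simp: matrix_mul_assoc\<close>)
  qed
  have rbij: "bij_betw (\<lambda>h. h ** a) H H" if a: "a \<in> H" for a
  proof -
    obtain a' where a': "a' \<in> H" "a' ** a = mat 1" "a ** a' = mat 1" using Hi[OF a] by blast
    show ?thesis
      by (rule bij_betwI[where g="\<lambda>h. h ** a'"]) (use a a' Hm in \<open>auto simp: matrix_mul_assoc[symmetric]\<close>)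
  qed
  define P where "P = (1 / n) *\<^sub>R (\<Sum>h\<in>H. h)"
  \<comment> \<open>Left and right translations permute \<open>H\<close>, so \<open>P\<close>
    absorbs its elements from both sides.\<close>
  have gP: "a ** P = P" and Pg: "P ** a = P" if a: "a \<in> H" for a
  proof -
    have "a ** (\<Sum>h\<in>H. h) = (\<Sum>h\<in>H. h)" unfolding matrix_sum_mult_left
      using sum.reindex_bij_betw[OF lbij[OF a], of "\<lambda>h. h"] by simp
    then show "a ** P = P" unfolding P_def by (simp add: matrix_mult_scaleR_right)
    have "(\<Sum>h\<in>H. h) ** a = (\<Sum>h\<in>H. h)" unfolding matrix_sum_mult_right
      using sum.reindex_bij_betw[OF rbij[OF a], of "\<lambda>h. h"] by simp
    then show "P ** a = P" unfolding P_def by (simp add: matrix_mult_scaleR_left)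
  qed
  have Pvec: "P *v v = (1 / n) *\<^sub>R (\<Sum>h\<in>H. h *v v)" for v
    unfolding P_def by (simp add: scaleR_matrix_vector_assoc[symmetric] matrix_sum_mult_vec)
  have Hfix: "h *v v = v" if "v \<in> fix_of g" "h \<in> H" for h v
    using that(2) unfolding H_def
  proof (induction rule: generate.induct)
    case (inv h)
    then have "h = g" by simp
    have "invertible g" using linear_group_closed(2)[OF g] .
    then have "inv\<^bsub>GL\<^esub> g ** g = mat 1" using GLg.l_inv[of g] by simp
    then have "(inv\<^bsub>GL\<^esub> g ** g) *v v = v" by simp
    then show ?case using that(1) \<open>h = g\<close> unfolding fix_of_def by (simp add: matrix_vector_mul_assoc[symmetric])
  next
    case (eng a b)
    then show ?case by (simp add: matrix_vector_mul_assoc[symmetric])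
  qed (use that(1) in \<open>auto simp: fix_of_def\<close>)
  have Pfix: "P *v v = v" if "v \<in> fix_of g" for v
    unfolding Pvec using Hfix[OF that] n by (simp add: n_def sum_constant_scaleR del: sum_constant)
  have Pin: "P *v v \<in> fix_of g" for v
    unfolding fix_of_def using gP[OF gH] by (simp add: matrix_vector_mul_assoc)
  have PP: "P *v (P *v v) = P *v v" for v using Pfix[OF Pin] .
  define R where "R = 2 *\<^sub>R P - mat 1"
  have Rv: "R *v v = 2 *\<^sub>R (P *v v) - v" for v
    unfolding R_def by (simp add: matrix_vector_mult_diff_rdistrib scaleR_matrix_vector_assoc[symmetric])
  define K where "K = {v. P *v v = 0}"
  have detR: "det R = (-1) ^ (CARD('n) - dim (fix_of g))"
  proof (rule det_involution[OF subspace_fix_of])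
    show "R *v v = v" if "v \<in> fix_of g" for v unfolding Rv Pfix[OF that] by (simp add: scaleR_2)
    show "subspace K" unfolding K_def subspace_def
      by (auto simp: matrix_vector_right_distrib matrix_vector_mult_scaleR)
    show "R *v v = - v" if "v \<in> K" for v using that unfolding Rv K_def by simp
    fix v
    have "v - P *v v \<in> K" unfolding K_def by (simp add: matrix_vector_mult_diff_distrib PP)
    then show "\<exists>x\<in>fix_of g. \<exists>y\<in>K. v = x + y" using Pin[of v] by (intro bexI[of _ "P *v v"] bexI[of _ "v - P *v v"]) auto
  qed
  \<comment> \<open>\<open>S\<close> is the Gram matrix of the averaged scalar product. It is
    invariant under \<open>H\<close>, so with respect to it the adjoint of a group element is its
    inverse.\<close>
  define S where "S = (\<Sum>h\<in>H. transpose h ** h)"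
  have Sinv: "transpose a ** S ** a = S" if a: "a \<in> H" for a
  proof -
    have "transpose a ** S ** a = (\<Sum>h\<in>H. transpose (h ** a) ** (h ** a))"
      unfolding S_def matrix_sum_mult_left matrix_sum_mult_right
      by (simp add: matrix_transpose_mul matrix_mul_assoc)
    also have "\<dots> = S" unfolding S_def using sum.reindex_bij_betw[OF rbij[OF a], of "\<lambda>h. transpose h ** h"] by simp
    finally show ?thesis .
  qed
  have detS: "det S \<noteq> 0"
  proof
    assume "det S = 0"
    then have "\<not> invertible S" using invertible_det_nz by blast
    then have "\<not> inj ((*v) S)" using invertible_left_inverse matrix_left_invertible_injective by blast
    then obtain x y where xy: "S *v x = S *v y" "x \<noteq> y" unfolding inj_def by blast
    define v where "v = x - y"
    have v: "v \<noteq> 0" "S *v v = 0" unfolding v_def using xy by (auto simp: matrix_vector_mult_diff_distrib)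
    have "(\<Sum>h\<in>H. (h *v v) \<bullet> (h *v v)) = v \<bullet> (S *v v)"
      unfolding S_def matrix_sum_mult_vec inner_sum_right
      by (simp add: matrix_vector_mul_assoc[symmetric] dot_lmul_matrix[symmetric] inner_commute)
    then have "(\<Sum>h\<in>H. (h *v v) \<bullet> (h *v v)) = 0" using v by simp
    then have "\<forall>h\<in>H. (h *v v) \<bullet> (h *v v) = 0"
      using sum_nonneg_eq_0_iff[OF finH, of "\<lambda>h. (h *v v) \<bullet> (h *v v)"] by simp
    from bspec[OF this oneH] show False using v(1) by simp
  qed
  obtain g' where g': "g' \<in> H" "g' ** g = mat 1" "g ** g' = mat 1" using Hi[OF gH] by blast
  have Sg': "S ** a' = transpose a ** S" if "a \<in> H" "a ** a' = mat 1" for a a'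
  proof -
    have "S ** a' = (transpose a ** S ** a) ** a'" using Sinv[OF that(1)] by simp
    also have "\<dots> = transpose a ** S ** (a ** a')" by (simp add: matrix_mul_assoc)
    also have "\<dots> = transpose a ** S" using that(2) by simp
    finally show ?thesis .
  qed
  \<comment> \<open>\<open>\<iota>\<close> is inversion on \<open>H\<close>; reindexing the average
    by it shows that \<open>P\<close> is self-adjoint for \<open>S\<close>.\<close>
  define \<iota> where "\<iota> = (\<lambda>h. SOME h'. h' \<in> H \<and> h' ** h = mat 1 \<and> h ** h' = mat 1)"
  have \<iota>: "\<iota> h \<in> H" "\<iota> h ** h = mat 1" "h ** \<iota> h = mat 1" if h: "h \<in> H" for h
  proof -
    have "\<exists>h'. h' \<in> H \<and> h' ** h = mat 1 \<and> h ** h' = mat 1" using Hi[OF h] by blast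
    from someI_ex[OF this] show "\<iota> h \<in> H" "\<iota> h ** h = mat 1" "h ** \<iota> h = mat 1" unfolding \<iota>_def by blast+
  qed
  have \<iota>\<iota>: "\<iota> (\<iota> h) = h" if h: "h \<in> H" for h
  proof -
    have "\<iota> (\<iota> h) = \<iota> (\<iota> h) ** (\<iota> h ** h)" using \<iota>(2)[OF h] by simp
    also have "\<dots> = h" using \<iota>(2)[OF \<iota>(1)[OF h]] by (simp add: matrix_mul_assoc)
    finally show ?thesis .
  qed
  have \<iota>bij: "bij_betw \<iota> H H" by (rule bij_betwI[where g=\<iota>]) (use \<iota>(1) \<iota>\<iota> in auto)
  have SP: "S ** P = transpose P ** S"
  proof -
    have "S ** (\<Sum>h\<in>H. h) = (\<Sum>h\<in>H. S ** h)" by (rule matrix_sum_mult_left)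
    also have "\<dots> = (\<Sum>h\<in>H. S ** \<iota> h)" using sum.reindex_bij_betw[OF \<iota>bij, of "\<lambda>h. S ** h"] by simp
    also have "\<dots> = (\<Sum>h\<in>H. transpose h ** S)" using Sg' \<iota>(3) by (intro sum.cong) auto
    also have "\<dots> = transpose (\<Sum>h\<in>H. h) ** S" unfolding transpose_sum matrix_sum_mult_right ..
    finally show ?thesis unfolding P_def by (simp add: matrix_mult_scaleR_right transpose_scalar matrix_mult_scaleR_left)
  qed
  define M where "M = g - mat 1 + P"
  define M' where "M' = g' - mat 1 + P"
  have "S ** M' = transpose M ** S"
  proof -
    have "transpose M = transpose g - mat 1 + transpose P" unfolding M_def by (simp add: transpose_def vec_eq_iff mat_def)
    then show ?thesis unfolding M'_def using Sg'[OF gH g'(3)] SP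
      by (simp add: matrix_add_ldistrib matrix_add_rdistrib matrix_diff_left_distrib matrix_diff_right_distrib)
  qed
  then have "det S * det M' = det (transpose M) * det S" by (metis det_mul)
  then have detM: "det M' = det M" using detS by (simp add: det_transpose)
  \<comment> \<open>Applying \<open>P\<close> to \<open>M *v v = 0\<close> leaves
    \<open>P *v v = 0\<close>. Then \<open>g\<close> fixes \<open>v\<close>, hence \<open>P\<close>
    fixes \<open>v\<close> too and \<open>v\<close> is 0.\<close>
  have detM0: "det M \<noteq> 0"
  proof
    assume "det M = 0"
    then have "\<not> invertible M" using invertible_det_nz by blast
    then have "\<not> inj ((*v) M)" using invertible_left_inverse matrix_left_invertible_injective by blast
    then obtain x y where xy: "M *v x = M *v y" "x \<noteq> y" unfolding inj_def by blast
    define v where "v = x - y"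
    have v: "v \<noteq> 0" "M *v v = 0" unfolding v_def using xy by (auto simp: matrix_vector_mult_diff_distrib)
    have Mv: "g *v v - v + P *v v = 0"
      using v(2) unfolding M_def by (simp add: matrix_vector_mult_add_rdistrib matrix_vector_mult_diff_rdistrib)
    have "P *v (g *v v - v + P *v v) = P *v v"
      using Pg[OF gH] PP by (simp add: matrix_vector_right_distrib matrix_vector_mult_diff_distrib matrix_vector_mul_assoc)
    then have P0: "P *v v = 0" using Mv by simp
    then have "v \<in> fix_of g" using Mv unfolding fix_of_def by simp
    then show False using Pfix P0 v(1) by fastforce
  qed
  have e: "g ** M' = M ** R"
  proof -
    have l: "(g ** M') *v v = v - g *v v + P *v v" for v
      unfolding M'_def matrix_vector_mul_assoc[symmetric]
      using g'(3) gP[OF gH]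
      by (simp add: matrix_vector_mult_add_rdistrib matrix_vector_mult_diff_rdistrib matrix_vector_right_distrib
          matrix_vector_mult_diff_distrib matrix_vector_mul_assoc)
    have r: "(M ** R) *v v = v - g *v v + P *v v" for v
    proof -
      have gPv: "g *v (P *v v) = P *v v" using gP[OF gH] by (simp add: matrix_vector_mul_assoc)
      have "(M ** R) *v v = M *v (2 *\<^sub>R (P *v v) - v)" unfolding matrix_vector_mul_assoc[symmetric] Rv ..
      also have "\<dots> = 2 *\<^sub>R (M *v (P *v v)) - M *v v"
        by (simp add: matrix_vector_mult_diff_distrib matrix_vector_mult_scaleR)
      also have "M *v (P *v v) = P *v v"
        unfolding M_def using gPv PP by (simp add: matrix_vector_mult_add_rdistrib matrix_vector_mult_diff_rdistrib)
      also have "M *v v = g *v v - v + P *v v"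
        unfolding M_def by (simp add: matrix_vector_mult_add_rdistrib matrix_vector_mult_diff_rdistrib)
      finally show ?thesis by (simp add: scaleR_2)
    qed
    show ?thesis unfolding matrix_eq using l r by simp
  qed
  have "det g * det M' = det M * det R" using arg_cong[OF e, of det] by (simp add: det_mul)
  then have "det g = det R" using detM detM0 by simp
  then show ?thesis using detR by simp
qed

section \<open>The arrangement of a finite linear group\<close>

lemma pointwise_stabilizer:
  fixes Y :: "(real^'n) set"
  defines "T \<equiv> {g \<in> G. \<forall>v\<in>Y. g *v v = v}"
  shows "stabilizer_subgroup G T" "Y \<subseteq> fixed_space T"
proof -
  interpret GLg: group "GL :: (real^'n^'n) monoid" by (rule group_GL)
  show Y: "Y \<subseteq> fixed_space T" unfolding fixed_space_def T_def by blast
  have "subgroup T GL"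
  proof (rule GLg.subgroupI)
    show "T \<subseteq> carrier GL" unfolding T_def using linear_group_closed(2) by auto
    show "T \<noteq> {}" unfolding T_def using linear_group_closed(1) by auto
    show "inv\<^bsub>GL\<^esub> a \<in> T" if a: "a \<in> T" for a
    proof -
      have aG: "a \<in> G" using a unfolding T_def by blast
      have "inv\<^bsub>GL\<^esub> a ** a = mat 1" using GLg.l_inv[of a] linear_group_closed(2)[OF aG] by simp
      then have "inv\<^bsub>GL\<^esub> a *v (a *v v) = v" for v by (simp add: matrix_vector_mul_assoc)
      then have "inv\<^bsub>GL\<^esub> a *v v = v" if "v \<in> Y" for v using a that unfolding T_def by (metis (mono_tags, lifting) mem_Collect_eq)
      then show ?thesis unfolding T_def using subgroup.m_inv_closed[OF G aG] by blast
    qed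
    show "a \<otimes>\<^bsub>GL\<^esub> b \<in> T" if "a \<in> T" "b \<in> T" for a b
      using that linear_group_closed(3) unfolding T_def by (auto simp: matrix_vector_mul_assoc[symmetric])
  qed
  moreover have "T = {g \<in> G. \<forall>v\<in>fixed_space T. g *v v = v}"
  proof
    show "T \<subseteq> {g \<in> G. \<forall>v\<in>fixed_space T. g *v v = v}" unfolding fixed_space_def T_def by blast
    show "{g \<in> G. \<forall>v\<in>fixed_space T. g *v v = v} \<subseteq> T"
    proof
      fix g assume "g \<in> {g \<in> G. \<forall>v\<in>fixed_space T. g *v v = v}"
      then show "g \<in> T" using Y unfolding T_def by blast
    qed
  qed
  moreover have "T \<subseteq> G" unfolding T_def by blast
  ultimately show "stabilizer_subgroup G T" unfolding stabilizer_subgroup_def by blast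
qed

text \<open>\<open>Y\<close> is the fixed space of its pointwise stabilizer once it contains every
  vector fixed by that stabilizer; \<open>h\<close> makes the stabilizer nontrivial.\<close>

lemma arrangement_memI:
  assumes "h \<in> G" "h \<noteq> mat 1" "\<And>v. v \<in> Y \<Longrightarrow> h *v v = v"
    and "\<And>v. (\<And>g. g \<in> G \<Longrightarrow> (\<And>w. w \<in> Y \<Longrightarrow> g *v w = w) \<Longrightarrow> g *v v = v) \<Longrightarrow> v \<in> Y"
  shows "Y \<in> arrangement G"
proof -
  define T where "T = {g \<in> G. \<forall>v\<in>Y. g *v v = v}"
  have T: "stabilizer_subgroup G T" "Y \<subseteq> fixed_space T" unfolding T_def using pointwise_stabilizer by blast+
  have "fixed_space T \<subseteq> Y"
  proof
    fix v assume "v \<in> fixed_space T"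
    then have "g *v v = v" if "g \<in> G" "\<And>w. w \<in> Y \<Longrightarrow> g *v w = w" for g
      using that unfolding fixed_space_def T_def by blast
    then show "v \<in> Y" using assms(4) by blast
  qed
  then have "Y = fixed_space T" using T(2) by blast
  moreover have "h \<in> T" unfolding T_def using assms by blast
  then have "T \<noteq> {mat 1}" using assms(2) by blast
  ultimately show ?thesis unfolding arrangement_def using T(1) by blast
qed

lemma fix_of_in_arrangement: "g \<in> G \<Longrightarrow> g \<noteq> mat 1 \<Longrightarrow> fix_of g \<in> arrangement G"
  by (rule arrangement_memI[of g]) (auto simp: fix_of_def)

lemma arrangementE:
  assumes "A \<in> arrangement G"
  obtains H where "H \<subseteq> G" "A = fixed_space H" "\<exists>h\<in>H. h \<noteq> mat 1"
proof -
  obtain H where H: "stabilizer_subgroup G H" "H \<noteq> {mat 1}" "A = fixed_space H"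
    using assms unfolding arrangement_def by blast
  have "mat 1 \<in> H" using H(1) subgroup.one_closed[of H GL] unfolding stabilizer_subgroup_def by auto
  then have "\<exists>h\<in>H. h \<noteq> mat 1" using H(2) by blast
  moreover have "H \<subseteq> G" using H(1) unfolding stabilizer_subgroup_def by blast
  ultimately show ?thesis using that H(3) by blast
qed

lemma finite_arrangement: "finite (arrangement G)"
proof -
  have "arrangement G \<subseteq> fixed_space ` Pow G" unfolding arrangement_def stabilizer_subgroup_def by blast
  then show ?thesis using finG finite_subset by (meson finite_Pow_iff finite_imageI)
qed

lemma subspace_arrangement: "A \<in> arrangement G \<Longrightarrow> subspace A"
  using arrangementE subspace_fixed_space by metis

text \<open>The elements that define \<open>A\<close> or \<open>B\<close> fix the intersection
  pointwise, and together they already cut it out.\<close>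

lemma arrangement_Int:
  assumes "A \<in> arrangement G" "B \<in> arrangement G"
  shows "A \<inter> B \<in> arrangement G"
proof -
  obtain H where H: "H \<subseteq> G" "A = fixed_space H" "\<exists>h\<in>H. h \<noteq> mat 1" using arrangementE[OF assms(1)] .
  obtain H' where H': "H' \<subseteq> G" "B = fixed_space H'" using arrangementE[OF assms(2)] by metis
  obtain h where h: "h \<in> H" "h \<noteq> mat 1" using H(3) by blast
  show ?thesis
  proof (rule arrangement_memI[of h])
    show "h \<in> G" "h \<noteq> mat 1" using h H(1) by blast+
    show "h *v v = v" if "v \<in> A \<inter> B" for v using that h unfolding H(2) fixed_space_def by blast
    fix v assume v: "\<And>g. g \<in> G \<Longrightarrow> (\<And>w. w \<in> A \<inter> B \<Longrightarrow> g *v w = w) \<Longrightarrow> g *v v = v"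
    have "g *v v = v" if "g \<in> H \<union> H'" for g
      using v[of g] that H(1) H'(1) unfolding H(2) H'(2) fixed_space_def by blast
    then show "v \<in> A \<inter> B" unfolding H(2) H'(2) fixed_space_def by blast
  qed
qed

lemma arrangement_Inter: "\<B> \<subseteq> arrangement G \<Longrightarrow> \<B> \<noteq> {} \<Longrightarrow> \<Inter>\<B> \<in> arrangement G"
proof -
  assume B: "\<B> \<subseteq> arrangement G" "\<B> \<noteq> {}"
  have "finite \<B>" using finite_subset[OF B(1) finite_arrangement] .
  then show ?thesis using B(2,1)
  proof (induction \<B> rule: finite_ne_induct)
    case (insert x F)
    then show ?case using arrangement_Int[of x "\<Inter>F"] by simp
  qed simp
qed

text \<open>Nonempty intersections stay in the arrangement, so only the empty one can add a
  member.\<close>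

lemma intersection_lattice_arrangement: "intersection_lattice (arrangement G) = insert UNIV (arrangement G)"
proof
  show "intersection_lattice (arrangement G) \<subseteq> insert UNIV (arrangement G)"
  proof
    fix X assume "X \<in> intersection_lattice (arrangement G)"
    then obtain \<B> where "\<B> \<subseteq> arrangement G" "X = \<Inter>\<B>" unfolding intersection_lattice_def by blast
    then show "X \<in> insert UNIV (arrangement G)" using arrangement_Inter[of \<B>] by (cases "\<B> = {}") auto
  qed
  show "insert UNIV (arrangement G) \<subseteq> intersection_lattice (arrangement G)"
  proof
    fix X assume "X \<in> insert UNIV (arrangement G)"
    then consider "X = \<Inter>{}" | "X = \<Inter>{X}" "{X} \<subseteq> arrangement G" by auto
    then show "X \<in> intersection_lattice (arrangement G)" unfolding intersection_lattice_def by cases blast+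
  qed
qed

lemma fixed_space_generate:
  assumes "X \<subseteq> G"
  shows "fixed_space (generate GL X) = fixed_space X"
proof
  interpret GLg: group "GL :: (real^'n^'n) monoid" by (rule group_GL)
  show "fixed_space (generate GL X) \<subseteq> fixed_space X"
    unfolding fixed_space_def using generate.incl[of _ X GL] by blast
  show "fixed_space X \<subseteq> fixed_space (generate GL X)"
  proof
    fix v assume v: "v \<in> fixed_space X"
    have "h *v v = v" if "h \<in> generate GL X" for h
      using that
    proof (induction rule: generate.induct)
      case (inv h)
      have "invertible h" using inv assms linear_group_closed(2) by blast
      then have "inv\<^bsub>GL\<^esub> h ** h = mat 1" using GLg.l_inv[of h] by simp
      then have "inv\<^bsub>GL\<^esub> h *v (h *v v) = v" by (simp add: matrix_vector_mul_assoc)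
      moreover have "h *v v = v" using v inv unfolding fixed_space_def by blast
      ultimately show ?case by simp
    next
      case (eng a b)
      then show ?case by (simp add: matrix_vector_mul_assoc[symmetric])
    qed (use v in \<open>auto simp: fixed_space_def\<close>)
    then show "v \<in> fixed_space (generate GL X)" unfolding fixed_space_def by blast
  qed
qed

end

section \<open>Groups strictly generated in codimension two\<close>

lemma codim_two_generated_det:
  fixes G :: "(real^4^4) set"
  assumes G: "subgroup G GL" and fin: "finite G" and gen: "strictly_generated_in_codim_two G" and g: "g \<in> G"
  shows "det g = 1"
proof -
  interpret GLg: group "GL :: (real^4^4) monoid" by (rule group_GL)
  define X where "X = {g \<in> G. codim (fixed_space (generate GL {g})) = 2}"
  have det1: "det h = 1" if h: "h \<in> X" for h
  proof -
    have hG: "h \<in> G" using h unfolding X_def by blast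
    have "codim (fix_of h) = 2"
      using h fixed_space_generate[OF G fin, of "{h}"] hG unfolding X_def fix_of_eq by simp
    then show ?thesis using det_eq_codim_fix[OF G fin hG] unfolding codim_def by simp
  qed
  have "g \<in> generate GL X" using gen g unfolding strictly_generated_in_codim_two_def X_def by simp
  then show ?thesis
  proof (induction rule: generate.induct)
    case (inv h)
    have "invertible h" using inv linear_group_closed(2)[OF G fin] unfolding X_def by blast
    then have "inv\<^bsub>GL\<^esub> h ** h = mat 1" using GLg.l_inv[of h] by simp
    then have "det (inv\<^bsub>GL\<^esub> h) * det h = 1" by (metis det_mul det_I)
    then show ?case using det1[OF inv] by simp
  qed (use det1 in \<open>auto simp: det_mul det_I\<close>)
qed

lemma fix_of_eq_UNIV_iff: "fix_of g = UNIV \<longleftrightarrow> g = mat 1"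
  unfolding fix_of_def by (auto simp: matrix_eq)

context
  fixes G :: "(real^4^4) set"
  assumes G: "subgroup G GL" and finG: "finite G" and gen: "strictly_generated_in_codim_two G"
begin

text \<open>Determinant 1 makes the codimension even, and codimension 0 would mean the
  identity.\<close>

lemma dim_fix_of:
  assumes "g \<in> G" "g \<noteq> mat 1"
  shows "dim (fix_of g) = 0 \<or> dim (fix_of g) = 2"
proof -
  have "(-1::real) ^ (4 - dim (fix_of g)) = 1"
    using det_eq_codim_fix[OF G finG assms(1)] codim_two_generated_det[OF G finG gen assms(1)] by simp
  then have ev: "even (4 - dim (fix_of g))" by (simp add: minus_one_power_iff split: if_splits)
  have "dim (fix_of g) \<le> 4" using dim_subset_UNIV[of "fix_of g"] by simp
  moreover have "dim (fix_of g) \<noteq> 4"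
  proof
    assume "dim (fix_of g) = 4"
    then have "span (fix_of g) = UNIV" using dim_eq_full[of "fix_of g"] by simp
    then have "fix_of g = UNIV" using subspace_fix_of[of g] by (simp add: span_eq_iff[symmetric] del: span_eq_iff)
    then show False using fix_of_eq_UNIV_iff assms(2) by blast
  qed
  ultimately have "dim (fix_of g) = 0 \<or> dim (fix_of g) = 1 \<or> dim (fix_of g) = 2 \<or> dim (fix_of g) = 3" by linarith
  then show ?thesis using ev by auto
qed

lemma arrangement_subset_fix_of:
  assumes "A \<in> arrangement G"
  obtains g where "g \<in> G" "g \<noteq> mat 1" "A \<subseteq> fix_of g"
proof -
  obtain H where H: "H \<subseteq> G" "A = fixed_space H" "\<exists>h\<in>H. h \<noteq> mat 1" using arrangementE[OF G finG assms] .
  then show ?thesis using that unfolding fixed_space_def fix_of_def by blast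
qed

lemma dim_arrangement:
  assumes "A \<in> arrangement G"
  shows "dim A \<le> 2"
proof -
  obtain g where g: "g \<in> G" "g \<noteq> mat 1" "A \<subseteq> fix_of g" using arrangement_subset_fix_of[OF assms] .
  then show ?thesis using dim_fix_of[OF g(1,2)] dim_subset[OF g(3)] by linarith
qed

definition "planes = {A \<in> arrangement G. dim A = 2}"

lemma finite_planes: "finite planes"
  unfolding planes_def using finite_arrangement[OF G finG] by simp

lemma plane_subspace: "S \<in> planes \<Longrightarrow> subspace S" and plane_dim: "S \<in> planes \<Longrightarrow> dim S = 2"
  unfolding planes_def using subspace_arrangement[OF G finG] by blast+

text \<open>Nontrivial elements of the stabilizer of a line \<open>l\<close> have planes as fixed
  spaces. If all these planes coincided, the common fixed space would be that plane instead of
  \<open>l\<close>; so two of them differ, and they meet in \<open>l\<close>.\<close>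

lemma arr_lines_eq: "arr_lines G = {S \<inter> T | S T. S \<in> planes \<and> T \<in> planes \<and> S \<noteq> T \<and> S \<inter> T \<noteq> {0}}"
proof (intro equalityI subsetI)
  fix l assume "l \<in> arr_lines G"
  then have l: "l \<in> arrangement G" "dim l = 1" unfolding arr_lines_def by auto
  obtain H where H: "H \<subseteq> G" "l = fixed_space H" "\<exists>h\<in>H. h \<noteq> mat 1" using arrangementE[OF G finG l(1)] .
  have fix_plane: "fix_of h \<in> planes" if h: "h \<in> H" "h \<noteq> mat 1" for h
  proof -
    have hG: "h \<in> G" using h H(1) by blast
    have "l \<subseteq> fix_of h" unfolding H(2) fixed_space_def fix_of_def using h by blast
    then have "1 \<le> dim (fix_of h)" using dim_subset[of l] l(2) by simp
    then have "dim (fix_of h) = 2" using dim_fix_of[OF hG h(2)] by linarith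
    then show ?thesis unfolding planes_def using fix_of_in_arrangement[OF G finG hG h(2)] by blast
  qed
  obtain h where h: "h \<in> H" "h \<noteq> mat 1" using H(3) by blast
  have "\<exists>h'\<in>H. h' \<noteq> mat 1 \<and> fix_of h' \<noteq> fix_of h"
  proof (rule ccontr)
    assume "\<not> ?thesis"
    then have "fix_of h \<subseteq> fix_of h'" if "h' \<in> H" for h'
      using that fix_of_eq_UNIV_iff[of h'] by (cases "h' = mat 1") auto
    then have "fix_of h \<subseteq> l" unfolding H(2) fixed_space_def fix_of_def by blast
    then show False using dim_subset[of "fix_of h" l] plane_dim[OF fix_plane[OF h]] l(2) by simp
  qed
  then obtain h' where h': "h' \<in> H" "h' \<noteq> mat 1" "fix_of h' \<noteq> fix_of h" by blast
  define m where "m = fix_of h \<inter> fix_of h'"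
  have S: "fix_of h \<in> planes" "fix_of h' \<in> planes" using fix_plane h h' by blast+
  have sm: "subspace m" unfolding m_def by (intro subspace_inter subspace_fix_of)
  have lm: "l \<subseteq> m" unfolding m_def H(2) fixed_space_def fix_of_def using h h' by blast
  have "dim m \<noteq> 2"
  proof
    assume "dim m = 2"
    then have "m = fix_of h" "m = fix_of h'"
      using subspace_dim_equal[OF sm] plane_subspace S plane_dim[OF S(1)] plane_dim[OF S(2)] unfolding m_def by auto
    then show False using h'(3) by simp
  qed
  moreover have "dim m \<le> 2" using dim_subset[of m "fix_of h"] plane_dim[OF S(1)] unfolding m_def by simp
  ultimately have "dim m \<le> dim l" using l(2) by simp
  then have eq: "l = m" using subspace_dim_equal[OF _ sm lm] subspace_arrangement[OF G finG l(1)] by blast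
  moreover have "m \<noteq> {0}" using eq l(2) by auto
  ultimately show "l \<in> {S \<inter> T | S T. S \<in> planes \<and> T \<in> planes \<and> S \<noteq> T \<and> S \<inter> T \<noteq> {0}}"
    using S h'(3) unfolding m_def by blast
next
  fix l assume "l \<in> {S \<inter> T | S T. S \<in> planes \<and> T \<in> planes \<and> S \<noteq> T \<and> S \<inter> T \<noteq> {0}}"
  then obtain S T where ST: "S \<in> planes" "T \<in> planes" "S \<noteq> T" "l = S \<inter> T" "l \<noteq> {0}" by blast
  have l: "l \<in> arrangement G" using ST arrangement_Int[OF G finG] unfolding planes_def by blast
  have sl: "subspace l" using subspace_arrangement[OF G finG l] .
  have "dim l \<noteq> 0" using ST(5) subspace_0[OF sl] by auto
  moreover have "dim l \<noteq> 2"
  proof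
    assume "dim l = 2"
    then have "l = S" "l = T"
      using subspace_dim_equal[OF sl] plane_subspace ST(1,2) plane_dim[OF ST(1)] plane_dim[OF ST(2)] ST(4) by auto
    then show False using ST(3) by simp
  qed
  ultimately have "dim l = 1" using dim_arrangement[OF l] by linarith
  then show "l \<in> arr_lines G" unfolding arr_lines_def using l by blast
qed

lemma line_in_plane: "l \<in> arr_lines G \<Longrightarrow> \<exists>S\<in>planes. l \<subseteq> S"
  unfolding arr_lines_eq by blast

text \<open>Without planes there is no element with fixed space of codimension two, and a group
  generated by the empty set is trivial.\<close>

lemma planes_nonempty: "arrangement G \<noteq> {} \<Longrightarrow> planes \<noteq> {}"
proof
  assume ne: "arrangement G \<noteq> {}" and P: "planes = {}"
  then obtain g where g: "g \<in> G" "g \<noteq> mat 1" using arrangement_subset_fix_of by blast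
  have noX: "{g \<in> G. codim (fixed_space (generate GL {g})) = 2} = {}"
  proof -
    have "codim (fixed_space (generate GL {h})) \<noteq> 2" if h: "h \<in> G" for h
    proof
      assume "codim (fixed_space (generate GL {h})) = 2"
      then have "codim (fix_of h) = 2" using fixed_space_generate[OF G finG, of "{h}"] h unfolding fix_of_eq by simp
      then have d: "dim (fix_of h) = 2" unfolding codim_def by simp
      then have "h \<noteq> mat 1" using fix_of_eq_UNIV_iff[of h] by auto
      then have "fix_of h \<in> planes" unfolding planes_def using d fix_of_in_arrangement[OF G finG h] by blast
      then show False using P by blast
    qed
    then show ?thesis by blast
  qed
  have "generate GL {} = G" using gen unfolding strictly_generated_in_codim_two_def noX .
  moreover have "generate GL {} \<subseteq> {mat 1 :: real^4^4}"
  proof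
    fix h :: "real^4^4" assume "h \<in> generate GL {}"
    then show "h \<in> {mat 1}" by (induction rule: generate.induct) auto
  qed
  ultimately show False using g by blast
qed

lemma Union_arrangement: "\<Union>(arrangement G) = \<Union>planes"
proof
  show "\<Union>planes \<subseteq> \<Union>(arrangement G)" unfolding planes_def by blast
  show "\<Union>(arrangement G) \<subseteq> \<Union>planes"
  proof
    fix v assume "v \<in> \<Union>(arrangement G)"
    then obtain A where A: "A \<in> arrangement G" "v \<in> A" by blast
    consider "dim A = 0" | "dim A = 1" | "dim A = 2" using dim_arrangement[OF A(1)] by linarith
    then show "v \<in> \<Union>planes"
    proof cases
      case 1
      then have "v = 0" using A(2) by auto
      obtain S where "S \<in> planes" using planes_nonempty A(1) by blast
      then show ?thesis using \<open>v = 0\<close> subspace_0[OF plane_subspace] by blast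
    next
      case 2
      then have "A \<in> arr_lines G" unfolding arr_lines_def using A(1) by simp
      then show ?thesis using line_in_plane A(2) by blast
    next
      case 3
      then show ?thesis using A unfolding planes_def by blast
    qed
  qed
qed

lemma atom_line_count_0: "atom_line_count G = 0"
proof -
  have "\<not> lattice_atom (intersection_lattice (arrangement G)) l" if d: "dim l = 1" for l
  proof
    assume "lattice_atom (intersection_lattice (arrangement G)) l"
    then have l: "l \<in> arrangement G" and no: "\<And>Y. Y \<in> arrangement G \<Longrightarrow> l \<subset> Y \<Longrightarrow> Y \<subset> UNIV \<Longrightarrow> False"
      unfolding lattice_atom_def intersection_lattice_arrangement[OF G finG] by auto
    have "l \<in> arr_lines G" unfolding arr_lines_def using l d by simp
    then obtain S where S: "S \<in> planes" "l \<subseteq> S" using line_in_plane by blast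
    have "l \<noteq> S" "S \<noteq> UNIV" using plane_dim[OF S(1)] d by auto
    then show False using no[of S] S unfolding planes_def by blast
  qed
  then have "{l. dim l = 1 \<and> lattice_atom (intersection_lattice (arrangement G)) l} = {}" by blast
  then show ?thesis unfolding atom_line_count_def by (simp only: card.empty)
qed

text \<open>\<open>k\<close> is the number of free incidences. Its relation to
  \<open>codim_count G 3\<close> is additive, which avoids truncated subtraction.\<close>

lemma cohomology_dim_1:
  "\<exists>n k. reduced_homology_dim (\<supset>) (Delta G) 1 = enat n \<and>
     reduced_cohomology_dim 1 (top_of_set (arr_complement G)) = enat (codim_count G 2 + k + n) \<and>
     k + codim_count G 3 = (\<Sum>l\<in>arr_lines G. planes_through G l)"
proof -
  obtain \<eta> p r a b q \<epsilon> \<tau> where fr: "framed_planes planes \<eta> p r a b q (arr_lines G) \<epsilon> \<tau>"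
    using framed_planes_exists[OF finite_planes plane_subspace plane_dim arr_lines_eq] .
  interpret fp: framed_planes planes \<eta> p r a b q "arr_lines G" \<epsilon> \<tau> by (rule fr)
  define m where "m = \<Inter>(arrangement G)"
  define V0 where "V0 = intersection_lattice (arrangement G) - {UNIV, m}"
  have arr: "A \<in> planes \<union> arr_lines G \<or> A = m" if A: "A \<in> arrangement G" for A
  proof -
    consider "dim A = 0" | "dim A = 1" | "dim A = 2" using dim_arrangement[OF A] by linarith
    then show ?thesis
    proof cases
      case 1
      \<comment> \<open>A zero-dimensional member is \<open>{0}\<close>, which every member
        contains, so it is the maximum of the lattice and not a vertex of
        \<open>Delta G\<close>.\<close>
      then have "A \<subseteq> {0}" by simp
      moreover have "m \<subseteq> A" unfolding m_def using A by blast
      moreover have "0 \<in> m" unfolding m_def using subspace_0[OF subspace_arrangement[OF G finG]] by blast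
      ultimately show ?thesis by blast
    qed (use A in \<open>auto simp: planes_def arr_lines_def\<close>)
  qed
  have PL: "x \<in> arrangement G \<and> x \<noteq> UNIV" if x: "x \<in> planes \<union> arr_lines G" for x
    using x unfolding planes_def arr_lines_def by auto
  have V1: "V0 \<subseteq> planes \<union> arr_lines G" unfolding V0_def intersection_lattice_arrangement[OF G finG] using arr by blast
  have V2: "x = m" if "x \<in> planes \<union> arr_lines G" "x \<notin> V0" for x
    using that PL unfolding V0_def intersection_lattice_arrangement[OF G finG] by blast
  have V3: "m \<subseteq> x" if "x \<in> planes \<union> arr_lines G" for x
    unfolding m_def using PL[OF that] by blast
  obtain n where n: "reduced_homology_dim (\<supset>) (order_complex (\<supset>) V0) 1 = enat n"
    "reduced_cohomology_dim 1 (top_of_set (- \<Union>planes)) = enat (card planes + card fp.free_incidences + n)"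
    using fp.cohomology_dim_complement[OF V1 V2 V3] by blast
  have "Delta G = order_complex (\<supset>) V0" unfolding Delta_def V0_def m_def ..
  moreover have "arr_complement G = - \<Union>planes"
    unfolding arr_complement_def Union_arrangement by (rule Compl_eq_Diff_UNIV[symmetric])
  moreover have "codim_count G 2 = card planes"
  proof -
    have "codim S = 2 \<longleftrightarrow> dim S = 2" if "S \<in> arrangement G" for S
      using dim_arrangement[OF that] unfolding codim_def by auto
    then show ?thesis unfolding codim_count_def planes_def by (metis (no_types, lifting) Collect_cong)
  qed
  moreover have "codim_count G 3 = card (arr_lines G)"
  proof -
    have "codim S = 3 \<longleftrightarrow> dim S = 1" if "S \<in> arrangement G" for S
      using dim_arrangement[OF that] unfolding codim_def by auto
    then show ?thesis unfolding codim_count_def arr_lines_def by (metis (no_types, lifting) Collect_cong)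
  qed
  moreover have "planes_through G l = card (fp.planes_thr l)" if l: "l \<in> arr_lines G" for l
  proof -
    have "l \<subset> S \<longleftrightarrow> l \<subseteq> S" if "dim S = 2" for S
      using l that unfolding arr_lines_def by auto
    then have "{\<pi> \<in> arrangement G. dim \<pi> = 2 \<and> l \<subset> \<pi>} = fp.planes_thr l"
      unfolding fp.planes_thr_def unfolding planes_def by blast
    then show ?thesis unfolding planes_through_def by simp
  qed
  then have "(\<Sum>l\<in>arr_lines G. planes_through G l) = (\<Sum>l\<in>arr_lines G. card (fp.planes_thr l))" by simp
  ultimately show ?thesis using n fp.card_free_incidences by metis
qed

end

theorem theorem7p16:
  fixes G :: "(real^4^4) set"
  assumes "subgroup G GL"
    and "finite G"
    and "strictly_generated_in_codim_two G"
  shows "ereal_of_enat (reduced_cohomology_dim 1 (top_of_set (arr_complement G)))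
           = ereal_of_enat (reduced_homology_dim (\<supset>) (Delta G) 1)
             + ereal (\<Sum>l\<in>arr_lines G. real (planes_through G l))
             - ereal (real (codim_count G 3))
             + ereal (real (atom_line_count G))
             + ereal (real (codim_count G 2))
       \<and> ereal_of_enat (reduced_cohomology_dim 2 (top_of_set (arr_complement G)))
           > ereal (2 * real (atom_line_count G) - 1)"
proof
  obtain n k where nk: "reduced_homology_dim (\<supset>) (Delta G) 1 = enat n"
    "reduced_cohomology_dim 1 (top_of_set (arr_complement G)) = enat (codim_count G 2 + k + n)"
    "k + codim_count G 3 = (\<Sum>l\<in>arr_lines G. planes_through G l)"
    using cohomology_dim_1[OF assms] by blast
  have "(\<Sum>l\<in>arr_lines G. real (planes_through G l)) = real k + real (codim_count G 3)"
    using nk(3) by (simp flip: of_nat_sum of_nat_add)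
  then show "ereal_of_enat (reduced_cohomology_dim 1 (top_of_set (arr_complement G)))
      = ereal_of_enat (reduced_homology_dim (\<supset>) (Delta G) 1)
        + ereal (\<Sum>l\<in>arr_lines G. real (planes_through G l))
        - ereal (real (codim_count G 3))
        + ereal (real (atom_line_count G))
        + ereal (real (codim_count G 2))"
    unfolding nk(1,2) atom_line_count_0[OF assms] by simp
  have "ereal (2 * real (atom_line_count G) - 1) < 0" unfolding atom_line_count_0[OF assms] by (simp add: zero_ereal_def)
  also have "0 \<le> ereal_of_enat (reduced_cohomology_dim 2 (top_of_set (arr_complement G)))" by simp
  finally show "ereal (2 * real (atom_line_count G) - 1)
      < ereal_of_enat (reduced_cohomology_dim 2 (top_of_set (arr_complement G)))" .
qed

end
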